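(* Let $(\underline{\mathcal C},\underline x)$ be a $G$-$A$-coring with a fixed grouplike family and left dual graded ring $R$, and consider the graded Morita context $(\mathrm{END}_R(A\{G\}),R,A\{G\},\mathrm{HOM}_R(A\{G\},R),\phi,\psi)$ associated to the graded right $R$-module $A\{G\}$. Using the isomorphisms $\Xi:\mathrm{END}_R(A\{G\})\to G*S'$ of graded rings and $\Psi:\mathrm{HOM}_R(A\{G\},R)\to Q'G$ of graded bimodules, this graded Morita context is isomorphic to the graded Morita context $\mathbb{GM}'=(G*S',R,A\{G\},Q'G,\omega',\nu')$, with connecting maps $$\omega':A\{G\}\otimes_RQ'G\to G*S',\quad \omega'(\mu_\alpha(a)\otimes_R\omega_\sigma(\underline q))=u_{\alpha\sigma}\bigl(q_{\sigma\beta}(x_{(\sigma\beta)^{-1}}a)\bigr)_{\beta\in G},$$ $$\nu':Q'G\otimes_{G*S'}A\{G\}\to R,\quad \nu'(\omega_\sigma(\underline q)\otimes\mu_\alpha(a))=q_{\sigma\alpha}\cdot a.$$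
   Context: $G$ is a group with unit $e$, $A$ is a ring with unit. A $G$-$A$-coring $\underline{\mathcal C}$ is a family $(\mathcal C_\alpha)_{\alpha\in G}$ of $A$-bimodules with $A$-bimodule maps $\Delta_{\alpha,\beta}:\mathcal C_{\alpha\beta}\to\mathcal C_\alpha\otimes_A\mathcal C_\beta$, $\Delta_{\alpha,\beta}(c)=c_{(1,\alpha)}\otimes_Ac_{(2,\beta)}$, and $\varepsilon:\mathcal C_e\to A$ such that $(\Delta_{\alpha,\beta}\otimes_A\mathcal C_\gamma)\circ\Delta_{\alpha\beta,\gamma}=(\mathcal C_\alpha\otimes_A\Delta_{\beta,\gamma})\circ\Delta_{\alpha,\beta\gamma}$ and $(\mathcal C_\alpha\otimes_A\varepsilon)\circ\Delta_{\alpha,e}=\mathcal C_\alpha=(\varepsilon\otimes_A\mathcal C_\alpha)\circ\Delta_{e,\alpha}$. A grouplike family is $\underline x=(x_\alpha)_\alpha\in\prod_\alpha\mathcal C_\alpha$ with $\Delta_{\alpha,\beta}(x_{\alpha\beta})=x_\alpha\otimes_Ax_\beta$, $\varepsilon(x_e)=1$. Left dual graded ring: $R=\bigoplus_\alpha R_\alpha$, $R_\alpha={}_A\mathrm{Hom}(\mathcal C_{\alpha^{-1}},A)$ (left $A$-linear maps), $(a\cdot f\cdot b)(c)=f(ca)b$, $(f\#g)(c)=g(c_{(1,\beta^{-1})}f(c_{(2,\alpha^{-1})}))$ for $f\in R_\alpha$, $g\in R_\beta$, $c\in\mathcal C_{(\alpha\beta)^{-1}}$, unit $\varepsilon$. $A\{G\}=\bigoplus_{\alpha\in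 G}\mu_\alpha(A)$ (copies of $A$), a $G$-graded right $R$-module via $\mu_\alpha(a)\cdot f=\mu_{\alpha\beta}(f(x_{\beta^{-1}}a))$ for $f\in R_\beta$. For $G$-graded right $R$-modules $M,N$: $\mathrm{HOM}_R(M,N)=\bigoplus_\sigma\mathrm{HOM}_R(M,N)_\sigma$, where the degree $\sigma$ part consists of right $R$-linear $f$ with $f(M_\alpha)\subset N_{\sigma\alpha}$ for all $\alpha$; $\mathrm{END}_R(M)=\mathrm{HOM}_R(M,M)$. A graded Morita context $(S,R,P,Q,\varphi,\psi)$ consists of $G$-graded rings $S,R$, graded bimodules $P\in{}_S\mathcal M_R^G$, $Q\in{}_R\mathcal M_S^G$ and bimodule maps $\varphi:P\otimes_RQ\to S$, $\psi:Q\otimes_SP\to R$, homogeneous of degree $e$, with $\varphi(p\otimes q)p'=p\psi(q\otimes p')$ and $\psi(q\otimes p)q'=q\varphi(p\otimes q')$. An isomorphism of such contexts consists of graded ring isomorphisms and compatible graded bimodule isomorphisms commuting with the connecting maps. The context associated to a graded right $R$-module $P$ has $S=\mathrm{END}_R(P)$, $Q=\mathrm{HOM}_R(P,R)$ with $(r\cdot q\cdot s)(p)=rq(s(p))$, and connecting maps $\phi(p\otimes q)(p')=pq(p')$, $\psi(q\otimes p)=q(p)$. $S'=\{\underline b=(b_\alpha)_\alpha\in\prod_{\alpha\in G}A\mid f(b_{\alpha\beta}x_{\beta^{-1}})=f(x_{\beta^{-1}}b_\alpha)\ \forall\alpha,\beta\in G,f\in R_\beta\}$ (a ring, componentwise),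 with right $G$-action $\underline b^\sigma=(b_{\sigma\alpha})_{\alpha}$. $G*S'=\bigoplus_\alpha u_\alpha S'$ with $u_\alpha\underline b\,u_\beta\underline c=u_{\alpha\beta}\underline b^\beta\underline c$, graded by $\deg u_\alpha=\alpha$; it acts on the left on $A\{G\}$ by $u_\sigma\underline b\cdot\mu_\alpha(a)=\mu_{\sigma\alpha}(b_\alpha a)$. $Q'=\{\underline q=(q_\alpha)_\alpha\in\prod_\alpha R_\alpha\mid f(c_{(1,\beta^{-1})}q_\alpha(c_{(2,\alpha^{-1})}))=f(q_{\alpha\beta}(c)x_{\beta^{-1}})\ \forall\alpha,\beta\in G,c\in\mathcal C_{(\alpha\beta)^{-1}},f\in R_\beta\}$. $Q'G=\bigoplus_\alpha\omega_\alpha(Q')$ (copies of $Q'$, degree $\alpha$) is a graded $(R,G*S')$-bimodule: for $f\in R_\beta$, $f\cdot\omega_\alpha(\underline q)=\omega_{\beta\alpha}(f\cdot\underline q)$ with $f\cdot\underline q=(f\#q_{\beta^{-1}\gamma})_{\gamma\in G}$; and $\omega_\alpha(\underline q)\cdot u_\tau\underline b=\omega_{\alpha\tau}(\underline q\cdot\underline b^{(\alpha\tau)^{-1}})$ with $\underline q\cdot\underline b=(q_\gamma\cdot b_\gamma)_{\gamma\in G}$. $\Xi(h)=u_\sigma\underline b$ with $b_\alpha=(\mu_{\sigma\alpha}^{-1}\circ h\circ\mu_\alpha)(1_A)$ for $h$ of degree $\sigma$; $\Psi(\varphi)=\omega_\sigma(\underline q)$ with $q_\alpha=\varphi(\mu_{\sigma^{-1}\alpha}(1_A))$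 for $\varphi$ of degree $\sigma$. *)

theory Defs
  imports "HOL-Algebra.Free_Abelian_Groups" "HOL-Algebra.QuotRing"
begin

section \<open>Bimodules over non-commutative rings\<close>

text \<open>As for the library record \<open>module\<close>, the fields \<open>mult\<close> and \<open>one\<close> inherited from
  \<open>ring\<close> carry no meaning; only the additive part of the ring record is used.\<close>

record ('r, 'm) rmodule = "'m ring" +
  rsmult :: "'m \<Rightarrow> 'r \<Rightarrow> 'm" (infixl \<open>\<triangleleft>\<index>\<close> 70)

record ('l, 'r, 'm) bimodule = "('r, 'm) rmodule" +
  lsmult :: "'l \<Rightarrow> 'm \<Rightarrow> 'm" (infixr \<open>\<triangleright>\<index>\<close> 70)

locale bimodule = L: ring A + R: ring B + abelian_group M
  for A :: "('l, 'x) ring_scheme" and B :: "('r, 'y) ring_scheme"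
    and M :: "('l, 'r, 'm, 'z) bimodule_scheme" +
  assumes lsmult_closed: "\<lbrakk>a \<in> carrier A; m \<in> carrier M\<rbrakk> \<Longrightarrow> a \<triangleright>\<^bsub>M\<^esub> m \<in> carrier M"
    and rsmult_closed: "\<lbrakk>m \<in> carrier M; b \<in> carrier B\<rbrakk> \<Longrightarrow> m \<triangleleft>\<^bsub>M\<^esub> b \<in> carrier M"
    and lsmult_distr_ring: "\<lbrakk>a \<in> carrier A; a' \<in> carrier A; m \<in> carrier M\<rbrakk> \<Longrightarrow>
      (a \<oplus>\<^bsub>A\<^esub> a') \<triangleright>\<^bsub>M\<^esub> m = (a \<triangleright>\<^bsub>M\<^esub> m) \<oplus>\<^bsub>M\<^esub> (a' \<triangleright>\<^bsub>M\<^esub> m)"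
    and lsmult_distr_mod: "\<lbrakk>a \<in> carrier A; m \<in> carrier M; m' \<in> carrier M\<rbrakk> \<Longrightarrow>
      a \<triangleright>\<^bsub>M\<^esub> (m \<oplus>\<^bsub>M\<^esub> m') = (a \<triangleright>\<^bsub>M\<^esub> m) \<oplus>\<^bsub>M\<^esub> (a \<triangleright>\<^bsub>M\<^esub> m')"
    and lsmult_assoc: "\<lbrakk>a \<in> carrier A; a' \<in> carrier A; m \<in> carrier M\<rbrakk> \<Longrightarrow>
      (a \<otimes>\<^bsub>A\<^esub> a') \<triangleright>\<^bsub>M\<^esub> m = a \<triangleright>\<^bsub>M\<^esub> (a' \<triangleright>\<^bsub>M\<^esub> m)"
    and lsmult_one: "m \<in> carrier M \<Longrightarrow> \<one>\<^bsub>A\<^esub> \<triangleright>\<^bsub>M\<^esub> m = m"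
    and rsmult_distr_ring: "\<lbrakk>m \<in> carrier M; b \<in> carrier B; b' \<in> carrier B\<rbrakk> \<Longrightarrow>
      m \<triangleleft>\<^bsub>M\<^esub> (b \<oplus>\<^bsub>B\<^esub> b') = (m \<triangleleft>\<^bsub>M\<^esub> b) \<oplus>\<^bsub>M\<^esub> (m \<triangleleft>\<^bsub>M\<^esub> b')"
    and rsmult_distr_mod: "\<lbrakk>m \<in> carrier M; m' \<in> carrier M; b \<in> carrier B\<rbrakk> \<Longrightarrow>
      (m \<oplus>\<^bsub>M\<^esub> m') \<triangleleft>\<^bsub>M\<^esub> b = (m \<triangleleft>\<^bsub>M\<^esub> b) \<oplus>\<^bsub>M\<^esub> (m' \<triangleleft>\<^bsub>M\<^esub> b)"
    and rsmult_assoc: "\<lbrakk>m \<in> carrier M; b \<in> carrier B; b' \<in> carrier B\<rbrakk> \<Longrightarrow>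
      m \<triangleleft>\<^bsub>M\<^esub> (b \<otimes>\<^bsub>B\<^esub> b') = (m \<triangleleft>\<^bsub>M\<^esub> b) \<triangleleft>\<^bsub>M\<^esub> b'"
    and rsmult_one: "m \<in> carrier M \<Longrightarrow> m \<triangleleft>\<^bsub>M\<^esub> \<one>\<^bsub>B\<^esub> = m"
    and smult_middle_assoc: "\<lbrakk>a \<in> carrier A; m \<in> carrier M; b \<in> carrier B\<rbrakk> \<Longrightarrow>
      (a \<triangleright>\<^bsub>M\<^esub> m) \<triangleleft>\<^bsub>M\<^esub> b = a \<triangleright>\<^bsub>M\<^esub> (m \<triangleleft>\<^bsub>M\<^esub> b)"

definition bimod_hom ::
  "('l, 'x) ring_scheme \<Rightarrow> ('r, 'y) ring_scheme \<Rightarrow> ('l, 'r, 'm, 'u) bimodule_scheme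
    \<Rightarrow> ('l, 'r, 'n, 'v) bimodule_scheme \<Rightarrow> ('m \<Rightarrow> 'n) set" where
  "bimod_hom A B M N = {f \<in> carrier M \<rightarrow> carrier N.
     (\<forall>m\<in>carrier M. \<forall>m'\<in>carrier M. f (m \<oplus>\<^bsub>M\<^esub> m') = f m \<oplus>\<^bsub>N\<^esub> f m') \<and>
     (\<forall>a\<in>carrier A. \<forall>m\<in>carrier M. f (a \<triangleright>\<^bsub>M\<^esub> m) = a \<triangleright>\<^bsub>N\<^esub> f m) \<and>
     (\<forall>m\<in>carrier M. \<forall>b\<in>carrier B. f (m \<triangleleft>\<^bsub>M\<^esub> b) = f m \<triangleleft>\<^bsub>N\<^esub> b)}"

definition with_ract :: "('m, 'x) ring_scheme \<Rightarrow> ('m \<Rightarrow> 'r \<Rightarrow> 'm) \<Rightarrow> ('r, 'm) rmodule" where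
  "with_ract M r = \<lparr>carrier = carrier M, mult = mult M, one = one M, zero = zero M, add = add M,
     rsmult = r\<rparr>"

definition with_lact ::
  "('r, 'm, 'x) rmodule_scheme \<Rightarrow> ('l \<Rightarrow> 'm \<Rightarrow> 'm) \<Rightarrow> ('l, 'r, 'm) bimodule" where
  "with_lact M l = \<lparr>carrier = carrier M, mult = mult M, one = one M, zero = zero M, add = add M,
     rsmult = rsmult M, lsmult = l\<rparr>"

definition regular :: "('r, 'x) ring_scheme \<Rightarrow> ('r, 'r, 'r) bimodule" where
  "regular R = with_lact (with_ract R (mult R)) (mult R)"


section \<open>Tensor products\<close>

text \<open>The tensor product \<open>M \<otimes>\<^sub>A N\<close> is the free abelian group on \<open>carrier M \<times> carrier N\<close> modulo the
  subgroup generated by the biadditivity and \<open>A\<close>-balancing relations; its elements are cosets.\<close>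

type_synonym ('m, 'n) tensor = "('m \<times> 'n \<Rightarrow>\<^sub>0 int) set"

definition tensor_free ::
  "('m, 'x) ring_scheme \<Rightarrow> ('n, 'y) ring_scheme \<Rightarrow> ('m \<times> 'n \<Rightarrow>\<^sub>0 int) monoid" where
  "tensor_free M N = free_Abelian_group (carrier M \<times> carrier N)"

definition tensor_rels ::
  "('a, 'w) ring_scheme \<Rightarrow> ('a, 'm, 'x) rmodule_scheme \<Rightarrow> ('a, 'r, 'n, 'y) bimodule_scheme
    \<Rightarrow> ('m \<times> 'n \<Rightarrow>\<^sub>0 int) set" where
  "tensor_rels A M N = generate (tensor_free M N)
    ({frag_of (m \<oplus>\<^bsub>M\<^esub> m', n) - frag_of (m, n) - frag_of (m', n) | m m' n.
        m \<in> carrier M \<and> m' \<in> carrier M \<and> n \<in> carrier N} \<union>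
     {frag_of (m, n \<oplus>\<^bsub>N\<^esub> n') - frag_of (m, n) - frag_of (m, n') | m n n'.
        m \<in> carrier M \<and> n \<in> carrier N \<and> n' \<in> carrier N} \<union>
     {frag_of (m \<triangleleft>\<^bsub>M\<^esub> a, n) - frag_of (m, a \<triangleright>\<^bsub>N\<^esub> n) | m a n.
        m \<in> carrier M \<and> a \<in> carrier A \<and> n \<in> carrier N})"

definition tensor_group ::
  "('a, 'w) ring_scheme \<Rightarrow> ('a, 'm, 'x) rmodule_scheme \<Rightarrow> ('a, 'r, 'n, 'y) bimodule_scheme
    \<Rightarrow> ('m, 'n) tensor ring" where
  "tensor_group A M N = (let F = tensor_free M N Mod tensor_rels A M N in
     \<lparr>carrier = carrier F, mult = undefined, one = undefined, zero = one F, add = mult F\<rparr>)"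

definition pure_tensor ::
  "('a, 'w) ring_scheme \<Rightarrow> ('a, 'm, 'x) rmodule_scheme \<Rightarrow> ('a, 'r, 'n, 'y) bimodule_scheme
    \<Rightarrow> 'm \<Rightarrow> 'n \<Rightarrow> ('m, 'n) tensor" where
  "pure_tensor A M N m n = tensor_rels A M N #>\<^bsub>tensor_free M N\<^esub> frag_of (m, n)"

text \<open>The additive map \<open>M \<otimes>\<^sub>A N \<rightarrow> L\<close> sending \<open>m \<otimes> n\<close> to \<open>f m n\<close>. It is computed on a chosen
  representative, which is harmless whenever \<open>f\<close> is biadditive and \<open>A\<close>-balanced. This is
  how Sweedler notation is rendered below: an expression \<open>f(c\<^sub>1, c\<^sub>2)\<close> is
  \<open>tensor_lift L f (\<Delta> c)\<close>.\<close>

definition tensor_lift ::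
  "('k, 'x) ring_scheme \<Rightarrow> ('m \<Rightarrow> 'n \<Rightarrow> 'k) \<Rightarrow> ('m, 'n) tensor \<Rightarrow> 'k" where
  "tensor_lift L f t = (let z = (SOME z. z \<in> t) in
     \<Oplus>\<^bsub>L\<^esub> p \<in> Poly_Mapping.keys z. [Poly_Mapping.lookup z p] \<cdot>\<^bsub>L\<^esub> f (fst p) (snd p))"

definition tensor ::
  "('a, 'w) ring_scheme \<Rightarrow> ('l, 'a, 'm, 'x) bimodule_scheme \<Rightarrow> ('a, 'r, 'n, 'y) bimodule_scheme
    \<Rightarrow> ('l, 'r, ('m, 'n) tensor) bimodule" where
  "tensor A M N =
    with_lact
      (with_ract (tensor_group A M N)
        (\<lambda>t b. tensor_lift (tensor_group A M N) (\<lambda>m n. pure_tensor A M N m (n \<triangleleft>\<^bsub>N\<^esub> b)) t))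
      (\<lambda>a t. tensor_lift (tensor_group A M N) (\<lambda>m n. pure_tensor A M N (a \<triangleright>\<^bsub>M\<^esub> m) n) t)"

text \<open>The map \<open>f \<otimes> g\<close> into \<open>M' \<otimes>\<^sub>A N'\<close>.\<close>

definition tensor_map ::
  "('a, 'w) ring_scheme \<Rightarrow> ('l, 'a, 'p, 'x) bimodule_scheme \<Rightarrow> ('a, 'r, 'q, 'y) bimodule_scheme
    \<Rightarrow> ('m \<Rightarrow> 'p) \<Rightarrow> ('n \<Rightarrow> 'q) \<Rightarrow> ('m, 'n) tensor \<Rightarrow> ('p, 'q) tensor" where
  "tensor_map A M' N' f g =
     tensor_lift (tensor A M' N') (\<lambda>m n. pure_tensor A M' N' (f m) (g n))"

text \<open>The canonical isomorphism \<open>(M \<otimes>\<^sub>A N) \<otimes>\<^sub>A P \<rightarrow> M \<otimes>\<^sub>A (N \<otimes>\<^sub>A P)\<close>.\<close>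

definition tensor_assoc ::
  "('a, 'w) ring_scheme \<Rightarrow> ('l, 'a, 'm, 'x) bimodule_scheme \<Rightarrow> ('a, 'a, 'n, 'y) bimodule_scheme
    \<Rightarrow> ('a, 'r, 'p, 'z) bimodule_scheme
    \<Rightarrow> (('m, 'n) tensor, 'p) tensor \<Rightarrow> ('m, ('n, 'p) tensor) tensor" where
  "tensor_assoc A M N P = (let T = tensor A M (tensor A N P) in
     tensor_lift T (\<lambda>t p. tensor_lift T
       (\<lambda>m n. pure_tensor A M (tensor A N P) m (pure_tensor A N P n p)) t))"


section \<open>Gradings\<close>

definition support :: "'g set \<Rightarrow> ('g \<Rightarrow> ('m, 'x) ring_scheme) \<Rightarrow> ('g \<Rightarrow> 'm) \<Rightarrow> 'g set" where
  "support I M f = {i \<in> I. f i \<noteq> \<zero>\<^bsub>M i\<^esub>}"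

text \<open>\<open>M\<close> is the internal direct sum of the subgroups \<open>d \<alpha>\<close>.\<close>

definition graded_group ::
  "('g, 'w) monoid_scheme \<Rightarrow> ('m, 'x) ring_scheme \<Rightarrow> ('g \<Rightarrow> 'm set) \<Rightarrow> bool" where
  "graded_group G M d \<longleftrightarrow> abelian_group M \<and>
     (\<forall>\<alpha>\<in>carrier G. subgroup (d \<alpha>) (add_monoid M)) \<and>
     (\<forall>m\<in>carrier M. \<exists>!f. f \<in> (\<Pi>\<^sub>E \<alpha>\<in>carrier G. d \<alpha>) \<and>
        finite (support (carrier G) (\<lambda>_. M) f) \<and>
        m = (\<Oplus>\<^bsub>M\<^esub> \<alpha> \<in> support (carrier G) (\<lambda>_. M) f. f \<alpha>))"

definition graded_ring ::
  "('g, 'w) monoid_scheme \<Rightarrow> ('r, 'x) ring_scheme \<Rightarrow> ('g \<Rightarrow> 'r set) \<Rightarrow> bool" where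
  "graded_ring G R d \<longleftrightarrow> ring R \<and> graded_group G R d \<and> \<one>\<^bsub>R\<^esub> \<in> d \<one>\<^bsub>G\<^esub> \<and>
     (\<forall>\<alpha>\<in>carrier G. \<forall>\<beta>\<in>carrier G. \<forall>r\<in>d \<alpha>. \<forall>s\<in>d \<beta>. r \<otimes>\<^bsub>R\<^esub> s \<in> d (\<alpha> \<otimes>\<^bsub>G\<^esub> \<beta>))"

definition graded_bimodule ::
  "('g, 'w) monoid_scheme \<Rightarrow> ('s, 'x) ring_scheme \<Rightarrow> ('g \<Rightarrow> 's set) \<Rightarrow> ('r, 'y) ring_scheme
    \<Rightarrow> ('g \<Rightarrow> 'r set) \<Rightarrow> ('s, 'r, 'm, 'z) bimodule_scheme \<Rightarrow> ('g \<Rightarrow> 'm set) \<Rightarrow> bool" where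
  "graded_bimodule G S dS R dR M dM \<longleftrightarrow> bimodule S R M \<and> graded_group G M dM \<and>
     (\<forall>\<alpha>\<in>carrier G. \<forall>\<beta>\<in>carrier G. \<forall>s\<in>dS \<alpha>. \<forall>m\<in>dM \<beta>. s \<triangleright>\<^bsub>M\<^esub> m \<in> dM (\<alpha> \<otimes>\<^bsub>G\<^esub> \<beta>)) \<and>
     (\<forall>\<alpha>\<in>carrier G. \<forall>\<beta>\<in>carrier G. \<forall>m\<in>dM \<alpha>. \<forall>r\<in>dR \<beta>. m \<triangleleft>\<^bsub>M\<^esub> r \<in> dM (\<alpha> \<otimes>\<^bsub>G\<^esub> \<beta>))"

definition tensor_deg ::
  "('g, 'w) monoid_scheme \<Rightarrow> ('a, 'v) ring_scheme \<Rightarrow> ('l, 'a, 'm, 'x) bimodule_scheme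
    \<Rightarrow> ('g \<Rightarrow> 'm set) \<Rightarrow> ('a, 'r, 'n, 'y) bimodule_scheme \<Rightarrow> ('g \<Rightarrow> 'n set)
    \<Rightarrow> 'g \<Rightarrow> ('m, 'n) tensor set" where
  "tensor_deg G A M dM N dN \<sigma> = generate (add_monoid (tensor A M N))
     {pure_tensor A M N m n | m n \<alpha> \<beta>. \<alpha> \<in> carrier G \<and> \<beta> \<in> carrier G \<and> \<alpha> \<otimes>\<^bsub>G\<^esub> \<beta> = \<sigma> \<and>
        m \<in> dM \<alpha> \<and> n \<in> dN \<beta>}"

text \<open>External direct sums: finitely supported families, with the inclusions of the summands.\<close>

definition dsum :: "'g set \<Rightarrow> ('g \<Rightarrow> ('m, 'x) ring_scheme) \<Rightarrow> ('g \<Rightarrow> 'm) ring" where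
  "dsum I M = (let D = sum_group I (\<lambda>i. add_monoid (M i)) in
     \<lparr>carrier = carrier D, mult = undefined, one = undefined, zero = one D, add = mult D\<rparr>)"

definition dsum_in :: "'g set \<Rightarrow> ('g \<Rightarrow> ('m, 'x) ring_scheme) \<Rightarrow> 'g \<Rightarrow> 'm \<Rightarrow> ('g \<Rightarrow> 'm)" where
  "dsum_in I M i m = (\<lambda>j\<in>I. if j = i then m else \<zero>\<^bsub>M j\<^esub>)"

definition dsum_deg :: "'g set \<Rightarrow> ('g \<Rightarrow> ('m, 'x) ring_scheme) \<Rightarrow> 'g \<Rightarrow> ('g \<Rightarrow> 'm) set" where
  "dsum_deg I M i = dsum_in I M i ` carrier (M i)"

text \<open>Extension of an operation given on homogeneous elements: for \<open>p = \<Sum>\<^sub>\<alpha> p\<^sub>\<alpha>\<close> and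
  \<open>q = \<Sum>\<^sub>\<beta> q\<^sub>\<beta>\<close>, this is the sum over all \<open>\<alpha>, \<beta>\<close> of \<open>h \<alpha> p\<^sub>\<alpha> \<beta> q\<^sub>\<beta>\<close>.\<close>

definition bilin_ext ::
  "'g set \<Rightarrow> ('g \<Rightarrow> ('m, 'x) ring_scheme) \<Rightarrow> ('g \<Rightarrow> ('n, 'y) ring_scheme) \<Rightarrow> ('t, 'z) ring_scheme
    \<Rightarrow> ('g \<Rightarrow> 'm \<Rightarrow> 'g \<Rightarrow> 'n \<Rightarrow> 't) \<Rightarrow> ('g \<Rightarrow> 'm) \<Rightarrow> ('g \<Rightarrow> 'n) \<Rightarrow> 't" where
  "bilin_ext I M N T h p q =
     (\<Oplus>\<^bsub>T\<^esub> z \<in> support I M p \<times> support I N q. h (fst z) (p (fst z)) (snd z) (q (snd z)))"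


section \<open>Graded homomorphisms\<close>

text \<open>Homomorphisms are represented by functions that are \<open>undefined\<close> outside the carrier.\<close>

definition HOM_deg ::
  "('g, 'w) monoid_scheme \<Rightarrow> ('r, 'x) ring_scheme \<Rightarrow> ('r, 'm, 'y) rmodule_scheme \<Rightarrow> ('g \<Rightarrow> 'm set)
    \<Rightarrow> ('r, 'n, 'z) rmodule_scheme \<Rightarrow> ('g \<Rightarrow> 'n set) \<Rightarrow> 'g \<Rightarrow> ('m \<Rightarrow> 'n) set" where
  "HOM_deg G R M dM N dN \<sigma> = {f \<in> carrier M \<rightarrow>\<^sub>E carrier N.
     (\<forall>m\<in>carrier M. \<forall>m'\<in>carrier M. f (m \<oplus>\<^bsub>M\<^esub> m') = f m \<oplus>\<^bsub>N\<^esub> f m') \<and>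
     (\<forall>m\<in>carrier M. \<forall>r\<in>carrier R. f (m \<triangleleft>\<^bsub>M\<^esub> r) = f m \<triangleleft>\<^bsub>N\<^esub> r) \<and>
     (\<forall>\<alpha>\<in>carrier G. f ` dM \<alpha> \<subseteq> dN (\<sigma> \<otimes>\<^bsub>G\<^esub> \<alpha>))}"

text \<open>The sum of the \<open>HOM_deg \<sigma>\<close> inside the group of all right \<open>R\<close>-linear maps.\<close>

definition HOM ::
  "('g, 'w) monoid_scheme \<Rightarrow> ('r, 'x) ring_scheme \<Rightarrow> ('r, 'm, 'y) rmodule_scheme \<Rightarrow> ('g \<Rightarrow> 'm set)
    \<Rightarrow> ('r, 'n, 'z) rmodule_scheme \<Rightarrow> ('g \<Rightarrow> 'n set) \<Rightarrow> ('m \<Rightarrow> 'n) ring" where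
  "HOM G R M dM N dN =
    \<lparr>carrier = {f. \<exists>F \<phi>. finite F \<and> F \<subseteq> carrier G \<and> (\<forall>\<sigma>\<in>F. \<phi> \<sigma> \<in> HOM_deg G R M dM N dN \<sigma>) \<and>
        f = (\<lambda>m\<in>carrier M. \<Oplus>\<^bsub>N\<^esub> \<sigma> \<in> F. \<phi> \<sigma> m)},
     mult = undefined, one = undefined,
     zero = (\<lambda>m\<in>carrier M. \<zero>\<^bsub>N\<^esub>), add = (\<lambda>f g. \<lambda>m\<in>carrier M. f m \<oplus>\<^bsub>N\<^esub> g m)\<rparr>"

definition END ::
  "('g, 'w) monoid_scheme \<Rightarrow> ('r, 'x) ring_scheme \<Rightarrow> ('r, 'm, 'y) rmodule_scheme \<Rightarrow> ('g \<Rightarrow> 'm set)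
    \<Rightarrow> ('m \<Rightarrow> 'm) ring" where
  "END G R M dM = (HOM G R M dM M dM)
     \<lparr>mult := compose (carrier M), one := (\<lambda>m\<in>carrier M. m)\<rparr>"


section \<open>Graded Morita contexts\<close>

record ('g, 's, 'r, 'p, 'q) morita =
  mcS :: "'s ring"
  mcdS :: "'g \<Rightarrow> 's set"
  mcR :: "'r ring"
  mcdR :: "'g \<Rightarrow> 'r set"
  mcP :: "('s, 'r, 'p) bimodule"
  mcdP :: "'g \<Rightarrow> 'p set"
  mcQ :: "('r, 's, 'q) bimodule"
  mcdQ :: "'g \<Rightarrow> 'q set"
  mcphi :: "('p, 'q) tensor \<Rightarrow> 's"
  mcpsi :: "('q, 'p) tensor \<Rightarrow> 'r"

abbreviation mcPQ where "mcPQ K \<equiv> tensor (mcR K) (mcP K) (mcQ K)"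
abbreviation mcQP where "mcQP K \<equiv> tensor (mcS K) (mcQ K) (mcP K)"
abbreviation mcpq where "mcpq K \<equiv> pure_tensor (mcR K) (mcP K) (mcQ K)"
abbreviation mcqp where "mcqp K \<equiv> pure_tensor (mcS K) (mcQ K) (mcP K)"

definition graded_morita ::
  "('g, 'w) monoid_scheme \<Rightarrow> ('g, 's, 'r, 'p, 'q) morita \<Rightarrow> bool" where
  "graded_morita G K \<longleftrightarrow>
     graded_ring G (mcS K) (mcdS K) \<and>
     graded_ring G (mcR K) (mcdR K) \<and>
     graded_bimodule G (mcS K) (mcdS K) (mcR K) (mcdR K) (mcP K) (mcdP K) \<and>
     graded_bimodule G (mcR K) (mcdR K) (mcS K) (mcdS K) (mcQ K) (mcdQ K) \<and>
     mcphi K \<in> bimod_hom (mcS K) (mcS K) (mcPQ K) (regular (mcS K)) \<and>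
     mcpsi K \<in> bimod_hom (mcR K) (mcR K) (mcQP K) (regular (mcR K)) \<and>
     (\<forall>\<sigma>\<in>carrier G.
        mcphi K ` tensor_deg G (mcR K) (mcP K) (mcdP K) (mcQ K) (mcdQ K) \<sigma> \<subseteq> mcdS K \<sigma>) \<and>
     (\<forall>\<sigma>\<in>carrier G.
        mcpsi K ` tensor_deg G (mcS K) (mcQ K) (mcdQ K) (mcP K) (mcdP K) \<sigma> \<subseteq> mcdR K \<sigma>) \<and>
     (\<forall>p\<in>carrier (mcP K). \<forall>q\<in>carrier (mcQ K). \<forall>p'\<in>carrier (mcP K).
        mcphi K (mcpq K p q) \<triangleright>\<^bsub>mcP K\<^esub> p' = p \<triangleleft>\<^bsub>mcP K\<^esub> mcpsi K (mcqp K q p')) \<and>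
     (\<forall>q\<in>carrier (mcQ K). \<forall>p\<in>carrier (mcP K). \<forall>q'\<in>carrier (mcQ K).
        mcpsi K (mcqp K q p) \<triangleright>\<^bsub>mcQ K\<^esub> q' = q \<triangleleft>\<^bsub>mcQ K\<^esub> mcphi K (mcpq K p q'))"

definition graded_ring_iso ::
  "('g, 'w) monoid_scheme \<Rightarrow> ('r, 'x) ring_scheme \<Rightarrow> ('g \<Rightarrow> 'r set)
    \<Rightarrow> ('s, 'y) ring_scheme \<Rightarrow> ('g \<Rightarrow> 's set) \<Rightarrow> ('r \<Rightarrow> 's) set" where
  "graded_ring_iso G R dR S dS = {f \<in> ring_iso R S. \<forall>\<alpha>\<in>carrier G. f ` dR \<alpha> = dS \<alpha>}"

text \<open>Isomorphisms of graded bimodules compatible with ring maps \<open>f\<close> (left) and \<open>g\<close> (right).\<close>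

definition graded_bimod_iso ::
  "('g, 'w) monoid_scheme \<Rightarrow> ('s, 'x) ring_scheme \<Rightarrow> ('r, 'y) ring_scheme \<Rightarrow> ('s \<Rightarrow> 's') \<Rightarrow> ('r \<Rightarrow> 'r')
    \<Rightarrow> ('s, 'r, 'm, 'u) bimodule_scheme \<Rightarrow> ('g \<Rightarrow> 'm set)
    \<Rightarrow> ('s', 'r', 'n, 'v) bimodule_scheme \<Rightarrow> ('g \<Rightarrow> 'n set) \<Rightarrow> ('m \<Rightarrow> 'n) set" where
  "graded_bimod_iso G S R f g M dM N dN = {h.
     bij_betw h (carrier M) (carrier N) \<and>
     (\<forall>m\<in>carrier M. \<forall>m'\<in>carrier M. h (m \<oplus>\<^bsub>M\<^esub> m') = h m \<oplus>\<^bsub>N\<^esub> h m') \<and>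
     (\<forall>s\<in>carrier S. \<forall>m\<in>carrier M. h (s \<triangleright>\<^bsub>M\<^esub> m) = f s \<triangleright>\<^bsub>N\<^esub> h m) \<and>
     (\<forall>m\<in>carrier M. \<forall>r\<in>carrier R. h (m \<triangleleft>\<^bsub>M\<^esub> r) = h m \<triangleleft>\<^bsub>N\<^esub> g r) \<and>
     (\<forall>\<alpha>\<in>carrier G. h ` dM \<alpha> = dN \<alpha>)}"

definition graded_morita_iso ::
  "('g, 'w) monoid_scheme \<Rightarrow> ('g, 's, 'r, 'p, 'q) morita \<Rightarrow> ('g, 's', 'r', 'p', 'q') morita
    \<Rightarrow> ('s \<Rightarrow> 's') \<Rightarrow> ('r \<Rightarrow> 'r') \<Rightarrow> ('p \<Rightarrow> 'p') \<Rightarrow> ('q \<Rightarrow> 'q') \<Rightarrow> bool" where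
  "graded_morita_iso G K K' f g h k \<longleftrightarrow>
     f \<in> graded_ring_iso G (mcS K) (mcdS K) (mcS K') (mcdS K') \<and>
     g \<in> graded_ring_iso G (mcR K) (mcdR K) (mcR K') (mcdR K') \<and>
     h \<in> graded_bimod_iso G (mcS K) (mcR K) f g (mcP K) (mcdP K) (mcP K') (mcdP K') \<and>
     k \<in> graded_bimod_iso G (mcR K) (mcS K) g f (mcQ K) (mcdQ K) (mcQ K') (mcdQ K') \<and>
     (\<forall>t\<in>carrier (mcPQ K).
        f (mcphi K t) = mcphi K' (tensor_map (mcR K') (mcP K') (mcQ K') h k t)) \<and>
     (\<forall>t\<in>carrier (mcQP K).
        g (mcpsi K t) = mcpsi K' (tensor_map (mcS K') (mcQ K') (mcP K') k h t))"

text \<open>The context associated to a graded right \<open>R\<close>-module \<open>P\<close>.\<close>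

definition module_morita ::
  "('g, 'w) monoid_scheme \<Rightarrow> 'r ring \<Rightarrow> ('g \<Rightarrow> 'r set) \<Rightarrow> ('r, 'p) rmodule \<Rightarrow> ('g \<Rightarrow> 'p set)
    \<Rightarrow> ('g, 'p \<Rightarrow> 'p, 'r, 'p, 'p \<Rightarrow> 'r) morita" where
  "module_morita G R dR P dP =
    \<lparr>mcS = END G R P dP,
     mcdS = HOM_deg G R P dP P dP,
     mcR = R,
     mcdR = dR,
     mcP = with_lact P (\<lambda>s p. s p),
     mcdP = dP,
     mcQ = with_lact
       (with_ract (HOM G R P dP (regular R) dR) (\<lambda>q s. compose (carrier P) q s))
       (\<lambda>r q. \<lambda>p\<in>carrier P. r \<otimes>\<^bsub>R\<^esub> q p),
     mcdQ = HOM_deg G R P dP (regular R) dR,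
     mcphi = tensor_lift (END G R P dP) (\<lambda>p q. \<lambda>p'\<in>carrier P. p \<triangleleft>\<^bsub>P\<^esub> q p'),
     mcpsi = tensor_lift R (\<lambda>q p. q p)\<rparr>"


section \<open>Group corings\<close>

locale group_coring = group G + A: ring A
  for G :: "'g monoid" (structure) and A :: "'a ring" +
  fixes C :: "'g \<Rightarrow> ('a, 'a, 'c) bimodule"
    and \<Delta> :: "'g \<Rightarrow> 'g \<Rightarrow> 'c \<Rightarrow> ('c, 'c) tensor"
    and \<epsilon> :: "'c \<Rightarrow> 'a"
  assumes C_bimodule: "\<alpha> \<in> carrier G \<Longrightarrow> bimodule A A (C \<alpha>)"
    and comult_hom: "\<lbrakk>\<alpha> \<in> carrier G; \<beta> \<in> carrier G\<rbrakk> \<Longrightarrow>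
      \<Delta> \<alpha> \<beta> \<in> bimod_hom A A (C (\<alpha> \<otimes> \<beta>)) (tensor A (C \<alpha>) (C \<beta>))"
    and counit_hom: "\<epsilon> \<in> bimod_hom A A (C \<one>) (regular A)"
    and coassoc: "\<lbrakk>\<alpha> \<in> carrier G; \<beta> \<in> carrier G; \<gamma> \<in> carrier G; c \<in> carrier (C (\<alpha> \<otimes> \<beta> \<otimes> \<gamma>))\<rbrakk> \<Longrightarrow>
      tensor_assoc A (C \<alpha>) (C \<beta>) (C \<gamma>)
        (tensor_map A (tensor A (C \<alpha>) (C \<beta>)) (C \<gamma>) (\<Delta> \<alpha> \<beta>) id (\<Delta> (\<alpha> \<otimes> \<beta>) \<gamma> c)) =
      tensor_map A (C \<alpha>) (tensor A (C \<beta>) (C \<gamma>)) id (\<Delta> \<beta> \<gamma>) (\<Delta> \<alpha> (\<beta> \<otimes> \<gamma>) c)"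
    and counit_right: "\<lbrakk>\<alpha> \<in> carrier G; c \<in> carrier (C \<alpha>)\<rbrakk> \<Longrightarrow>
      tensor_lift (C \<alpha>) (\<lambda>d a. d \<triangleleft>\<^bsub>C \<alpha>\<^esub> a)
        (tensor_map A (C \<alpha>) (regular A) id \<epsilon> (\<Delta> \<alpha> \<one> c)) = c"
    and counit_left: "\<lbrakk>\<alpha> \<in> carrier G; c \<in> carrier (C \<alpha>)\<rbrakk> \<Longrightarrow>
      tensor_lift (C \<alpha>) (\<lambda>a d. a \<triangleright>\<^bsub>C \<alpha>\<^esub> d)
        (tensor_map A (regular A) (C \<alpha>) \<epsilon> id (\<Delta> \<one> \<alpha> c)) = c"

locale grouplike_coring = group_coring +
  fixes x :: "'g \<Rightarrow> 'c"
  assumes x_closed: "\<alpha> \<in> carrier G \<Longrightarrow> x \<alpha> \<in> carrier (C \<alpha>)"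
    and comult_x: "\<lbrakk>\<alpha> \<in> carrier G; \<beta> \<in> carrier G\<rbrakk> \<Longrightarrow>
      \<Delta> \<alpha> \<beta> (x (\<alpha> \<otimes> \<beta>)) = pure_tensor A (C \<alpha>) (C \<beta>) (x \<alpha>) (x \<beta>)"
    and counit_x: "\<epsilon> (x \<one>) = \<one>\<^bsub>A\<^esub>"

context group_coring
begin

text \<open>The homogeneous component \<open>R\<^sub>\<alpha>\<close> of the left dual.\<close>

definition dual :: "'g \<Rightarrow> ('a, 'a, 'c \<Rightarrow> 'a) bimodule" where
  "dual \<alpha> =
    \<lparr>carrier = {f \<in> carrier (C (inv \<alpha>)) \<rightarrow>\<^sub>E carrier A.
       (\<forall>c\<in>carrier (C (inv \<alpha>)). \<forall>c'\<in>carrier (C (inv \<alpha>)).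
          f (c \<oplus>\<^bsub>C (inv \<alpha>)\<^esub> c') = f c \<oplus>\<^bsub>A\<^esub> f c') \<and>
       (\<forall>a\<in>carrier A. \<forall>c\<in>carrier (C (inv \<alpha>)). f (a \<triangleright>\<^bsub>C (inv \<alpha>)\<^esub> c) = a \<otimes>\<^bsub>A\<^esub> f c)},
     mult = undefined, one = undefined,
     zero = (\<lambda>c\<in>carrier (C (inv \<alpha>)). \<zero>\<^bsub>A\<^esub>),
     add = (\<lambda>f g. \<lambda>c\<in>carrier (C (inv \<alpha>)). f c \<oplus>\<^bsub>A\<^esub> g c),
     rsmult = (\<lambda>f b. \<lambda>c\<in>carrier (C (inv \<alpha>)). f c \<otimes>\<^bsub>A\<^esub> b),
     lsmult = (\<lambda>a f. \<lambda>c\<in>carrier (C (inv \<alpha>)). f (c \<triangleleft>\<^bsub>C (inv \<alpha>)\<^esub> a))\<rparr>"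

text \<open>\<open>conv \<alpha> f \<beta> g\<close> is \<open>f # g\<close> for \<open>f\<close> of degree \<open>\<alpha>\<close> and \<open>g\<close> of degree \<open>\<beta>\<close>.\<close>

definition conv :: "'g \<Rightarrow> ('c \<Rightarrow> 'a) \<Rightarrow> 'g \<Rightarrow> ('c \<Rightarrow> 'a) \<Rightarrow> 'c \<Rightarrow> 'a" where
  "conv \<alpha> f \<beta> g = (\<lambda>c\<in>carrier (C (inv (\<alpha> \<otimes> \<beta>))).
     tensor_lift A (\<lambda>c\<^sub>1 c\<^sub>2. g (c\<^sub>1 \<triangleleft>\<^bsub>C (inv \<beta>)\<^esub> f c\<^sub>2)) (\<Delta> (inv \<beta>) (inv \<alpha>) c))"

abbreviation \<rho> :: "'g \<Rightarrow> ('c \<Rightarrow> 'a) \<Rightarrow> ('g \<Rightarrow> 'c \<Rightarrow> 'a)" where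
  "\<rho> \<equiv> dsum_in (carrier G) dual"

definition Rdual :: "('g \<Rightarrow> 'c \<Rightarrow> 'a) ring" where
  "Rdual = (dsum (carrier G) dual)
    \<lparr>mult := bilin_ext (carrier G) dual dual (dsum (carrier G) dual)
               (\<lambda>\<alpha> f \<beta> g. \<rho> (\<alpha> \<otimes> \<beta>) (conv \<alpha> f \<beta> g)),
     one := \<rho> \<one> (\<lambda>c\<in>carrier (C \<one>). \<epsilon> c)\<rparr>"

definition Rdual_deg :: "'g \<Rightarrow> ('g \<Rightarrow> 'c \<Rightarrow> 'a) set" where
  "Rdual_deg = dsum_deg (carrier G) dual"

definition \<mu> :: "'g \<Rightarrow> 'a \<Rightarrow> ('g \<Rightarrow> 'a)" where
  "\<mu> = dsum_in (carrier G) (\<lambda>_. A)"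

definition AG_deg :: "'g \<Rightarrow> ('g \<Rightarrow> 'a) set" where
  "AG_deg = dsum_deg (carrier G) (\<lambda>_. A)"

end

context grouplike_coring
begin

definition AG :: "('g \<Rightarrow> 'c \<Rightarrow> 'a, 'g \<Rightarrow> 'a) rmodule" where
  "AG = with_ract (dsum (carrier G) (\<lambda>_. A))
     (bilin_ext (carrier G) (\<lambda>_. A) dual (dsum (carrier G) (\<lambda>_. A))
       (\<lambda>\<alpha> a \<beta> f. \<mu> (\<alpha> \<otimes> \<beta>) (f (x (inv \<beta>) \<triangleleft>\<^bsub>C (inv \<beta>)\<^esub> a))))"

definition S' :: "('g \<Rightarrow> 'a) ring" where
  "S' =
    \<lparr>carrier = {b \<in> carrier G \<rightarrow>\<^sub>E carrier A.
       \<forall>\<alpha>\<in>carrier G. \<forall>\<beta>\<in>carrier G. \<forall>f\<in>carrier (dual \<beta>).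
         f (b (\<alpha> \<otimes> \<beta>) \<triangleright>\<^bsub>C (inv \<beta>)\<^esub> x (inv \<beta>)) = f (x (inv \<beta>) \<triangleleft>\<^bsub>C (inv \<beta>)\<^esub> b \<alpha>)},
     mult = (\<lambda>b c. \<lambda>\<alpha>\<in>carrier G. b \<alpha> \<otimes>\<^bsub>A\<^esub> c \<alpha>),
     one = (\<lambda>\<alpha>\<in>carrier G. \<one>\<^bsub>A\<^esub>),
     zero = (\<lambda>\<alpha>\<in>carrier G. \<zero>\<^bsub>A\<^esub>),
     add = (\<lambda>b c. \<lambda>\<alpha>\<in>carrier G. b \<alpha> \<oplus>\<^bsub>A\<^esub> c \<alpha>)\<rparr>"

text \<open>The right action \<open>b\<^sup>\<sigma>\<close> of \<open>G\<close> on \<open>S'\<close>.\<close>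

definition shift :: "('g \<Rightarrow> 'a) \<Rightarrow> 'g \<Rightarrow> ('g \<Rightarrow> 'a)" where
  "shift b \<sigma> = (\<lambda>\<alpha>\<in>carrier G. b (\<sigma> \<otimes> \<alpha>))"

definition u :: "'g \<Rightarrow> ('g \<Rightarrow> 'a) \<Rightarrow> ('g \<Rightarrow> 'g \<Rightarrow> 'a)" where
  "u = dsum_in (carrier G) (\<lambda>_. S')"

definition GS' :: "('g \<Rightarrow> 'g \<Rightarrow> 'a) ring" where
  "GS' = (dsum (carrier G) (\<lambda>_. S'))
    \<lparr>mult := bilin_ext (carrier G) (\<lambda>_. S') (\<lambda>_. S') (dsum (carrier G) (\<lambda>_. S'))
               (\<lambda>\<alpha> b \<beta> c. u (\<alpha> \<otimes> \<beta>) (shift b \<beta> \<otimes>\<^bsub>S'\<^esub> c)),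
     one := u \<one> \<one>\<^bsub>S'\<^esub>\<rparr>"

definition GS'_deg :: "'g \<Rightarrow> ('g \<Rightarrow> 'g \<Rightarrow> 'a) set" where
  "GS'_deg = dsum_deg (carrier G) (\<lambda>_. S')"

definition AG_GS' :: "('g \<Rightarrow> 'g \<Rightarrow> 'a, 'g \<Rightarrow> 'c \<Rightarrow> 'a, 'g \<Rightarrow> 'a) bimodule" where
  "AG_GS' = with_lact AG
     (bilin_ext (carrier G) (\<lambda>_. S') (\<lambda>_. A) AG (\<lambda>\<sigma> b \<alpha> a. \<mu> (\<sigma> \<otimes> \<alpha>) (b \<alpha> \<otimes>\<^bsub>A\<^esub> a)))"

text \<open>Only the additive group structure of \<open>Q'\<close> is recorded here.\<close>

definition Q' :: "('g \<Rightarrow> 'c \<Rightarrow> 'a) ring" where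
  "Q' =
    \<lparr>carrier = {q \<in> (\<Pi>\<^sub>E \<alpha>\<in>carrier G. carrier (dual \<alpha>)).
       \<forall>\<alpha>\<in>carrier G. \<forall>\<beta>\<in>carrier G. \<forall>c\<in>carrier (C (inv (\<alpha> \<otimes> \<beta>))). \<forall>f\<in>carrier (dual \<beta>).
         tensor_lift A (\<lambda>c\<^sub>1 c\<^sub>2. f (c\<^sub>1 \<triangleleft>\<^bsub>C (inv \<beta>)\<^esub> q \<alpha> c\<^sub>2)) (\<Delta> (inv \<beta>) (inv \<alpha>) c) =
         f (q (\<alpha> \<otimes> \<beta>) c \<triangleright>\<^bsub>C (inv \<beta>)\<^esub> x (inv \<beta>))},
     mult = undefined, one = undefined,
     zero = (\<lambda>\<alpha>\<in>carrier G. \<zero>\<^bsub>dual \<alpha>\<^esub>),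
     add = (\<lambda>p q. \<lambda>\<alpha>\<in>carrier G. p \<alpha> \<oplus>\<^bsub>dual \<alpha>\<^esub> q \<alpha>)\<rparr>"

definition \<omega> :: "'g \<Rightarrow> ('g \<Rightarrow> 'c \<Rightarrow> 'a) \<Rightarrow> ('g \<Rightarrow> 'g \<Rightarrow> 'c \<Rightarrow> 'a)" where
  "\<omega> = dsum_in (carrier G) (\<lambda>_. Q')"

text \<open>\<open>f \<cdot> q\<close> for \<open>f\<close> of degree \<open>\<beta>\<close>, and \<open>q \<cdot> b\<close>.\<close>

definition Q'_lact :: "'g \<Rightarrow> ('c \<Rightarrow> 'a) \<Rightarrow> ('g \<Rightarrow> 'c \<Rightarrow> 'a) \<Rightarrow> ('g \<Rightarrow> 'c \<Rightarrow> 'a)" where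
  "Q'_lact \<beta> f q = (\<lambda>\<gamma>\<in>carrier G. conv \<beta> f (inv \<beta> \<otimes> \<gamma>) (q (inv \<beta> \<otimes> \<gamma>)))"

definition Q'_ract :: "('g \<Rightarrow> 'c \<Rightarrow> 'a) \<Rightarrow> ('g \<Rightarrow> 'a) \<Rightarrow> ('g \<Rightarrow> 'c \<Rightarrow> 'a)" where
  "Q'_ract q b = (\<lambda>\<gamma>\<in>carrier G. q \<gamma> \<triangleleft>\<^bsub>dual \<gamma>\<^esub> b \<gamma>)"

definition Q'G :: "('g \<Rightarrow> 'c \<Rightarrow> 'a, 'g \<Rightarrow> 'g \<Rightarrow> 'a, 'g \<Rightarrow> 'g \<Rightarrow> 'c \<Rightarrow> 'a) bimodule" where
  "Q'G = (let D = dsum (carrier G) (\<lambda>_. Q') in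
     with_lact
       (with_ract D (bilin_ext (carrier G) (\<lambda>_. Q') (\<lambda>_. S') D
         (\<lambda>\<alpha> q \<tau> b. \<omega> (\<alpha> \<otimes> \<tau>) (Q'_ract q (shift b (inv (\<alpha> \<otimes> \<tau>)))))))
       (bilin_ext (carrier G) dual (\<lambda>_. Q') D (\<lambda>\<beta> f \<alpha> q. \<omega> (\<beta> \<otimes> \<alpha>) (Q'_lact \<beta> f q))))"

definition Q'G_deg :: "'g \<Rightarrow> ('g \<Rightarrow> 'g \<Rightarrow> 'c \<Rightarrow> 'a) set" where
  "Q'G_deg = dsum_deg (carrier G) (\<lambda>_. Q')"

definition \<omega>' :: "('g \<Rightarrow> 'a, 'g \<Rightarrow> 'g \<Rightarrow> 'c \<Rightarrow> 'a) tensor \<Rightarrow> ('g \<Rightarrow> 'g \<Rightarrow> 'a)" where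
  "\<omega>' = tensor_lift GS' (bilin_ext (carrier G) (\<lambda>_. A) (\<lambda>_. Q') GS'
     (\<lambda>\<alpha> a \<sigma> q. u (\<alpha> \<otimes> \<sigma>)
        (\<lambda>\<beta>\<in>carrier G. q (\<sigma> \<otimes> \<beta>) (x (inv (\<sigma> \<otimes> \<beta>)) \<triangleleft>\<^bsub>C (inv (\<sigma> \<otimes> \<beta>))\<^esub> a))))"

definition \<nu>' :: "('g \<Rightarrow> 'g \<Rightarrow> 'c \<Rightarrow> 'a, 'g \<Rightarrow> 'a) tensor \<Rightarrow> ('g \<Rightarrow> 'c \<Rightarrow> 'a)" where
  "\<nu>' = tensor_lift Rdual (bilin_ext (carrier G) (\<lambda>_. Q') (\<lambda>_. A) Rdual
     (\<lambda>\<sigma> q \<alpha> a. \<rho> (\<sigma> \<otimes> \<alpha>) (q (\<sigma> \<otimes> \<alpha>) \<triangleleft>\<^bsub>dual (\<sigma> \<otimes> \<alpha>)\<^esub> a)))"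

definition GM' ::
  "('g, 'g \<Rightarrow> 'g \<Rightarrow> 'a, 'g \<Rightarrow> 'c \<Rightarrow> 'a, 'g \<Rightarrow> 'a, 'g \<Rightarrow> 'g \<Rightarrow> 'c \<Rightarrow> 'a) morita" where
  "GM' = \<lparr>mcS = GS', mcdS = GS'_deg, mcR = Rdual, mcdR = Rdual_deg,
     mcP = AG_GS', mcdP = AG_deg, mcQ = Q'G, mcdQ = Q'G_deg, mcphi = \<omega>', mcpsi = \<nu>'\<rparr>"

definition GM_AG ::
  "('g, ('g \<Rightarrow> 'a) \<Rightarrow> ('g \<Rightarrow> 'a), 'g \<Rightarrow> 'c \<Rightarrow> 'a, 'g \<Rightarrow> 'a, ('g \<Rightarrow> 'a) \<Rightarrow> ('g \<Rightarrow> 'c \<Rightarrow> 'a)) morita" where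
  "GM_AG = module_morita G Rdual Rdual_deg AG AG_deg"

text \<open>The additive extensions of \<open>\<Xi>\<close> and \<open>\<Psi>\<close> from homogeneous to all elements: if
  \<open>h = \<Sum>\<^sub>\<sigma> h\<^sub>\<sigma>\<close> with \<open>h\<^sub>\<sigma>\<close> of degree \<open>\<sigma>\<close>, then the degree \<open>\<sigma>\<alpha>\<close> part of \<open>h (\<mu>\<^sub>\<alpha> 1)\<close> is
  \<open>h\<^sub>\<sigma> (\<mu>\<^sub>\<alpha> 1)\<close>.\<close>

definition \<Xi> :: "(('g \<Rightarrow> 'a) \<Rightarrow> ('g \<Rightarrow> 'a)) \<Rightarrow> ('g \<Rightarrow> 'g \<Rightarrow> 'a)" where
  "\<Xi> h = (\<lambda>\<sigma>\<in>carrier G. \<lambda>\<alpha>\<in>carrier G. h (\<mu> \<alpha> \<one>\<^bsub>A\<^esub>) (\<sigma> \<otimes> \<alpha>))"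

definition \<Psi> :: "(('g \<Rightarrow> 'a) \<Rightarrow> ('g \<Rightarrow> 'c \<Rightarrow> 'a)) \<Rightarrow> ('g \<Rightarrow> 'g \<Rightarrow> 'c \<Rightarrow> 'a)" where
  "\<Psi> \<phi> = (\<lambda>\<sigma>\<in>carrier G. \<lambda>\<alpha>\<in>carrier G. \<phi> (\<mu> (inv \<sigma> \<otimes> \<alpha>) \<one>\<^bsub>A\<^esub>) \<alpha>)"

end

end

theory Submission
  imports Defs
begin

text \<open>
  An \<open>R\<close>-linear map out of \<open>A{G}\<close> is determined by its values at the elements \<open>\<mu>\<^sub>\<alpha>(1)\<close>: the
  elements \<open>\<epsilon> a\<close> form a copy of \<open>A\<close> in \<open>R\<^sub>e\<close>, and \<open>\<mu>\<^sub>\<alpha>(1) \<cdot> (\<epsilon> a) = \<mu>\<^sub>\<alpha>(a)\<close> because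
  \<open>\<epsilon>(x\<^sub>e) = 1\<close>. Hence an endomorphism \<open>h\<close> of degree \<open>\<sigma>\<close> has the form
  \<open>h(\<mu>\<^sub>\<alpha>(a)) = \<mu>\<^sub>\<sigma>\<^sub>\<alpha>(b\<^sub>\<alpha> a)\<close>, and a functional \<open>\<phi>\<close> of degree \<open>\<sigma>\<close> the form
  \<open>\<phi>(\<mu>\<^sub>\<alpha>(a)) = q\<^sub>\<sigma>\<^sub>\<alpha> \<cdot> a\<close>. Evaluating both at \<open>\<mu>\<^sub>\<alpha>(1) \<cdot> f\<close>, which is \<open>\<mu>\<^sub>\<alpha>\<^sub>\<beta>\<close> of
  \<open>f(x)\<close> for \<open>f\<close> of degree \<open>\<beta>\<close>, shows that linearity of \<open>h\<close> is the system of equations defining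
  \<open>S'\<close>, and linearity of \<open>\<phi>\<close> the one defining \<open>Q'\<close> (lemmas \<open>END_coordinates\<close>, \<open>act_END\<close>,
  \<open>HOM_coordinates\<close>, \<open>nu_HOM\<close>). So \<open>\<Xi>\<close> and \<open>\<Psi>\<close> are bijective in every degree, and therefore
  bijective.

  All operations and connecting maps are biadditive, and all groups involved are generated by
  elements on which the operations are given by explicit formulas: homogeneous elements in
  graded groups, pure tensors in tensor products. The compatibility of \<open>\<Xi>\<close> and \<open>\<Psi>\<close> with the
  structure is therefore checked on generators only (\<open>\<Xi>_mult\<close>, \<open>\<Xi>_act\<close>, \<open>\<Psi>_lact\<close>,
  \<open>\<Psi>_ract\<close>, \<open>om_rank_one\<close>, \<open>nu_eval\<close>).

  The axioms of a graded Morita context are proved only once, for the context of an arbitrary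
  graded module over a graded ring (\<open>module_morita_paired\<close>), where the elements of the rings and
  bimodules are maps and the axioms are properties of composition. They reach \<open>GM'\<close> by transport
  along \<open>\<Xi>\<close> and \<open>\<Psi>\<close> (\<open>paired_morita_transport\<close>). To have this, \<open>R\<close> must be a graded ring and
  \<open>A{G}\<close> a graded \<open>R\<close>-module. Associativity of \<open>#\<close> is coassociativity of \<open>\<Delta>\<close>, tested against the
  functionals \<open>m \<otimes> n \<otimes> p \<mapsto> h(m g(n f(p)))\<close> (\<open>conv_assoc\<close>); associativity of the action on
  \<open>A{G}\<close> is the equation \<open>\<Delta>(x\<^sub>\<alpha>\<^sub>\<beta>) = x\<^sub>\<alpha> \<otimes> x\<^sub>\<beta>\<close> (\<open>conv_x\<close>).
\<close>

section \<open>Additive and biadditive maps\<close>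

definition additive :: "('m, 'x) ring_scheme \<Rightarrow> ('n, 'y) ring_scheme \<Rightarrow> ('m \<Rightarrow> 'n) \<Rightarrow> bool" where
  "additive M N f \<longleftrightarrow> f \<in> carrier M \<rightarrow> carrier N \<and>
     (\<forall>m\<in>carrier M. \<forall>m'\<in>carrier M. f (m \<oplus>\<^bsub>M\<^esub> m') = f m \<oplus>\<^bsub>N\<^esub> f m')"

definition biadditive ::
  "('m, 'x) ring_scheme \<Rightarrow> ('n, 'y) ring_scheme \<Rightarrow> ('t, 'z) ring_scheme \<Rightarrow> ('m \<Rightarrow> 'n \<Rightarrow> 't) \<Rightarrow> bool"
  where "biadditive M N T h \<longleftrightarrow>
     (\<forall>m\<in>carrier M. additive N T (h m)) \<and> (\<forall>n\<in>carrier N. additive M T (\<lambda>m. h m n))"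

text \<open>Only zero and sums are allowed in the closure: every generating set that occurs below
  is closed under negation, and induction over sums alone needs no case for inverses.\<close>

definition generated_by :: "('m, 'x) ring_scheme \<Rightarrow> 'm set \<Rightarrow> bool" where
  "generated_by M B \<longleftrightarrow> B \<subseteq> carrier M \<and>
     (\<forall>X. \<zero>\<^bsub>M\<^esub> \<in> X \<longrightarrow> B \<subseteq> X \<longrightarrow>
       (\<forall>a\<in>carrier M \<inter> X. \<forall>b\<in>carrier M \<inter> X. a \<oplus>\<^bsub>M\<^esub> b \<in> X) \<longrightarrow> carrier M \<subseteq> X)"

text \<open>Equality of the underlying additive groups of two records whose other fields may differ.\<close>

definition same_add :: "('m, 'x) ring_scheme \<Rightarrow> ('m, 'y) ring_scheme \<Rightarrow> bool" where
  "same_add M N \<longleftrightarrow> carrier M = carrier N \<and> zero M = zero N \<and> add M = add N"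

lemma additiveI:
  assumes "\<And>m. m \<in> carrier M \<Longrightarrow> f m \<in> carrier N"
    and "\<And>m m'. \<lbrakk>m \<in> carrier M; m' \<in> carrier M\<rbrakk> \<Longrightarrow> f (m \<oplus>\<^bsub>M\<^esub> m') = f m \<oplus>\<^bsub>N\<^esub> f m'"
  shows "additive M N f"
  using assms by (auto simp: additive_def)

lemma additive_closed: "\<lbrakk>additive M N f; m \<in> carrier M\<rbrakk> \<Longrightarrow> f m \<in> carrier N"
  by (auto simp: additive_def)

lemma additive_add:
  "\<lbrakk>additive M N f; m \<in> carrier M; m' \<in> carrier M\<rbrakk> \<Longrightarrow> f (m \<oplus>\<^bsub>M\<^esub> m') = f m \<oplus>\<^bsub>N\<^esub> f m'"
  by (auto simp: additive_def)

lemma additive_zero: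
  assumes "abelian_group M" "abelian_group N" "additive M N f"
  shows "f \<zero>\<^bsub>M\<^esub> = \<zero>\<^bsub>N\<^esub>"
proof -
  interpret M: abelian_group M by fact
  interpret N: abelian_group N by fact
  have "f \<zero>\<^bsub>M\<^esub> \<oplus>\<^bsub>N\<^esub> f \<zero>\<^bsub>M\<^esub> = f \<zero>\<^bsub>M\<^esub>"
    using additive_add[OF assms(3), of "\<zero>\<^bsub>M\<^esub>" "\<zero>\<^bsub>M\<^esub>"] by simp
  then show ?thesis
    using additive_closed[OF assms(3)] N.add.l_cancel_one by auto
qed

lemma additive_neg:
  assumes "abelian_group M" "abelian_group N" "additive M N f" "m \<in> carrier M"
  shows "f (\<ominus>\<^bsub>M\<^esub> m) = \<ominus>\<^bsub>N\<^esub> f m"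
proof -
  interpret M: abelian_group M by fact
  interpret N: abelian_group N by fact
  have "f (\<ominus>\<^bsub>M\<^esub> m) \<oplus>\<^bsub>N\<^esub> f m = \<zero>\<^bsub>N\<^esub>"
    using additive_add[OF assms(3), of "\<ominus>\<^bsub>M\<^esub> m" m] additive_zero[OF assms(1-3)] assms(4)
    by (simp add: M.l_neg)
  then show ?thesis
    using additive_closed[OF assms(3)] assms(4) N.minus_equality by auto
qed

lemma additive_comp: "\<lbrakk>additive M N f; additive N T g\<rbrakk> \<Longrightarrow> additive M T (\<lambda>m. g (f m))"
  by (auto simp: additive_def Pi_iff)

lemma additive_id: "additive M M (\<lambda>m. m)"
  by (auto simp: additive_def)

lemma additive_add_maps:
  assumes "abelian_group N" "additive M N f" "additive M N g"
  shows "additive M N (\<lambda>m. f m \<oplus>\<^bsub>N\<^esub> g m)"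
proof -
  interpret N: abelian_group N by fact
  show ?thesis
    by (rule additiveI)
      (use assms(2,3) in \<open>auto simp: additive_add additive_closed N.a_ac\<close>)
qed

lemma additive_finsum:
  assumes "abelian_group M" "abelian_group N" "additive M N f" "\<phi> \<in> F \<rightarrow> carrier M"
  shows "f (\<Oplus>\<^bsub>M\<^esub>i\<in>F. \<phi> i) = (\<Oplus>\<^bsub>N\<^esub>i\<in>F. f (\<phi> i))"
proof -
  interpret M: abelian_group M by fact
  interpret N: abelian_group N by fact
  show ?thesis
    using assms(4)
  proof (induction F rule: infinite_finite_induct)
    case (infinite F)
    then show ?case using additive_zero[OF assms(1-3)] by (simp add: M.finsum_infinite N.finsum_infinite)
  next
    case empty
    then show ?case using additive_zero[OF assms(1-3)] by simp
  next
    case (insert i F)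
    then have "\<phi> \<in> F \<rightarrow> carrier M" "\<phi> i \<in> carrier M" "(\<lambda>i. f (\<phi> i)) \<in> F \<rightarrow> carrier N"
      using additive_closed[OF assms(3)] by auto
    then show ?case using insert additive_closed[OF assms(3)]
      by (simp add: M.finsum_insert N.finsum_insert additive_add[OF assms(3)] M.finsum_closed)
  qed
qed

lemma biadditiveI:
  assumes "\<And>m n. \<lbrakk>m \<in> carrier M; n \<in> carrier N\<rbrakk> \<Longrightarrow> h m n \<in> carrier T"
    and "\<And>m m' n. \<lbrakk>m \<in> carrier M; m' \<in> carrier M; n \<in> carrier N\<rbrakk> \<Longrightarrow>
      h (m \<oplus>\<^bsub>M\<^esub> m') n = h m n \<oplus>\<^bsub>T\<^esub> h m' n"
    and "\<And>m n n'. \<lbrakk>m \<in> carrier M; n \<in> carrier N; n' \<in> carrier N\<rbrakk> \<Longrightarrow>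
      h m (n \<oplus>\<^bsub>N\<^esub> n') = h m n \<oplus>\<^bsub>T\<^esub> h m n'"
  shows "biadditive M N T h"
  using assms by (auto simp: biadditive_def additive_def)

lemma biadditive_left: "\<lbrakk>biadditive M N T h; n \<in> carrier N\<rbrakk> \<Longrightarrow> additive M T (\<lambda>m. h m n)"
  by (auto simp: biadditive_def)

lemma biadditive_right: "\<lbrakk>biadditive M N T h; m \<in> carrier M\<rbrakk> \<Longrightarrow> additive N T (h m)"
  by (auto simp: biadditive_def)

lemma biadditive_closed:
  "\<lbrakk>biadditive M N T h; m \<in> carrier M; n \<in> carrier N\<rbrakk> \<Longrightarrow> h m n \<in> carrier T"
  by (auto simp: biadditive_def additive_def)

lemma biadditive_add_left:
  "\<lbrakk>biadditive M N T h; m \<in> carrier M; m' \<in> carrier M; n \<in> carrier N\<rbrakk> \<Longrightarrow>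
    h (m \<oplus>\<^bsub>M\<^esub> m') n = h m n \<oplus>\<^bsub>T\<^esub> h m' n"
  by (auto simp: biadditive_def additive_def)

lemma biadditive_add_right:
  "\<lbrakk>biadditive M N T h; m \<in> carrier M; n \<in> carrier N; n' \<in> carrier N\<rbrakk> \<Longrightarrow>
    h m (n \<oplus>\<^bsub>N\<^esub> n') = h m n \<oplus>\<^bsub>T\<^esub> h m n'"
  by (auto simp: biadditive_def additive_def)

lemma biadditive_comp:
  assumes "biadditive M' N' T h" "additive M M' f" "additive N N' g"
  shows "biadditive M N T (\<lambda>m n. h (f m) (g n))"
  using assms by (auto simp: biadditive_def additive_def Pi_iff)

lemma biadditive_post:
  assumes "biadditive M N T h" "additive T T' f"
  shows "biadditive M N T' (\<lambda>m n. f (h m n))"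
  using assms by (auto simp: biadditive_def additive_def Pi_iff)

lemma generated_by_induct [consumes 2, case_names zero add generator]:
  assumes "generated_by M B" "m \<in> carrier M" "P \<zero>\<^bsub>M\<^esub>"
    and "\<And>a b. \<lbrakk>a \<in> carrier M; b \<in> carrier M; P a; P b\<rbrakk> \<Longrightarrow> P (a \<oplus>\<^bsub>M\<^esub> b)"
    and "\<And>b. b \<in> B \<Longrightarrow> P b"
  shows "P m"
proof -
  have "carrier M \<subseteq> {m. P m}"
    using assms(1,3-) unfolding generated_by_def by (elim conjE allE[of _ "{m. P m}"]) blast
  then show ?thesis using assms(2) by blast
qed

lemma additive_eqI:
  assumes "abelian_group M" "abelian_group N" "generated_by M B"
    and "additive M N f" "additive M N g" "\<And>b. b \<in> B \<Longrightarrow> f b = g b" "m \<in> carrier M"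
  shows "f m = g m"
  using assms(3,7)
  by (induction rule: generated_by_induct)
    (auto simp: assms(6) additive_add[OF assms(4)] additive_add[OF assms(5)]
      additive_zero[OF assms(1,2,4)] additive_zero[OF assms(1,2,5)])

lemma biadditive_eqI:
  assumes "abelian_group M" "abelian_group N" "abelian_group T" "generated_by M B" "generated_by N B'"
    and "biadditive M N T h" "biadditive M N T k" "\<And>b b'. \<lbrakk>b \<in> B; b' \<in> B'\<rbrakk> \<Longrightarrow> h b b' = k b b'"
    and "m \<in> carrier M" "n \<in> carrier N"
  shows "h m n = k m n"
proof (rule additive_eqI[OF assms(1,3,4) biadditive_left[OF assms(6,10)] biadditive_left[OF assms(7,10)] _ assms(9)])
  fix b assume b: "b \<in> B"
  then have "b \<in> carrier M" using assms(4) by (auto simp: generated_by_def)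
  with b show "h b n = k b n"
    by (intro additive_eqI[OF assms(2,3,5) biadditive_right[OF assms(6)] biadditive_right[OF assms(7)] _ assms(10)])
      (auto simp: assms(8))
qed

text \<open>Membership of the values in \<open>N\<close> propagates from the generators, so that it need not be known
  beforehand.\<close>

lemma additive_generatedI:
  assumes "abelian_group N" "generated_by M B" "f \<zero>\<^bsub>M\<^esub> = \<zero>\<^bsub>N\<^esub>"
    and add: "\<And>m m'. \<lbrakk>m \<in> carrier M; m' \<in> carrier M\<rbrakk> \<Longrightarrow> f (m \<oplus>\<^bsub>M\<^esub> m') = f m \<oplus>\<^bsub>N\<^esub> f m'"
    and "\<And>b. b \<in> B \<Longrightarrow> f b \<in> carrier N"
  shows "additive M N f"
proof (rule additiveI[OF _ add])
  interpret N: abelian_group N by fact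
  show "f m \<in> carrier N" if "m \<in> carrier M" for m
    using assms(2) that by (induction rule: generated_by_induct) (auto simp: assms(3,5) add)
qed

text \<open>This is how composites and products of sums of homogeneous maps are seen to be again sums of
  homogeneous maps, without ever expanding the sums.\<close>

lemma biadditive_generatedI:
  assumes "abelian_group T" "generated_by M B" "generated_by N B'"
    and zl: "\<And>n. n \<in> carrier N \<Longrightarrow> h \<zero>\<^bsub>M\<^esub> n = \<zero>\<^bsub>T\<^esub>"
    and zr: "\<And>m. m \<in> carrier M \<Longrightarrow> h m \<zero>\<^bsub>N\<^esub> = \<zero>\<^bsub>T\<^esub>"
    and al: "\<And>m m' n. \<lbrakk>m \<in> carrier M; m' \<in> carrier M; n \<in> carrier N\<rbrakk> \<Longrightarrow>
      h (m \<oplus>\<^bsub>M\<^esub> m') n = h m n \<oplus>\<^bsub>T\<^esub> h m' n"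
    and ar: "\<And>m n n'. \<lbrakk>m \<in> carrier M; n \<in> carrier N; n' \<in> carrier N\<rbrakk> \<Longrightarrow>
      h m (n \<oplus>\<^bsub>N\<^esub> n') = h m n \<oplus>\<^bsub>T\<^esub> h m n'"
    and cl: "\<And>b b'. \<lbrakk>b \<in> B; b' \<in> B'\<rbrakk> \<Longrightarrow> h b b' \<in> carrier T"
  shows "biadditive M N T h"
proof (rule biadditiveI[OF _ al ar])
  interpret T: abelian_group T by fact
  fix m n assume m: "m \<in> carrier M" and n: "n \<in> carrier N"
  have bn: "h b n \<in> carrier T" if b: "b \<in> B" for b
  proof -
    have "b \<in> carrier M" using b assms(2) by (auto simp: generated_by_def)
    with assms(3) n show ?thesis
      by (induction rule: generated_by_induct) (auto simp: zr ar cl b)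
  qed
  show "h m n \<in> carrier T"
    using assms(2) m by (induction rule: generated_by_induct) (auto simp: zl al bn n)
qed

text \<open>For a fixed third argument both sides are biadditive in the first two; on generators they are
  additive in the third.\<close>

lemma biadditive_assocI:
  assumes groups: "abelian_group M" "abelian_group N" "abelian_group P" "abelian_group Z"
    and gens: "generated_by M B" "generated_by N B'" "generated_by P B''"
    and m: "biadditive M N X m1" "biadditive X P Z m2" "biadditive N P Y m3" "biadditive M Y Z m4"
    and eq: "\<And>a b c. \<lbrakk>a \<in> B; b \<in> B'; c \<in> B''\<rbrakk> \<Longrightarrow> m2 (m1 a b) c = m4 a (m3 b c)"
    and abc: "a \<in> carrier M" "b \<in> carrier N" "c \<in> carrier P"
  shows "m2 (m1 a b) c = m4 a (m3 b c)"
proof (rule biadditive_eqI[OF groups(1,2,4) gens(1,2) _ _ _ abc(1,2)])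
  have M: "\<And>a. a \<in> B \<Longrightarrow> a \<in> carrier M" and N: "\<And>b. b \<in> B' \<Longrightarrow> b \<in> carrier N"
    using gens by (auto simp: generated_by_def)
  show "biadditive M N Z (\<lambda>a b. m2 (m1 a b) c)"
    by (rule biadditive_post[OF m(1) biadditive_left[OF m(2) abc(3)]])
  show "biadditive M N Z (\<lambda>a b. m4 a (m3 b c))"
    by (rule biadditive_comp[OF m(4) additive_id biadditive_left[OF m(3) abc(3)]])
  fix a b assume ab: "a \<in> B" "b \<in> B'"
  show "m2 (m1 a b) c = m4 a (m3 b c)"
    by (rule additive_eqI[OF groups(3,4) gens(3) biadditive_right[OF m(2)] _ _ abc(3)])
      (use ab M N in \<open>auto intro!: biadditive_closed[OF m(1)] eq
        additive_comp[OF biadditive_right[OF m(3)] biadditive_right[OF m(4)]]\<close>)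
qed

lemma abelian_group_product:
  assumes M: "\<And>i. i \<in> I \<Longrightarrow> abelian_group (M i)"
    and N: "carrier N = (\<Pi>\<^sub>E i\<in>I. carrier (M i))" "zero N = (\<lambda>i\<in>I. \<zero>\<^bsub>M i\<^esub>)"
      "\<And>p q. p \<oplus>\<^bsub>N\<^esub> q = (\<lambda>i\<in>I. p i \<oplus>\<^bsub>M i\<^esub> q i)"
  shows "abelian_group N"
proof (rule abelian_groupI)
  fix p assume p: "p \<in> carrier N"
  have "\<exists>r. \<forall>i\<in>I. r i \<in> carrier (M i) \<and> r i \<oplus>\<^bsub>M i\<^esub> p i = \<zero>\<^bsub>M i\<^esub>"
    using p abelian_groupE(6)[OF M] by (intro bchoice) (fastforce simp: N(1) PiE_iff)
  then obtain r where r: "\<And>i. i \<in> I \<Longrightarrow> r i \<in> carrier (M i)" "\<And>i. i \<in> I \<Longrightarrow> r i \<oplus>\<^bsub>M i\<^esub> p i = \<zero>\<^bsub>M i\<^esub>"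
    by blast
  show "\<exists>q\<in>carrier N. q \<oplus>\<^bsub>N\<^esub> p = \<zero>\<^bsub>N\<^esub>"
    by (rule bexI[of _ "\<lambda>i\<in>I. r i"]) (auto simp: N r intro!: restrict_ext)
  show "\<zero>\<^bsub>N\<^esub> \<oplus>\<^bsub>N\<^esub> p = p"
    using p abelian_groupE(5)[OF M] by (auto simp: N PiE_iff fun_eq_iff extensional_def)
  show "p \<oplus>\<^bsub>N\<^esub> q \<oplus>\<^bsub>N\<^esub> r = p \<oplus>\<^bsub>N\<^esub> (q \<oplus>\<^bsub>N\<^esub> r)" if "q \<in> carrier N" "r \<in> carrier N" for q r
    using p that by (auto simp: N PiE_iff abelian_groupE(3)[OF M] intro!: restrict_ext)
qed (auto simp: N PiE_iff abelian_groupE(1,2,4)[OF M] intro!: restrict_ext)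

text \<open>Both \<open>S'\<close> and \<open>Q'\<close> are cut out of a product by equations between additive maps.\<close>

lemma abelian_group_equalizer:
  assumes N: "abelian_group N" and T: "\<And>j. j \<in> J \<Longrightarrow> abelian_group (T j)"
    and L: "\<And>j. j \<in> J \<Longrightarrow> additive N (T j) (L j)" and R: "\<And>j. j \<in> J \<Longrightarrow> additive N (T j) (R j)"
    and E: "carrier E = {b \<in> carrier N. \<forall>j\<in>J. L j b = R j b}" "zero E = zero N" "add E = add N"
  shows "abelian_group E"
proof -
  interpret N: abelian_group N by fact
  show ?thesis
  proof (rule abelian_groupI)
    show "\<zero>\<^bsub>E\<^esub> \<in> carrier E"
      using additive_zero[OF N T L] additive_zero[OF N T R] by (auto simp: E)
    show "a \<oplus>\<^bsub>E\<^esub> b \<in> carrier E" if "a \<in> carrier E" "b \<in> carrier E" for a b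
      using that additive_add[OF L] additive_add[OF R] by (auto simp: E)
    show "\<exists>b\<in>carrier E. b \<oplus>\<^bsub>E\<^esub> a = \<zero>\<^bsub>E\<^esub>" if "a \<in> carrier E" for a
      by (rule bexI[of _ "\<ominus>\<^bsub>N\<^esub> a"])
        (use that additive_neg[OF N T L] additive_neg[OF N T R] in \<open>auto simp: E N.l_neg\<close>)
  qed (auto simp: E N.a_ac)
qed

lemma same_add_finsum: "same_add M N \<Longrightarrow> finsum M = finsum N"
  by (intro ext) (simp add: same_add_def finsum_def finprod_def)

lemma same_add_int_pow: "same_add M N \<Longrightarrow> add_pow M (k :: int) = add_pow N k"
  by (intro ext) (simp add: same_add_def add_pow_def int_pow_def nat_pow_def m_inv_def Let_def)

lemma same_add_abelian_group: "\<lbrakk>same_add M N; abelian_group M\<rbrakk> \<Longrightarrow> abelian_group N"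
  using abelian_groupE[of M] unfolding same_add_def by (intro abelian_groupI) (metis (no_types))+

lemma same_add_sym: "same_add M N \<Longrightarrow> same_add N M"
  by (auto simp: same_add_def)

lemma same_add_additive: "same_add M M' \<Longrightarrow> same_add N N' \<Longrightarrow> additive M N = additive M' N'"
  by (auto simp: same_add_def additive_def fun_eq_iff)

lemma same_add_biadditive: "same_add M M' \<Longrightarrow> same_add N N' \<Longrightarrow> same_add T T'
  \<Longrightarrow> biadditive M N T = biadditive M' N' T'"
  by (auto simp: same_add_def biadditive_def additive_def fun_eq_iff)

lemma same_add_generated_by: "same_add M N \<Longrightarrow> generated_by M = generated_by N"
  by (auto simp: same_add_def generated_by_def fun_eq_iff)

lemma same_add_refl: "same_add M M"
  by (simp add: same_add_def)

lemma same_add_with_lact: "same_add (with_lact M l) M"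
  by (simp add: same_add_def with_lact_def)

lemma same_add_regular: "same_add (regular R) R"
  by (simp add: same_add_def regular_def with_lact_def with_ract_def)

lemma with_ract_simps [simp]:
  "carrier (with_ract M r) = carrier M" "zero (with_ract M r) = zero M"
  "add (with_ract M r) = add M" "rsmult (with_ract M r) = r"
  by (simp_all add: with_ract_def)

lemma with_lact_simps [simp]:
  "carrier (with_lact M l) = carrier M" "zero (with_lact M l) = zero M"
  "add (with_lact M l) = add M" "rsmult (with_lact M l) = rsmult M" "lsmult (with_lact M l) = l"
  by (simp_all add: with_lact_def)

lemma regular_simps [simp]:
  "carrier (regular R) = carrier R" "zero (regular R) = zero R"
  "add (regular R) = add R" "rsmult (regular R) = mult R" "lsmult (regular R) = mult R"
  by (simp_all add: regular_def)

context bimodule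
begin

lemma additive_lsmult: "a \<in> carrier A \<Longrightarrow> additive M M (\<lambda>m. a \<triangleright>\<^bsub>M\<^esub> m)"
  by (rule additiveI) (auto simp: lsmult_closed lsmult_distr_mod)

lemma additive_rsmult: "b \<in> carrier B \<Longrightarrow> additive M M (\<lambda>m. m \<triangleleft>\<^bsub>M\<^esub> b)"
  by (rule additiveI) (auto simp: rsmult_closed rsmult_distr_mod)

end


section \<open>The universal property of the tensor product\<close>

definition balanced ::
  "('a, 'w) ring_scheme \<Rightarrow> ('a, 'm, 'x) rmodule_scheme \<Rightarrow> ('a, 'r, 'n, 'y) bimodule_scheme
    \<Rightarrow> ('t, 'z) ring_scheme \<Rightarrow> ('m \<Rightarrow> 'n \<Rightarrow> 't) \<Rightarrow> bool" where
  "balanced A M N T h \<longleftrightarrow> biadditive M N T h \<and>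
     (\<forall>m\<in>carrier M. \<forall>a\<in>carrier A. \<forall>n\<in>carrier N. h (m \<triangleleft>\<^bsub>M\<^esub> a) n = h m (a \<triangleright>\<^bsub>N\<^esub> n))"

lemma same_add_tensor: "same_add (tensor A M N) (tensor_group A M N)"
  by (simp add: same_add_def tensor_def)

lemma tensor_lift_same_add: "same_add L L' \<Longrightarrow> tensor_lift L f = tensor_lift L' f"
  by (simp add: fun_eq_iff tensor_lift_def same_add_finsum same_add_int_pow)

locale tensor_factors = M: bimodule S A M + N: bimodule A R N for S A R M N
begin

abbreviation "F \<equiv> tensor_free M N"
abbreviation "Rel \<equiv> tensor_rels A M N"
abbreviation "T \<equiv> tensor A M N"
abbreviation "pure \<equiv> pure_tensor A M N"

definition relators :: "(_ \<times> _ \<Rightarrow>\<^sub>0 int) set" where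
  "relators = {frag_of (m \<oplus>\<^bsub>M\<^esub> m', n) - frag_of (m, n) - frag_of (m', n) | m m' n.
        m \<in> carrier M \<and> m' \<in> carrier M \<and> n \<in> carrier N} \<union>
     {frag_of (m, n \<oplus>\<^bsub>N\<^esub> n') - frag_of (m, n) - frag_of (m, n') | m n n'.
        m \<in> carrier M \<and> n \<in> carrier N \<and> n' \<in> carrier N} \<union>
     {frag_of (m \<triangleleft>\<^bsub>M\<^esub> a, n) - frag_of (m, a \<triangleright>\<^bsub>N\<^esub> n) | m a n.
        m \<in> carrier M \<and> a \<in> carrier A \<and> n \<in> carrier N}"

lemma F_comm_group: "comm_group F"
  by (simp add: tensor_free_def abelian_free_Abelian_group)

lemma F_simps [simp]: "x \<in> carrier F \<longleftrightarrow> Poly_Mapping.keys x \<subseteq> carrier M \<times> carrier N"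
  "x \<otimes>\<^bsub>F\<^esub> y = x + y" "\<one>\<^bsub>F\<^esub> = 0"
  by (simp_all add: tensor_free_def)

lemma F_diff: "\<lbrakk>x \<in> carrier F; y \<in> carrier F\<rbrakk> \<Longrightarrow> x - y \<in> carrier F"
  using keys_diff[of x y] by auto

lemma relators_carrier: "relators \<subseteq> carrier F"
proof
  fix r assume "r \<in> relators"
  then show "r \<in> carrier F"
    unfolding relators_def
    by (elim UnE CollectE exE conjE; hypsubst; intro F_diff)
      (auto simp: M.rsmult_closed N.lsmult_closed M.a_closed N.a_closed simp del: F_simps(2))
qed

lemma Rel_eq: "Rel = generate F relators"
  by (simp add: tensor_rels_def relators_def)

lemma Rel_subgroup: "subgroup Rel F"
  unfolding Rel_eq
  by (rule group.generate_is_subgroup[OF comm_group.axioms(2)[OF F_comm_group] relators_carrier])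

lemma Rel_normal: "normal Rel F"
  by (rule comm_group.subgroup_imp_normal[OF F_comm_group Rel_subgroup])

lemma T_simps:
  "carrier T = rcosets\<^bsub>F\<^esub> Rel" "zero T = Rel" "add T = (<#>\<^bsub>F\<^esub>)"
  by (simp_all add: tensor_def tensor_group_def Let_def FactGroup_def)

lemma T_abelian_group: "abelian_group T"
proof -
  have "comm_group (F Mod Rel)"
    by (rule comm_group.abelian_FactGroup[OF F_comm_group Rel_subgroup])
  then have "abelian_group (tensor_group A M N)"
    unfolding tensor_group_def Let_def
    using comm_groupE[of "F Mod Rel"] by (intro abelian_groupI) simp_all
  then show ?thesis
    by (rule same_add_abelian_group[OF same_add_sym[OF same_add_tensor]])
qed

lemma T_elem: "t \<in> carrier T \<Longrightarrow> \<exists>z\<in>carrier F. t = Rel #>\<^bsub>F\<^esub> z"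
  unfolding T_simps RCOSETS_def by blast

lemma coset_closed: "z \<in> carrier F \<Longrightarrow> Rel #>\<^bsub>F\<^esub> z \<in> carrier T"
  unfolding T_simps RCOSETS_def by blast

lemma coset_add: "\<lbrakk>z \<in> carrier F; w \<in> carrier F\<rbrakk> \<Longrightarrow>
    (Rel #>\<^bsub>F\<^esub> z) \<oplus>\<^bsub>T\<^esub> (Rel #>\<^bsub>F\<^esub> w) = Rel #>\<^bsub>F\<^esub> (z + w)"
  using normal.rcos_sum[OF Rel_normal, of z w] by (simp add: T_simps)

lemma coset_eqI:
  assumes "z \<in> carrier F" "w \<in> carrier F" "z - w \<in> Rel"
  shows "Rel #>\<^bsub>F\<^esub> z = Rel #>\<^bsub>F\<^esub> w"
proof -
  interpret comm_group F by (rule F_comm_group)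
  have "z \<in> Rel #>\<^bsub>F\<^esub> w"
    using assms(3) unfolding r_coset_def by (auto intro!: bexI[of _ "z - w"])
  then show ?thesis
    using repr_independence[OF _ assms(2) Rel_subgroup] by simp
qed

lemma relator_in_Rel: "r \<in> relators \<Longrightarrow> r \<in> Rel"
  unfolding Rel_eq by (rule generate.incl)

lemma frag_in_F [simp]: "\<lbrakk>m \<in> carrier M; n \<in> carrier N\<rbrakk> \<Longrightarrow> frag_of (m, n) \<in> carrier F"
  by simp

lemma pure_closed: "\<lbrakk>m \<in> carrier M; n \<in> carrier N\<rbrakk> \<Longrightarrow> pure m n \<in> carrier T"
  unfolding pure_tensor_def by (intro coset_closed frag_in_F)

lemma F_add: "\<lbrakk>x \<in> carrier F; y \<in> carrier F\<rbrakk> \<Longrightarrow> x + y \<in> carrier F"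
  using keys_add[of x y] by auto

text \<open>In each case the difference of the two representatives is a relator.\<close>

lemma pure_balanced: "balanced A M N T pure"
  unfolding balanced_def
proof (intro conjI biadditiveI ballI)
  fix m m' n assume a: "m \<in> carrier M" "m' \<in> carrier M" "n \<in> carrier N"
  have "frag_of (m \<oplus>\<^bsub>M\<^esub> m', n) - (frag_of (m, n) + frag_of (m', n)) \<in> Rel"
    by (rule relator_in_Rel) (use a in \<open>auto simp: relators_def diff_diff_eq\<close>)
  then show "pure (m \<oplus>\<^bsub>M\<^esub> m') n = pure m n \<oplus>\<^bsub>T\<^esub> pure m' n"
    unfolding pure_tensor_def using a
    by (simp only: coset_add frag_in_F)
      (rule coset_eqI; (intro F_add frag_in_F)?; simp add: M.a_closed del: F_simps)
next
  fix m n n' assume a: "m \<in> carrier M" "n \<in> carrier N" "n' \<in> carrier N"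
  have "frag_of (m, n \<oplus>\<^bsub>N\<^esub> n') - (frag_of (m, n) + frag_of (m, n')) \<in> Rel"
    by (rule relator_in_Rel) (use a in \<open>auto simp: relators_def diff_diff_eq\<close>)
  then show "pure m (n \<oplus>\<^bsub>N\<^esub> n') = pure m n \<oplus>\<^bsub>T\<^esub> pure m n'"
    unfolding pure_tensor_def using a
    by (simp only: coset_add frag_in_F)
      (rule coset_eqI; (intro F_add frag_in_F)?; simp add: N.a_closed del: F_simps)
next
  fix m a n assume a: "m \<in> carrier M" "a \<in> carrier A" "n \<in> carrier N"
  have "frag_of (m \<triangleleft>\<^bsub>M\<^esub> a, n) - frag_of (m, a \<triangleright>\<^bsub>N\<^esub> n) \<in> Rel"
    by (rule relator_in_Rel) (use a in \<open>auto simp: relators_def\<close>)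
  then show "pure (m \<triangleleft>\<^bsub>M\<^esub> a) n = pure m (a \<triangleright>\<^bsub>N\<^esub> n)"
    unfolding pure_tensor_def using a
    by (intro coset_eqI) (auto simp: M.rsmult_closed N.lsmult_closed simp del: F_simps)
qed (rule pure_closed)

lemmas pure_biadditive = pure_balanced[unfolded balanced_def, THEN conjunct1]

lemma pure_middle: "\<lbrakk>m \<in> carrier M; a \<in> carrier A; n \<in> carrier N\<rbrakk> \<Longrightarrow>
    pure (m \<triangleleft>\<^bsub>M\<^esub> a) n = pure m (a \<triangleright>\<^bsub>N\<^esub> n)"
  using pure_balanced by (auto simp: balanced_def)

text \<open>Pure tensors generate without taking inverses, since \<open>- (m \<otimes> n) = (- m) \<otimes> n\<close>.\<close>

lemma T_generated: "generated_by T {pure m n | m n. m \<in> carrier M \<and> n \<in> carrier N}"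
  unfolding generated_by_def
proof (intro conjI allI impI subsetI)
  interpret T: abelian_group T by (rule T_abelian_group)
  fix X t
  assume X: "\<zero>\<^bsub>T\<^esub> \<in> X" "{pure m n | m n. m \<in> carrier M \<and> n \<in> carrier N} \<subseteq> X"
    "\<forall>a\<in>carrier T \<inter> X. \<forall>b\<in>carrier T \<inter> X. a \<oplus>\<^bsub>T\<^esub> b \<in> X" and t: "t \<in> carrier T"
  obtain z where z: "z \<in> carrier F" "t = Rel #>\<^bsub>F\<^esub> z" using T_elem[OF t] by blast
  \<comment> \<open>The induction principle for free abelian groups runs over differences, so \<open>- z\<close> has to be tracked
    together with \<open>z\<close>.\<close>
  define P where "P z \<longleftrightarrow> Rel #>\<^bsub>F\<^esub> z \<in> carrier T \<inter> X \<and> Rel #>\<^bsub>F\<^esub> (- z) \<in> carrier T \<inter> X" for z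
  have Rel0: "Rel #>\<^bsub>F\<^esub> 0 = \<zero>\<^bsub>T\<^esub>"
    by (simp add: T_simps r_coset_def)
  have neg: "z \<in> carrier F \<Longrightarrow> - z \<in> carrier F" for z by (simp add: keys_minus)
  have "P z"
  proof (rule free_Abelian_group_induct[of z "carrier M \<times> carrier N"])
    show "Poly_Mapping.keys z \<subseteq> carrier M \<times> carrier N" using z(1) by simp
    show "P 0" using X(1) by (simp add: P_def Rel0)
    show "P (v - w)" if k: "Poly_Mapping.keys v \<subseteq> carrier M \<times> carrier N"
      "Poly_Mapping.keys w \<subseteq> carrier M \<times> carrier N" and "P v" "P w" for v w
    proof -
      have c: "v \<in> carrier F" "w \<in> carrier F" using k by auto
      have "Rel #>\<^bsub>F\<^esub> (v - w) = (Rel #>\<^bsub>F\<^esub> v) \<oplus>\<^bsub>T\<^esub> (Rel #>\<^bsub>F\<^esub> (- w))"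
        "Rel #>\<^bsub>F\<^esub> (- (v - w)) = (Rel #>\<^bsub>F\<^esub> (- v)) \<oplus>\<^bsub>T\<^esub> (Rel #>\<^bsub>F\<^esub> w)"
        using c by (simp_all add: coset_add neg del: F_simps)
      then show ?thesis using that X(3) unfolding P_def by auto
    qed
    show "P (frag_of p)" if p0: "p \<in> carrier M \<times> carrier N" for p
    proof -
      obtain m n where p: "p = (m, n)" "m \<in> carrier M" "n \<in> carrier N"
        using p0 by (cases p) auto
      have 1: "Rel #>\<^bsub>F\<^esub> frag_of p = pure m n" by (simp add: p pure_tensor_def)
      have "(Rel #>\<^bsub>F\<^esub> (- frag_of p)) \<oplus>\<^bsub>T\<^esub> pure m n = \<zero>\<^bsub>T\<^esub>"
        unfolding 1[symmetric] using p by (subst coset_add) (auto simp: neg Rel0 simp del: F_simps)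
      then have "Rel #>\<^bsub>F\<^esub> (- frag_of p) = \<ominus>\<^bsub>T\<^esub> (pure m n)"
        using T.minus_equality p by (metis coset_closed frag_in_F neg pure_closed)
      also have "\<dots> = pure (\<ominus>\<^bsub>M\<^esub> m) n"
        using additive_neg[OF M.abelian_group_axioms T_abelian_group
            biadditive_left[OF pure_biadditive p(3)] p(2)] by simp
      finally show ?thesis
        using subsetD[OF X(2), of "pure m n"] subsetD[OF X(2), of "pure (\<ominus>\<^bsub>M\<^esub> m) n"] p pure_closed
        unfolding P_def 1 by auto
    qed
  qed
  then show "t \<in> X" by (simp add: P_def z)
qed (auto intro: pure_closed)

lemmas tensor_eqI = additive_eqI[OF T_abelian_group _ T_generated]

context
  fixes L :: "('k, 'l) ring_scheme" and f
  assumes L: "abelian_group L" and f: "balanced A M N L f"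
begin

interpretation L: abelian_group L by (rule L)

lemma L_pow:
  assumes "a \<in> carrier L"
  shows "[(k :: int)] \<cdot>\<^bsub>L\<^esub> a \<in> carrier L" "[(0 :: int)] \<cdot>\<^bsub>L\<^esub> a = \<zero>\<^bsub>L\<^esub>" "[(1 :: int)] \<cdot>\<^bsub>L\<^esub> a = a"
    "[(k + l :: int)] \<cdot>\<^bsub>L\<^esub> a = [k] \<cdot>\<^bsub>L\<^esub> a \<oplus>\<^bsub>L\<^esub> [l] \<cdot>\<^bsub>L\<^esub> a"
  using assms group.int_pow_closed[OF L.a_group, of a k] group.int_pow_1[OF L.a_group, of a]
    group.int_pow_mult[OF L.a_group, of a k l]
  by (simp_all add: add_pow_def)

text \<open>The additive extension of \<open>f\<close> to the free abelian group, as \<open>tensor_lift\<close> computes it from a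
  representative.\<close>

definition lift_free where
  "lift_free z = (\<Oplus>\<^bsub>L\<^esub> p \<in> Poly_Mapping.keys z. [(Poly_Mapping.lookup z p :: int)] \<cdot>\<^bsub>L\<^esub> f (fst p) (snd p))"

lemma f_closed: "p \<in> carrier M \<times> carrier N \<Longrightarrow> f (fst p) (snd p) \<in> carrier L"
  using f biadditive_closed unfolding balanced_def by fastforce

text \<open>Only zero summands are added; this gives the sums for \<open>z\<close>, \<open>w\<close> and \<open>z + w\<close> a common index set.\<close>

lemma lift_free_superset:
  assumes "finite K" "Poly_Mapping.keys z \<subseteq> K" "K \<subseteq> carrier M \<times> carrier N"
  shows "lift_free z = (\<Oplus>\<^bsub>L\<^esub> p \<in> K. [Poly_Mapping.lookup z p] \<cdot>\<^bsub>L\<^esub> f (fst p) (snd p))"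
  unfolding lift_free_def
  by (rule L.add.finprod_mono_neutral_cong_left)
    (use assms(1,2) f_closed[OF subsetD[OF assms(3)]] in
      \<open>simp_all add: Pi_iff subset_iff in_keys_iff L_pow\<close>)

lemma lift_free_add:
  assumes "z \<in> carrier F" "w \<in> carrier F"
  shows "lift_free (z + w) = lift_free z \<oplus>\<^bsub>L\<^esub> lift_free w"
proof -
  define K where "K = Poly_Mapping.keys z \<union> Poly_Mapping.keys w"
  have K: "finite K" "K \<subseteq> carrier M \<times> carrier N" using assms by (auto simp: K_def)
  have cl: "(\<lambda>p. [k p] \<cdot>\<^bsub>L\<^esub> f (fst p) (snd p)) \<in> K \<rightarrow> carrier L" for k :: "_ \<Rightarrow> int"
    using K(2) f_closed by (auto simp: L_pow)
  have "lift_free (z + w) = (\<Oplus>\<^bsub>L\<^esub> p \<in> K. [Poly_Mapping.lookup (z + w) p] \<cdot>\<^bsub>L\<^esub> f (fst p) (snd p))"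
    by (rule lift_free_superset[OF K(1) _ K(2)]) (use keys_add[of z w] in \<open>auto simp: K_def\<close>)
  also have "\<dots> = (\<Oplus>\<^bsub>L\<^esub> p \<in> K. [Poly_Mapping.lookup z p] \<cdot>\<^bsub>L\<^esub> f (fst p) (snd p) \<oplus>\<^bsub>L\<^esub>
      [Poly_Mapping.lookup w p] \<cdot>\<^bsub>L\<^esub> f (fst p) (snd p))"
    by (rule L.finsum_cong') (use K(2) f_closed in \<open>auto simp: lookup_add L_pow subset_iff\<close>)
  also have "\<dots> = lift_free z \<oplus>\<^bsub>L\<^esub> lift_free w"
    using lift_free_superset[OF K(1) _ K(2), of z] lift_free_superset[OF K(1) _ K(2), of w]
    by (subst L.finsum_addf[OF cl cl]) (simp add: K_def)
  finally show ?thesis .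
qed

lemma lift_free_closed: "z \<in> carrier F \<Longrightarrow> lift_free z \<in> carrier L"
  unfolding lift_free_def by (rule L.finsum_closed) (use f_closed in \<open>auto simp: L_pow\<close>)

lemma lift_free_frag: "\<lbrakk>m \<in> carrier M; n \<in> carrier N\<rbrakk> \<Longrightarrow> lift_free (frag_of (m, n)) = f m n"
  using f_closed[of "(m, n)"] unfolding lift_free_def by (simp add: L.finsum_insert L_pow)

lemma lift_free_diff:
  assumes "z \<in> carrier F" "w \<in> carrier F"
  shows "lift_free (z - w) = lift_free z \<ominus>\<^bsub>L\<^esub> lift_free w"
  using lift_free_add[OF F_diff[OF assms] assms(2)] lift_free_closed[OF assms(1)]
    lift_free_closed[OF assms(2)] lift_free_closed[OF F_diff[OF assms]]
  by (simp add: L.minus_eq L.a_assoc L.r_neg)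

lemma lift_free_relators:
  assumes "r \<in> relators" shows "lift_free r = \<zero>\<^bsub>L\<^esub>"
proof -
  have fb: "biadditive M N L f" and fm: "\<And>m a n. \<lbrakk>m \<in> carrier M; a \<in> carrier A; n \<in> carrier N\<rbrakk> \<Longrightarrow>
      f (m \<triangleleft>\<^bsub>M\<^esub> a) n = f m (a \<triangleright>\<^bsub>N\<^esub> n)"
    using f by (auto simp: balanced_def)
  note fc = biadditive_closed[OF fb]
  have canc: "u \<oplus>\<^bsub>L\<^esub> v \<oplus>\<^bsub>L\<^esub> \<ominus>\<^bsub>L\<^esub> u \<oplus>\<^bsub>L\<^esub> \<ominus>\<^bsub>L\<^esub> v = \<zero>\<^bsub>L\<^esub>" if "u \<in> carrier L" "v \<in> carrier L" for u v
  proof -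
    have "u \<oplus>\<^bsub>L\<^esub> v \<oplus>\<^bsub>L\<^esub> \<ominus>\<^bsub>L\<^esub> u \<oplus>\<^bsub>L\<^esub> \<ominus>\<^bsub>L\<^esub> v = (u \<oplus>\<^bsub>L\<^esub> \<ominus>\<^bsub>L\<^esub> u) \<oplus>\<^bsub>L\<^esub> (v \<oplus>\<^bsub>L\<^esub> \<ominus>\<^bsub>L\<^esub> v)"
      using that by (simp add: L.a_ac)
    then show ?thesis using that by (simp add: L.r_neg)
  qed
  show ?thesis
    using assms unfolding relators_def
    by (elim UnE CollectE exE conjE; hypsubst)
      (auto simp: lift_free_diff lift_free_frag F_diff M.a_closed N.a_closed M.rsmult_closed N.lsmult_closed
        biadditive_add_left[OF fb] biadditive_add_right[OF fb] fm fc canc L.minus_eq[of _ "_"] L.r_neg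
        simp del: F_simps)
qed

lemma lift_free_Rel: "r \<in> Rel \<Longrightarrow> lift_free r = \<zero>\<^bsub>L\<^esub>"
  unfolding Rel_eq
proof (induction rule: generate.induct)
  case one
  then show ?case by (simp add: lift_free_def)
next
  case (incl h)
  then show ?case by (rule lift_free_relators)
next
  case (inv h)
  have h: "h \<in> carrier F" by (rule subsetD[OF relators_carrier inv])
  have 0: "(0::_ \<Rightarrow>\<^sub>0 int) \<in> carrier F" "lift_free 0 = \<zero>\<^bsub>L\<^esub>" by (simp_all add: lift_free_def)
  have "inv\<^bsub>F\<^esub> h = 0 - h" using h by (simp add: tensor_free_def)
  then show ?case using lift_free_diff[OF 0(1) h] lift_free_relators[OF inv] by (simp add: 0 L.minus_eq)
next
  case (eng h1 h2)
  have "h1 \<in> carrier F" "h2 \<in> carrier F"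
    using eng(1,2) Rel_subgroup subgroup.subset Rel_eq by fastforce+
  then show ?case using eng by (simp add: lift_free_add del: F_simps(1))
qed

text \<open>The extension vanishes on the relations, so the choice of the representative is immaterial.\<close>

lemma tensor_lift_coset:
  assumes "z \<in> carrier F" shows "tensor_lift L f (Rel #>\<^bsub>F\<^esub> z) = lift_free z"
proof -
  interpret F: comm_group F by (rule F_comm_group)
  define w where "w = (SOME w. w \<in> Rel #>\<^bsub>F\<^esub> z)"
  have "w \<in> Rel #>\<^bsub>F\<^esub> z"
    unfolding w_def by (rule someI[of _ z]) (rule F.rcos_self[OF assms Rel_subgroup])
  then obtain r where r: "r \<in> Rel" "w = r + z" unfolding r_coset_def by auto
  have "r \<in> carrier F" using r Rel_subgroup subgroup.subset by blast
  then have "lift_free w = lift_free z"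
    using lift_free_add[of r z] assms r lift_free_Rel[OF r(1)] lift_free_closed[OF assms] by simp
  then show ?thesis unfolding tensor_lift_def Let_def w_def[symmetric] lift_free_def .
qed

lemma tensor_lift_additive: "additive T L (tensor_lift L f)"
proof (rule additiveI)
  show "tensor_lift L f t \<in> carrier L" if "t \<in> carrier T" for t
    using T_elem[OF that] by (auto simp: tensor_lift_coset lift_free_closed simp del: F_simps)
  show "tensor_lift L f (t \<oplus>\<^bsub>T\<^esub> t') = tensor_lift L f t \<oplus>\<^bsub>L\<^esub> tensor_lift L f t'"
    if "t \<in> carrier T" "t' \<in> carrier T" for t t'
    using T_elem[OF that(1)] T_elem[OF that(2)]
    by (auto simp: tensor_lift_coset coset_add lift_free_add F_add simp del: F_simps)
qed

lemma tensor_lift_pure: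
  "\<lbrakk>m \<in> carrier M; n \<in> carrier N\<rbrakk> \<Longrightarrow> tensor_lift L f (pure m n) = f m n"
  unfolding pure_tensor_def by (subst tensor_lift_coset) (auto simp: lift_free_frag simp del: F_simps)

end

text \<open>The defining formula is balanced because the two actions on \<open>M\<close> commute, so it descends to the
  tensor product.\<close>

lemma tensor_lact:
  assumes "s \<in> carrier S"
  shows "additive T T (\<lambda>t. s \<triangleright>\<^bsub>T\<^esub> t)"
    and "\<lbrakk>m \<in> carrier M; n \<in> carrier N\<rbrakk> \<Longrightarrow> s \<triangleright>\<^bsub>T\<^esub> pure m n = pure (s \<triangleright>\<^bsub>M\<^esub> m) n"
proof -
  have b: "balanced A M N T (\<lambda>m n. pure (s \<triangleright>\<^bsub>M\<^esub> m) n)"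
    unfolding balanced_def
    using biadditive_comp[OF pure_biadditive M.additive_lsmult[OF assms] additive_id] assms
    by (simp add: pure_middle[symmetric] M.lsmult_closed M.smult_middle_assoc)
  have eq: "lsmult T s = tensor_lift T (\<lambda>m n. pure (s \<triangleright>\<^bsub>M\<^esub> m) n)"
    by (rule trans[OF _ tensor_lift_same_add[OF same_add_sym[OF same_add_tensor]]])
      (simp add: tensor_def)
  show "additive T T (\<lambda>t. s \<triangleright>\<^bsub>T\<^esub> t)"
    "\<lbrakk>m \<in> carrier M; n \<in> carrier N\<rbrakk> \<Longrightarrow> s \<triangleright>\<^bsub>T\<^esub> pure m n = pure (s \<triangleright>\<^bsub>M\<^esub> m) n"
    unfolding eq using tensor_lift_additive[OF T_abelian_group b] tensor_lift_pure[OF T_abelian_group b]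
    by auto
qed

lemma tensor_ract:
  assumes "r \<in> carrier R"
  shows "additive T T (\<lambda>t. t \<triangleleft>\<^bsub>T\<^esub> r)"
    and "\<lbrakk>m \<in> carrier M; n \<in> carrier N\<rbrakk> \<Longrightarrow> pure m n \<triangleleft>\<^bsub>T\<^esub> r = pure m (n \<triangleleft>\<^bsub>N\<^esub> r)"
proof -
  have b: "balanced A M N T (\<lambda>m n. pure m (n \<triangleleft>\<^bsub>N\<^esub> r))"
    unfolding balanced_def
    using biadditive_comp[OF pure_biadditive additive_id N.additive_rsmult[OF assms]] assms
    by (simp add: pure_middle N.rsmult_closed N.smult_middle_assoc)
  have eq: "(\<lambda>t. t \<triangleleft>\<^bsub>T\<^esub> r) = tensor_lift T (\<lambda>m n. pure m (n \<triangleleft>\<^bsub>N\<^esub> r))"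
    by (rule trans[OF _ tensor_lift_same_add[OF same_add_sym[OF same_add_tensor]]])
      (simp add: tensor_def)
  show "additive T T (\<lambda>t. t \<triangleleft>\<^bsub>T\<^esub> r)"
    unfolding eq using tensor_lift_additive[OF T_abelian_group b] by auto
  show "\<lbrakk>m \<in> carrier M; n \<in> carrier N\<rbrakk> \<Longrightarrow> pure m n \<triangleleft>\<^bsub>T\<^esub> r = pure m (n \<triangleleft>\<^bsub>N\<^esub> r)"
    using tensor_lift_pure[OF T_abelian_group b] fun_cong[OF eq] by auto
qed

text \<open>Every axiom states that two additive maps agree, which is seen on pure tensors.\<close>

lemma tensor_bimodule: "bimodule S R T"
proof -
  interpret T: abelian_group T by (rule T_abelian_group)
  note cl = M.lsmult_closed N.rsmult_closed additive_closed[OF tensor_lact(1)]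
    additive_closed[OF tensor_ract(1)]
  note add = additive_add[OF tensor_lact(1)] additive_add[OF tensor_ract(1)]
  note eqI = tensor_eqI[OF T_abelian_group]
  show ?thesis
  proof
    fix a a' t assume a: "a \<in> carrier S" "a' \<in> carrier S" and t: "t \<in> carrier T"
    show "(a \<oplus>\<^bsub>S\<^esub> a') \<triangleright>\<^bsub>T\<^esub> t = (a \<triangleright>\<^bsub>T\<^esub> t) \<oplus>\<^bsub>T\<^esub> (a' \<triangleright>\<^bsub>T\<^esub> t)"
      using a by (intro eqI[OF tensor_lact(1) additive_add_maps[OF T_abelian_group tensor_lact(1) tensor_lact(1)] _ t])
        (auto simp: tensor_lact(2) cl M.lsmult_distr_ring biadditive_add_left[OF pure_biadditive])
    show "(a \<otimes>\<^bsub>S\<^esub> a') \<triangleright>\<^bsub>T\<^esub> t = a \<triangleright>\<^bsub>T\<^esub> (a' \<triangleright>\<^bsub>T\<^esub> t)"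
      using a by (intro eqI[OF tensor_lact(1) additive_comp[OF tensor_lact(1) tensor_lact(1)] _ t])
        (auto simp: tensor_lact(2) cl M.lsmult_assoc)
  next
    fix t b b' assume t: "t \<in> carrier T" and a: "b \<in> carrier R" "b' \<in> carrier R"
    show "t \<triangleleft>\<^bsub>T\<^esub> (b \<oplus>\<^bsub>R\<^esub> b') = (t \<triangleleft>\<^bsub>T\<^esub> b) \<oplus>\<^bsub>T\<^esub> (t \<triangleleft>\<^bsub>T\<^esub> b')"
      using a by (intro eqI[OF tensor_ract(1) additive_add_maps[OF T_abelian_group tensor_ract(1) tensor_ract(1)] _ t])
        (auto simp: tensor_ract(2) cl N.rsmult_distr_ring biadditive_add_right[OF pure_biadditive])
    show "t \<triangleleft>\<^bsub>T\<^esub> (b \<otimes>\<^bsub>R\<^esub> b') = (t \<triangleleft>\<^bsub>T\<^esub> b) \<triangleleft>\<^bsub>T\<^esub> b'"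
      using a by (intro eqI[OF tensor_ract(1) additive_comp[OF tensor_ract(1) tensor_ract(1)] _ t])
        (auto simp: tensor_ract(2) cl N.rsmult_assoc)
  next
    fix t assume t: "t \<in> carrier T"
    show "\<one>\<^bsub>S\<^esub> \<triangleright>\<^bsub>T\<^esub> t = t"
      by (intro eqI[OF tensor_lact(1) additive_id _ t]) (auto simp: tensor_lact(2) M.lsmult_one)
    show "t \<triangleleft>\<^bsub>T\<^esub> \<one>\<^bsub>R\<^esub> = t"
      by (intro eqI[OF tensor_ract(1) additive_id _ t]) (auto simp: tensor_ract(2) N.rsmult_one)
  next
    fix a t b assume a: "a \<in> carrier S" "b \<in> carrier R" and t: "t \<in> carrier T"
    show "(a \<triangleright>\<^bsub>T\<^esub> t) \<triangleleft>\<^bsub>T\<^esub> b = a \<triangleright>\<^bsub>T\<^esub> (t \<triangleleft>\<^bsub>T\<^esub> b)"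
      using a by (intro eqI[OF additive_comp[OF tensor_lact(1) tensor_ract(1)]
            additive_comp[OF tensor_ract(1) tensor_lact(1)] _ t])
        (auto simp: tensor_ract(2) tensor_lact(2) cl)
  qed (auto simp: cl add)
qed

end

section \<open>Gradings and direct sums\<close>

lemma (in abelian_group) eq_if_minus_zero:
  "\<lbrakk>a \<in> carrier G; b \<in> carrier G; a \<ominus> b = \<zero>\<rbrakk> \<Longrightarrow> a = b"
  using minus_equality[of a "\<ominus> b"] by (simp add: minus_eq)

lemma graded_group_abelian: "graded_group G M d \<Longrightarrow> abelian_group M"
  by (simp add: graded_group_def)

lemma graded_deg_subgroup:
  "\<lbrakk>graded_group G M d; \<alpha> \<in> carrier G\<rbrakk> \<Longrightarrow> subgroup (d \<alpha>) (add_monoid M)"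
  by (simp add: graded_group_def)

lemma graded_deg_closed:
  "\<lbrakk>graded_group G M d; \<alpha> \<in> carrier G; m \<in> d \<alpha>\<rbrakk> \<Longrightarrow> m \<in> carrier M"
  using subgroup.subset[OF graded_deg_subgroup] by fastforce

lemma graded_deg_zero: "\<lbrakk>graded_group G M d; \<alpha> \<in> carrier G\<rbrakk> \<Longrightarrow> \<zero>\<^bsub>M\<^esub> \<in> d \<alpha>"
  using subgroup.one_closed[OF graded_deg_subgroup] by fastforce

lemma finsum_support:
  assumes "abelian_group M" "finite F" "F \<subseteq> I" "support I (\<lambda>_. M) f \<subseteq> F" "f \<in> F \<rightarrow> carrier M"
  shows "(\<Oplus>\<^bsub>M\<^esub>i\<in>support I (\<lambda>_. M) f. f i) = (\<Oplus>\<^bsub>M\<^esub>i\<in>F. f i)"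
proof -
  interpret M: abelian_group M by fact
  show ?thesis
    by (rule M.add.finprod_mono_neutral_cong_left) (use assms in \<open>auto simp: support_def\<close>)
qed

lemma graded_decomposition:
  assumes "graded_group G M d" "m \<in> carrier M"
  obtains F f where "finite F" "F \<subseteq> carrier G" "f \<in> (\<Pi> \<alpha>\<in>carrier G. d \<alpha>)" "m = (\<Oplus>\<^bsub>M\<^esub>\<alpha>\<in>F. f \<alpha>)"
proof -
  have "\<exists>f. f \<in> (\<Pi>\<^sub>E \<alpha>\<in>carrier G. d \<alpha>) \<and> finite (support (carrier G) (\<lambda>_. M) f) \<and>
      m = (\<Oplus>\<^bsub>M\<^esub>\<alpha>\<in>support (carrier G) (\<lambda>_. M) f. f \<alpha>)"
    using assms unfolding graded_group_def by blast
  then obtain f where "f \<in> (\<Pi>\<^sub>E \<alpha>\<in>carrier G. d \<alpha>)" "finite (support (carrier G) (\<lambda>_. M) f)"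
    "m = (\<Oplus>\<^bsub>M\<^esub>\<alpha>\<in>support (carrier G) (\<lambda>_. M) f. f \<alpha>)" by blast
  then show thesis
    by (intro that[of "support (carrier G) (\<lambda>_. M) f" f]) (auto simp: support_def)
qed

lemma generated_byI:
  assumes "abelian_group M" "B \<subseteq> carrier M"
    and "\<And>m. m \<in> carrier M \<Longrightarrow> \<exists>(F :: 'i set) f. finite F \<and> f \<in> F \<rightarrow> B \<and> m = (\<Oplus>\<^bsub>M\<^esub>i\<in>F. f i)"
  shows "generated_by M B"
  unfolding generated_by_def
proof (intro conjI allI impI subsetI)
  interpret M: abelian_group M by fact
  fix X m
  assume X: "\<zero>\<^bsub>M\<^esub> \<in> X" "B \<subseteq> X"
    "\<forall>a\<in>carrier M \<inter> X. \<forall>b\<in>carrier M \<inter> X. a \<oplus>\<^bsub>M\<^esub> b \<in> X" and m: "m \<in> carrier M"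
  obtain F :: "'i set" and f where F: "finite F" "f \<in> F \<rightarrow> B" "m = (\<Oplus>\<^bsub>M\<^esub>i\<in>F. f i)"
    using assms(3)[OF m] by blast
  have "(\<Oplus>\<^bsub>M\<^esub>i\<in>F. f i) \<in> X"
    using F(1,2)
  proof (induction F rule: finite_induct)
    case empty
    then show ?case using X(1) by simp
  next
    case (insert i F)
    have "f j \<in> carrier M \<inter> X" if j: "j \<in> insert i F" for j
      using subsetD[OF X(2)] subsetD[OF assms(2)] Pi_mem[OF insert.prems j] by simp
    moreover from this have "f \<in> F \<rightarrow> carrier M" by auto
    ultimately show ?case
      using insert X(3) by (simp add: M.finsum_insert M.finsum_closed)
  qed
  then show "m \<in> X" using F(3) by simp
qed (use assms(2) in auto)

lemma graded_generated:
  fixes G :: "('g, 'w) monoid_scheme"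
  assumes "graded_group G M d"
  shows "generated_by M (\<Union>\<alpha>\<in>carrier G. d \<alpha>)"
proof (rule generated_byI[OF graded_group_abelian[OF assms]])
  show "(\<Union>\<alpha>\<in>carrier G. d \<alpha>) \<subseteq> carrier M"
    using graded_deg_closed[OF assms] by blast
  fix m assume m: "m \<in> carrier M"
  obtain F f where "finite F" "F \<subseteq> carrier G" "f \<in> (\<Pi> \<alpha>\<in>carrier G. d \<alpha>)" "m = (\<Oplus>\<^bsub>M\<^esub>\<alpha>\<in>F. f \<alpha>)"
    using graded_decomposition[OF assms m] .
  then show "\<exists>(F :: 'g set) f. finite F \<and> f \<in> F \<rightarrow> (\<Union>\<alpha>\<in>carrier G. d \<alpha>) \<and> m = (\<Oplus>\<^bsub>M\<^esub>i\<in>F. f i)"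
    by (intro exI[of _ F] exI[of _ f]) auto
qed

text \<open>Otherwise zero would have two different decompositions.\<close>

lemma graded_independent:
  assumes "graded_group G M d" "finite F" "F \<subseteq> carrier G" "\<And>\<alpha>. \<alpha> \<in> F \<Longrightarrow> f \<alpha> \<in> d \<alpha>"
    and "(\<Oplus>\<^bsub>M\<^esub>\<alpha>\<in>F. f \<alpha>) = \<zero>\<^bsub>M\<^esub>" "\<alpha> \<in> F"
  shows "f \<alpha> = \<zero>\<^bsub>M\<^esub>"
proof -
  interpret M: abelian_group M by (rule graded_group_abelian[OF assms(1)])
  let ?f = "\<lambda>\<alpha>\<in>carrier G. if \<alpha> \<in> F then f \<alpha> else \<zero>\<^bsub>M\<^esub>" and ?z = "\<lambda>\<alpha>\<in>carrier G. \<zero>\<^bsub>M\<^esub>"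
  let ?s = "support (carrier G) (\<lambda>_. M)"
  have s: "?s ?f \<subseteq> F" "?s ?z = {}" by (auto simp: support_def)
  have fc: "f \<beta> \<in> carrier M" if "\<beta> \<in> F" for \<beta>
    using that assms(3,4) graded_deg_closed[OF assms(1)] by blast
  have "(\<Oplus>\<^bsub>M\<^esub>\<alpha>\<in>?s ?f. ?f \<alpha>) = (\<Oplus>\<^bsub>M\<^esub>\<alpha>\<in>F. ?f \<alpha>)"
    by (rule finsum_support[OF M.abelian_group_axioms assms(2,3) s(1)]) (use fc assms(3) in auto)
  also have "\<dots> = (\<Oplus>\<^bsub>M\<^esub>\<alpha>\<in>F. f \<alpha>)"
    by (rule M.finsum_cong') (use fc assms(3) in auto)
  finally have "(\<Oplus>\<^bsub>M\<^esub>\<alpha>\<in>?s ?f. ?f \<alpha>) = \<zero>\<^bsub>M\<^esub>" using assms(5) by simp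
  moreover have "(\<Oplus>\<^bsub>M\<^esub>\<alpha>\<in>?s ?z. ?z \<alpha>) = \<zero>\<^bsub>M\<^esub>" using s(2) by simp
  moreover have "?f \<in> (\<Pi>\<^sub>E \<alpha>\<in>carrier G. d \<alpha>)" "?z \<in> (\<Pi>\<^sub>E \<alpha>\<in>carrier G. d \<alpha>)"
    using assms(4) graded_deg_zero[OF assms(1)] by auto
  moreover have "finite (?s ?f)" "finite (?s ?z)"
    using s assms(2) finite_subset by auto
  moreover have "g = g'"
    if "g \<in> (\<Pi>\<^sub>E \<alpha>\<in>carrier G. d \<alpha>)" "g' \<in> (\<Pi>\<^sub>E \<alpha>\<in>carrier G. d \<alpha>)" "finite (?s g)" "finite (?s g')"
      "(\<Oplus>\<^bsub>M\<^esub>\<alpha>\<in>?s g. g \<alpha>) = \<zero>\<^bsub>M\<^esub>" "(\<Oplus>\<^bsub>M\<^esub>\<alpha>\<in>?s g'. g' \<alpha>) = \<zero>\<^bsub>M\<^esub>" for g g'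
  proof -
    let ?P = "\<lambda>f. f \<in> (\<Pi>\<^sub>E \<alpha>\<in>carrier G. d \<alpha>) \<and> finite (?s f) \<and> \<zero>\<^bsub>M\<^esub> = (\<Oplus>\<^bsub>M\<^esub>\<alpha>\<in>?s f. f \<alpha>)"
    have ex1: "\<exists>!f. ?P f"
      using assms(1) M.zero_closed unfolding graded_group_def by blast
    have g: "?P g" using that(1,3,5) by simp
    have g': "?P g'" using that(2,4,6) by simp
    show ?thesis by (rule trans[OF sym[OF the1_equality[OF ex1, OF g]] the1_equality[OF ex1, OF g']])
  qed
  ultimately have "?f = ?z" by blast
  from fun_cong[OF this, of \<alpha>] show ?thesis using assms(3,6) by auto
qed

text \<open>Decompositions exist by induction over the generators, and independence applied to the difference
  of two decompositions shows that they are equal.\<close>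

lemma graded_groupI:
  assumes "abelian_group M" "\<And>\<alpha>. \<alpha> \<in> carrier G \<Longrightarrow> subgroup (d \<alpha>) (add_monoid M)"
    and gen: "generated_by M (\<Union>\<alpha>\<in>carrier G. d \<alpha>)"
    and indep: "\<And>F f \<alpha>. \<lbrakk>finite F; F \<subseteq> carrier G; \<forall>\<alpha>\<in>F. f \<alpha> \<in> d \<alpha>; (\<Oplus>\<^bsub>M\<^esub>\<alpha>\<in>F. f \<alpha>) = \<zero>\<^bsub>M\<^esub>; \<alpha> \<in> F\<rbrakk>
      \<Longrightarrow> f \<alpha> = \<zero>\<^bsub>M\<^esub>"
  shows "graded_group G M d"
  unfolding graded_group_def
proof (intro conjI ballI)
  interpret M: abelian_group M by fact
  let ?s = "support (carrier G) (\<lambda>_. M)"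
  have dc: "m \<in> carrier M" if "\<alpha> \<in> carrier G" "m \<in> d \<alpha>" for m \<alpha>
    using subgroup.subset[OF assms(2)[OF that(1)]] that(2) by auto
  have dz: "\<zero>\<^bsub>M\<^esub> \<in> d \<alpha>" if "\<alpha> \<in> carrier G" for \<alpha>
    using subgroup.one_closed[OF assms(2)[OF that]] by simp
  have da: "a \<oplus>\<^bsub>M\<^esub> b \<in> d \<alpha>" if "\<alpha> \<in> carrier G" "a \<in> d \<alpha>" "b \<in> d \<alpha>" for \<alpha> a b
    using subgroup.m_closed[OF assms(2)[OF that(1)] that(2,3)] by simp
  have dm: "a \<ominus>\<^bsub>M\<^esub> b \<in> d \<alpha>" if "\<alpha> \<in> carrier G" "a \<in> d \<alpha>" "b \<in> d \<alpha>" for \<alpha> a b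
    using subgroup.m_inv_closed[OF assms(2)[OF that(1)] that(3)] da[OF that(1,2)]
    by (simp add: a_minus_def a_inv_def)
  define Q where "Q m f \<longleftrightarrow> f \<in> (\<Pi>\<^sub>E \<alpha>\<in>carrier G. d \<alpha>) \<and> finite (?s f) \<and> m = (\<Oplus>\<^bsub>M\<^esub>\<alpha>\<in>?s f. f \<alpha>)" for m f
  have Qsum: "m = (\<Oplus>\<^bsub>M\<^esub>\<alpha>\<in>F. f \<alpha>)" if "Q m f" "finite F" "?s f \<subseteq> F" "F \<subseteq> carrier G" for m f F
  proof -
    have "f \<in> F \<rightarrow> carrier M" using that dc by (fastforce simp: Q_def)
    then show ?thesis using finsum_support[OF assms(1) that(2,4,3)] that(1) by (simp add: Q_def)
  qed
  have QI: "Q (\<Oplus>\<^bsub>M\<^esub>\<alpha>\<in>F. f \<alpha>) f"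
    if "f \<in> (\<Pi>\<^sub>E \<alpha>\<in>carrier G. d \<alpha>)" "finite F" "F \<subseteq> carrier G" "?s f \<subseteq> F" for F f
  proof -
    have "f \<in> F \<rightarrow> carrier M" using that dc by fastforce
    then show ?thesis
      using finsum_support[OF assms(1) that(2,3,4)] that finite_subset[OF that(4,2)] by (simp add: Q_def)
  qed
  fix m assume m: "m \<in> carrier M"
  have "\<exists>f. Q m f"
    using gen m
  proof (induction rule: generated_by_induct)
    case zero
    have "Q (\<Oplus>\<^bsub>M\<^esub>\<alpha>\<in>{}. (\<lambda>\<alpha>\<in>carrier G. \<zero>\<^bsub>M\<^esub>) \<alpha>) (\<lambda>\<alpha>\<in>carrier G. \<zero>\<^bsub>M\<^esub>)"
      by (rule QI) (auto simp: dz support_def)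
    then show ?case by auto
  next
    case (add a b)
    then obtain f g where fg: "Q a f" "Q b g" by blast
    let ?h = "\<lambda>\<alpha>\<in>carrier G. f \<alpha> \<oplus>\<^bsub>M\<^esub> g \<alpha>" and ?F = "?s f \<union> ?s g"
    have F: "finite ?F" "?F \<subseteq> carrier G" using fg by (auto simp: Q_def support_def)
    have fgd: "f \<alpha> \<in> d \<alpha>" "g \<alpha> \<in> d \<alpha>" if "\<alpha> \<in> carrier G" for \<alpha> using that fg by (auto simp: Q_def)
    have fgc: "f \<in> ?F \<rightarrow> carrier M" "g \<in> ?F \<rightarrow> carrier M" using fgd dc F(2) by blast+
    have "Q (\<Oplus>\<^bsub>M\<^esub>\<alpha>\<in>?F. ?h \<alpha>) ?h"
      by (rule QI) (use F in \<open>auto simp: fgd da support_def\<close>)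
    moreover have "(\<Oplus>\<^bsub>M\<^esub>\<alpha>\<in>?F. ?h \<alpha>) = (\<Oplus>\<^bsub>M\<^esub>\<alpha>\<in>?F. f \<alpha> \<oplus>\<^bsub>M\<^esub> g \<alpha>)"
      by (rule M.finsum_cong') (use fgc F(2) in \<open>auto simp: Pi_iff subset_iff\<close>)
    moreover have "\<dots> = a \<oplus>\<^bsub>M\<^esub> b"
      using Qsum[OF fg(1) F(1) _ F(2)] Qsum[OF fg(2) F(1) _ F(2)] M.finsum_addf[OF fgc] by simp
    ultimately show ?case by auto
  next
    case (generator b)
    then obtain \<alpha> where \<alpha>: "\<alpha> \<in> carrier G" "b \<in> d \<alpha>" by blast
    let ?f = "\<lambda>\<beta>\<in>carrier G. if \<beta> = \<alpha> then b else \<zero>\<^bsub>M\<^esub>"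
    have "Q (\<Oplus>\<^bsub>M\<^esub>\<beta>\<in>{\<alpha>}. ?f \<beta>) ?f"
      by (rule QI) (use \<alpha> in \<open>auto simp: dz support_def\<close>)
    then show ?case using \<alpha> dc by (auto simp: M.finsum_insert)
  qed
  moreover have "f = g" if "Q m f" "Q m g" for f g
  proof
    fix \<alpha>
    let ?F = "?s f \<union> ?s g"
    have F: "finite ?F" "?F \<subseteq> carrier G" using that by (auto simp: Q_def support_def)
    have fgd: "f \<alpha> \<in> d \<alpha>" "g \<alpha> \<in> d \<alpha>" if "\<alpha> \<in> carrier G" for \<alpha>
      using that \<open>Q m f\<close> \<open>Q m g\<close> by (auto simp: Q_def)
    have fgc: "f \<alpha> \<in> carrier M" "g \<alpha> \<in> carrier M" if "\<alpha> \<in> carrier G" for \<alpha>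
      using that fgd dc by blast+
    have add: "additive M M (\<lambda>m. \<ominus>\<^bsub>M\<^esub> m)"
      by (rule additiveI) (auto simp: M.minus_add M.a_comm)
    have gF: "g \<in> ?F \<rightarrow> carrier M" "f \<in> ?F \<rightarrow> carrier M" using F(2) fgc by auto
    have "(\<Oplus>\<^bsub>M\<^esub>\<alpha>\<in>?F. f \<alpha> \<ominus>\<^bsub>M\<^esub> g \<alpha>) = (\<Oplus>\<^bsub>M\<^esub>\<alpha>\<in>?F. f \<alpha>) \<oplus>\<^bsub>M\<^esub> (\<Oplus>\<^bsub>M\<^esub>\<alpha>\<in>?F. \<ominus>\<^bsub>M\<^esub> g \<alpha>)"
      unfolding M.minus_eq by (rule M.finsum_addf) (use F(2) fgc in auto)
    also have "\<dots> = m \<ominus>\<^bsub>M\<^esub> m"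
      using Qsum[OF that(1) F(1) _ F(2)] Qsum[OF that(2) F(1) _ F(2)]
        additive_finsum[OF assms(1,1) add gF(1)] by (simp add: M.minus_eq)
    finally have 0: "(\<Oplus>\<^bsub>M\<^esub>\<alpha>\<in>?F. f \<alpha> \<ominus>\<^bsub>M\<^esub> g \<alpha>) = \<zero>\<^bsub>M\<^esub>" using m by (simp add: M.minus_eq M.r_neg)
    show "f \<alpha> = g \<alpha>"
    proof (cases "\<alpha> \<in> ?F")
      case True
      have "f \<alpha> \<ominus>\<^bsub>M\<^esub> g \<alpha> = \<zero>\<^bsub>M\<^esub>"
        by (rule indep[OF F _ 0 True]) (use F(2) fgd dm in blast)
      then show ?thesis using fgc True F(2) M.eq_if_minus_zero by blast
    next
      case False
      show ?thesis
      proof (cases "\<alpha> \<in> carrier G")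
        case True
        then show ?thesis using False by (auto simp: support_def)
      next
        case False
        then show ?thesis using that by (auto simp: Q_def PiE_iff extensional_def)
      qed
    qed
  qed
  ultimately show "\<exists>!f. f \<in> (\<Pi>\<^sub>E \<alpha>\<in>carrier G. d \<alpha>) \<and> finite (?s f) \<and> m = (\<Oplus>\<^bsub>M\<^esub>\<alpha>\<in>?s f. f \<alpha>)"
    unfolding Q_def by blast
qed (use assms in auto)

lemma graded_group_same_add:
  assumes "same_add M N" "graded_group G M d" shows "graded_group G N d"
proof -
  have "generated_by N (\<Union>\<alpha>\<in>carrier G. d \<alpha>)"
    using graded_generated[OF assms(2)] same_add_generated_by[OF assms(1)] by simp
  moreover have "subgroup (d \<alpha>) (add_monoid N)" if "\<alpha> \<in> carrier G" for \<alpha>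
    using graded_deg_subgroup[OF assms(2) that] assms(1)
    unfolding subgroup_def same_add_def m_inv_def by simp
  moreover have "f \<alpha> = \<zero>\<^bsub>N\<^esub>"
    if "finite F" "F \<subseteq> carrier G" "\<forall>\<alpha>\<in>F. f \<alpha> \<in> d \<alpha>" "(\<Oplus>\<^bsub>N\<^esub>\<alpha>\<in>F. f \<alpha>) = \<zero>\<^bsub>N\<^esub>" "\<alpha> \<in> F" for F f \<alpha>
  proof -
    have 0: "\<zero>\<^bsub>M\<^esub> = \<zero>\<^bsub>N\<^esub>" using assms(1) by (simp add: same_add_def)
    show ?thesis
      unfolding 0[symmetric]
      by (rule graded_independent[OF assms(2) that(1,2) _ _ that(5)])
        (use that(3,4) in \<open>simp_all add: same_add_finsum[OF assms(1)] 0\<close>)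
  qed
  ultimately show ?thesis
    by (intro graded_groupI same_add_abelian_group[OF assms(1)] graded_group_abelian[OF assms(2)])
qed

text \<open>If a sum of homogeneous elements is mapped to zero, independence of the degrees in the target
  shows that each of them is.\<close>

lemma graded_bij_betw:
  assumes M: "graded_group G M dM" and N: "graded_group G N dN" and f: "additive M N f"
    and bij: "\<And>\<alpha>. \<alpha> \<in> carrier G \<Longrightarrow> bij_betw f (dM \<alpha>) (dN \<alpha>)"
  shows "bij_betw f (carrier M) (carrier N)"
proof -
  interpret M: abelian_group M by (rule graded_group_abelian[OF M])
  interpret N: abelian_group N by (rule graded_group_abelian[OF N])
  have f0: "f \<zero>\<^bsub>M\<^esub> = \<zero>\<^bsub>N\<^esub>" by (rule additive_zero[OF M.abelian_group_axioms N.abelian_group_axioms f])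
  have ker: "m = \<zero>\<^bsub>M\<^esub>" if m: "m \<in> carrier M" "f m = \<zero>\<^bsub>N\<^esub>" for m
  proof -
    obtain F g where F: "finite F" "F \<subseteq> carrier G" "g \<in> (\<Pi> \<alpha>\<in>carrier G. dM \<alpha>)" "m = (\<Oplus>\<^bsub>M\<^esub>\<alpha>\<in>F. g \<alpha>)"
      using graded_decomposition[OF M m(1)] .
    have g: "g \<in> F \<rightarrow> carrier M" using F(2,3) graded_deg_closed[OF M] by blast
    have 0: "(\<Oplus>\<^bsub>N\<^esub>\<alpha>\<in>F. f (g \<alpha>)) = \<zero>\<^bsub>N\<^esub>"
      using additive_finsum[OF M.abelian_group_axioms N.abelian_group_axioms f g] m(2) F(4) by simp
    have "g \<alpha> = \<zero>\<^bsub>M\<^esub>" if \<alpha>: "\<alpha> \<in> F" for \<alpha>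
    proof -
      have "f (g \<alpha>) = \<zero>\<^bsub>N\<^esub>"
        by (rule graded_independent[OF N F(1,2) _ 0 \<alpha>]) (use F(2,3) bij bij_betwE in blast)
      then have "f (g \<alpha>) = f \<zero>\<^bsub>M\<^esub>" by (simp add: f0)
      then show ?thesis
        using inj_onD[OF bij_betw_imp_inj_on[OF bij]] \<alpha> F(2,3) graded_deg_zero[OF M] by blast
    qed
    then have "m = (\<Oplus>\<^bsub>M\<^esub>\<alpha>\<in>F. \<zero>\<^bsub>M\<^esub>)" unfolding F(4) by (intro M.finsum_cong') auto
    then show ?thesis by simp
  qed
  have "inj_on f (carrier M)"
  proof (rule inj_onI)
    fix a b assume ab: "a \<in> carrier M" "b \<in> carrier M" "f a = f b"
    have "f (a \<ominus>\<^bsub>M\<^esub> b) = f a \<ominus>\<^bsub>N\<^esub> f b"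
      using ab additive_neg[OF M.abelian_group_axioms N.abelian_group_axioms f]
      by (simp add: M.minus_eq N.minus_eq additive_add[OF f])
    also have "\<dots> = \<zero>\<^bsub>N\<^esub>" using ab additive_closed[OF f] by (simp add: N.minus_eq N.r_neg)
    finally have "a \<ominus>\<^bsub>M\<^esub> b = \<zero>\<^bsub>M\<^esub>" using ker ab by simp
    then show "a = b" using ab M.eq_if_minus_zero by blast
  qed
  moreover have "n \<in> f ` carrier M" if "n \<in> carrier N" for n
    using graded_generated[OF N] that
  proof (induction rule: generated_by_induct)
    case zero
    then show ?case using f0 by (intro image_eqI[of _ _ "\<zero>\<^bsub>M\<^esub>"]) auto
  next
    case (add a b)
    then show ?case using additive_add[OF f] by (metis (no_types, lifting) M.a_closed image_iff)
  next
    case (generator b)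
    then obtain \<alpha> where \<alpha>: "\<alpha> \<in> carrier G" "b \<in> dN \<alpha>" by blast
    then have "b \<in> f ` dM \<alpha>" using bij bij_betw_imp_surj_on by blast
    then show ?case using graded_deg_closed[OF M \<alpha>(1)] by auto
  qed
  ultimately show ?thesis
    using additive_closed[OF f] by (auto simp: bij_betw_def)
qed

locale abelian_family =
  fixes I :: "'g set" and M :: "'g \<Rightarrow> ('m, 'x) ring_scheme"
  assumes abelian: "i \<in> I \<Longrightarrow> abelian_group (M i)"
begin

abbreviation "D \<equiv> dsum I M"

lemma carrier_dsum: "carrier D = {p \<in> (\<Pi>\<^sub>E i\<in>I. carrier (M i)). finite (support I M p)}"
proof -
  have "group (add_monoid (M i))" if "i \<in> I" for i
    using abelian_group.a_group[OF abelian[OF that]] .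
  then show ?thesis by (simp add: dsum_def Let_def carrier_sum_group support_def)
qed

lemma dsum_zero: "zero D = (\<lambda>i\<in>I. \<zero>\<^bsub>M i\<^esub>)"
  and dsum_add: "p \<oplus>\<^bsub>D\<^esub> q = (\<lambda>i\<in>I. p i \<oplus>\<^bsub>M i\<^esub> q i)"
  by (simp_all add: dsum_def Let_def)

lemma dsum_component: "\<lbrakk>p \<in> carrier D; i \<in> I\<rbrakk> \<Longrightarrow> p i \<in> carrier (M i)"
  by (auto simp: carrier_dsum)

lemma dsum_ext: "\<lbrakk>p \<in> carrier D; q \<in> carrier D; \<And>i. i \<in> I \<Longrightarrow> p i = q i\<rbrakk> \<Longrightarrow> p = q"
  by (auto simp: carrier_dsum intro: PiE_ext)

lemma dsum_abelian_group: "abelian_group D"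
proof -
  have g: "group (add_monoid (M i))" if "i \<in> I" for i
    using abelian_group.a_group[OF abelian[OF that]] .
  have sg: "group (sum_group I (\<lambda>i. add_monoid (M i)))" using g by (rule sum_group)
  moreover have "p \<oplus>\<^bsub>D\<^esub> q = q \<oplus>\<^bsub>D\<^esub> p" if "p \<in> carrier D" "q \<in> carrier D" for p q
    using that dsum_component abelian_groupE(4)[OF abelian] by (auto simp: dsum_add fun_eq_iff restrict_def)
  ultimately show ?thesis
    using monoid.m_closed[OF group.is_monoid[OF sg]] monoid.one_closed[OF group.is_monoid[OF sg]]
      monoid.m_assoc[OF group.is_monoid[OF sg]] monoid.l_one[OF group.is_monoid[OF sg]]
      group.l_inv_ex[OF sg]
    unfolding dsum_def Let_def by (intro abelian_groupI) (simp_all del: mult_sum_group one_sum_group)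
qed

lemma dsum_in_apply: "j \<in> I \<Longrightarrow> dsum_in I M i m j = (if j = i then m else \<zero>\<^bsub>M j\<^esub>)"
  by (simp add: dsum_in_def)

lemma dsum_in_closed: "\<lbrakk>i \<in> I; m \<in> carrier (M i)\<rbrakk> \<Longrightarrow> dsum_in I M i m \<in> carrier D"
proof -
  assume a: "i \<in> I" "m \<in> carrier (M i)"
  have "support I M (dsum_in I M i m) \<subseteq> {i}" by (auto simp: support_def dsum_in_def)
  then have "finite (support I M (dsum_in I M i m))" using finite_subset by auto
  then show ?thesis using a abelian_groupE(2)[OF abelian] by (auto simp: carrier_dsum dsum_in_def)
qed

lemma dsum_in_additive: "i \<in> I \<Longrightarrow> additive (M i) D (dsum_in I M i)"
  by (rule additiveI)
    (simp_all add: dsum_in_closed,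
      auto simp: dsum_add dsum_in_def fun_eq_iff restrict_def abelian_groupE[OF abelian])

lemma dsum_component_additive: "i \<in> I \<Longrightarrow> additive D (M i) (\<lambda>p. p i)"
  by (rule additiveI) (auto simp: dsum_component dsum_add)

lemma dsum_finsum_component:
  assumes "\<phi> \<in> F \<rightarrow> carrier D" "i \<in> I"
  shows "(\<Oplus>\<^bsub>D\<^esub>j\<in>F. \<phi> j) i = (\<Oplus>\<^bsub>M i\<^esub>j\<in>F. \<phi> j i)"
  by (rule additive_finsum[OF dsum_abelian_group abelian[OF assms(2)] dsum_component_additive[OF assms(2)] assms(1)])

text \<open>Split off one component at a time, by induction on a finite set containing the support.\<close>

lemma dsum_generated: "generated_by D (\<Union>i\<in>I. dsum_deg I M i)"
  unfolding generated_by_def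
proof (intro conjI allI impI subsetI)
  show "p \<in> carrier D" if "p \<in> (\<Union>i\<in>I. dsum_deg I M i)" for p
    using that by (auto simp: dsum_deg_def dsum_in_closed)
next
  interpret D: abelian_group D by (rule dsum_abelian_group)
  fix X p
  assume X: "\<zero>\<^bsub>D\<^esub> \<in> X" "(\<Union>i\<in>I. dsum_deg I M i) \<subseteq> X"
    "\<forall>a\<in>carrier D \<inter> X. \<forall>b\<in>carrier D \<inter> X. a \<oplus>\<^bsub>D\<^esub> b \<in> X" and p: "p \<in> carrier D"
  have "p \<in> X" if "finite F" "support I M p \<subseteq> F" "p \<in> carrier D" for F p
    using that
  proof (induction F arbitrary: p rule: finite_induct)
    case empty
    then have "p = \<zero>\<^bsub>D\<^esub>"
      by (intro dsum_ext) (auto simp: dsum_zero support_def intro!: D.zero_closed[unfolded dsum_zero])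
    then show ?case using X(1) by simp
  next
    case (insert i F)
    show ?case
    proof (cases "i \<in> I")
      case True
      define q where "q = (\<lambda>j\<in>I. if j = i then \<zero>\<^bsub>M j\<^esub> else p j)"
      have sq: "support I M q \<subseteq> F" using insert(4) by (auto simp: q_def support_def)
      then have q: "q \<in> carrier D"
        using insert(1,5) finite_subset abelian_groupE(2)[OF abelian]
        unfolding carrier_dsum by (auto simp: q_def)
      have pi: "p i \<in> carrier (M i)" by (rule dsum_component[OF insert(5) True])
      have i: "dsum_in I M i (p i) \<in> carrier D \<inter> X"
        using dsum_in_closed[OF True pi] X(2) True pi by (auto simp: dsum_deg_def)
      have "p = q \<oplus>\<^bsub>D\<^esub> dsum_in I M i (p i)"
      proof (rule dsum_ext[OF insert(5)])
        show "q \<oplus>\<^bsub>D\<^esub> dsum_in I M i (p i) \<in> carrier D" using q i by simp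
        show "p j = (q \<oplus>\<^bsub>D\<^esub> dsum_in I M i (p i)) j" if "j \<in> I" for j
        proof -
          have "p j \<oplus>\<^bsub>M j\<^esub> \<zero>\<^bsub>M j\<^esub> = p j" "\<zero>\<^bsub>M j\<^esub> \<oplus>\<^bsub>M j\<^esub> p j = p j"
            using dsum_component[OF insert(5) that] abelian_groupE[OF abelian[OF that]] by metis+
          then show ?thesis using that by (auto simp: dsum_add q_def dsum_in_def)
        qed
      qed
      then show ?thesis using X(3) i q insert(3)[OF sq q] by (metis IntI)
    next
      case False
      then show ?thesis using insert(3)[OF _ insert(5)] insert(4) by (auto simp: support_def)
    qed
  qed
  then show "p \<in> X" using p by (auto simp: carrier_dsum)
qed

end

lemma dsum_graded:
  assumes "\<And>\<alpha>. \<alpha> \<in> carrier G \<Longrightarrow> abelian_group (M \<alpha>)"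
  shows "graded_group G (dsum (carrier G) M) (dsum_deg (carrier G) M)"
proof -
  interpret abelian_family "carrier G" M by (rule abelian_family.intro) (rule assms)
  interpret D: abelian_group D by (rule dsum_abelian_group)
  let ?d = "dsum_deg (carrier G) M" and ?in = "dsum_in (carrier G) M"
  show ?thesis
  proof (rule graded_groupI[OF dsum_abelian_group _ dsum_generated])
    fix \<alpha> assume \<alpha>: "\<alpha> \<in> carrier G"
    interpret Ma: abelian_group "M \<alpha>" by (rule assms[OF \<alpha>])
    have "group_hom (add_monoid (M \<alpha>)) (add_monoid D) (?in \<alpha>)"
      by (intro group_hom.intro group_hom_axioms.intro Ma.a_group D.a_group)
        (use dsum_in_additive[OF \<alpha>] in \<open>auto simp: hom_def additive_def\<close>)
    then have "subgroup (?in \<alpha> ` carrier (add_monoid (M \<alpha>))) (add_monoid D)"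
      by (rule group_hom.img_is_subgroup)
    then show "subgroup (?d \<alpha>) (add_monoid D)" by (simp add: dsum_deg_def)
  next
    fix F f \<alpha> assume F: "finite F" "F \<subseteq> carrier G" "\<forall>\<alpha>\<in>F. f \<alpha> \<in> ?d \<alpha>"
      "(\<Oplus>\<^bsub>D\<^esub>\<alpha>\<in>F. f \<alpha>) = \<zero>\<^bsub>D\<^esub>" "\<alpha> \<in> F"
    have \<alpha>: "\<alpha> \<in> carrier G" using F(2,5) by blast
    interpret Ma: abelian_group "M \<alpha>" by (rule assms[OF \<alpha>])
    have f: "\<exists>m. m \<in> carrier (M \<beta>) \<and> f \<beta> = ?in \<beta> m" if "\<beta> \<in> F" for \<beta>
      using that F(3) by (auto simp: dsum_deg_def)
    have fc: "f \<in> F \<rightarrow> carrier D"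
    proof
      fix \<beta> assume \<beta>: "\<beta> \<in> F"
      show "f \<beta> \<in> carrier D" using f[OF \<beta>] dsum_in_closed \<beta> F(2) by auto
    qed
    have z: "f \<beta> \<alpha> = \<zero>\<^bsub>M \<alpha>\<^esub>" if "\<beta> \<in> F" "\<beta> \<noteq> \<alpha>" for \<beta>
      using f[OF that(1)] that(2) \<alpha> by (auto simp: dsum_in_apply)
    have "\<zero>\<^bsub>M \<alpha>\<^esub> = (\<Oplus>\<^bsub>M \<alpha>\<^esub>\<beta>\<in>F. f \<beta> \<alpha>)"
      using dsum_finsum_component[OF fc \<alpha>] F(4) \<alpha> by (simp add: dsum_zero)
    also have "\<dots> = (\<Oplus>\<^bsub>M \<alpha>\<^esub>\<beta>\<in>F. if \<alpha> = \<beta> then f \<beta> \<alpha> else \<zero>\<^bsub>M \<alpha>\<^esub>)"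
      by (rule Ma.finsum_cong') (use z fc \<alpha> dsum_component in \<open>auto simp: Pi_iff\<close>)
    also have "\<dots> = f \<alpha> \<alpha>"
      by (rule Ma.add.finprod_singleton[OF F(5,1)]) (use fc \<alpha> dsum_component in \<open>auto simp: Pi_iff\<close>)
    finally have "f \<alpha> \<alpha> = \<zero>\<^bsub>M \<alpha>\<^esub>" by simp
    moreover obtain m where "m \<in> carrier (M \<alpha>)" "f \<alpha> = ?in \<alpha> m" using f[OF F(5)] by blast
    ultimately have "f \<alpha> = ?in \<alpha> \<zero>\<^bsub>M \<alpha>\<^esub>" using \<alpha> by (simp add: dsum_in_apply)
    then show "f \<alpha> = \<zero>\<^bsub>D\<^esub>"
      using additive_zero[OF Ma.abelian_group_axioms dsum_abelian_group dsum_in_additive[OF \<alpha>]] by simp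
  qed
qed

text \<open>The situation in which the extension \<open>bilin_ext\<close> of \<open>h\<close> is biadditive.\<close>

locale graded_pairing = M: abelian_family I M + N: abelian_family I N + T: abelian_group T
  for I :: "'g set" and M :: "'g \<Rightarrow> ('m, 'x) ring_scheme" and N :: "'g \<Rightarrow> ('n, 'y) ring_scheme"
    and T :: "('t, 'z) ring_scheme" +
  fixes h :: "'g \<Rightarrow> 'm \<Rightarrow> 'g \<Rightarrow> 'n \<Rightarrow> 't"
  assumes h: "\<lbrakk>\<alpha> \<in> I; \<beta> \<in> I\<rbrakk> \<Longrightarrow> biadditive (M \<alpha>) (N \<beta>) T (\<lambda>m n. h \<alpha> m \<beta> n)"
begin

abbreviation "ext \<equiv> bilin_ext I M N T h"

lemma pair_closed:
  assumes "p \<in> carrier M.D" "q \<in> carrier N.D" "F \<subseteq> I" "F' \<subseteq> I"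
  shows "(\<lambda>z. h (fst z) (p (fst z)) (snd z) (q (snd z))) \<in> F \<times> F' \<rightarrow> carrier T"
proof
  fix z assume "z \<in> F \<times> F'"
  then have z: "fst z \<in> I" "snd z \<in> I" using assms(3,4) by auto
  show "h (fst z) (p (fst z)) (snd z) (q (snd z)) \<in> carrier T"
    by (rule biadditive_closed[OF h[OF z] M.dsum_component[OF assms(1) z(1)] N.dsum_component[OF assms(2) z(2)]])
qed

lemma pair_zero:
  assumes "\<alpha> \<in> I" "\<beta> \<in> I"
  shows "n \<in> carrier (N \<beta>) \<Longrightarrow> h \<alpha> \<zero>\<^bsub>M \<alpha>\<^esub> \<beta> n = \<zero>\<^bsub>T\<^esub>"
    "m \<in> carrier (M \<alpha>) \<Longrightarrow> h \<alpha> m \<beta> \<zero>\<^bsub>N \<beta>\<^esub> = \<zero>\<^bsub>T\<^esub>"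
  using additive_zero[OF M.abelian[OF assms(1)] T.abelian_group_axioms biadditive_left[OF h[OF assms]]]
    additive_zero[OF N.abelian[OF assms(2)] T.abelian_group_axioms biadditive_right[OF h[OF assms]]]
  by auto

text \<open>With a common finite index set for all summands, additivity of the extension becomes
  additivity of each term.\<close>

lemma bilin_ext_superset:
  assumes "p \<in> carrier M.D" "q \<in> carrier N.D" "finite F" "finite F'" "F \<subseteq> I" "F' \<subseteq> I"
    and "support I M p \<subseteq> F" "support I N q \<subseteq> F'"
  shows "ext p q = (\<Oplus>\<^bsub>T\<^esub>z\<in>F \<times> F'. h (fst z) (p (fst z)) (snd z) (q (snd z)))"
  unfolding bilin_ext_def
proof (rule T.add.finprod_mono_neutral_cong_left)
  show "finite (F \<times> F')" "support I M p \<times> support I N q \<subseteq> F \<times> F'" using assms by auto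
  show "(\<lambda>z. h (fst z) (p (fst z)) (snd z) (q (snd z))) \<in> F \<times> F' \<rightarrow> carrier T"
    by (rule pair_closed[OF assms(1,2,5,6)])
  fix z assume z: "z \<in> F \<times> F' - support I M p \<times> support I N q"
  then have "fst z \<in> I" "snd z \<in> I" using assms(5,6) by auto
  then show "h (fst z) (p (fst z)) (snd z) (q (snd z)) = \<zero>\<^bsub>T\<^esub>"
    using z pair_zero M.dsum_component[OF assms(1)] N.dsum_component[OF assms(2)]
    by (auto simp: support_def)
qed simp

lemma bilin_ext_biadditive: "biadditive M.D N.D T ext"
proof (rule biadditiveI)
  interpret MD: abelian_group M.D by (rule M.dsum_abelian_group)
  interpret ND: abelian_group N.D by (rule N.dsum_abelian_group)
  show "ext p q \<in> carrier T" if "p \<in> carrier M.D" "q \<in> carrier N.D" for p q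
    unfolding bilin_ext_def by (rule T.finsum_closed[OF pair_closed[OF that]]) (auto simp: support_def)
  show "ext (p \<oplus>\<^bsub>M.D\<^esub> p') q = ext p q \<oplus>\<^bsub>T\<^esub> ext p' q"
    if c: "p \<in> carrier M.D" "p' \<in> carrier M.D" "q \<in> carrier N.D" for p p' q
  proof -
    let ?F = "support I M p \<union> support I M p' \<union> support I M (p \<oplus>\<^bsub>M.D\<^esub> p')" and ?F' = "support I N q"
    have c': "p \<oplus>\<^bsub>M.D\<^esub> p' \<in> carrier M.D" using c by simp
    have F: "finite ?F" "finite ?F'" "?F \<subseteq> I" "?F' \<subseteq> I"
      using c c' by (auto simp: M.carrier_dsum N.carrier_dsum support_def)
    note sup = bilin_ext_superset[OF _ c(3) F _ subset_refl]
    have "(\<Oplus>\<^bsub>T\<^esub>z\<in>?F \<times> ?F'. h (fst z) ((p \<oplus>\<^bsub>M.D\<^esub> p') (fst z)) (snd z) (q (snd z))) =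
      (\<Oplus>\<^bsub>T\<^esub>z\<in>?F \<times> ?F'. h (fst z) (p (fst z)) (snd z) (q (snd z)) \<oplus>\<^bsub>T\<^esub> h (fst z) (p' (fst z)) (snd z) (q (snd z)))"
    proof (rule T.finsum_cong'[OF refl])
      show "(\<lambda>z. h (fst z) (p (fst z)) (snd z) (q (snd z)) \<oplus>\<^bsub>T\<^esub> h (fst z) (p' (fst z)) (snd z) (q (snd z)))
          \<in> ?F \<times> ?F' \<rightarrow> carrier T"
        using pair_closed[OF c(1,3) F(3,4)] pair_closed[OF c(2,3) F(3,4)] by (auto simp: Pi_iff)
      fix z assume "z \<in> ?F \<times> ?F'"
      then have z: "fst z \<in> I" "snd z \<in> I" using F(3,4) by auto
      then show "h (fst z) ((p \<oplus>\<^bsub>M.D\<^esub> p') (fst z)) (snd z) (q (snd z)) =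
          h (fst z) (p (fst z)) (snd z) (q (snd z)) \<oplus>\<^bsub>T\<^esub> h (fst z) (p' (fst z)) (snd z) (q (snd z))"
        using biadditive_add_left[OF h[OF z]] M.dsum_component c N.dsum_component by (simp add: M.dsum_add)
    qed
    then show ?thesis
      by (subst (1 2 3) sup) (use c c' T.finsum_addf[OF pair_closed[OF c(1,3) F(3,4)]
            pair_closed[OF c(2,3) F(3,4)]] in auto)
  qed
  show "ext p (q \<oplus>\<^bsub>N.D\<^esub> q') = ext p q \<oplus>\<^bsub>T\<^esub> ext p q'"
    if c: "p \<in> carrier M.D" "q \<in> carrier N.D" "q' \<in> carrier N.D" for p q q'
  proof -
    let ?F' = "support I N q \<union> support I N q' \<union> support I N (q \<oplus>\<^bsub>N.D\<^esub> q')" and ?F = "support I M p"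
    have c': "q \<oplus>\<^bsub>N.D\<^esub> q' \<in> carrier N.D" using c by simp
    have F: "finite ?F" "finite ?F'" "?F \<subseteq> I" "?F' \<subseteq> I"
      using c c' by (auto simp: M.carrier_dsum N.carrier_dsum support_def)
    note sup = bilin_ext_superset[OF c(1) _ F subset_refl]
    have "(\<Oplus>\<^bsub>T\<^esub>z\<in>?F \<times> ?F'. h (fst z) (p (fst z)) (snd z) ((q \<oplus>\<^bsub>N.D\<^esub> q') (snd z))) =
      (\<Oplus>\<^bsub>T\<^esub>z\<in>?F \<times> ?F'. h (fst z) (p (fst z)) (snd z) (q (snd z)) \<oplus>\<^bsub>T\<^esub> h (fst z) (p (fst z)) (snd z) (q' (snd z)))"
    proof (rule T.finsum_cong'[OF refl])
      show "(\<lambda>z. h (fst z) (p (fst z)) (snd z) (q (snd z)) \<oplus>\<^bsub>T\<^esub> h (fst z) (p (fst z)) (snd z) (q' (snd z)))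
          \<in> ?F \<times> ?F' \<rightarrow> carrier T"
        using pair_closed[OF c(1,2) F(3,4)] pair_closed[OF c(1,3) F(3,4)] by (auto simp: Pi_iff)
      fix z assume "z \<in> ?F \<times> ?F'"
      then have z: "fst z \<in> I" "snd z \<in> I" using F(3,4) by auto
      then show "h (fst z) (p (fst z)) (snd z) ((q \<oplus>\<^bsub>N.D\<^esub> q') (snd z)) =
          h (fst z) (p (fst z)) (snd z) (q (snd z)) \<oplus>\<^bsub>T\<^esub> h (fst z) (p (fst z)) (snd z) (q' (snd z))"
        using biadditive_add_right[OF h[OF z]] M.dsum_component c N.dsum_component by (simp add: N.dsum_add)
    qed
    then show ?thesis
      by (subst (1 2 3) sup) (use c c' T.finsum_addf[OF pair_closed[OF c(1,2) F(3,4)]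
            pair_closed[OF c(1,3) F(3,4)]] in auto)
  qed
qed

lemma bilin_ext_in:
  assumes "\<alpha> \<in> I" "\<beta> \<in> I" "m \<in> carrier (M \<alpha>)" "n \<in> carrier (N \<beta>)"
  shows "ext (dsum_in I M \<alpha> m) (dsum_in I N \<beta> n) = h \<alpha> m \<beta> n"
proof -
  have "ext (dsum_in I M \<alpha> m) (dsum_in I N \<beta> n) = (\<Oplus>\<^bsub>T\<^esub>z\<in>{\<alpha>} \<times> {\<beta>}.
      h (fst z) (dsum_in I M \<alpha> m (fst z)) (snd z) (dsum_in I N \<beta> n (snd z)))"
    by (rule bilin_ext_superset[OF M.dsum_in_closed[OF assms(1,3)] N.dsum_in_closed[OF assms(2,4)]])
      (use assms(1,2) in \<open>auto simp: support_def dsum_in_def\<close>)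
  then show ?thesis
    using assms biadditive_closed[OF h[OF assms(1,2)]]
    by (simp add: T.finsum_insert M.dsum_in_apply N.dsum_in_apply)
qed

end

section \<open>Graded homomorphisms\<close>

locale right_module = R: ring R + abelian_group P
  for R :: "('r, 'x) ring_scheme" and P :: "('r, 'm, 'z) rmodule_scheme" +
  assumes ract_closed: "\<lbrakk>p \<in> carrier P; r \<in> carrier R\<rbrakk> \<Longrightarrow> p \<triangleleft>\<^bsub>P\<^esub> r \<in> carrier P"
    and ract_distr_ring: "\<lbrakk>p \<in> carrier P; r \<in> carrier R; r' \<in> carrier R\<rbrakk> \<Longrightarrow>
      p \<triangleleft>\<^bsub>P\<^esub> (r \<oplus>\<^bsub>R\<^esub> r') = (p \<triangleleft>\<^bsub>P\<^esub> r) \<oplus>\<^bsub>P\<^esub> (p \<triangleleft>\<^bsub>P\<^esub> r')"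
    and ract_distr_mod: "\<lbrakk>p \<in> carrier P; p' \<in> carrier P; r \<in> carrier R\<rbrakk> \<Longrightarrow>
      (p \<oplus>\<^bsub>P\<^esub> p') \<triangleleft>\<^bsub>P\<^esub> r = (p \<triangleleft>\<^bsub>P\<^esub> r) \<oplus>\<^bsub>P\<^esub> (p' \<triangleleft>\<^bsub>P\<^esub> r)"
    and ract_assoc: "\<lbrakk>p \<in> carrier P; r \<in> carrier R; r' \<in> carrier R\<rbrakk> \<Longrightarrow>
      p \<triangleleft>\<^bsub>P\<^esub> (r \<otimes>\<^bsub>R\<^esub> r') = (p \<triangleleft>\<^bsub>P\<^esub> r) \<triangleleft>\<^bsub>P\<^esub> r'"
    and ract_one: "p \<in> carrier P \<Longrightarrow> p \<triangleleft>\<^bsub>P\<^esub> \<one>\<^bsub>R\<^esub> = p"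
begin

lemma ract_biadditive: "biadditive P R P (\<lambda>p r. p \<triangleleft>\<^bsub>P\<^esub> r)"
  by (rule biadditiveI) (auto simp: ract_closed ract_distr_ring ract_distr_mod)

end

locale graded_right_module = group G + right_module R P
  for G :: "('g, 'w) monoid_scheme" (structure) and R :: "('r, 'x) ring_scheme"
    and P :: "('r, 'm, 'z) rmodule_scheme" +
  fixes dR :: "'g \<Rightarrow> 'r set" and dP :: "'g \<Rightarrow> 'm set"
  assumes R_graded: "graded_ring G R dR" and P_graded: "graded_group G P dP"
    and ract_deg: "\<lbrakk>\<alpha> \<in> carrier G; \<beta> \<in> carrier G; p \<in> dP \<alpha>; r \<in> dR \<beta>\<rbrakk> \<Longrightarrow> p \<triangleleft>\<^bsub>P\<^esub> r \<in> dP (\<alpha> \<otimes> \<beta>)"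

locale graded_hom = P: graded_right_module G R P dR dP + N: graded_right_module G R N dR dN
  for G :: "('g, 'w) monoid_scheme" (structure) and R :: "('r, 'x) ring_scheme"
    and P :: "('r, 'm, 'z) rmodule_scheme" and N :: "('r, 'n, 'y) rmodule_scheme" and dR dP dN
begin

abbreviation "H \<equiv> HOM G R P dP N dN"
abbreviation "Hd \<equiv> HOM_deg G R P dP N dN"

lemma HOM_zero: "zero H = (\<lambda>m\<in>carrier P. \<zero>\<^bsub>N\<^esub>)"
  and HOM_add: "f \<oplus>\<^bsub>H\<^esub> g = (\<lambda>m\<in>carrier P. f m \<oplus>\<^bsub>N\<^esub> g m)"
  by (simp_all add: HOM_def)

lemma HOM_degD:
  assumes "f \<in> Hd \<sigma>"
  shows "f \<in> extensional (carrier P)" "additive P N f" "m \<in> carrier P \<Longrightarrow> f m \<in> carrier N"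
    "\<lbrakk>m \<in> carrier P; r \<in> carrier R\<rbrakk> \<Longrightarrow> f (m \<triangleleft>\<^bsub>P\<^esub> r) = f m \<triangleleft>\<^bsub>N\<^esub> r"
    "\<lbrakk>\<alpha> \<in> carrier G; m \<in> dP \<alpha>\<rbrakk> \<Longrightarrow> f m \<in> dN (\<sigma> \<otimes> \<alpha>)"
  using assms by (auto simp: HOM_deg_def additive_def PiE_def image_subset_iff)

lemma HOM_degI:
  assumes "f \<in> extensional (carrier P)" "additive P N f"
    "\<And>m r. \<lbrakk>m \<in> carrier P; r \<in> carrier R\<rbrakk> \<Longrightarrow> f (m \<triangleleft>\<^bsub>P\<^esub> r) = f m \<triangleleft>\<^bsub>N\<^esub> r"
    "\<And>\<alpha> m. \<lbrakk>\<alpha> \<in> carrier G; m \<in> dP \<alpha>\<rbrakk> \<Longrightarrow> f m \<in> dN (\<sigma> \<otimes> \<alpha>)"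
  shows "f \<in> Hd \<sigma>"
  using assms by (auto simp: HOM_deg_def additive_def PiE_def)

lemma N_deg:
  assumes "\<alpha> \<in> carrier G"
  shows "\<zero>\<^bsub>N\<^esub> \<in> dN \<alpha>" "\<lbrakk>m \<in> dN \<alpha>; n \<in> dN \<alpha>\<rbrakk> \<Longrightarrow> m \<oplus>\<^bsub>N\<^esub> n \<in> dN \<alpha>" "m \<in> dN \<alpha> \<Longrightarrow> \<ominus>\<^bsub>N\<^esub> m \<in> dN \<alpha>"
  using subgroup.one_closed[OF graded_deg_subgroup[OF N.P_graded assms]]
    subgroup.m_closed[OF graded_deg_subgroup[OF N.P_graded assms]]
    subgroup.m_inv_closed[OF graded_deg_subgroup[OF N.P_graded assms]]
  by (simp_all add: a_inv_def)

lemma N_zero_ract: "r \<in> carrier R \<Longrightarrow> \<zero>\<^bsub>N\<^esub> \<triangleleft>\<^bsub>N\<^esub> r = \<zero>\<^bsub>N\<^esub>"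
  by (rule additive_zero[OF N.abelian_group_axioms N.abelian_group_axioms
        biadditive_left[OF N.ract_biadditive]])

lemma HOM_deg_zero: "\<sigma> \<in> carrier G \<Longrightarrow> zero H \<in> Hd \<sigma>"
  by (rule HOM_degI) (auto simp: HOM_zero additive_def P.ract_closed N_zero_ract N_deg
      graded_deg_closed[OF P.P_graded])

lemma HOM_deg_add:
  assumes "\<sigma> \<in> carrier G" "f \<in> Hd \<sigma>" "g \<in> Hd \<sigma>" shows "f \<oplus>\<^bsub>H\<^esub> g \<in> Hd \<sigma>"
proof (rule HOM_degI)
  note fg = HOM_degD[OF assms(2)] HOM_degD[OF assms(3)]
  show "additive P N (f \<oplus>\<^bsub>H\<^esub> g)"
    using additive_add_maps[OF N.abelian_group_axioms fg(2,7)]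
    by (auto simp: HOM_add additive_def)
qed (use assms(1) HOM_degD[OF assms(2)] HOM_degD[OF assms(3)] in
    \<open>auto simp: HOM_add N.ract_distr_mod P.ract_closed N_deg graded_deg_closed[OF P.P_graded]\<close>)

lemma HOM_deg_neg:
  assumes "\<sigma> \<in> carrier G" "f \<in> Hd \<sigma>" shows "(\<lambda>m\<in>carrier P. \<ominus>\<^bsub>N\<^esub> f m) \<in> Hd \<sigma>"
proof (rule HOM_degI)
  note f = HOM_degD[OF assms(2)]
  show "additive P N (\<lambda>m\<in>carrier P. \<ominus>\<^bsub>N\<^esub> f m)"
    by (rule additiveI) (auto simp: f additive_add[OF f(2)] N.minus_add N.a_comm)
  show "(\<lambda>m\<in>carrier P. \<ominus>\<^bsub>N\<^esub> f m) (m \<triangleleft>\<^bsub>P\<^esub> r) = (\<lambda>m\<in>carrier P. \<ominus>\<^bsub>N\<^esub> f m) m \<triangleleft>\<^bsub>N\<^esub> r"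
    if "m \<in> carrier P" "r \<in> carrier R" for m r
    using that additive_neg[OF N.abelian_group_axioms N.abelian_group_axioms
        biadditive_left[OF N.ract_biadditive that(2)] f(3)[OF that(1)]]
    by (simp add: f P.ract_closed)
qed (use assms(1) HOM_degD[OF assms(2)] in
    \<open>auto simp: N_deg graded_deg_closed[OF P.P_graded]\<close>)

lemma HOM_deg_HOM: "\<lbrakk>\<sigma> \<in> carrier G; f \<in> Hd \<sigma>\<rbrakk> \<Longrightarrow> f \<in> carrier H"
proof -
  assume a: "\<sigma> \<in> carrier G" "f \<in> Hd \<sigma>"
  have "f = (\<lambda>m\<in>carrier P. \<Oplus>\<^bsub>N\<^esub>\<sigma>\<in>{\<sigma>}. f m)"
    using HOM_degD[OF a(2)] by (auto simp: fun_eq_iff N.finsum_insert extensional_def)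
  then show ?thesis
    unfolding HOM_def using a by (auto intro!: exI[of _ "{\<sigma>}"] exI[of _ "\<lambda>_. f"])
qed

lemma HOM_elim:
  assumes "f \<in> carrier H"
  obtains F \<phi> where "finite F" "F \<subseteq> carrier G" "\<And>\<sigma>. \<sigma> \<in> F \<Longrightarrow> \<phi> \<sigma> \<in> Hd \<sigma>"
    "f = (\<lambda>m\<in>carrier P. \<Oplus>\<^bsub>N\<^esub>\<sigma>\<in>F. \<phi> \<sigma> m)"
  using assms unfolding HOM_def by auto

lemma HOM_intro:
  assumes "finite F" "F \<subseteq> carrier G" "\<And>\<sigma>. \<sigma> \<in> F \<Longrightarrow> \<phi> \<sigma> \<in> Hd \<sigma>"
  shows "(\<lambda>m\<in>carrier P. \<Oplus>\<^bsub>N\<^esub>\<sigma>\<in>F. \<phi> \<sigma> m) \<in> carrier H"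
  using assms unfolding HOM_def by auto

lemma HOM_linear:
  assumes "f \<in> carrier H"
  shows "f \<in> extensional (carrier P)" "additive P N f"
    "\<lbrakk>m \<in> carrier P; r \<in> carrier R\<rbrakk> \<Longrightarrow> f (m \<triangleleft>\<^bsub>P\<^esub> r) = f m \<triangleleft>\<^bsub>N\<^esub> r"
proof -
  obtain F \<phi> where F: "finite F" "F \<subseteq> carrier G" "\<And>\<sigma>. \<sigma> \<in> F \<Longrightarrow> \<phi> \<sigma> \<in> Hd \<sigma>"
    "f = (\<lambda>m\<in>carrier P. \<Oplus>\<^bsub>N\<^esub>\<sigma>\<in>F. \<phi> \<sigma> m)" by (rule HOM_elim[OF assms]) (rule that)
  have c: "(\<lambda>\<sigma>. \<phi> \<sigma> m) \<in> F \<rightarrow> carrier N" if "m \<in> carrier P" for m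
    using HOM_degD(3)[OF F(3) that] by auto
  show "f \<in> extensional (carrier P)" using F(4) by auto
  show "additive P N f"
  proof (rule additiveI)
    fix m m' assume m: "m \<in> carrier P" "m' \<in> carrier P"
    have "(\<Oplus>\<^bsub>N\<^esub>\<sigma>\<in>F. \<phi> \<sigma> (m \<oplus>\<^bsub>P\<^esub> m')) = (\<Oplus>\<^bsub>N\<^esub>\<sigma>\<in>F. \<phi> \<sigma> m \<oplus>\<^bsub>N\<^esub> \<phi> \<sigma> m')"
      by (rule N.finsum_cong') (use c[OF m(1)] c[OF m(2)] in
          \<open>auto simp: Pi_iff additive_add[OF HOM_degD(2)[OF F(3)] m]\<close>)
    then show "f (m \<oplus>\<^bsub>P\<^esub> m') = f m \<oplus>\<^bsub>N\<^esub> f m'"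
      using m N.finsum_addf[OF c[OF m(1)] c[OF m(2)]] by (simp add: F(4))
  qed (simp add: F(4) c N.finsum_closed)
  show "f (m \<triangleleft>\<^bsub>P\<^esub> r) = f m \<triangleleft>\<^bsub>N\<^esub> r" if m: "m \<in> carrier P" "r \<in> carrier R"
  proof -
    have "(\<Oplus>\<^bsub>N\<^esub>\<sigma>\<in>F. \<phi> \<sigma> (m \<triangleleft>\<^bsub>P\<^esub> r)) = (\<Oplus>\<^bsub>N\<^esub>\<sigma>\<in>F. \<phi> \<sigma> m \<triangleleft>\<^bsub>N\<^esub> r)"
      by (rule N.finsum_cong') (use c[OF m(1)] m in
          \<open>auto simp: Pi_iff N.ract_closed HOM_degD(4)[OF F(3) m]\<close>)
    then show ?thesis
      using m additive_finsum[OF N.abelian_group_axioms N.abelian_group_axioms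
          biadditive_left[OF N.ract_biadditive m(2)] c[OF m(1)]] by (simp add: F(4) P.ract_closed)
  qed
qed

lemma HOM_closed: "\<lbrakk>f \<in> carrier H; m \<in> carrier P\<rbrakk> \<Longrightarrow> f m \<in> carrier N"
  by (rule additive_closed[OF HOM_linear(2)])

text \<open>Homogeneous elements generate \<open>P\<close>.\<close>

lemma HOM_ext:
  assumes "f \<in> extensional (carrier P)" "g \<in> extensional (carrier P)" "additive P N f" "additive P N g"
    and "\<And>\<alpha> m. \<lbrakk>\<alpha> \<in> carrier G; m \<in> dP \<alpha>\<rbrakk> \<Longrightarrow> f m = g m"
  shows "f = g"
proof
  fix m
  show "f m = g m"
  proof (cases "m \<in> carrier P")
    case True
    show ?thesis
      by (rule additive_eqI[OF P.abelian_group_axioms N.abelian_group_axioms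
            graded_generated[OF P.P_graded] assms(3,4) _ True]) (use assms(5) in auto)
  qed (use assms in \<open>auto simp: extensional_def\<close>)
qed

lemma HOM_add_closed:
  assumes "f \<in> carrier H" "g \<in> carrier H" shows "f \<oplus>\<^bsub>H\<^esub> g \<in> carrier H"
proof -
  obtain F \<phi> where F: "finite F" "F \<subseteq> carrier G" "\<And>\<sigma>. \<sigma> \<in> F \<Longrightarrow> \<phi> \<sigma> \<in> Hd \<sigma>"
    "f = (\<lambda>m\<in>carrier P. \<Oplus>\<^bsub>N\<^esub>\<sigma>\<in>F. \<phi> \<sigma> m)" by (rule HOM_elim[OF assms(1)]) (rule that)
  obtain E \<psi> where E: "finite E" "E \<subseteq> carrier G" "\<And>\<sigma>. \<sigma> \<in> E \<Longrightarrow> \<psi> \<sigma> \<in> Hd \<sigma>"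
    "g = (\<lambda>m\<in>carrier P. \<Oplus>\<^bsub>N\<^esub>\<sigma>\<in>E. \<psi> \<sigma> m)" by (rule HOM_elim[OF assms(2)]) (rule that)
  \<comment> \<open>Pad both families by zero to the common index set \<open>F \<union> E\<close>.\<close>
  define \<phi>' where "\<phi>' \<sigma> = (if \<sigma> \<in> F then \<phi> \<sigma> else zero H)" for \<sigma>
  define \<psi>' where "\<psi>' \<sigma> = (if \<sigma> \<in> E then \<psi> \<sigma> else zero H)" for \<sigma>
  have U: "finite (F \<union> E)" "F \<union> E \<subseteq> carrier G" using E F by auto
  have d: "\<phi>' \<sigma> \<in> Hd \<sigma>" "\<psi>' \<sigma> \<in> Hd \<sigma>" if "\<sigma> \<in> F \<union> E" for \<sigma>
    using that U F(3) E(3) HOM_deg_zero by (auto simp: \<phi>'_def \<psi>'_def)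
  have "(\<lambda>m\<in>carrier P. \<Oplus>\<^bsub>N\<^esub>\<sigma>\<in>F \<union> E. (\<phi>' \<sigma> \<oplus>\<^bsub>H\<^esub> \<psi>' \<sigma>) m) \<in> carrier H"
    by (rule HOM_intro[OF U]) (use HOM_deg_add[OF _ d] U in auto)
  moreover have "f m \<oplus>\<^bsub>N\<^esub> g m = (\<Oplus>\<^bsub>N\<^esub>\<sigma>\<in>F \<union> E. (\<phi>' \<sigma> \<oplus>\<^bsub>H\<^esub> \<psi>' \<sigma>) m)" if m: "m \<in> carrier P" for m
  proof -
    have c: "(\<lambda>\<sigma>. \<phi>' \<sigma> m) \<in> F \<union> E \<rightarrow> carrier N" "(\<lambda>\<sigma>. \<psi>' \<sigma> m) \<in> F \<union> E \<rightarrow> carrier N"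
      using HOM_degD(3)[OF d(1) m] HOM_degD(3)[OF d(2) m] by blast+
    have "(\<Oplus>\<^bsub>N\<^esub>\<sigma>\<in>F \<union> E. (\<phi>' \<sigma> \<oplus>\<^bsub>H\<^esub> \<psi>' \<sigma>) m) = (\<Oplus>\<^bsub>N\<^esub>\<sigma>\<in>F \<union> E. \<phi>' \<sigma> m) \<oplus>\<^bsub>N\<^esub> (\<Oplus>\<^bsub>N\<^esub>\<sigma>\<in>F \<union> E. \<psi>' \<sigma> m)"
      using m N.finsum_addf[OF c] by (simp add: HOM_add)
    also have "(\<Oplus>\<^bsub>N\<^esub>\<sigma>\<in>F \<union> E. \<phi>' \<sigma> m) = (\<Oplus>\<^bsub>N\<^esub>\<sigma>\<in>F. \<phi> \<sigma> m)"
      by (rule N.add.finprod_mono_neutral_cong_right)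
        (use U c m in \<open>auto simp: \<phi>'_def HOM_zero\<close>)
    also have "(\<Oplus>\<^bsub>N\<^esub>\<sigma>\<in>F \<union> E. \<psi>' \<sigma> m) = (\<Oplus>\<^bsub>N\<^esub>\<sigma>\<in>E. \<psi> \<sigma> m)"
      by (rule N.add.finprod_mono_neutral_cong_right)
        (use U c m in \<open>auto simp: \<psi>'_def HOM_zero\<close>)
    finally show ?thesis using m by (simp add: F(4) E(4))
  qed
  ultimately show ?thesis
    unfolding HOM_add[of f g] by (simp cong: restrict_cong)
qed

lemma HOM_neg_closed:
  assumes "f \<in> carrier H" shows "(\<lambda>m\<in>carrier P. \<ominus>\<^bsub>N\<^esub> f m) \<in> carrier H"
proof -
  obtain F \<phi> where F: "finite F" "F \<subseteq> carrier G" "\<And>\<sigma>. \<sigma> \<in> F \<Longrightarrow> \<phi> \<sigma> \<in> Hd \<sigma>"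
    "f = (\<lambda>m\<in>carrier P. \<Oplus>\<^bsub>N\<^esub>\<sigma>\<in>F. \<phi> \<sigma> m)" by (rule HOM_elim[OF assms]) (rule that)
  have "(\<lambda>m\<in>carrier P. \<Oplus>\<^bsub>N\<^esub>\<sigma>\<in>F. (\<lambda>m\<in>carrier P. \<ominus>\<^bsub>N\<^esub> \<phi> \<sigma> m) m) \<in> carrier H"
    by (rule HOM_intro[OF F(1,2)]) (rule HOM_deg_neg[OF subsetD[OF F(2)] F(3)])
  moreover have "\<ominus>\<^bsub>N\<^esub> f m = (\<Oplus>\<^bsub>N\<^esub>\<sigma>\<in>F. \<ominus>\<^bsub>N\<^esub> \<phi> \<sigma> m)" if m: "m \<in> carrier P" for m
  proof -
    have "additive N N (\<lambda>m. \<ominus>\<^bsub>N\<^esub> m)"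
      by (rule additiveI) (auto simp: N.minus_add N.a_comm)
    then show ?thesis
      using additive_finsum[OF N.abelian_group_axioms N.abelian_group_axioms, of "\<lambda>m. \<ominus>\<^bsub>N\<^esub> m" "\<lambda>\<sigma>. \<phi> \<sigma> m" F]
        HOM_degD(3)[OF F(3) m] m by (auto simp: F(4))
  qed
  ultimately show ?thesis by (simp cong: restrict_cong)
qed

lemma HOM_abelian_group: "abelian_group H"
proof (rule abelian_groupI)
  have "zero H \<in> Hd \<one>" by (rule HOM_deg_zero) simp
  then show "\<zero>\<^bsub>H\<^esub> \<in> carrier H" by (intro HOM_deg_HOM[of \<one>]) simp_all
  show "\<exists>g\<in>carrier H. g \<oplus>\<^bsub>H\<^esub> f = \<zero>\<^bsub>H\<^esub>" if "f \<in> carrier H" for f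
    by (rule bexI[OF _ HOM_neg_closed[OF that]])
      (use that in \<open>auto simp: HOM_add HOM_zero HOM_closed N.l_neg intro!: restrict_ext\<close>)
  show "\<zero>\<^bsub>H\<^esub> \<oplus>\<^bsub>H\<^esub> f = f" if "f \<in> carrier H" for f
    using HOM_linear(1)[OF that] HOM_closed[OF that]
    by (auto simp: HOM_add HOM_zero fun_eq_iff extensional_def)
qed (rule HOM_add_closed, auto simp: HOM_closed N.a_ac HOM_add intro!: restrict_ext)

lemma HOM_eval_additive: "m \<in> carrier P \<Longrightarrow> additive H N (\<lambda>f. f m)"
  by (rule additiveI) (auto simp: HOM_closed HOM_add)

lemma HOM_finsum:
  assumes "\<phi> \<in> F \<rightarrow> carrier H" "m \<in> carrier P"
  shows "(\<Oplus>\<^bsub>H\<^esub>\<sigma>\<in>F. \<phi> \<sigma>) m = (\<Oplus>\<^bsub>N\<^esub>\<sigma>\<in>F. \<phi> \<sigma> m)"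
  by (rule additive_finsum[OF HOM_abelian_group N.abelian_group_axioms HOM_eval_additive[OF assms(2)] assms(1)])

text \<open>The components of a sum \<open>\<Sum>\<^sub>\<sigma> \<phi>\<^sub>\<sigma>\<close> are determined by it: on an element of degree \<open>\<alpha>\<close> the
  values \<open>\<phi>\<^sub>\<sigma> m\<close> lie in the distinct degrees \<open>\<sigma>\<alpha>\<close>, and homogeneous elements generate \<open>P\<close>.\<close>

lemma HOM_graded: "graded_group G H Hd"
proof (rule graded_groupI[OF HOM_abelian_group])
  interpret H: abelian_group H by (rule HOM_abelian_group)
  show "subgroup (Hd \<sigma>) (add_monoid H)" if "\<sigma> \<in> carrier G" for \<sigma>
  proof (rule group.subgroupI[OF H.a_group])
    show "Hd \<sigma> \<subseteq> carrier (add_monoid H)" using HOM_deg_HOM[OF that] by auto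
    show "Hd \<sigma> \<noteq> {}" using HOM_deg_zero[OF that] by auto
    fix f assume f: "f \<in> Hd \<sigma>"
    have "\<ominus>\<^bsub>H\<^esub> f = (\<lambda>m\<in>carrier P. \<ominus>\<^bsub>N\<^esub> f m)"
    proof (rule H.minus_equality)
      show "(\<lambda>m\<in>carrier P. \<ominus>\<^bsub>N\<^esub> f m) \<oplus>\<^bsub>H\<^esub> f = \<zero>\<^bsub>H\<^esub>"
        using HOM_degD(3)[OF f] by (auto simp: HOM_add HOM_zero N.l_neg intro!: restrict_ext)
    qed (use HOM_deg_HOM[OF that f] HOM_neg_closed in auto)
    then show "inv\<^bsub>add_monoid H\<^esub> f \<in> Hd \<sigma>"
      using HOM_deg_neg[OF that f] by (simp add: a_inv_def)
  qed (use HOM_deg_add[OF that] in auto)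
  show "generated_by H (\<Union>\<sigma>\<in>carrier G. Hd \<sigma>)"
  proof (rule generated_byI[OF HOM_abelian_group])
    show "(\<Union>\<sigma>\<in>carrier G. Hd \<sigma>) \<subseteq> carrier H" using HOM_deg_HOM by blast
    fix f assume f: "f \<in> carrier H"
    obtain F \<phi> where F: "finite F" "F \<subseteq> carrier G" "\<And>\<sigma>. \<sigma> \<in> F \<Longrightarrow> \<phi> \<sigma> \<in> Hd \<sigma>"
      "f = (\<lambda>m\<in>carrier P. \<Oplus>\<^bsub>N\<^esub>\<sigma>\<in>F. \<phi> \<sigma> m)" by (rule HOM_elim[OF f]) (rule that)
    have c: "\<phi> \<in> F \<rightarrow> carrier H" using F(2,3) HOM_deg_HOM by blast
    have "f m = (\<Oplus>\<^bsub>H\<^esub>\<sigma>\<in>F. \<phi> \<sigma>) m" for m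
    proof (cases "m \<in> carrier P")
      case True
      then show ?thesis using HOM_finsum[OF c] by (simp add: F(4))
    next
      case False
      then show ?thesis
        using HOM_linear(1)[OF H.finsum_closed[OF c]] by (simp add: F(4) extensional_def)
    qed
    then have "f = (\<Oplus>\<^bsub>H\<^esub>\<sigma>\<in>F. \<phi> \<sigma>)" ..
    then show "\<exists>(F :: 'g set) \<phi>. finite F \<and> \<phi> \<in> F \<rightarrow> (\<Union>\<sigma>\<in>carrier G. Hd \<sigma>) \<and> f = (\<Oplus>\<^bsub>H\<^esub>i\<in>F. \<phi> i)"
      using F by (intro exI[of _ F] exI[of _ \<phi>]) auto
  qed
  fix F \<phi> \<sigma> assume F: "finite F" "F \<subseteq> carrier G" "\<forall>\<sigma>\<in>F. \<phi> \<sigma> \<in> Hd \<sigma>"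
    "(\<Oplus>\<^bsub>H\<^esub>\<sigma>\<in>F. \<phi> \<sigma>) = \<zero>\<^bsub>H\<^esub>" "\<sigma> \<in> F"
  have \<sigma>: "\<sigma> \<in> carrier G" "\<phi> \<sigma> \<in> Hd \<sigma>" using F by auto
  have c: "\<phi> \<in> F \<rightarrow> carrier H" using F(2,3) HOM_deg_HOM by blast
  show "\<phi> \<sigma> = \<zero>\<^bsub>H\<^esub>"
  proof (rule HOM_ext)
    fix \<alpha> m assume m: "\<alpha> \<in> carrier G" "m \<in> dP \<alpha>"
    have mc: "m \<in> carrier P" by (rule graded_deg_closed[OF P.P_graded m])
    have inj: "inj_on (\<lambda>\<sigma>. \<sigma> \<otimes> \<alpha>) F" by (rule inj_onI) (use F(2) m(1) in \<open>auto simp: subset_iff\<close>)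
    \<comment> \<open>Index the summands \<open>\<phi>\<^sub>\<sigma> m\<close> by their degrees \<open>\<beta> = \<sigma>\<alpha>\<close> in \<open>N\<close>.\<close>
    define g where "g \<beta> = \<phi> (\<beta> \<otimes> inv \<alpha>) m" for \<beta>
    have g: "g (\<tau> \<otimes> \<alpha>) = \<phi> \<tau> m" if "\<tau> \<in> F" for \<tau>
      using that F(2) m(1) by (auto simp: g_def P.m_assoc)
    have cg: "g \<in> (\<lambda>\<sigma>. \<sigma> \<otimes> \<alpha>) ` F \<rightarrow> carrier N"
      using g HOM_closed c mc by (auto simp: Pi_iff)
    have "(\<Oplus>\<^bsub>N\<^esub>\<beta>\<in>(\<lambda>\<sigma>. \<sigma> \<otimes> \<alpha>) ` F. g \<beta>) = (\<Oplus>\<^bsub>N\<^esub>\<tau>\<in>F. g (\<tau> \<otimes> \<alpha>))"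
      by (rule N.finsum_reindex[OF cg inj])
    also have "\<dots> = (\<Oplus>\<^bsub>N\<^esub>\<tau>\<in>F. \<phi> \<tau> m)"
      by (rule N.finsum_cong') (use g HOM_closed c mc in \<open>auto simp: Pi_iff\<close>)
    also have "\<dots> = \<zero>\<^bsub>N\<^esub>" using HOM_finsum[OF c mc] F(4) mc by (simp add: HOM_zero)
    finally have 0: "(\<Oplus>\<^bsub>N\<^esub>\<beta>\<in>(\<lambda>\<sigma>. \<sigma> \<otimes> \<alpha>) ` F. g \<beta>) = \<zero>\<^bsub>N\<^esub>" .
    have gd: "g \<beta> \<in> dN \<beta>" if "\<beta> \<in> (\<lambda>\<sigma>. \<sigma> \<otimes> \<alpha>) ` F" for \<beta>
      using that g F(3) HOM_degD(5)[OF _ m] by auto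
    have "g (\<sigma> \<otimes> \<alpha>) = \<zero>\<^bsub>N\<^esub>"
      by (rule graded_independent[OF N.P_graded _ _ gd 0]) (use F(1,2,5) m(1) in auto)
    then show "\<phi> \<sigma> m = \<zero>\<^bsub>H\<^esub> m" using g[OF F(5)] mc by (simp add: HOM_zero)
  qed (use HOM_degD[OF \<sigma>(2)] HOM_degD[OF HOM_deg_zero[OF \<sigma>(1)]] in auto)
qed

lemmas HOM_generated = graded_generated[OF HOM_graded]

end

section \<open>Graded Morita contexts from pairings\<close>

text \<open>The data of a connecting map \<open>M \<otimes>\<^sub>R N \<rightarrow> S\<close>, before passing to the tensor product.\<close>

definition morita_pairing ::
  "('s, 'x) ring_scheme \<Rightarrow> ('r, 'y) ring_scheme \<Rightarrow> ('s, 'r, 'm, 'u) bimodule_scheme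
    \<Rightarrow> ('r, 's, 'n, 'v) bimodule_scheme \<Rightarrow> ('m \<Rightarrow> 'n \<Rightarrow> 's) \<Rightarrow> bool" where
  "morita_pairing S R M N h \<longleftrightarrow> balanced R M N S h \<and>
     (\<forall>s\<in>carrier S. \<forall>m\<in>carrier M. \<forall>n\<in>carrier N.
        h (s \<triangleright>\<^bsub>M\<^esub> m) n = s \<otimes>\<^bsub>S\<^esub> h m n \<and> h m (n \<triangleleft>\<^bsub>N\<^esub> s) = h m n \<otimes>\<^bsub>S\<^esub> s)"

lemma morita_pairing_lift:
  assumes M: "bimodule S R M" and N: "bimodule R S N" and h: "morita_pairing S R M N h"
  shows "tensor_lift S h \<in> bimod_hom S S (tensor R M N) (regular S)"
    and "additive (tensor R M N) S (tensor_lift S h)"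
    and "\<lbrakk>m \<in> carrier M; n \<in> carrier N\<rbrakk> \<Longrightarrow> tensor_lift S h (pure_tensor R M N m n) = h m n"
proof -
  interpret MN: tensor_factors S R S M N
    using M N by (simp add: tensor_factors_def)
  note S = MN.M.L.abelian_group_axioms
  have b: "balanced R M N S h" using h by (simp add: morita_pairing_def)
  note add = MN.tensor_lift_additive[OF S b] and pure = MN.tensor_lift_pure[OF S b]
  have mult: "additive S S (\<lambda>t. s \<otimes>\<^bsub>S\<^esub> t)" "additive S S (\<lambda>t. t \<otimes>\<^bsub>S\<^esub> s)" if "s \<in> carrier S" for s
    using that by (auto simp: additive_def MN.M.L.r_distr MN.M.L.l_distr)
  show "additive (tensor R M N) S (tensor_lift S h)" by (rule add)
  show "\<lbrakk>m \<in> carrier M; n \<in> carrier N\<rbrakk> \<Longrightarrow> tensor_lift S h (pure_tensor R M N m n) = h m n"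
    by (rule pure)
  have l: "tensor_lift S h (s \<triangleright>\<^bsub>tensor R M N\<^esub> t) = s \<otimes>\<^bsub>S\<^esub> tensor_lift S h t"
    if "s \<in> carrier S" "t \<in> carrier (tensor R M N)" for s t
    using that(1) h by (intro MN.tensor_eqI[OF S additive_comp[OF MN.tensor_lact(1) add]
          additive_comp[OF add mult(1)] _ that(2)])
      (auto simp: MN.tensor_lact(2) pure MN.M.lsmult_closed morita_pairing_def)
  have r: "tensor_lift S h (t \<triangleleft>\<^bsub>tensor R M N\<^esub> s) = tensor_lift S h t \<otimes>\<^bsub>S\<^esub> s"
    if "s \<in> carrier S" "t \<in> carrier (tensor R M N)" for s t
    using that(1) h by (intro MN.tensor_eqI[OF S additive_comp[OF MN.tensor_ract(1) add]
          additive_comp[OF add mult(2)] _ that(2)])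
      (auto simp: MN.tensor_ract(2) pure MN.N.rsmult_closed morita_pairing_def)
  show "tensor_lift S h \<in> bimod_hom S S (tensor R M N) (regular S)"
    using additive_closed[OF add] additive_add[OF add] l r by (auto simp: bimod_hom_def)
qed

text \<open>The homogeneous component of the tensor product is a generated subgroup, and its target degree is
  a subgroup, so that the generators decide.\<close>

lemma morita_pairing_degree:
  assumes M: "bimodule S R M" and N: "bimodule R S N" and h: "morita_pairing S R M N h"
    and dS: "graded_group G S dS" and \<sigma>: "\<sigma> \<in> carrier G"
    and deg: "\<And>\<alpha> \<beta> m n. \<lbrakk>\<alpha> \<in> carrier G; \<beta> \<in> carrier G; m \<in> dM \<alpha>; n \<in> dN \<beta>\<rbrakk> \<Longrightarrow>
      m \<in> carrier M \<and> n \<in> carrier N \<and> h m n \<in> dS (\<alpha> \<otimes>\<^bsub>G\<^esub> \<beta>)"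
  shows "tensor_lift S h ` tensor_deg G R M dM N dN \<sigma> \<subseteq> dS \<sigma>"
proof
  interpret MN: tensor_factors S R S M N
    using M N by (simp add: tensor_factors_def)
  let ?T = "tensor R M N" and ?f = "tensor_lift S h"
  interpret T: abelian_group ?T by (rule MN.T_abelian_group)
  note lift = morita_pairing_lift[OF M N h]
  let ?B = "{pure_tensor R M N m n | m n \<alpha> \<beta>. \<alpha> \<in> carrier G \<and> \<beta> \<in> carrier G \<and> \<alpha> \<otimes>\<^bsub>G\<^esub> \<beta> = \<sigma> \<and>
        m \<in> dM \<alpha> \<and> n \<in> dN \<beta>}"
  note sub = graded_deg_subgroup[OF dS \<sigma>]
  have B: "b \<in> carrier ?T \<and> ?f b \<in> dS \<sigma>" if "b \<in> ?B" for b
    using that deg MN.pure_closed lift(3) by fastforce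
  fix s assume "s \<in> ?f ` tensor_deg G R M dM N dN \<sigma>"
  then obtain t where t: "t \<in> generate (add_monoid ?T) ?B" "s = ?f t"
    unfolding tensor_deg_def by blast
  have "t \<in> carrier ?T \<and> ?f t \<in> dS \<sigma>"
    using t(1)
  proof (induction rule: generate.induct)
    case one
    then show ?case
      using additive_zero[OF T.abelian_group_axioms MN.M.L.abelian_group_axioms lift(2)]
        graded_deg_zero[OF dS \<sigma>] by simp
  next
    case (incl b)
    then show ?case by (rule B)
  next
    case (inv b)
    then have "?f (\<ominus>\<^bsub>?T\<^esub> b) = \<ominus>\<^bsub>S\<^esub> ?f b"
      using additive_neg[OF T.abelian_group_axioms MN.M.L.abelian_group_axioms lift(2)] B by blast
    then show ?case
      using subgroup.m_inv_closed[OF sub] B[OF inv] T.a_inv_closed by (simp add: a_inv_def)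
  next
    case (eng a b)
    then show ?case using additive_add[OF lift(2)] subgroup.m_closed[OF sub] by simp
  qed
  then show "s \<in> dS \<sigma>" using t(2) by simp
qed

text \<open>A graded Morita context whose connecting maps come from two pairings. Its axioms do not mention
  tensor products, which makes them easy to verify for maps and to transport along bijections.\<close>

locale paired_morita_context = group G
  for G :: "('g, 'w) monoid_scheme" (structure) and K :: "('g, 's, 'r, 'p, 'q) morita"
    and hp :: "'p \<Rightarrow> 'q \<Rightarrow> 's" and hq :: "'q \<Rightarrow> 'p \<Rightarrow> 'r" +
  assumes S: "graded_ring G (mcS K) (mcdS K)" and R: "graded_ring G (mcR K) (mcdR K)"
    and P: "graded_bimodule G (mcS K) (mcdS K) (mcR K) (mcdR K) (mcP K) (mcdP K)"
    and Q: "graded_bimodule G (mcR K) (mcdR K) (mcS K) (mcdS K) (mcQ K) (mcdQ K)"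
    and phi: "mcphi K = tensor_lift (mcS K) hp" and psi: "mcpsi K = tensor_lift (mcR K) hq"
    and hp: "morita_pairing (mcS K) (mcR K) (mcP K) (mcQ K) hp"
    and hq: "morita_pairing (mcR K) (mcS K) (mcQ K) (mcP K) hq"
    and hp_deg: "\<lbrakk>\<alpha> \<in> carrier G; \<beta> \<in> carrier G; p \<in> mcdP K \<alpha>; q \<in> mcdQ K \<beta>\<rbrakk> \<Longrightarrow>
      hp p q \<in> mcdS K (\<alpha> \<otimes> \<beta>)"
    and hq_deg: "\<lbrakk>\<alpha> \<in> carrier G; \<beta> \<in> carrier G; q \<in> mcdQ K \<alpha>; p \<in> mcdP K \<beta>\<rbrakk> \<Longrightarrow>
      hq q p \<in> mcdR K (\<alpha> \<otimes> \<beta>)"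
    and hp_assoc: "\<lbrakk>p \<in> carrier (mcP K); q \<in> carrier (mcQ K); p' \<in> carrier (mcP K)\<rbrakk> \<Longrightarrow>
      hp p q \<triangleright>\<^bsub>mcP K\<^esub> p' = p \<triangleleft>\<^bsub>mcP K\<^esub> hq q p'"
    and hq_assoc: "\<lbrakk>q \<in> carrier (mcQ K); p \<in> carrier (mcP K); q' \<in> carrier (mcQ K)\<rbrakk> \<Longrightarrow>
      hq q p \<triangleright>\<^bsub>mcQ K\<^esub> q' = q \<triangleleft>\<^bsub>mcQ K\<^esub> hp p q'"
begin

lemma P_bimodule: "bimodule (mcS K) (mcR K) (mcP K)" and Q_bimodule: "bimodule (mcR K) (mcS K) (mcQ K)"
  and P_group: "graded_group G (mcP K) (mcdP K)" and Q_group: "graded_group G (mcQ K) (mcdQ K)"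
  and S_group: "graded_group G (mcS K) (mcdS K)" and R_group: "graded_group G (mcR K) (mcdR K)"
  using P Q S R by (auto simp: graded_bimodule_def graded_ring_def)

lemmas phi_lift = morita_pairing_lift[OF P_bimodule Q_bimodule hp, folded phi]
lemmas psi_lift = morita_pairing_lift[OF Q_bimodule P_bimodule hq, folded psi]

lemma graded_morita: "graded_morita G K"
proof -
  have "mcphi K ` tensor_deg G (mcR K) (mcP K) (mcdP K) (mcQ K) (mcdQ K) \<sigma> \<subseteq> mcdS K \<sigma>"
    if "\<sigma> \<in> carrier G" for \<sigma>
    unfolding phi by (rule morita_pairing_degree[OF P_bimodule Q_bimodule hp S_group that])
      (use hp_deg graded_deg_closed[OF P_group] graded_deg_closed[OF Q_group] in blast)
  moreover have "mcpsi K ` tensor_deg G (mcS K) (mcQ K) (mcdQ K) (mcP K) (mcdP K) \<sigma> \<subseteq> mcdR K \<sigma>"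
    if "\<sigma> \<in> carrier G" for \<sigma>
    unfolding psi by (rule morita_pairing_degree[OF Q_bimodule P_bimodule hq R_group that])
      (use hq_deg graded_deg_closed[OF P_group] graded_deg_closed[OF Q_group] in blast)
  ultimately show ?thesis
    using S R P Q phi_lift(1) psi_lift(1)
    by (simp add: graded_morita_def phi_lift(3) psi_lift(3) hp_assoc hq_assoc)
qed

end


section \<open>The context associated to a graded module\<close>

context graded_hom
begin

interpretation E: graded_hom G R P P dR dP dP ..

lemma HOM_compose_deg:
  assumes "q \<in> Hd \<sigma>" "s \<in> E.Hd \<tau>" "\<sigma> \<in> carrier G" "\<tau> \<in> carrier G"
  shows "compose (carrier P) q s \<in> Hd (\<sigma> \<otimes> \<tau>)"
proof (rule HOM_degI)
  show "additive P N (compose (carrier P) q s)"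
    using additive_comp[OF E.HOM_degD(2)[OF assms(2)] HOM_degD(2)[OF assms(1)]]
    by (auto simp: additive_def compose_def)
qed (use HOM_degD[OF assms(1)] E.HOM_degD[OF assms(2)] assms(3,4) graded_deg_closed[OF P.P_graded] in
    \<open>auto simp: compose_def P.ract_closed P.m_assoc\<close>)

lemma HOM_compose_biadditive: "biadditive H E.H H (compose (carrier P))"
proof (rule biadditive_generatedI[OF HOM_abelian_group HOM_generated E.HOM_generated])
  show "compose (carrier P) q s \<in> carrier H" if "q \<in> (\<Union>\<sigma>\<in>carrier G. Hd \<sigma>)" "s \<in> (\<Union>\<sigma>\<in>carrier G. E.Hd \<sigma>)" for q s
    using that HOM_deg_HOM[OF _ HOM_compose_deg] by auto
  show "compose (carrier P) q \<zero>\<^bsub>E.H\<^esub> = \<zero>\<^bsub>H\<^esub>" if "q \<in> carrier H" for q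
    using additive_zero[OF P.abelian_group_axioms N.abelian_group_axioms HOM_linear(2)[OF that]]
    by (auto simp: compose_def HOM_zero E.HOM_zero)
  show "compose (carrier P) q (s \<oplus>\<^bsub>E.H\<^esub> s') = compose (carrier P) q s \<oplus>\<^bsub>H\<^esub> compose (carrier P) q s'"
    if "q \<in> carrier H" "s \<in> carrier E.H" "s' \<in> carrier E.H" for q s s'
    using E.HOM_closed[OF that(2)] E.HOM_closed[OF that(3)]
    by (auto simp: compose_def HOM_add E.HOM_add additive_add[OF HOM_linear(2)[OF that(1)]] intro!: restrict_ext)
qed (auto simp: compose_def HOM_add HOM_zero E.HOM_closed intro!: restrict_ext)

lemma HOM_compose_assoc:
  assumes "s \<in> carrier E.H" "s' \<in> carrier E.H"
  shows "compose (carrier P) q (compose (carrier P) s s') = compose (carrier P) (compose (carrier P) q s) s'"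
  using E.HOM_closed[OF assms(2)] by (auto simp: compose_def intro!: restrict_ext)

end

locale graded_module = graded_right_module G R P dR dP
  for G :: "('g, 'w) monoid_scheme" (structure) and R :: "'r ring" and P :: "('r, 'm) rmodule" and dR dP
begin

abbreviation "K \<equiv> module_morita G R dR P dP"

lemma R_facts: "graded_group G R dR" "\<one>\<^bsub>R\<^esub> \<in> dR \<one>"
  "\<lbrakk>\<alpha> \<in> carrier G; \<beta> \<in> carrier G; r \<in> dR \<alpha>; r' \<in> dR \<beta>\<rbrakk> \<Longrightarrow> r \<otimes>\<^bsub>R\<^esub> r' \<in> dR (\<alpha> \<otimes> \<beta>)"
  using R_graded by (auto simp: graded_ring_def)

lemma regular_graded_module: "graded_right_module G R (regular R) dR dR"
proof -
  have "abelian_group (regular R)"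
    by (rule same_add_abelian_group[OF same_add_sym[OF same_add_regular] R.abelian_group_axioms])
  moreover have "graded_group G (regular R) dR"
    by (rule graded_group_same_add[OF same_add_sym[OF same_add_regular] R_facts(1)])
  ultimately show ?thesis
    by (intro graded_right_module.intro right_module.intro right_module_axioms.intro
        graded_right_module_axioms.intro is_group R.ring_axioms)
      (auto simp: R.r_distr R.l_distr R.m_assoc R_graded R_facts)
qed

interpretation E: graded_hom G R P P dR dP dP ..
interpretation D: graded_hom G R P "regular R" dR dP dR
  by (intro graded_hom.intro graded_right_module_axioms regular_graded_module)

abbreviation "S \<equiv> END G R P dP"

lemma S_simps: "carrier S = carrier E.H" "zero S = zero E.H" "add S = add E.H"
  "mult S = compose (carrier P)" "one S = (\<lambda>m\<in>carrier P. m)"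
  by (simp_all add: END_def HOM_def)

lemma S_same_add: "same_add E.H S"
  by (simp add: same_add_def S_simps)

lemma S_one: "one S \<in> E.Hd \<one>"
  by (rule E.HOM_degI)
    (auto simp: S_simps additive_def ract_closed graded_deg_closed[OF P_graded])

lemma S_ring: "ring S"
proof (rule ringI)
  note b = E.HOM_compose_biadditive
  show "abelian_group S" by (rule same_add_abelian_group[OF S_same_add E.HOM_abelian_group])
  show "monoid S"
  proof
    show "\<one>\<^bsub>S\<^esub> \<in> carrier S" using E.HOM_deg_HOM[OF one_closed S_one] by (simp add: S_simps(1))
    show "f \<otimes>\<^bsub>S\<^esub> \<one>\<^bsub>S\<^esub> = f" "\<one>\<^bsub>S\<^esub> \<otimes>\<^bsub>S\<^esub> f = f" if "f \<in> carrier S" for f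
      using that E.HOM_linear(1)[of f] E.HOM_closed[of f]
      by (auto simp: S_simps compose_def fun_eq_iff extensional_def)
    show "f \<otimes>\<^bsub>S\<^esub> g \<in> carrier S" "f \<otimes>\<^bsub>S\<^esub> g \<otimes>\<^bsub>S\<^esub> h = f \<otimes>\<^bsub>S\<^esub> (g \<otimes>\<^bsub>S\<^esub> h)"
      if "f \<in> carrier S" "g \<in> carrier S" "h \<in> carrier S" for f g h
      using that biadditive_closed[OF b] by (auto simp: S_simps E.HOM_compose_assoc)
  qed
  show "(f \<oplus>\<^bsub>S\<^esub> g) \<otimes>\<^bsub>S\<^esub> h = f \<otimes>\<^bsub>S\<^esub> h \<oplus>\<^bsub>S\<^esub> g \<otimes>\<^bsub>S\<^esub> h" "h \<otimes>\<^bsub>S\<^esub> (f \<oplus>\<^bsub>S\<^esub> g) = h \<otimes>\<^bsub>S\<^esub> f \<oplus>\<^bsub>S\<^esub> h \<otimes>\<^bsub>S\<^esub> g"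
    if "f \<in> carrier S" "g \<in> carrier S" "h \<in> carrier S" for f g h
    using that biadditive_add_left[OF b] biadditive_add_right[OF b] by (auto simp: S_simps)
qed

lemma S_graded: "graded_ring G S E.Hd"
  using S_ring graded_group_same_add[OF S_same_add E.HOM_graded] S_one E.HOM_compose_deg
  by (auto simp: graded_ring_def S_simps)

abbreviation "PS \<equiv> with_lact P (\<lambda>s p. s p)"

lemma P_bimodule: "graded_bimodule G S E.Hd R dR PS dP"
proof -
  interpret S: ring S by (rule S_ring)
  have "bimodule S R PS"
    by (intro bimodule.intro bimodule_axioms.intro S_ring R.ring_axioms
        same_add_abelian_group[OF same_add_sym[OF same_add_with_lact] abelian_group_axioms])
      (auto simp: S_simps E.HOM_closed E.HOM_add E.HOM_linear(3) additive_add[OF E.HOM_linear(2)]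
        ract_closed ract_distr_ring ract_distr_mod ract_assoc ract_one compose_def)
  then show ?thesis
    using graded_group_same_add[OF same_add_sym[OF same_add_with_lact] P_graded] ract_deg E.HOM_degD(5)
    by (auto simp: graded_bimodule_def)
qed

definition lmul where "lmul r q = (\<lambda>p\<in>carrier P. r \<otimes>\<^bsub>R\<^esub> q p)" for r q

abbreviation "QR \<equiv> with_lact (with_ract D.H (\<lambda>q s. compose (carrier P) q s)) lmul"

lemma D_closed: "\<lbrakk>q \<in> carrier D.H; p \<in> carrier P\<rbrakk> \<Longrightarrow> q p \<in> carrier R"
  using D.HOM_closed by simp

lemma D_deg: "\<lbrakk>q \<in> D.Hd \<sigma>; p \<in> carrier P\<rbrakk> \<Longrightarrow> q p \<in> carrier R"
  using D.HOM_degD(3) by simp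

lemma lmul_deg:
  assumes "r \<in> dR \<sigma>" "q \<in> D.Hd \<tau>" "\<sigma> \<in> carrier G" "\<tau> \<in> carrier G"
  shows "lmul r q \<in> D.Hd (\<sigma> \<otimes> \<tau>)"
proof (rule D.HOM_degI)
  have r: "r \<in> carrier R" using graded_deg_closed[OF R_facts(1)] assms by blast
  note q = D.HOM_degD[OF assms(2)] D_deg[OF assms(2)]
  show "additive P (regular R) (lmul r q)"
    using r q additive_add[OF q(2)] by (auto simp: lmul_def additive_def R.r_distr)
  show "lmul r q (m \<triangleleft>\<^bsub>P\<^esub> r') = lmul r q m \<triangleleft>\<^bsub>regular R\<^esub> r'" if "m \<in> carrier P" "r' \<in> carrier R" for m r'
    using that r q by (simp add: lmul_def ract_closed R.m_assoc)
  show "lmul r q m \<in> dR (\<sigma> \<otimes> \<tau> \<otimes> \<alpha>)" if "\<alpha> \<in> carrier G" "m \<in> dP \<alpha>" for \<alpha> m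
    using R_facts(3)[OF assms(3) _ assms(1) q(5)[OF that]] that assms(3,4) graded_deg_closed[OF P_graded that]
    by (simp add: lmul_def m_assoc)
qed (simp add: lmul_def)

lemma lmul_biadditive: "biadditive R D.H D.H lmul"
proof (rule biadditive_generatedI[OF D.HOM_abelian_group graded_generated[OF R_facts(1)] D.HOM_generated])
  show "lmul r q \<in> carrier D.H" if "r \<in> (\<Union>\<sigma>\<in>carrier G. dR \<sigma>)" "q \<in> (\<Union>\<sigma>\<in>carrier G. D.Hd \<sigma>)" for r q
    using that D.HOM_deg_HOM[OF _ lmul_deg] by auto
qed (auto simp: lmul_def D.HOM_zero D.HOM_add D_closed R.l_distr R.r_distr intro!: restrict_ext)

lemma Q_bimodule: "graded_bimodule G R dR S E.Hd QR D.Hd"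
proof -
  have same: "same_add D.H QR" by (simp add: same_add_def)
  note b = D.HOM_compose_biadditive and l = lmul_biadditive
  have "bimodule R S QR"
  proof (intro bimodule.intro bimodule_axioms.intro S_ring R.ring_axioms
      same_add_abelian_group[OF same D.HOM_abelian_group])
    fix q assume q: "q \<in> carrier QR"
    show "\<one>\<^bsub>R\<^esub> \<triangleright>\<^bsub>QR\<^esub> q = q" "q \<triangleleft>\<^bsub>QR\<^esub> \<one>\<^bsub>S\<^esub> = q"
      using q D.HOM_linear(1)[of q] D_closed[of q]
      by (auto simp: lmul_def S_simps compose_def fun_eq_iff extensional_def)
    fix r s assume rs: "r \<in> carrier R" "s \<in> carrier S"
    then show "(r \<triangleright>\<^bsub>QR\<^esub> q) \<triangleleft>\<^bsub>QR\<^esub> s = r \<triangleright>\<^bsub>QR\<^esub> (q \<triangleleft>\<^bsub>QR\<^esub> s)"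
      using E.HOM_closed[of s] by (auto simp: S_simps lmul_def compose_def intro!: restrict_ext)
  next
    fix r r' q assume "r \<in> carrier R" "r' \<in> carrier R" "q \<in> carrier QR"
    then show "(r \<otimes>\<^bsub>R\<^esub> r') \<triangleright>\<^bsub>QR\<^esub> q = r \<triangleright>\<^bsub>QR\<^esub> (r' \<triangleright>\<^bsub>QR\<^esub> q)"
      by (auto simp: lmul_def D_closed R.m_assoc intro!: restrict_ext)
  qed (auto simp: S_simps D.HOM_compose_assoc biadditive_closed[OF b] biadditive_closed[OF l]
      biadditive_add_left[OF b] biadditive_add_right[OF b]
      biadditive_add_left[OF l] biadditive_add_right[OF l])
  then show ?thesis
    using graded_group_same_add[OF same D.HOM_graded] lmul_deg D.HOM_compose_deg
    by (auto simp: graded_bimodule_def)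
qed

definition rank_one where "rank_one p q = (\<lambda>p'\<in>carrier P. p \<triangleleft>\<^bsub>P\<^esub> q p')" for p q

lemma rank_one_deg:
  assumes "p \<in> dP \<sigma>" "q \<in> D.Hd \<tau>" "\<sigma> \<in> carrier G" "\<tau> \<in> carrier G"
  shows "rank_one p q \<in> E.Hd (\<sigma> \<otimes> \<tau>)"
proof (rule E.HOM_degI)
  have p: "p \<in> carrier P" using graded_deg_closed[OF P_graded] assms by blast
  note q = D.HOM_degD[OF assms(2)] D_deg[OF assms(2)]
  show "additive P P (rank_one p q)"
    using p q additive_add[OF q(2)] by (auto simp: rank_one_def additive_def ract_closed ract_distr_ring)
  show "rank_one p q (m \<triangleleft>\<^bsub>P\<^esub> r') = rank_one p q m \<triangleleft>\<^bsub>P\<^esub> r'" if "m \<in> carrier P" "r' \<in> carrier R" for m r'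
    using that p q by (simp add: rank_one_def ract_closed ract_assoc)
  show "rank_one p q m \<in> dP (\<sigma> \<otimes> \<tau> \<otimes> \<alpha>)" if "\<alpha> \<in> carrier G" "m \<in> dP \<alpha>" for \<alpha> m
    using ract_deg[OF assms(3) _ assms(1) q(5)[OF that]] that assms(3,4) graded_deg_closed[OF P_graded that]
    by (simp add: rank_one_def m_assoc)
qed (simp add: rank_one_def)

lemma zero_ract: "r \<in> carrier R \<Longrightarrow> \<zero>\<^bsub>P\<^esub> \<triangleleft>\<^bsub>P\<^esub> r = \<zero>\<^bsub>P\<^esub>" and ract_zero: "p \<in> carrier P \<Longrightarrow> p \<triangleleft>\<^bsub>P\<^esub> \<zero>\<^bsub>R\<^esub> = \<zero>\<^bsub>P\<^esub>"
  using additive_zero[OF abelian_group_axioms abelian_group_axioms biadditive_left[OF ract_biadditive]]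
    additive_zero[OF R.abelian_group_axioms abelian_group_axioms biadditive_right[OF ract_biadditive]] by auto

lemma rank_one_biadditive: "biadditive P D.H E.H rank_one"
proof (rule biadditive_generatedI[OF E.HOM_abelian_group graded_generated[OF P_graded] D.HOM_generated])
  show "rank_one p q \<in> carrier E.H" if "p \<in> (\<Union>\<sigma>\<in>carrier G. dP \<sigma>)" "q \<in> (\<Union>\<sigma>\<in>carrier G. D.Hd \<sigma>)" for p q
    using that E.HOM_deg_HOM[OF _ rank_one_deg] by auto
qed (auto simp: rank_one_def D.HOM_zero E.HOM_zero D.HOM_add E.HOM_add D_closed ract_distr_ring ract_distr_mod
    zero_ract ract_zero intro!: restrict_ext)

lemma rank_one_pairing: "morita_pairing S R PS QR rank_one"
  unfolding morita_pairing_def balanced_def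
proof (intro conjI ballI)
  show "biadditive PS QR S rank_one"
    using rank_one_biadditive by (simp add: biadditive_def additive_def S_simps)
  fix p r q assume "p \<in> carrier PS" "r \<in> carrier R" "q \<in> carrier QR"
  then show "rank_one (p \<triangleleft>\<^bsub>PS\<^esub> r) q = rank_one p (r \<triangleright>\<^bsub>QR\<^esub> q)"
    by (auto simp: rank_one_def lmul_def D_closed ract_assoc intro!: restrict_ext)
next
  fix s p q assume "s \<in> carrier S" "p \<in> carrier PS" "q \<in> carrier QR"
  then have spq: "s \<in> carrier E.H" "p \<in> carrier P" "q \<in> carrier D.H" by (simp_all add: S_simps)
  show "rank_one (s \<triangleright>\<^bsub>PS\<^esub> p) q = s \<otimes>\<^bsub>S\<^esub> rank_one p q"
    using spq by (auto simp: rank_one_def S_simps compose_def E.HOM_linear(3) D_closed intro!: restrict_ext)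
  show "rank_one p (q \<triangleleft>\<^bsub>QR\<^esub> s) = rank_one p q \<otimes>\<^bsub>S\<^esub> s"
    using spq by (auto simp: rank_one_def S_simps compose_def E.HOM_closed intro!: restrict_ext)
qed

lemma eval_pairing: "morita_pairing R S QR PS (\<lambda>q p. q p)"
  unfolding morita_pairing_def balanced_def
proof (intro conjI ballI)
  show "biadditive QR PS R (\<lambda>q p. q p)"
    by (rule biadditiveI) (auto simp: D_closed D.HOM_add additive_add[OF D.HOM_linear(2), simplified])
qed (auto simp: lmul_def compose_def D.HOM_linear(3)[simplified])

text \<open>The first associativity law is the definition of the endomorphism \<open>p q(-)\<close>; the second one,
  \<open>q(p) q'(p') = q(p q'(p'))\<close>, is \<open>R\<close>-linearity of \<open>q\<close>.\<close>

theorem module_morita_paired: "paired_morita_context G K rank_one (\<lambda>q p. q p)"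
proof -
  have K: "mcS K = S" "mcdS K = E.Hd" "mcR K = R" "mcdR K = dR" "mcP K = PS" "mcdP K = dP" "mcQ K = QR"
    "mcdQ K = D.Hd" "mcphi K = tensor_lift S rank_one" "mcpsi K = tensor_lift R (\<lambda>q p. q p)"
    by (simp_all add: module_morita_def lmul_def[abs_def] rank_one_def[abs_def])
  have deg: "q p \<in> dR (\<alpha> \<otimes> \<beta>)" if "\<beta> \<in> carrier G" "q \<in> D.Hd \<alpha>" "p \<in> dP \<beta>" for \<alpha> \<beta> q p
    using D.HOM_degD(5)[OF that(2,1,3)] .
  have assoc: "lmul (q p) q' = compose (carrier P) q (rank_one p q')"
    if "q \<in> carrier D.H" "p \<in> carrier P" "q' \<in> carrier D.H" for q p q'
    using that D.HOM_linear(3)[OF that(1,2) D_closed[OF that(3)]]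
    by (auto simp: lmul_def compose_def rank_one_def intro!: restrict_ext)
  show ?thesis
    by (intro paired_morita_context.intro paired_morita_context_axioms.intro is_group; (unfold K)?)
      (use S_graded R_graded P_bimodule Q_bimodule rank_one_pairing eval_pairing rank_one_deg deg assoc in
        \<open>auto simp: rank_one_def\<close>)
qed

end

section \<open>Transport of Morita contexts along bijections\<close>

lemma ring_transport:
  assumes "ring R" "abelian_group S" "f \<in> ring_iso R S" shows "ring S"
proof -
  have "additive R S f" using assms(3) by (auto simp: ring_iso_def ring_hom_def additive_def)
  then have "f \<zero>\<^bsub>R\<^esub> = \<zero>\<^bsub>S\<^esub>"
    using additive_zero[OF ring.is_abelian_group[OF assms(1)] assms(2)] by blast
  then show ?thesis using ring.ring_iso_imp_img_ring[OF assms(1,3)] by simp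
qed

lemma graded_ring_transport:
  assumes R: "graded_ring G R dR" and S: "graded_group G S dS" and f: "f \<in> graded_ring_iso G R dR S dS"
    and G: "group G"
  shows "graded_ring G S dS"
proof -
  have fi: "f \<in> ring_iso R S" and fd: "\<And>\<alpha>. \<alpha> \<in> carrier G \<Longrightarrow> dS \<alpha> = f ` dR \<alpha>"
    using f by (auto simp: graded_ring_iso_def)
  have R': "ring R" "graded_group G R dR" "\<one>\<^bsub>R\<^esub> \<in> dR \<one>\<^bsub>G\<^esub>"
    "\<And>\<alpha> \<beta> r s. \<lbrakk>\<alpha> \<in> carrier G; \<beta> \<in> carrier G; r \<in> dR \<alpha>; s \<in> dR \<beta>\<rbrakk> \<Longrightarrow> r \<otimes>\<^bsub>R\<^esub> s \<in> dR (\<alpha> \<otimes>\<^bsub>G\<^esub> \<beta>)"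
    using R by (auto simp: graded_ring_def)
  interpret G: group G by fact
  have f1: "f \<one>\<^bsub>R\<^esub> = \<one>\<^bsub>S\<^esub>" and fm: "\<And>r s. \<lbrakk>r \<in> carrier R; s \<in> carrier R\<rbrakk> \<Longrightarrow> f (r \<otimes>\<^bsub>R\<^esub> s) = f r \<otimes>\<^bsub>S\<^esub> f s"
    using fi by (auto simp: ring_iso_def ring_hom_def)
  show ?thesis
    unfolding graded_ring_def
  proof (intro conjI ballI S ring_transport[OF R'(1) graded_group_abelian[OF S] fi])
    show "\<one>\<^bsub>S\<^esub> \<in> dS \<one>\<^bsub>G\<^esub>" using imageI[OF R'(3), of f] f1 fd[OF G.one_closed] by simp
    fix \<alpha> \<beta> r s assume a: "\<alpha> \<in> carrier G" "\<beta> \<in> carrier G" "r \<in> dS \<alpha>" "s \<in> dS \<beta>"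
    then obtain r' s' where rs: "r' \<in> dR \<alpha>" "s' \<in> dR \<beta>" "r = f r'" "s = f s'" using fd by auto
    then have "r \<otimes>\<^bsub>S\<^esub> s = f (r' \<otimes>\<^bsub>R\<^esub> s')"
      using fm graded_deg_closed[OF R'(2)] a(1,2) by simp
    then show "r \<otimes>\<^bsub>S\<^esub> s \<in> dS (\<alpha> \<otimes>\<^bsub>G\<^esub> \<beta>)"
      using R'(4)[OF a(1,2) rs(1,2)] fd[of "\<alpha> \<otimes>\<^bsub>G\<^esub> \<beta>"] a by auto
  qed
qed

lemma ring_iso_surj: "f \<in> ring_iso R S \<Longrightarrow> carrier S = f ` carrier R"
  by (auto simp: ring_iso_def bij_betw_def)

text \<open>Written as images of elements of \<open>S\<close>, \<open>R\<close> and \<open>M\<close>, the elements in an axiom for \<open>N\<close> can be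
  combined inside \<open>h\<close>, where the axiom holds in \<open>M\<close>.\<close>

lemma graded_bimodule_transport:
  assumes M: "graded_bimodule G S dS R dR M dM" and N: "graded_group G N dN" and G: "group G"
    and S': "ring S'" and R': "ring R'"
    and f: "f \<in> graded_ring_iso G S dS S' dS'" and g: "g \<in> graded_ring_iso G R dR R' dR'"
    and gS: "graded_group G S dS" and gR: "graded_group G R dR"
    and h: "h \<in> graded_bimod_iso G S R f g M dM N dN"
  shows "graded_bimodule G S' dS' R' dR' N dN"
proof -
  interpret G: group G by fact
  interpret M: bimodule S R M using M by (simp add: graded_bimodule_def)
  have gM: "graded_group G M dM" using M by (simp add: graded_bimodule_def)
  have f': "f \<in> ring_iso S S'" and g': "g \<in> ring_iso R R'" using f g by (auto simp: graded_ring_iso_def)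
  have surj: "carrier S' = f ` carrier S" "carrier R' = g ` carrier R" "carrier N = h ` carrier M"
    using ring_iso_surj[OF f'] ring_iso_surj[OF g'] h by (auto simp: graded_bimod_iso_def bij_betw_def)
  have fh: "f s \<triangleright>\<^bsub>N\<^esub> h m = h (s \<triangleright>\<^bsub>M\<^esub> m)" if "s \<in> carrier S" "m \<in> carrier M" for s m
    using that h by (auto simp: graded_bimod_iso_def)
  have hg: "h m \<triangleleft>\<^bsub>N\<^esub> g r = h (m \<triangleleft>\<^bsub>M\<^esub> r)" if "r \<in> carrier R" "m \<in> carrier M" for r m
    using that h by (auto simp: graded_bimod_iso_def)
  have ha: "h m \<oplus>\<^bsub>N\<^esub> h m' = h (m \<oplus>\<^bsub>M\<^esub> m')" if "m \<in> carrier M" "m' \<in> carrier M" for m m'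
    using that h by (auto simp: graded_bimod_iso_def)
  have fr: "f s \<oplus>\<^bsub>S'\<^esub> f t = f (s \<oplus>\<^bsub>S\<^esub> t)" "f s \<otimes>\<^bsub>S'\<^esub> f t = f (s \<otimes>\<^bsub>S\<^esub> t)" if "s \<in> carrier S" "t \<in> carrier S" for s t
    using that f' by (auto simp: ring_iso_def ring_hom_def)
  have gr: "g s \<oplus>\<^bsub>R'\<^esub> g t = g (s \<oplus>\<^bsub>R\<^esub> t)" "g s \<otimes>\<^bsub>R'\<^esub> g t = g (s \<otimes>\<^bsub>R\<^esub> t)" if "s \<in> carrier R" "t \<in> carrier R" for s t
    using that g' by (auto simp: ring_iso_def ring_hom_def)
  have one: "\<one>\<^bsub>S'\<^esub> = f \<one>\<^bsub>S\<^esub>" "\<one>\<^bsub>R'\<^esub> = g \<one>\<^bsub>R\<^esub>"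
    using f' g' by (auto simp: ring_iso_def ring_hom_def)
  have "bimodule S' R' N"
    by (intro bimodule.intro bimodule_axioms.intro S' R' graded_group_abelian[OF N])
      (auto simp: surj fh hg ha fr gr one M.lsmult_closed M.rsmult_closed M.lsmult_distr_ring M.lsmult_distr_mod
        M.lsmult_assoc M.lsmult_one M.rsmult_distr_ring M.rsmult_distr_mod M.rsmult_assoc M.rsmult_one
        M.smult_middle_assoc)
  moreover have deg: "dS' \<alpha> = f ` dS \<alpha>" "dR' \<alpha> = g ` dR \<alpha>" "dN \<alpha> = h ` dM \<alpha>" if "\<alpha> \<in> carrier G" for \<alpha>
    using that f g h by (auto simp: graded_ring_iso_def graded_bimod_iso_def)
  have "s \<triangleright>\<^bsub>N\<^esub> n \<in> dN (\<alpha> \<otimes>\<^bsub>G\<^esub> \<beta>)"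
    if a: "\<alpha> \<in> carrier G" "\<beta> \<in> carrier G" "s \<in> dS' \<alpha>" "n \<in> dN \<beta>" for \<alpha> \<beta> s n
  proof -
    obtain s' m where *: "s' \<in> dS \<alpha>" "m \<in> dM \<beta>" "s = f s'" "n = h m" using deg a by auto
    then have "s' \<triangleright>\<^bsub>M\<^esub> m \<in> dM (\<alpha> \<otimes>\<^bsub>G\<^esub> \<beta>)" using M a(1,2) by (auto simp: graded_bimodule_def)
    then show ?thesis
      using * fh graded_deg_closed[OF gS a(1) *(1)] graded_deg_closed[OF gM a(2) *(2)] deg(3) a(1,2) by auto
  qed
  moreover have "n \<triangleleft>\<^bsub>N\<^esub> r \<in> dN (\<alpha> \<otimes>\<^bsub>G\<^esub> \<beta>)"
    if a: "\<alpha> \<in> carrier G" "\<beta> \<in> carrier G" "n \<in> dN \<alpha>" "r \<in> dR' \<beta>" for \<alpha> \<beta> n r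
  proof -
    obtain r' m where *: "r' \<in> dR \<beta>" "m \<in> dM \<alpha>" "r = g r'" "n = h m" using deg a by auto
    then have "m \<triangleleft>\<^bsub>M\<^esub> r' \<in> dM (\<alpha> \<otimes>\<^bsub>G\<^esub> \<beta>)" using M a(1,2) by (auto simp: graded_bimodule_def)
    then show ?thesis
      using * hg graded_deg_closed[OF gR a(2) *(1)] graded_deg_closed[OF gM a(1) *(2)] deg(3) a(1,2) by auto
  qed
  ultimately show ?thesis using N by (simp add: graded_bimodule_def)
qed

lemma morita_pairing_transport:
  assumes p: "morita_pairing S R M N p" and MN: "bimodule S R M" "bimodule R S N"
    and f: "f \<in> graded_ring_iso G S dS S' dS'" and g: "g \<in> graded_ring_iso G R dR R' dR'"
    and h: "h \<in> graded_bimod_iso G S R f g M dM M' dM'" and k: "k \<in> graded_bimod_iso G R S g f N dN N' dN'"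
    and p': "\<And>m n. \<lbrakk>m \<in> carrier M; n \<in> carrier N\<rbrakk> \<Longrightarrow> p' (h m) (k n) = f (p m n)"
  shows "morita_pairing S' R' M' N' p'"
proof -
  interpret M: bimodule S R M by fact
  interpret N: bimodule R S N by fact
  have f': "f \<in> ring_iso S S'" and g': "g \<in> ring_iso R R'" using f g by (auto simp: graded_ring_iso_def)
  have surj: "carrier S' = f ` carrier S" "carrier R' = g ` carrier R" "carrier M' = h ` carrier M"
    "carrier N' = k ` carrier N"
    using ring_iso_surj[OF f'] ring_iso_surj[OF g'] h k by (auto simp: graded_bimod_iso_def bij_betw_def)
  have fr: "f s \<oplus>\<^bsub>S'\<^esub> f t = f (s \<oplus>\<^bsub>S\<^esub> t)" "f s \<otimes>\<^bsub>S'\<^esub> f t = f (s \<otimes>\<^bsub>S\<^esub> t)" if "s \<in> carrier S" "t \<in> carrier S" for s t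
    using that f' by (auto simp: ring_iso_def ring_hom_def)
  have h': "f s \<triangleright>\<^bsub>M'\<^esub> h m = h (s \<triangleright>\<^bsub>M\<^esub> m)" "h m \<triangleleft>\<^bsub>M'\<^esub> g r = h (m \<triangleleft>\<^bsub>M\<^esub> r)" "h m \<oplus>\<^bsub>M'\<^esub> h m' = h (m \<oplus>\<^bsub>M\<^esub> m')"
    if "s \<in> carrier S" "m \<in> carrier M" "m' \<in> carrier M" "r \<in> carrier R" for s m m' r
    using that h by (auto simp: graded_bimod_iso_def)
  have k': "g r \<triangleright>\<^bsub>N'\<^esub> k n = k (r \<triangleright>\<^bsub>N\<^esub> n)" "k n \<triangleleft>\<^bsub>N'\<^esub> f s = k (n \<triangleleft>\<^bsub>N\<^esub> s)" "k n \<oplus>\<^bsub>N'\<^esub> k n' = k (n \<oplus>\<^bsub>N\<^esub> n')"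
    if "s \<in> carrier S" "n \<in> carrier N" "n' \<in> carrier N" "r \<in> carrier R" for s n n' r
    using that k by (auto simp: graded_bimod_iso_def)
  have b: "biadditive M N S p" and bal: "\<And>m r n. \<lbrakk>m \<in> carrier M; r \<in> carrier R; n \<in> carrier N\<rbrakk> \<Longrightarrow>
      p (m \<triangleleft>\<^bsub>M\<^esub> r) n = p m (r \<triangleright>\<^bsub>N\<^esub> n)"
    and lin: "\<And>s m n. \<lbrakk>s \<in> carrier S; m \<in> carrier M; n \<in> carrier N\<rbrakk> \<Longrightarrow>
      p (s \<triangleright>\<^bsub>M\<^esub> m) n = s \<otimes>\<^bsub>S\<^esub> p m n \<and> p m (n \<triangleleft>\<^bsub>N\<^esub> s) = p m n \<otimes>\<^bsub>S\<^esub> s"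
    using p by (auto simp: morita_pairing_def balanced_def)
  note cl = biadditive_closed[OF b]
  have z: "\<zero>\<^bsub>S\<^esub> \<in> carrier S" "\<zero>\<^bsub>R\<^esub> \<in> carrier R" by auto
  have "biadditive M' N' S' p'"
    by (rule biadditiveI)
      (auto simp: surj p' cl h'(3)[OF z(1) _ _ z(2)] k'(3)[OF z(1) _ _ z(2)] fr
        biadditive_add_left[OF b] biadditive_add_right[OF b])
  moreover have "p' (m \<triangleleft>\<^bsub>M'\<^esub> r) n = p' m (r \<triangleright>\<^bsub>N'\<^esub> n)"
    if "m \<in> carrier M'" "r \<in> carrier R'" "n \<in> carrier N'" for m r n
    using that by (auto simp: surj p' h'(2)[OF z(1) _ M.zero_closed] k'(1)[OF z(1) _ N.zero_closed] bal
        M.rsmult_closed N.lsmult_closed)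
  moreover have "p' (s \<triangleright>\<^bsub>M'\<^esub> m) n = s \<otimes>\<^bsub>S'\<^esub> p' m n \<and> p' m (n \<triangleleft>\<^bsub>N'\<^esub> s) = p' m n \<otimes>\<^bsub>S'\<^esub> s"
    if "s \<in> carrier S'" "m \<in> carrier M'" "n \<in> carrier N'" for s m n
    using that by (auto simp: surj p' h'(1)[OF _ _ M.zero_closed z(2)] k'(2)[OF _ _ N.zero_closed z(2)] lin fr cl
        M.lsmult_closed N.rsmult_closed)
  ultimately show ?thesis by (simp add: morita_pairing_def balanced_def)
qed

text \<open>Both sides are additive in \<open>t\<close>, and on \<open>m \<otimes> n\<close> they are the two sides of the assumption on
  the pairings.\<close>

lemma tensor_map_pairing:
  assumes T: "tensor_factors S R S M N" and T': "tensor_factors S' R' S' M' N'"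
    and f: "f \<in> ring_iso S S'"
    and h: "h \<in> graded_bimod_iso G S R f g M dM M' dM'" and k: "k \<in> graded_bimod_iso G R S g f N dN N' dN'"
    and p: "morita_pairing S R M N p" and p': "morita_pairing S' R' M' N' p'"
    and pp': "\<And>m n. \<lbrakk>m \<in> carrier M; n \<in> carrier N\<rbrakk> \<Longrightarrow> p' (h m) (k n) = f (p m n)"
    and g: "\<And>r. r \<in> carrier R \<Longrightarrow> g r \<in> carrier R'"
    and t: "t \<in> carrier (tensor R M N)"
  shows "f (tensor_lift S p t) = tensor_lift S' p' (tensor_map R' M' N' h k t)"
proof -
  interpret T: tensor_factors S R S M N by fact
  interpret T': tensor_factors S' R' S' M' N' by fact
  note l = morita_pairing_lift[OF T.M.bimodule_axioms T.N.bimodule_axioms p]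
  note l' = morita_pairing_lift[OF T'.M.bimodule_axioms T'.N.bimodule_axioms p']
  have fa: "additive S S' f" using f by (auto simp: ring_iso_def ring_hom_def additive_def)
  have ha: "additive M M' h" and ka: "additive N N' k"
    using h k by (auto simp: graded_bimod_iso_def additive_def bij_betw_def)
  have b: "balanced R M N T'.T (\<lambda>m n. T'.pure (h m) (k n))"
    unfolding balanced_def
  proof (intro conjI ballI)
    show "biadditive M N T'.T (\<lambda>m n. T'.pure (h m) (k n))"
      by (rule biadditive_comp[OF T'.pure_biadditive ha ka])
    fix m r n assume a: "m \<in> carrier M" "r \<in> carrier R" "n \<in> carrier N"
    have "h (m \<triangleleft>\<^bsub>M\<^esub> r) = h m \<triangleleft>\<^bsub>M'\<^esub> g r" "k (r \<triangleright>\<^bsub>N\<^esub> n) = g r \<triangleright>\<^bsub>N'\<^esub> k n"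
      using a h k by (auto simp: graded_bimod_iso_def)
    then show "T'.pure (h (m \<triangleleft>\<^bsub>M\<^esub> r)) (k n) = T'.pure (h m) (k (r \<triangleright>\<^bsub>N\<^esub> n))"
      using T'.pure_middle[of "h m" "g r" "k n"] a additive_closed[OF ha] additive_closed[OF ka] g by simp
  qed
  note m = T.tensor_lift_additive[OF T'.T_abelian_group b, folded tensor_map_def]
    and mp = T.tensor_lift_pure[OF T'.T_abelian_group b, folded tensor_map_def]
  show ?thesis
    by (rule T.tensor_eqI[OF T'.M.L.abelian_group_axioms additive_comp[OF l(2) fa] additive_comp[OF m l'(2)] _ t])
      (auto simp: l(3) l'(3) mp pp' additive_closed[OF ha] additive_closed[OF ka])
qed

text \<open>Of the target only the gradings of the additive groups have to be known; every axiom about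
  multiplication, actions or connecting maps is inherited.\<close>

theorem (in paired_morita_context) paired_morita_transport:
  assumes groups: "graded_group G (mcS K') (mcdS K')" "graded_group G (mcR K') (mcdR K')"
      "graded_group G (mcP K') (mcdP K')" "graded_group G (mcQ K') (mcdQ K')"
    and f: "f \<in> graded_ring_iso G (mcS K) (mcdS K) (mcS K') (mcdS K')"
    and g: "g \<in> graded_ring_iso G (mcR K) (mcdR K) (mcR K') (mcdR K')"
    and h: "h \<in> graded_bimod_iso G (mcS K) (mcR K) f g (mcP K) (mcdP K) (mcP K') (mcdP K')"
    and k: "k \<in> graded_bimod_iso G (mcR K) (mcS K) g f (mcQ K) (mcdQ K) (mcQ K') (mcdQ K')"
    and phi': "mcphi K' = tensor_lift (mcS K') hp'" and psi': "mcpsi K' = tensor_lift (mcR K') hq'"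
    and hp': "\<And>p q. \<lbrakk>p \<in> carrier (mcP K); q \<in> carrier (mcQ K)\<rbrakk> \<Longrightarrow> hp' (h p) (k q) = f (hp p q)"
    and hq': "\<And>q p. \<lbrakk>q \<in> carrier (mcQ K); p \<in> carrier (mcP K)\<rbrakk> \<Longrightarrow> hq' (k q) (h p) = g (hq q p)"
  shows "paired_morita_context G K' hp' hq'" "graded_morita_iso G K K' f g h k"
proof -
  have S': "graded_ring G (mcS K') (mcdS K')" and R': "graded_ring G (mcR K') (mcdR K')"
    using graded_ring_transport[OF S groups(1) f is_group] graded_ring_transport[OF R groups(2) g is_group] by auto
  have r: "ring (mcS K')" "ring (mcR K')" using S' R' by (auto simp: graded_ring_def)
  have P': "graded_bimodule G (mcS K') (mcdS K') (mcR K') (mcdR K') (mcP K') (mcdP K')"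
    by (rule graded_bimodule_transport[OF P groups(3) is_group r f g S_group R_group h])
  have Q': "graded_bimodule G (mcR K') (mcdR K') (mcS K') (mcdS K') (mcQ K') (mcdQ K')"
    by (rule graded_bimodule_transport[OF Q groups(4) is_group r(2,1) g f R_group S_group k])
  have pair: "morita_pairing (mcS K') (mcR K') (mcP K') (mcQ K') hp'"
    by (rule morita_pairing_transport[OF hp P_bimodule Q_bimodule f g h k hp'])
  have pair': "morita_pairing (mcR K') (mcS K') (mcQ K') (mcP K') hq'"
    by (rule morita_pairing_transport[OF hq Q_bimodule P_bimodule g f k h hq'])
  have surj: "mcdS K' \<alpha> = f ` mcdS K \<alpha>" "mcdR K' \<alpha> = g ` mcdR K \<alpha>" "mcdP K' \<alpha> = h ` mcdP K \<alpha>"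
    "mcdQ K' \<alpha> = k ` mcdQ K \<alpha>" if "\<alpha> \<in> carrier G" for \<alpha>
    using that f g h k by (auto simp: graded_ring_iso_def graded_bimod_iso_def)
  have csurj: "carrier (mcP K') = h ` carrier (mcP K)" "carrier (mcQ K') = k ` carrier (mcQ K)"
    using h k by (auto simp: graded_bimod_iso_def bij_betw_def)
  note dc = graded_deg_closed[OF P_group] graded_deg_closed[OF Q_group]
  note hpc = biadditive_closed[of "mcP K" "mcQ K" "mcS K" hp] and hqc = biadditive_closed[of "mcQ K" "mcP K" "mcR K" hq]
  have bi: "biadditive (mcP K) (mcQ K) (mcS K) hp" "biadditive (mcQ K) (mcP K) (mcR K) hq"
    using hp hq by (auto simp: morita_pairing_def balanced_def)
  have ah: "s \<in> carrier (mcS K) \<Longrightarrow> f s \<triangleright>\<^bsub>mcP K'\<^esub> h p = h (s \<triangleright>\<^bsub>mcP K\<^esub> p)"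
    "r \<in> carrier (mcR K) \<Longrightarrow> h p \<triangleleft>\<^bsub>mcP K'\<^esub> g r = h (p \<triangleleft>\<^bsub>mcP K\<^esub> r)"
    if "p \<in> carrier (mcP K)" for s p r
    using that h by (auto simp: graded_bimod_iso_def)
  have ak: "r \<in> carrier (mcR K) \<Longrightarrow> g r \<triangleright>\<^bsub>mcQ K'\<^esub> k q = k (r \<triangleright>\<^bsub>mcQ K\<^esub> q)"
    "s \<in> carrier (mcS K) \<Longrightarrow> k q \<triangleleft>\<^bsub>mcQ K'\<^esub> f s = k (q \<triangleleft>\<^bsub>mcQ K\<^esub> s)"
    if "q \<in> carrier (mcQ K)" for s q r
    using that k by (auto simp: graded_bimod_iso_def)
  show paired: "paired_morita_context G K' hp' hq'"
  proof (intro paired_morita_context.intro paired_morita_context_axioms.intro is_group S' R' P' Q' phi' psi' pair pair')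
    fix \<alpha> \<beta> p q assume a: "\<alpha> \<in> carrier G" "\<beta> \<in> carrier G"
    show "hp' p q \<in> mcdS K' (\<alpha> \<otimes> \<beta>)" if "p \<in> mcdP K' \<alpha>" "q \<in> mcdQ K' \<beta>"
      using that a surj hp_deg[OF a] hp' dc by auto
    show "hq' q p \<in> mcdR K' (\<alpha> \<otimes> \<beta>)" if "q \<in> mcdQ K' \<alpha>" "p \<in> mcdP K' \<beta>"
      using that a surj hq_deg[OF a] hq' dc by auto
  next
    fix p q p' assume a: "p \<in> carrier (mcP K')" "q \<in> carrier (mcQ K')" "p' \<in> carrier (mcP K')"
    show "hp' p q \<triangleright>\<^bsub>mcP K'\<^esub> p' = p \<triangleleft>\<^bsub>mcP K'\<^esub> hq' q p'"
      using a hpc[OF bi(1)] hqc[OF bi(2)] by (auto simp: csurj hp' hq' ah hp_assoc)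
  next
    fix q p q' assume a: "q \<in> carrier (mcQ K')" "p \<in> carrier (mcP K')" "q' \<in> carrier (mcQ K')"
    show "hq' q p \<triangleright>\<^bsub>mcQ K'\<^esub> q' = q \<triangleleft>\<^bsub>mcQ K'\<^esub> hp' p q'"
      using a hpc[OF bi(1)] hqc[OF bi(2)] by (auto simp: csurj hp' hq' ak hq_assoc)
  qed
  interpret K': paired_morita_context G K' hp' hq' by (rule paired)
  have f': "f \<in> ring_iso (mcS K) (mcS K')" and g': "g \<in> ring_iso (mcR K) (mcR K')"
    using f g by (auto simp: graded_ring_iso_def)
  note sf = ring_iso_surj[OF f'] and sg = ring_iso_surj[OF g']
  show "graded_morita_iso G K K' f g h k"
    unfolding graded_morita_iso_def phi phi' psi psi'
  proof (intro conjI ballI f g h k)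
    show "f (tensor_lift (mcS K) hp t) = tensor_lift (mcS K') hp' (tensor_map (mcR K') (mcP K') (mcQ K') h k t)"
      if "t \<in> carrier (mcPQ K)" for t
      using that sg P_bimodule Q_bimodule K'.P_bimodule K'.Q_bimodule
      by (intro tensor_map_pairing[OF _ _ f' h k hp pair hp']) (auto simp: tensor_factors_def)
    show "g (tensor_lift (mcR K) hq t) = tensor_lift (mcR K') hq' (tensor_map (mcS K') (mcQ K') (mcP K') k h t)"
      if "t \<in> carrier (mcQP K)" for t
      using that sf P_bimodule Q_bimodule K'.P_bimodule K'.Q_bimodule
      by (intro tensor_map_pairing[OF _ _ g' k h hq pair' hq']) (auto simp: tensor_factors_def)
  qed
qed

section \<open>The dual graded ring of a group coring\<close>

lemma regular_bimodule: "ring A \<Longrightarrow> bimodule A A (regular A)"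
proof -
  assume "ring A"
  then interpret A: ring A .
  show ?thesis
    by (intro bimodule.intro bimodule_axioms.intro A.ring_axioms
        same_add_abelian_group[OF same_add_sym[OF same_add_regular] A.abelian_group_axioms])
      (auto simp: A.l_distr A.r_distr A.m_assoc)
qed

definition left_linear ::
  "('a, 'x) ring_scheme \<Rightarrow> ('a, 'r, 'm, 'y) bimodule_scheme \<Rightarrow> ('m \<Rightarrow> 'a) \<Rightarrow> bool" where
  "left_linear A M f \<longleftrightarrow> additive M A f \<and>
     (\<forall>a\<in>carrier A. \<forall>m\<in>carrier M. f (a \<triangleright>\<^bsub>M\<^esub> m) = a \<otimes>\<^bsub>A\<^esub> f m)"

text \<open>The functional \<open>m \<otimes> n \<mapsto> g (m f(n))\<close> on \<open>M \<otimes>\<^sub>A N\<close>, of which every convolution product is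
  the composition with a comultiplication.\<close>

definition sweedler ::
  "('a, 'x) ring_scheme \<Rightarrow> ('l, 'a, 'm, 'y) bimodule_scheme \<Rightarrow> ('m \<Rightarrow> 'a) \<Rightarrow> ('n \<Rightarrow> 'a) \<Rightarrow> ('m, 'n) tensor \<Rightarrow> 'a"
  where "sweedler A M g f = tensor_lift A (\<lambda>m n. g (m \<triangleleft>\<^bsub>M\<^esub> f n))"

locale bimodule_pair = tensor_factors A A A M N for A M N
begin

lemma A_group: "abelian_group A" by (rule M.L.abelian_group_axioms)

text \<open>Moving \<open>a\<close> across the tensor sign gives \<open>g ((m a) f(n)) = g (m (a f(n))) = g (m f(a n))\<close>.\<close>

lemma sweedler_balanced:
  assumes "left_linear A M g" "left_linear A N f"
  shows "balanced A M N A (\<lambda>m n. g (m \<triangleleft>\<^bsub>M\<^esub> f n))"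
proof -
  have g: "additive M A g" and f: "additive N A f" "\<And>a n. \<lbrakk>a \<in> carrier A; n \<in> carrier N\<rbrakk> \<Longrightarrow>
      f (a \<triangleright>\<^bsub>N\<^esub> n) = a \<otimes>\<^bsub>A\<^esub> f n"
    using assms by (auto simp: left_linear_def)
  show ?thesis
    unfolding balanced_def
    by (intro conjI biadditiveI ballI)
      (simp_all add: additive_closed[OF g] additive_closed[OF f(1)] additive_add[OF g] additive_add[OF f(1)] f(2)
        M.rsmult_closed M.rsmult_distr_ring M.rsmult_distr_mod M.rsmult_assoc)
qed

lemma sweedler_pure:
  "\<lbrakk>left_linear A M g; left_linear A N f; m \<in> carrier M; n \<in> carrier N\<rbrakk> \<Longrightarrow>
    sweedler A M g f (pure m n) = g (m \<triangleleft>\<^bsub>M\<^esub> f n)"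
  unfolding sweedler_def by (rule tensor_lift_pure[OF A_group sweedler_balanced])

lemma sweedler_linear:
  assumes g: "left_linear A M g" and f: "left_linear A N f"
  shows "left_linear A T (sweedler A M g f)"
proof -
  have add: "additive T A (sweedler A M g f)"
    unfolding sweedler_def by (rule tensor_lift_additive[OF A_group sweedler_balanced[OF g f]])
  have mult: "additive A A (\<lambda>t. a \<otimes>\<^bsub>A\<^esub> t)" if "a \<in> carrier A" for a
    using that by (auto simp: additive_def M.L.r_distr)
  have "sweedler A M g f (a \<triangleright>\<^bsub>T\<^esub> t) = a \<otimes>\<^bsub>A\<^esub> sweedler A M g f t"
    if a: "a \<in> carrier A" and t: "t \<in> carrier T" for a t
  proof (rule tensor_eqI[OF A_group additive_comp[OF tensor_lact(1)[OF a] add] additive_comp[OF add mult[OF a]] _ t])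
    fix t assume "t \<in> {pure m n | m n. m \<in> carrier M \<and> n \<in> carrier N}"
    then obtain m n where t: "t = pure m n" "m \<in> carrier M" "n \<in> carrier N" by blast
    have "f n \<in> carrier A" using f t(3) additive_closed by (auto simp: left_linear_def)
    then have "g ((a \<triangleright>\<^bsub>M\<^esub> m) \<triangleleft>\<^bsub>M\<^esub> f n) = a \<otimes>\<^bsub>A\<^esub> g (m \<triangleleft>\<^bsub>M\<^esub> f n)"
      using a t g by (simp add: M.smult_middle_assoc M.rsmult_closed left_linear_def)
    then show "sweedler A M g f (a \<triangleright>\<^bsub>T\<^esub> t) = a \<otimes>\<^bsub>A\<^esub> sweedler A M g f t"
      using a t by (simp add: tensor_lact(2) sweedler_pure[OF g f] M.lsmult_closed)
  qed
  then show ?thesis using add by (simp add: left_linear_def)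
qed

lemma sweedler_additive:
  "\<lbrakk>left_linear A M g; left_linear A N f\<rbrakk> \<Longrightarrow> additive T A (sweedler A M g f)"
  using sweedler_linear by (simp add: left_linear_def)

text \<open>The case \<open>g = g' = g''\<close> gives additivity of the convolution product in one argument, and
  \<open>f = f' = f''\<close> in the other.\<close>

lemma sweedler_add:
  assumes "left_linear A M g" "left_linear A N f" "left_linear A M g'" "left_linear A N f'"
    "left_linear A M g''" "left_linear A N f''"
    and "\<And>m n. \<lbrakk>m \<in> carrier M; n \<in> carrier N\<rbrakk> \<Longrightarrow>
      g'' (m \<triangleleft>\<^bsub>M\<^esub> f'' n) = g (m \<triangleleft>\<^bsub>M\<^esub> f n) \<oplus>\<^bsub>A\<^esub> g' (m \<triangleleft>\<^bsub>M\<^esub> f' n)"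
    and t: "t \<in> carrier T"
  shows "sweedler A M g'' f'' t = sweedler A M g f t \<oplus>\<^bsub>A\<^esub> sweedler A M g' f' t"
  by (rule tensor_eqI[OF A_group sweedler_additive[OF assms(5,6)]
        additive_add_maps[OF A_group sweedler_additive[OF assms(1,2)] sweedler_additive[OF assms(3,4)]] _ t])
    (auto simp: sweedler_pure assms)

end

lemma left_linear_ract:
  assumes "bimodule A A M" "left_linear A M f" "a \<in> carrier A"
  shows "left_linear A M (\<lambda>m. f (m \<triangleleft>\<^bsub>M\<^esub> a))"
proof -
  interpret bimodule A A M by fact
  show ?thesis
    using assms(2,3) by (auto simp: left_linear_def additive_def rsmult_closed rsmult_distr_mod smult_middle_assoc Pi_iff)
qed

locale bimodule_triple = M: bimodule A A M + N: bimodule A A N + P: bimodule A A P for A M N P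
begin

sublocale MN: bimodule_pair A M N ..
sublocale NP: bimodule_pair A N P ..
sublocale MN_P: bimodule_pair A "tensor A M N" P
  by (intro bimodule_pair.intro tensor_factors.intro MN.tensor_bimodule P.bimodule_axioms)
sublocale M_NP: bimodule_pair A M "tensor A N P"
  by (intro bimodule_pair.intro tensor_factors.intro NP.tensor_bimodule M.bimodule_axioms)

abbreviation "T \<equiv> tensor A M (tensor A N P)"

definition assoc_pure where "assoc_pure p m n = M_NP.pure m (NP.pure n p)" for p m n

lemma assoc_pure_balanced: "p \<in> carrier P \<Longrightarrow> balanced A M N T (assoc_pure p)"
  unfolding balanced_def
proof (intro conjI ballI)
  assume p: "p \<in> carrier P"
  show "biadditive M N T (assoc_pure p)"
    unfolding assoc_pure_def[abs_def]
    by (rule biadditive_comp[OF M_NP.pure_biadditive additive_id biadditive_left[OF NP.pure_biadditive p]])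
  fix m a n assume "m \<in> carrier M" "a \<in> carrier A" "n \<in> carrier N"
  then show "assoc_pure p (m \<triangleleft>\<^bsub>M\<^esub> a) n = assoc_pure p m (a \<triangleright>\<^bsub>N\<^esub> n)"
    using p by (simp add: assoc_pure_def M_NP.pure_middle NP.pure_closed NP.tensor_lact(2))
qed

text \<open>The map underlying the canonical isomorphism of iterated tensor products.\<close>

lemma assoc_lift_balanced: "balanced A (tensor A M N) P T (\<lambda>t p. tensor_lift T (assoc_pure p) t)"
proof -
  note TG = M_NP.T_abelian_group
  note l = MN.tensor_lift_additive[OF TG assoc_pure_balanced] and lp = MN.tensor_lift_pure[OF TG assoc_pure_balanced]
  have padd: "tensor_lift T (assoc_pure (p \<oplus>\<^bsub>P\<^esub> p')) t = tensor_lift T (assoc_pure p) t \<oplus>\<^bsub>T\<^esub> tensor_lift T (assoc_pure p') t"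
    if t: "t \<in> carrier (tensor A M N)" and p: "p \<in> carrier P" "p' \<in> carrier P" for t p p'
    by (rule MN.tensor_eqI[OF TG l additive_add_maps[OF TG l l] _ t])
      (use p in \<open>auto simp: lp P.a_closed assoc_pure_def biadditive_add_right[OF NP.pure_biadditive]
        biadditive_add_right[OF M_NP.pure_biadditive] NP.pure_closed\<close>)
  have mid: "tensor_lift T (assoc_pure p) (t \<triangleleft>\<^bsub>tensor A M N\<^esub> a) = tensor_lift T (assoc_pure (a \<triangleright>\<^bsub>P\<^esub> p)) t"
    if t: "t \<in> carrier (tensor A M N)" and p: "p \<in> carrier P" "a \<in> carrier A" for t p a
    by (rule MN.tensor_eqI[OF TG additive_comp[OF MN.tensor_ract(1) l] l _ t])
      (use p in \<open>auto simp: lp P.lsmult_closed N.rsmult_closed assoc_pure_def MN.tensor_ract(2) NP.pure_middle\<close>)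
  show ?thesis
    unfolding balanced_def
    by (intro conjI ballI biadditiveI) (auto simp: additive_closed[OF l] additive_add[OF l] padd mid)
qed

lemma tensor_assoc_additive: "additive (tensor A (tensor A M N) P) T (tensor_assoc A M N P)"
  using MN_P.tensor_lift_additive[OF M_NP.T_abelian_group assoc_lift_balanced]
  by (simp add: tensor_assoc_def assoc_pure_def[abs_def] Let_def)

lemma tensor_assoc_pure:
  assumes "t \<in> carrier (tensor A M N)" "p \<in> carrier P"
  shows "tensor_assoc A M N P (MN_P.pure t p) = tensor_lift T (assoc_pure p) t"
  using MN_P.tensor_lift_pure[OF M_NP.T_abelian_group assoc_lift_balanced assms]
  by (simp add: tensor_assoc_def assoc_pure_def[abs_def] Let_def)

text \<open>Both sides are additive in \<open>t\<close>, and for \<open>t = m \<otimes> n\<close> both are \<open>h (m g (n f (p)))\<close>.\<close>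

lemma sweedler_assoc_pure:
  assumes h: "left_linear A M h" and g: "left_linear A N g" and f: "left_linear A P f"
    and t: "t \<in> carrier (tensor A M N)" and p: "p \<in> carrier P"
  shows "sweedler A M h (sweedler A N g f) (tensor_assoc A M N P (MN_P.pure t p)) =
    sweedler A M h g (t \<triangleleft>\<^bsub>tensor A M N\<^esub> f p)"
proof -
  note TG = M_NP.T_abelian_group
  have fp: "f p \<in> carrier A" using f p additive_closed by (auto simp: left_linear_def)
  show ?thesis
    unfolding tensor_assoc_pure[OF t p]
    by (rule MN.tensor_eqI[OF MN.A_group
          additive_comp[OF MN.tensor_lift_additive[OF TG assoc_pure_balanced[OF p]]
            M_NP.sweedler_additive[OF h NP.sweedler_linear[OF g f]]]
          additive_comp[OF MN.tensor_ract(1)[OF fp] MN.sweedler_additive[OF h g]] _ t])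
      (use p fp in \<open>auto simp: MN.tensor_lift_pure[OF TG assoc_pure_balanced] assoc_pure_def NP.pure_closed
        M_NP.sweedler_pure[OF h NP.sweedler_linear[OF g f]] NP.sweedler_pure[OF g f]
        MN.tensor_ract(2) MN.sweedler_pure[OF h g] N.rsmult_closed\<close>)
qed

end

context group_coring
begin

lemma C_pair: "\<lbrakk>\<alpha> \<in> carrier G; \<beta> \<in> carrier G\<rbrakk> \<Longrightarrow> bimodule_pair A (C \<alpha>) (C \<beta>)"
  by (intro bimodule_pair.intro tensor_factors.intro C_bimodule)

lemma C_triple: "\<lbrakk>\<alpha> \<in> carrier G; \<beta> \<in> carrier G; \<gamma> \<in> carrier G\<rbrakk> \<Longrightarrow> bimodule_triple A (C \<alpha>) (C \<beta>) (C \<gamma>)"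
  by (intro bimodule_triple.intro C_bimodule)

lemma comult:
  assumes "\<alpha> \<in> carrier G" "\<beta> \<in> carrier G"
  shows "additive (C (\<alpha> \<otimes> \<beta>)) (tensor A (C \<alpha>) (C \<beta>)) (\<Delta> \<alpha> \<beta>)"
    "\<lbrakk>a \<in> carrier A; c \<in> carrier (C (\<alpha> \<otimes> \<beta>))\<rbrakk> \<Longrightarrow>
      \<Delta> \<alpha> \<beta> (a \<triangleright>\<^bsub>C (\<alpha> \<otimes> \<beta>)\<^esub> c) = a \<triangleright>\<^bsub>tensor A (C \<alpha>) (C \<beta>)\<^esub> \<Delta> \<alpha> \<beta> c"
    "\<lbrakk>a \<in> carrier A; c \<in> carrier (C (\<alpha> \<otimes> \<beta>))\<rbrakk> \<Longrightarrow>
      \<Delta> \<alpha> \<beta> (c \<triangleleft>\<^bsub>C (\<alpha> \<otimes> \<beta>)\<^esub> a) = \<Delta> \<alpha> \<beta> c \<triangleleft>\<^bsub>tensor A (C \<alpha>) (C \<beta>)\<^esub> a"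
  using comult_hom[OF assms] by (auto simp: bimod_hom_def additive_def)

lemma counit:
  "additive (C \<one>) A \<epsilon>" "\<lbrakk>a \<in> carrier A; c \<in> carrier (C \<one>)\<rbrakk> \<Longrightarrow> \<epsilon> (a \<triangleright>\<^bsub>C \<one>\<^esub> c) = a \<otimes>\<^bsub>A\<^esub> \<epsilon> c"
  "\<lbrakk>a \<in> carrier A; c \<in> carrier (C \<one>)\<rbrakk> \<Longrightarrow> \<epsilon> (c \<triangleleft>\<^bsub>C \<one>\<^esub> a) = \<epsilon> c \<otimes>\<^bsub>A\<^esub> a"
  using counit_hom by (auto simp: bimod_hom_def additive_def)

lemma counit_linear: "left_linear A (C \<one>) \<epsilon>"
  using counit by (simp add: left_linear_def)

lemma dual_iff: "f \<in> carrier (dual \<alpha>) \<longleftrightarrow>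
    f \<in> extensional (carrier (C (inv \<alpha>))) \<and> left_linear A (C (inv \<alpha>)) f"
  by (auto simp: dual_def left_linear_def additive_def PiE_def)

lemma dual_simps:
  "zero (dual \<alpha>) = (\<lambda>c\<in>carrier (C (inv \<alpha>)). \<zero>\<^bsub>A\<^esub>)"
  "f \<oplus>\<^bsub>dual \<alpha>\<^esub> g = (\<lambda>c\<in>carrier (C (inv \<alpha>)). f c \<oplus>\<^bsub>A\<^esub> g c)"
  "f \<triangleleft>\<^bsub>dual \<alpha>\<^esub> b = (\<lambda>c\<in>carrier (C (inv \<alpha>)). f c \<otimes>\<^bsub>A\<^esub> b)"
  "a \<triangleright>\<^bsub>dual \<alpha>\<^esub> f = (\<lambda>c\<in>carrier (C (inv \<alpha>)). f (c \<triangleleft>\<^bsub>C (inv \<alpha>)\<^esub> a))"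
  by (simp_all add: dual_def)

lemma dual_linear: "f \<in> carrier (dual \<alpha>) \<Longrightarrow> left_linear A (C (inv \<alpha>)) f"
  by (simp add: dual_iff)

lemma dual_additive: "f \<in> carrier (dual \<alpha>) \<Longrightarrow> additive (C (inv \<alpha>)) A f"
  by (simp add: dual_iff left_linear_def)

lemma dual_lact: "\<lbrakk>f \<in> carrier (dual \<alpha>); a \<in> carrier A; c \<in> carrier (C (inv \<alpha>))\<rbrakk> \<Longrightarrow>
    f (a \<triangleright>\<^bsub>C (inv \<alpha>)\<^esub> c) = a \<otimes>\<^bsub>A\<^esub> f c"
  by (simp add: dual_iff left_linear_def)

lemma dual_closed: "\<lbrakk>f \<in> carrier (dual \<alpha>); c \<in> carrier (C (inv \<alpha>))\<rbrakk> \<Longrightarrow> f c \<in> carrier A"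
  by (rule additive_closed[OF dual_additive])

lemma dual_ext: "\<lbrakk>f \<in> carrier (dual \<alpha>); g \<in> carrier (dual \<alpha>); \<And>c. c \<in> carrier (C (inv \<alpha>)) \<Longrightarrow> f c = g c\<rbrakk>
    \<Longrightarrow> f = g"
  by (rule extensionalityI[of _ "carrier (C (inv \<alpha>))"]) (simp_all add: dual_iff)

lemma left_linear_restrict:
  assumes "bimodule A A M" shows "left_linear A M (restrict f (carrier M)) = left_linear A M f"
proof -
  interpret bimodule A A M by fact
  show ?thesis by (auto simp: left_linear_def additive_def lsmult_closed Pi_iff)
qed

lemma dual_restrictI: "\<lbrakk>\<alpha> \<in> carrier G; left_linear A (C (inv \<alpha>)) f\<rbrakk> \<Longrightarrow>
    restrict f (carrier (C (inv \<alpha>))) \<in> carrier (dual \<alpha>)"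
  by (simp add: dual_iff left_linear_restrict C_bimodule)

lemma left_linear_zero: "bimodule A A M \<Longrightarrow> left_linear A M (\<lambda>_. \<zero>\<^bsub>A\<^esub>)"
  by (simp add: left_linear_def additive_def)

lemma left_linear_add:
  assumes "left_linear A M f" "left_linear A M g" shows "left_linear A M (\<lambda>m. f m \<oplus>\<^bsub>A\<^esub> g m)"
  using assms additive_add_maps[OF A.abelian_group_axioms, of M f g] additive_closed[of M A]
  by (simp add: left_linear_def A.r_distr)

lemma left_linear_rmult:
  assumes "left_linear A M f" "a \<in> carrier A" shows "left_linear A M (\<lambda>m. f m \<otimes>\<^bsub>A\<^esub> a)"
  using assms by (auto simp: left_linear_def additive_def A.l_distr A.m_assoc Pi_iff)

lemma dual_add_closed: "\<lbrakk>\<alpha> \<in> carrier G; f \<in> carrier (dual \<alpha>); g \<in> carrier (dual \<alpha>)\<rbrakk> \<Longrightarrow>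
    f \<oplus>\<^bsub>dual \<alpha>\<^esub> g \<in> carrier (dual \<alpha>)"
  by (simp add: dual_simps dual_restrictI left_linear_add dual_linear)

lemma dual_rsmult_closed: "\<lbrakk>\<alpha> \<in> carrier G; f \<in> carrier (dual \<alpha>); a \<in> carrier A\<rbrakk> \<Longrightarrow>
    f \<triangleleft>\<^bsub>dual \<alpha>\<^esub> a \<in> carrier (dual \<alpha>)"
  by (simp add: dual_simps dual_restrictI left_linear_rmult dual_linear)

lemma dual_lsmult_closed: "\<lbrakk>\<alpha> \<in> carrier G; f \<in> carrier (dual \<alpha>); a \<in> carrier A\<rbrakk> \<Longrightarrow>
    a \<triangleright>\<^bsub>dual \<alpha>\<^esub> f \<in> carrier (dual \<alpha>)"
  by (simp add: dual_simps dual_restrictI left_linear_ract C_bimodule dual_linear)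

lemma dual_abelian_group:
  assumes \<alpha>: "\<alpha> \<in> carrier G" shows "abelian_group (dual \<alpha>)"
proof (rule abelian_groupI)
  note cl = dual_add_closed[OF \<alpha>]
  show "\<zero>\<^bsub>dual \<alpha>\<^esub> \<in> carrier (dual \<alpha>)"
    using \<alpha> by (simp add: dual_simps dual_restrictI left_linear_zero C_bimodule)
  then show "\<zero>\<^bsub>dual \<alpha>\<^esub> \<oplus>\<^bsub>dual \<alpha>\<^esub> f = f" if "f \<in> carrier (dual \<alpha>)" for f
    by (rule dual_ext[OF cl _]) (use that in \<open>auto simp: dual_simps dual_closed\<close>)
  show "\<exists>g\<in>carrier (dual \<alpha>). g \<oplus>\<^bsub>dual \<alpha>\<^esub> f = \<zero>\<^bsub>dual \<alpha>\<^esub>" if f: "f \<in> carrier (dual \<alpha>)" for f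
  proof
    show "(\<lambda>c\<in>carrier (C (inv \<alpha>)). \<ominus>\<^bsub>A\<^esub> f c) \<in> carrier (dual \<alpha>)"
    proof (rule dual_restrictI[OF \<alpha>])
      show "left_linear A (C (inv \<alpha>)) (\<lambda>c. \<ominus>\<^bsub>A\<^esub> f c)"
        unfolding left_linear_def
        by (intro conjI additiveI ballI) (use f in \<open>auto simp: dual_closed additive_add[OF dual_additive]
          dual_lact A.minus_add A.r_minus A.a_comm\<close>)
    qed
    show "(\<lambda>c\<in>carrier (C (inv \<alpha>)). \<ominus>\<^bsub>A\<^esub> f c) \<oplus>\<^bsub>dual \<alpha>\<^esub> f = \<zero>\<^bsub>dual \<alpha>\<^esub>"
      using f by (auto simp: dual_simps dual_closed A.l_neg intro!: restrict_ext)
  qed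
  show "f \<oplus>\<^bsub>dual \<alpha>\<^esub> g \<in> carrier (dual \<alpha>)" if "f \<in> carrier (dual \<alpha>)" "g \<in> carrier (dual \<alpha>)" for f g
    by (rule cl[OF that])
  show "f \<oplus>\<^bsub>dual \<alpha>\<^esub> g = g \<oplus>\<^bsub>dual \<alpha>\<^esub> f" if "f \<in> carrier (dual \<alpha>)" "g \<in> carrier (dual \<alpha>)" for f g
    using that by (auto simp: dual_simps dual_closed A.a_comm intro!: restrict_ext)
  show "f \<oplus>\<^bsub>dual \<alpha>\<^esub> g \<oplus>\<^bsub>dual \<alpha>\<^esub> h = f \<oplus>\<^bsub>dual \<alpha>\<^esub> (g \<oplus>\<^bsub>dual \<alpha>\<^esub> h)"
    if "f \<in> carrier (dual \<alpha>)" "g \<in> carrier (dual \<alpha>)" "h \<in> carrier (dual \<alpha>)" for f g h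
    using that by (auto simp: dual_simps dual_closed A.a_assoc intro!: restrict_ext)
qed

lemma conv_eq:
  "conv \<alpha> f \<beta> g = (\<lambda>c\<in>carrier (C (inv (\<alpha> \<otimes> \<beta>))). sweedler A (C (inv \<beta>)) g f (\<Delta> (inv \<beta>) (inv \<alpha>) c))"
  by (simp add: conv_def sweedler_def)

lemma conv_closed:
  assumes \<alpha>: "\<alpha> \<in> carrier G" "\<beta> \<in> carrier G" and f: "f \<in> carrier (dual \<alpha>)" and g: "g \<in> carrier (dual \<beta>)"
  shows "conv \<alpha> f \<beta> g \<in> carrier (dual (\<alpha> \<otimes> \<beta>))"
proof -
  interpret CC: bimodule_pair A "C (inv \<beta>)" "C (inv \<alpha>)" using \<alpha> by (simp add: C_pair)
  note s = CC.sweedler_linear[OF dual_linear[OF g] dual_linear[OF f], unfolded left_linear_def]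
  have i: "inv (\<alpha> \<otimes> \<beta>) = inv \<beta> \<otimes> inv \<alpha>" using \<alpha> by (simp add: inv_mult_group)
  have \<alpha>': "inv \<beta> \<in> carrier G" "inv \<alpha> \<in> carrier G" using \<alpha> by auto
  have "left_linear A (C (inv (\<alpha> \<otimes> \<beta>))) (\<lambda>c. sweedler A (C (inv \<beta>)) g f (\<Delta> (inv \<beta>) (inv \<alpha>) c))"
    unfolding left_linear_def i
    using additive_comp[OF comult(1)[OF \<alpha>']] s comult(2)[OF \<alpha>'] additive_closed[OF comult(1)[OF \<alpha>']]
    by auto
  then show ?thesis unfolding conv_eq using \<alpha> by (intro dual_restrictI) auto
qed

lemma conv_biadditive:
  assumes \<alpha>: "\<alpha> \<in> carrier G" "\<beta> \<in> carrier G"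
  shows "biadditive (dual \<alpha>) (dual \<beta>) (dual (\<alpha> \<otimes> \<beta>)) (\<lambda>f g. conv \<alpha> f \<beta> g)"
proof -
  interpret CC: bimodule_pair A "C (inv \<beta>)" "C (inv \<alpha>)" using \<alpha> by (simp add: C_pair)
  have i: "inv (\<alpha> \<otimes> \<beta>) = inv \<beta> \<otimes> inv \<alpha>" using \<alpha> by (simp add: inv_mult_group)
  have \<alpha>': "inv \<beta> \<in> carrier G" "inv \<alpha> \<in> carrier G" using \<alpha> by auto
  note dc = additive_closed[OF comult(1)[OF \<alpha>']]
  note add = additive_add[OF dual_additive]
  show ?thesis
  proof (rule biadditiveI)
    fix f f' g assume a: "f \<in> carrier (dual \<alpha>)" "f' \<in> carrier (dual \<alpha>)" "g \<in> carrier (dual \<beta>)"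
    note a' = a[THEN dual_linear]
    have "sweedler A (C (inv \<beta>)) g (f \<oplus>\<^bsub>dual \<alpha>\<^esub> f') t =
        sweedler A (C (inv \<beta>)) g f t \<oplus>\<^bsub>A\<^esub> sweedler A (C (inv \<beta>)) g f' t" if "t \<in> carrier CC.T" for t
      by (rule CC.sweedler_add[OF a'(3,1,3,2,3) dual_linear[OF dual_add_closed[OF \<alpha>(1) a(1,2)]] _ that])
        (use a in \<open>auto simp: dual_simps dual_closed CC.M.rsmult_distr_ring add CC.M.rsmult_closed\<close>)
    then show "conv \<alpha> (f \<oplus>\<^bsub>dual \<alpha>\<^esub> f') \<beta> g = conv \<alpha> f \<beta> g \<oplus>\<^bsub>dual (\<alpha> \<otimes> \<beta>)\<^esub> conv \<alpha> f' \<beta> g"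
      by (auto simp: conv_eq dual_simps(2)[of "\<alpha> \<otimes> \<beta>"] i dc intro!: restrict_ext)
  next
    fix f g g' assume a: "f \<in> carrier (dual \<alpha>)" "g \<in> carrier (dual \<beta>)" "g' \<in> carrier (dual \<beta>)"
    note a' = a[THEN dual_linear]
    have "sweedler A (C (inv \<beta>)) (g \<oplus>\<^bsub>dual \<beta>\<^esub> g') f t =
        sweedler A (C (inv \<beta>)) g f t \<oplus>\<^bsub>A\<^esub> sweedler A (C (inv \<beta>)) g' f t" if "t \<in> carrier CC.T" for t
      by (rule CC.sweedler_add[OF a'(2,1,3,1) dual_linear[OF dual_add_closed[OF \<alpha>(2) a(2,3)]] a'(1) _ that])
        (use a in \<open>auto simp: dual_simps dual_closed CC.M.rsmult_closed\<close>)
    then show "conv \<alpha> f \<beta> (g \<oplus>\<^bsub>dual \<beta>\<^esub> g') = conv \<alpha> f \<beta> g \<oplus>\<^bsub>dual (\<alpha> \<otimes> \<beta>)\<^esub> conv \<alpha> f \<beta> g'"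
      by (auto simp: conv_eq dual_simps(2)[of "\<alpha> \<otimes> \<beta>"] i dc intro!: restrict_ext)
  qed (rule conv_closed[OF \<alpha>])
qed

text \<open>At \<open>c\<close>, both sides are the functional \<open>m \<otimes> n \<otimes> p \<mapsto> h (m g (n f(p)))\<close> applied to an iterated
  comultiplication of \<open>c\<close>. For the right-hand side this uses that \<open>\<Delta>\<close> is right \<open>A\<close>-linear, which
  lets the factor \<open>f(p)\<close> pass through it. Coassociativity identifies the two.\<close>

lemma conv_assoc:
  assumes \<alpha>: "\<alpha> \<in> carrier G" and \<beta>: "\<beta> \<in> carrier G" and \<gamma>: "\<gamma> \<in> carrier G"
    and f: "f \<in> carrier (dual \<alpha>)" and g: "g \<in> carrier (dual \<beta>)" and h: "h \<in> carrier (dual \<gamma>)"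
  shows "conv (\<alpha> \<otimes> \<beta>) (conv \<alpha> f \<beta> g) \<gamma> h = conv \<alpha> f (\<beta> \<otimes> \<gamma>) (conv \<beta> g \<gamma> h)"
proof (rule dual_ext)
  note inv = inv_closed[OF \<alpha>] inv_closed[OF \<beta>] inv_closed[OF \<gamma>]
  interpret T: bimodule_triple A "C (inv \<gamma>)" "C (inv \<beta>)" "C (inv \<alpha>)" by (rule C_triple[OF inv(3,2,1)])
  interpret L: bimodule_pair A "C (inv \<gamma> \<otimes> inv \<beta>)" "C (inv \<alpha>)" by (rule C_pair) (use inv in auto)
  interpret R: bimodule_pair A "C (inv \<gamma>)" "C (inv \<beta> \<otimes> inv \<alpha>)" by (rule C_pair) (use inv in auto)
  have i: "inv (\<alpha> \<otimes> \<beta>) = inv \<beta> \<otimes> inv \<alpha>" "inv (\<beta> \<otimes> \<gamma>) = inv \<gamma> \<otimes> inv \<beta>"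
    "inv (\<alpha> \<otimes> \<beta> \<otimes> \<gamma>) = inv \<gamma> \<otimes> inv \<beta> \<otimes> inv \<alpha>"
    using \<alpha> \<beta> \<gamma> by (simp_all add: inv_mult_group m_assoc)
  have fgh: "left_linear A (C (inv \<alpha>)) f" "left_linear A (C (inv \<beta>)) g" "left_linear A (C (inv \<gamma>)) h"
    using f g h by (auto intro: dual_linear)
  show fg_h: "conv (\<alpha> \<otimes> \<beta>) (conv \<alpha> f \<beta> g) \<gamma> h \<in> carrier (dual (\<alpha> \<otimes> \<beta> \<otimes> \<gamma>))"
    using assms by (intro conv_closed) auto
  have "conv \<alpha> f (\<beta> \<otimes> \<gamma>) (conv \<beta> g \<gamma> h) \<in> carrier (dual (\<alpha> \<otimes> (\<beta> \<otimes> \<gamma>)))"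
    using assms by (intro conv_closed) auto
  then show "conv \<alpha> f (\<beta> \<otimes> \<gamma>) (conv \<beta> g \<gamma> h) \<in> carrier (dual (\<alpha> \<otimes> \<beta> \<otimes> \<gamma>))"
    using \<alpha> \<beta> \<gamma> by (simp add: m_assoc)
  have gh: "left_linear A (C (inv \<gamma> \<otimes> inv \<beta>)) (conv \<beta> g \<gamma> h)"
    using dual_linear[OF conv_closed[OF \<beta> \<gamma> g h]] by (simp add: i)
  have fg: "left_linear A (C (inv \<beta> \<otimes> inv \<alpha>)) (conv \<alpha> f \<beta> g)"
    using dual_linear[OF conv_closed[OF \<alpha> \<beta> f g]] by (simp add: i)
  have fg_apply: "conv \<alpha> f \<beta> g d = sweedler A (C (inv \<beta>)) g f (\<Delta> (inv \<beta>) (inv \<alpha>) d)"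
    if "d \<in> carrier (C (inv \<beta> \<otimes> inv \<alpha>))" for d
    using that by (simp add: conv_eq i)
  let ?F = "sweedler A (C (inv \<gamma>)) h (sweedler A (C (inv \<beta>)) g f)"
  have F: "left_linear A T.T ?F"
    by (rule T.M_NP.sweedler_linear[OF fgh(3) T.NP.sweedler_linear[OF fgh(2,1)]])
  fix c assume "c \<in> carrier (C (inv (\<alpha> \<otimes> \<beta> \<otimes> \<gamma>)))"
  then have c: "c \<in> carrier (C (inv \<gamma> \<otimes> inv \<beta> \<otimes> inv \<alpha>))" "c \<in> carrier (C (inv \<gamma> \<otimes> (inv \<beta> \<otimes> inv \<alpha>)))"
    using inv by (simp_all add: i m_assoc)
  define l where "l = \<Delta> (inv \<gamma> \<otimes> inv \<beta>) (inv \<alpha>) c"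
  define r where "r = \<Delta> (inv \<gamma>) (inv \<beta> \<otimes> inv \<alpha>) c"
  have l: "l \<in> carrier L.T" unfolding l_def
    by (rule additive_closed[OF comult(1) c(1)]) (use inv in auto)
  have r: "r \<in> carrier R.T" unfolding r_def
    by (rule additive_closed[OF comult(1) c(2)]) (use inv in auto)
  have d1: "balanced A (C (inv \<gamma> \<otimes> inv \<beta>)) (C (inv \<alpha>)) (tensor A T.MN.T (C (inv \<alpha>)))
      (\<lambda>d p. T.MN_P.pure (\<Delta> (inv \<gamma>) (inv \<beta>) d) p)"
    unfolding balanced_def
    using biadditive_comp[OF T.MN_P.pure_biadditive comult(1)[OF inv(3,2)] additive_id] comult(3)[OF inv(3,2)]
      additive_closed[OF comult(1)[OF inv(3,2)]]
    by (auto simp: T.MN_P.pure_middle)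
  have d2: "balanced A (C (inv \<gamma>)) (C (inv \<beta> \<otimes> inv \<alpha>)) (tensor A (C (inv \<gamma>)) T.NP.T)
      (\<lambda>m d. T.M_NP.pure m (\<Delta> (inv \<beta>) (inv \<alpha>) d))"
    unfolding balanced_def
    using biadditive_comp[OF T.M_NP.pure_biadditive additive_id comult(1)[OF inv(2,1)]] comult(2)[OF inv(2,1)]
      additive_closed[OF comult(1)[OF inv(2,1)]]
    by (auto simp: T.M_NP.pure_middle)
  note m1 = L.tensor_lift_additive[OF T.MN_P.T_abelian_group d1]
    and p1 = L.tensor_lift_pure[OF T.MN_P.T_abelian_group d1]
    and m2 = R.tensor_lift_additive[OF T.M_NP.T_abelian_group d2]
    and p2 = R.tensor_lift_pure[OF T.M_NP.T_abelian_group d2]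
  have Fa: "additive T.T A ?F" using F by (simp add: left_linear_def)
  have "conv \<alpha> f (\<beta> \<otimes> \<gamma>) (conv \<beta> g \<gamma> h) c = sweedler A (C (inv \<gamma> \<otimes> inv \<beta>)) (conv \<beta> g \<gamma> h) f l"
    unfolding conv_eq[of \<alpha> f "\<beta> \<otimes> \<gamma>"] using c \<alpha> \<beta> \<gamma> by (simp add: i l_def m_assoc[symmetric])
  also have "\<dots> = ?F (tensor_assoc A (C (inv \<gamma>)) (C (inv \<beta>)) (C (inv \<alpha>))
      (tensor_map A T.MN.T (C (inv \<alpha>)) (\<Delta> (inv \<gamma>) (inv \<beta>)) id l))"
    unfolding tensor_map_def id_apply
  proof (rule L.tensor_eqI[OF L.A_group L.sweedler_additive[OF gh fgh(1)]
        additive_comp[OF additive_comp[OF m1 T.tensor_assoc_additive] Fa] _ l])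
    fix t assume "t \<in> {L.pure d p | d p. d \<in> carrier (C (inv \<gamma> \<otimes> inv \<beta>)) \<and> p \<in> carrier (C (inv \<alpha>))}"
    then obtain d p where t: "t = L.pure d p" and dp: "d \<in> carrier (C (inv \<gamma> \<otimes> inv \<beta>))" "p \<in> carrier (C (inv \<alpha>))"
      by blast
    have fp: "f p \<in> carrier A" by (rule dual_closed[OF f dp(2)])
    have \<Delta>d: "\<Delta> (inv \<gamma>) (inv \<beta>) d \<in> carrier T.MN.T"
      by (rule additive_closed[OF comult(1)[OF inv(3,2)] dp(1)])
    have "sweedler A (C (inv \<gamma> \<otimes> inv \<beta>)) (conv \<beta> g \<gamma> h) f t =
        sweedler A (C (inv \<gamma>)) h g (\<Delta> (inv \<gamma>) (inv \<beta>) d \<triangleleft>\<^bsub>T.MN.T\<^esub> f p)"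
      using dp fp L.M.rsmult_closed[OF dp(1) fp]
      unfolding t L.sweedler_pure[OF gh fgh(1) dp] by (simp add: conv_eq i comult(3)[OF inv(3,2)])
    also have "\<dots> = ?F (tensor_assoc A (C (inv \<gamma>)) (C (inv \<beta>)) (C (inv \<alpha>))
        (T.MN_P.pure (\<Delta> (inv \<gamma>) (inv \<beta>) d) p))"
      by (rule T.sweedler_assoc_pure[OF fgh(3,2,1) \<Delta>d dp(2), symmetric])
    finally show "sweedler A (C (inv \<gamma> \<otimes> inv \<beta>)) (conv \<beta> g \<gamma> h) f t =
        ?F (tensor_assoc A (C (inv \<gamma>)) (C (inv \<beta>)) (C (inv \<alpha>))
          (tensor_lift (tensor A T.MN.T (C (inv \<alpha>))) (\<lambda>d p. T.MN_P.pure (\<Delta> (inv \<gamma>) (inv \<beta>) d) p) t))"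
      using dp by (simp add: t p1)
  qed
  also have "\<dots> = ?F (tensor_map A (C (inv \<gamma>)) T.NP.T id (\<Delta> (inv \<beta>) (inv \<alpha>)) r)"
    using coassoc[OF inv(3,2,1) c(1)] by (simp add: l_def r_def)
  also have "\<dots> = sweedler A (C (inv \<gamma>)) h (conv \<alpha> f \<beta> g) r"
    unfolding tensor_map_def id_apply
    by (rule R.tensor_eqI[OF R.A_group additive_comp[OF m2 Fa] R.sweedler_additive[OF fgh(3) fg] _ r])
      (auto simp: p2 R.sweedler_pure[OF fgh(3) fg] fg_apply
        T.M_NP.sweedler_pure[OF fgh(3) T.NP.sweedler_linear[OF fgh(2,1)]] additive_closed[OF comult(1)[OF inv(2,1)]])
  also have "\<dots> = conv (\<alpha> \<otimes> \<beta>) (conv \<alpha> f \<beta> g) \<gamma> h c"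
    unfolding conv_eq[of "\<alpha> \<otimes> \<beta>"] using c inv by (simp add: i r_def m_assoc)
  finally show "conv (\<alpha> \<otimes> \<beta>) (conv \<alpha> f \<beta> g) \<gamma> h c = conv \<alpha> f (\<beta> \<otimes> \<gamma>) (conv \<beta> g \<gamma> h) c" by simp
qed

text \<open>The counit as an element of \<open>R\<^sub>e\<close>, that is, as a function undefined outside the carrier.\<close>

definition eps where "eps = (\<lambda>c\<in>carrier (C \<one>). \<epsilon> c)"

lemma eps_closed: "eps \<in> carrier (dual \<one>)"
  using dual_restrictI[OF one_closed, of \<epsilon>] counit_linear by (simp add: eps_def)

lemma eps_apply: "c \<in> carrier (C \<one>) \<Longrightarrow> eps c = \<epsilon> c"
  by (simp add: eps_def)

lemma eps_linear: "left_linear A (C \<one>) eps"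
  using dual_linear[OF eps_closed] by simp

lemma conv_eps_left:
  assumes \<beta>: "\<beta> \<in> carrier G" and g: "g \<in> carrier (dual \<beta>)"
  shows "conv \<one> eps \<beta> g = g"
proof (rule dual_ext)
  show "conv \<one> eps \<beta> g \<in> carrier (dual \<beta>)" using conv_closed[OF one_closed \<beta> eps_closed g] \<beta> by simp
  have inv: "inv \<beta> \<in> carrier G" using \<beta> by simp
  interpret CC: bimodule_pair A "C (inv \<beta>)" "C \<one>" by (rule C_pair) (use \<beta> in auto)
  interpret CA: bimodule_pair A "C (inv \<beta>)" "regular A"
    by (intro bimodule_pair.intro tensor_factors.intro C_bimodule[OF inv] regular_bimodule A.ring_axioms)
  note gl = dual_linear[OF g]
  have b1: "balanced A (C (inv \<beta>)) (C \<one>) CA.T (\<lambda>d e. CA.pure d (\<epsilon> e))"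
    unfolding balanced_def
    using biadditive_comp[OF CA.pure_biadditive additive_id, of "C \<one>" \<epsilon>] counit additive_closed[OF counit(1)]
    by (auto simp: CA.pure_middle additive_def)
  have b2: "balanced A (C (inv \<beta>)) (regular A) (C (inv \<beta>)) (\<lambda>d a. d \<triangleleft>\<^bsub>C (inv \<beta>)\<^esub> a)"
    unfolding balanced_def
    by (intro conjI biadditiveI) (auto simp: CC.M.rsmult_closed CC.M.rsmult_distr_ring CC.M.rsmult_distr_mod CC.M.rsmult_assoc)
  note m = CC.tensor_lift_additive[OF CA.T_abelian_group b1]
    and mp = CC.tensor_lift_pure[OF CA.T_abelian_group b1]
    and k = CA.tensor_lift_additive[OF CC.M.abelian_group_axioms b2]
    and kp = CA.tensor_lift_pure[OF CC.M.abelian_group_axioms b2]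
  fix c assume c: "c \<in> carrier (C (inv \<beta>))"
  have \<Delta>c: "\<Delta> (inv \<beta>) \<one> c \<in> carrier CC.T"
    using additive_closed[OF comult(1)[OF inv one_closed]] c inv by simp
  have "conv \<one> eps \<beta> g c = sweedler A (C (inv \<beta>)) g eps (\<Delta> (inv \<beta>) \<one> c)"
    using c \<beta> by (simp add: conv_eq)
  also have "\<dots> = g (tensor_lift (C (inv \<beta>)) (\<lambda>d a. d \<triangleleft>\<^bsub>C (inv \<beta>)\<^esub> a)
      (tensor_map A (C (inv \<beta>)) (regular A) id \<epsilon> (\<Delta> (inv \<beta>) \<one> c)))"
    unfolding tensor_map_def id_apply
    by (rule CC.tensor_eqI[OF CC.A_group CC.sweedler_additive[OF gl eps_linear]
          additive_comp[OF additive_comp[OF m k] dual_additive[OF g]] _ \<Delta>c])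
      (auto simp: CC.sweedler_pure[OF gl eps_linear] mp kp eps_apply additive_closed[OF counit(1)])
  also have "\<dots> = g c" using counit_right[OF inv c] by simp
  finally show "conv \<one> eps \<beta> g c = g c" .
qed (rule g)

text \<open>Here \<open>\<epsilon> (m f(n)) = \<epsilon>(m) f(n) = f (\<epsilon>(m) n)\<close>, by right linearity of \<open>\<epsilon>\<close> and left linearity of
  \<open>f\<close>.\<close>

lemma conv_eps_right:
  assumes \<alpha>: "\<alpha> \<in> carrier G" and f: "f \<in> carrier (dual \<alpha>)"
  shows "conv \<alpha> f \<one> eps = f"
proof (rule dual_ext)
  show "conv \<alpha> f \<one> eps \<in> carrier (dual \<alpha>)" using conv_closed[OF \<alpha> one_closed f eps_closed] \<alpha> by simp
  have inv: "inv \<alpha> \<in> carrier G" using \<alpha> by simp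
  interpret CC: bimodule_pair A "C \<one>" "C (inv \<alpha>)" by (rule C_pair) (use \<alpha> in auto)
  interpret AC: bimodule_pair A "regular A" "C (inv \<alpha>)"
    by (intro bimodule_pair.intro tensor_factors.intro C_bimodule[OF inv] regular_bimodule A.ring_axioms)
  note fl = dual_linear[OF f]
  have b1: "balanced A (C \<one>) (C (inv \<alpha>)) AC.T (\<lambda>d e. AC.pure (\<epsilon> d) e)"
    unfolding balanced_def
    using biadditive_comp[OF AC.pure_biadditive _ additive_id, of "C \<one>" \<epsilon>] counit additive_closed[OF counit(1)]
    by (auto simp: AC.pure_middle[symmetric] additive_def)
  have b2: "balanced A (regular A) (C (inv \<alpha>)) (C (inv \<alpha>)) (\<lambda>a d. a \<triangleright>\<^bsub>C (inv \<alpha>)\<^esub> d)"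
    unfolding balanced_def
    by (intro conjI biadditiveI) (auto simp: CC.N.lsmult_closed CC.N.lsmult_distr_ring CC.N.lsmult_distr_mod CC.N.lsmult_assoc)
  note m = CC.tensor_lift_additive[OF AC.T_abelian_group b1]
    and mp = CC.tensor_lift_pure[OF AC.T_abelian_group b1]
    and k = AC.tensor_lift_additive[OF CC.N.abelian_group_axioms b2]
    and kp = AC.tensor_lift_pure[OF CC.N.abelian_group_axioms b2]
  fix c assume c: "c \<in> carrier (C (inv \<alpha>))"
  have \<Delta>c: "\<Delta> \<one> (inv \<alpha>) c \<in> carrier CC.T"
    using additive_closed[OF comult(1)[OF one_closed inv]] c inv by simp
  have "conv \<alpha> f \<one> eps c = sweedler A (C \<one>) eps f (\<Delta> \<one> (inv \<alpha>) c)"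
    using c \<alpha> by (simp add: conv_eq)
  also have "\<dots> = f (tensor_lift (C (inv \<alpha>)) (\<lambda>a d. a \<triangleright>\<^bsub>C (inv \<alpha>)\<^esub> d)
      (tensor_map A (regular A) (C (inv \<alpha>)) \<epsilon> id (\<Delta> \<one> (inv \<alpha>) c)))"
    unfolding tensor_map_def id_apply
    by (rule CC.tensor_eqI[OF CC.A_group CC.sweedler_additive[OF eps_linear fl]
          additive_comp[OF additive_comp[OF m k] dual_additive[OF f]] _ \<Delta>c])
      (auto simp: CC.sweedler_pure[OF eps_linear fl] mp kp eps_apply additive_closed[OF counit(1)] dual_closed[OF f]
        CC.M.rsmult_closed counit(3) dual_lact[OF f])
  also have "\<dots> = f c" using counit_left[OF inv c] by simp
  finally show "conv \<alpha> f \<one> eps c = f c" .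
qed (rule f)

sublocale DR: abelian_family "carrier G" dual
  by (rule abelian_family.intro) (rule dual_abelian_group)

lemma Rdual_simps:
  "carrier Rdual = carrier DR.D" "zero Rdual = zero DR.D" "add Rdual = add DR.D"
  "mult Rdual = bilin_ext (carrier G) dual dual DR.D (\<lambda>\<alpha> f \<beta> g. \<rho> (\<alpha> \<otimes> \<beta>) (conv \<alpha> f \<beta> g))"
  "one Rdual = \<rho> \<one> eps"
  by (simp_all add: Rdual_def eps_def)

lemma Rdual_same_add: "same_add DR.D Rdual"
  by (simp add: same_add_def Rdual_simps)

lemma Rdual_pairing: "graded_pairing (carrier G) dual dual DR.D (\<lambda>\<alpha> f \<beta> g. \<rho> (\<alpha> \<otimes> \<beta>) (conv \<alpha> f \<beta> g))"
  by (intro graded_pairing.intro graded_pairing_axioms.intro DR.abelian_family_axioms DR.dsum_abelian_group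
      biadditive_post[OF conv_biadditive DR.dsum_in_additive]) auto

lemma Rdual_mult_biadditive: "biadditive Rdual Rdual Rdual (mult Rdual)"
  unfolding Rdual_simps(4)
  using graded_pairing.bilin_ext_biadditive[OF Rdual_pairing]
    same_add_biadditive[OF Rdual_same_add Rdual_same_add Rdual_same_add] by simp

lemma Rdual_mult:
  "\<lbrakk>\<alpha> \<in> carrier G; \<beta> \<in> carrier G; f \<in> carrier (dual \<alpha>); g \<in> carrier (dual \<beta>)\<rbrakk> \<Longrightarrow>
    \<rho> \<alpha> f \<otimes>\<^bsub>Rdual\<^esub> \<rho> \<beta> g = \<rho> (\<alpha> \<otimes> \<beta>) (conv \<alpha> f \<beta> g)"
  unfolding Rdual_simps(4) by (rule graded_pairing.bilin_ext_in[OF Rdual_pairing])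

lemma Rdual_abelian_group: "abelian_group Rdual"
  by (rule same_add_abelian_group[OF Rdual_same_add DR.dsum_abelian_group])

lemma Rdual_graded_group: "graded_group G Rdual Rdual_deg"
  unfolding Rdual_deg_def by (rule graded_group_same_add[OF Rdual_same_add dsum_graded[OF dual_abelian_group]])

lemma Rdual_degE: "r \<in> Rdual_deg \<alpha> \<Longrightarrow> \<exists>f\<in>carrier (dual \<alpha>). r = \<rho> \<alpha> f"
  by (auto simp: Rdual_deg_def dsum_deg_def)

lemma \<rho>_deg: "f \<in> carrier (dual \<alpha>) \<Longrightarrow> \<rho> \<alpha> f \<in> Rdual_deg \<alpha>"
  by (auto simp: Rdual_deg_def dsum_deg_def)

lemma Rdual_graded_ring: "graded_ring G Rdual Rdual_deg"
proof -
  note b = Rdual_mult_biadditive and gen = graded_generated[OF Rdual_graded_group] and ab = Rdual_abelian_group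
  have one: "\<one>\<^bsub>Rdual\<^esub> \<in> carrier Rdual"
    by (simp add: Rdual_simps DR.dsum_in_closed eps_closed)
  have "ring Rdual"
  proof (rule ringI[OF ab])
    show "monoid Rdual"
    proof (rule monoidI)
      fix r s t assume rst: "r \<in> carrier Rdual" "s \<in> carrier Rdual" "t \<in> carrier Rdual"
      show "r \<otimes>\<^bsub>Rdual\<^esub> s \<in> carrier Rdual" by (rule biadditive_closed[OF b rst(1,2)])
      show "r \<otimes>\<^bsub>Rdual\<^esub> s \<otimes>\<^bsub>Rdual\<^esub> t = r \<otimes>\<^bsub>Rdual\<^esub> (s \<otimes>\<^bsub>Rdual\<^esub> t)"
      proof (rule biadditive_assocI[OF ab ab ab ab gen gen gen b b b b _ rst])
        fix r s t assume "r \<in> (\<Union>\<alpha>\<in>carrier G. Rdual_deg \<alpha>)" "s \<in> (\<Union>\<alpha>\<in>carrier G. Rdual_deg \<alpha>)"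
          "t \<in> (\<Union>\<alpha>\<in>carrier G. Rdual_deg \<alpha>)"
        then obtain \<alpha> \<beta> \<gamma> f g h where "\<alpha> \<in> carrier G" "\<beta> \<in> carrier G" "\<gamma> \<in> carrier G" "f \<in> carrier (dual \<alpha>)"
          "g \<in> carrier (dual \<beta>)" "h \<in> carrier (dual \<gamma>)" "r = \<rho> \<alpha> f" "s = \<rho> \<beta> g" "t = \<rho> \<gamma> h"
          using Rdual_degE by (metis (no_types, lifting) UN_E)
        then show "r \<otimes>\<^bsub>Rdual\<^esub> s \<otimes>\<^bsub>Rdual\<^esub> t = r \<otimes>\<^bsub>Rdual\<^esub> (s \<otimes>\<^bsub>Rdual\<^esub> t)"
          by (simp add: Rdual_mult conv_closed conv_assoc m_assoc)
      qed
    next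
      fix r assume r: "r \<in> carrier Rdual"
      show "\<one>\<^bsub>Rdual\<^esub> \<otimes>\<^bsub>Rdual\<^esub> r = r"
        by (rule additive_eqI[OF ab ab gen biadditive_right[OF b one] additive_id _ r])
          (auto dest!: Rdual_degE simp: Rdual_simps(5) Rdual_mult eps_closed conv_eps_left)
      show "r \<otimes>\<^bsub>Rdual\<^esub> \<one>\<^bsub>Rdual\<^esub> = r"
        by (rule additive_eqI[OF ab ab gen biadditive_left[OF b one] additive_id _ r])
          (auto dest!: Rdual_degE simp: Rdual_simps(5) Rdual_mult eps_closed conv_eps_right)
    qed (rule one)
  qed (use biadditive_add_left[OF b] biadditive_add_right[OF b] in auto)
  moreover have "r \<otimes>\<^bsub>Rdual\<^esub> s \<in> Rdual_deg (\<alpha> \<otimes> \<beta>)"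
    if "\<alpha> \<in> carrier G" "\<beta> \<in> carrier G" "r \<in> Rdual_deg \<alpha>" "s \<in> Rdual_deg \<beta>" for \<alpha> \<beta> r s
    using Rdual_degE[OF that(3)] Rdual_degE[OF that(4)] that(1,2) by (auto simp: Rdual_mult intro!: \<rho>_deg conv_closed)
  ultimately show ?thesis
    using Rdual_graded_group by (auto simp: graded_ring_def Rdual_simps(5) intro: \<rho>_deg eps_closed)
qed

end


section \<open>The graded module \<open>A{G}\<close>\<close>

context grouplike_coring
begin

sublocale DA: abelian_family "carrier G" "\<lambda>_. A"
  by (rule abelian_family.intro) (rule A.abelian_group_axioms)

lemma AG_simps:
  "carrier AG = carrier DA.D" "zero AG = zero DA.D" "add AG = add DA.D"
  "rsmult AG = bilin_ext (carrier G) (\<lambda>_. A) dual DA.D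
    (\<lambda>\<alpha> a \<beta> f. \<mu> (\<alpha> \<otimes> \<beta>) (f (x (inv \<beta>) \<triangleleft>\<^bsub>C (inv \<beta>)\<^esub> a)))"
  by (simp_all add: AG_def)

lemma AG_same_add: "same_add DA.D AG"
  by (simp add: same_add_def AG_simps)

lemma x_ract_closed: "\<lbrakk>\<alpha> \<in> carrier G; a \<in> carrier A\<rbrakk> \<Longrightarrow> x \<alpha> \<triangleleft>\<^bsub>C \<alpha>\<^esub> a \<in> carrier (C \<alpha>)"
  using bimodule.rsmult_closed[OF C_bimodule] x_closed by blast

lemma \<mu>_additive: "\<alpha> \<in> carrier G \<Longrightarrow> additive A DA.D (\<mu> \<alpha>)"
  unfolding \<mu>_def by (rule DA.dsum_in_additive)

lemma \<mu>_closed: "\<lbrakk>\<alpha> \<in> carrier G; a \<in> carrier A\<rbrakk> \<Longrightarrow> \<mu> \<alpha> a \<in> carrier AG"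
  unfolding \<mu>_def AG_simps by (rule DA.dsum_in_closed)

lemma \<mu>_apply: "\<beta> \<in> carrier G \<Longrightarrow> \<mu> \<alpha> a \<beta> = (if \<beta> = \<alpha> then a else \<zero>\<^bsub>A\<^esub>)"
  unfolding \<mu>_def by (rule DA.dsum_in_apply)

lemma AG_pairing: "graded_pairing (carrier G) (\<lambda>_. A) dual DA.D
    (\<lambda>\<alpha> a \<beta> f. \<mu> (\<alpha> \<otimes> \<beta>) (f (x (inv \<beta>) \<triangleleft>\<^bsub>C (inv \<beta>)\<^esub> a)))"
proof (intro graded_pairing.intro graded_pairing_axioms.intro DA.abelian_family_axioms DR.abelian_family_axioms
    DA.dsum_abelian_group)
  fix \<alpha> \<beta> assume ab: "\<alpha> \<in> carrier G" "\<beta> \<in> carrier G"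
  interpret Cb: bimodule A A "C (inv \<beta>)" using ab by (intro C_bimodule) simp
  have x: "x (inv \<beta>) \<in> carrier (C (inv \<beta>))" using ab by (simp add: x_closed)
  show "biadditive A (dual \<beta>) DA.D (\<lambda>a f. \<mu> (\<alpha> \<otimes> \<beta>) (f (x (inv \<beta>) \<triangleleft>\<^bsub>C (inv \<beta>)\<^esub> a)))"
  proof (rule biadditive_post[OF _ \<mu>_additive])
    show "biadditive A (dual \<beta>) A (\<lambda>a f. f (x (inv \<beta>) \<triangleleft>\<^bsub>C (inv \<beta>)\<^esub> a))"
      by (rule biadditiveI) (use x in \<open>auto simp: dual_closed Cb.rsmult_closed Cb.rsmult_distr_ring
        additive_add[OF dual_additive] dual_simps\<close>)
  qed (use ab in simp)
qed

lemma AG_act_biadditive: "biadditive AG Rdual AG (rsmult AG)"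
  unfolding AG_simps(4)
  using graded_pairing.bilin_ext_biadditive[OF AG_pairing]
    same_add_biadditive[OF AG_same_add Rdual_same_add AG_same_add] by simp

lemma AG_act:
  "\<lbrakk>\<alpha> \<in> carrier G; \<beta> \<in> carrier G; a \<in> carrier A; f \<in> carrier (dual \<beta>)\<rbrakk> \<Longrightarrow>
    \<mu> \<alpha> a \<triangleleft>\<^bsub>AG\<^esub> \<rho> \<beta> f = \<mu> (\<alpha> \<otimes> \<beta>) (f (x (inv \<beta>) \<triangleleft>\<^bsub>C (inv \<beta>)\<^esub> a))"
  unfolding AG_simps(4) \<mu>_def using graded_pairing.bilin_ext_in[OF AG_pairing] by (simp add: \<mu>_def)

lemma AG_abelian_group: "abelian_group AG"
  by (rule same_add_abelian_group[OF AG_same_add DA.dsum_abelian_group])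

lemma AG_graded_group: "graded_group G AG AG_deg"
  unfolding AG_deg_def by (rule graded_group_same_add[OF AG_same_add dsum_graded[OF A.abelian_group_axioms]])

lemma AG_degE: "p \<in> AG_deg \<alpha> \<Longrightarrow> \<exists>a\<in>carrier A. p = \<mu> \<alpha> a"
  by (auto simp: AG_deg_def dsum_deg_def \<mu>_def)

lemma \<mu>_deg: "a \<in> carrier A \<Longrightarrow> \<mu> \<alpha> a \<in> AG_deg \<alpha>"
  by (auto simp: AG_deg_def dsum_deg_def \<mu>_def)

text \<open>By right linearity, the comultiplication sends \<open>x a\<close> of degree \<open>\<gamma>\<inverse>\<beta>\<inverse>\<close> to \<open>x \<otimes> x a\<close>, with the
  two factors in degrees \<open>\<gamma>\<inverse>\<close> and \<open>\<beta>\<inverse>\<close>.\<close>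

lemma conv_x:
  assumes "\<beta> \<in> carrier G" "\<gamma> \<in> carrier G" "f \<in> carrier (dual \<beta>)" "g \<in> carrier (dual \<gamma>)" "a \<in> carrier A"
  shows "conv \<beta> f \<gamma> g (x (inv (\<beta> \<otimes> \<gamma>)) \<triangleleft>\<^bsub>C (inv (\<beta> \<otimes> \<gamma>))\<^esub> a) =
    g (x (inv \<gamma>) \<triangleleft>\<^bsub>C (inv \<gamma>)\<^esub> f (x (inv \<beta>) \<triangleleft>\<^bsub>C (inv \<beta>)\<^esub> a))"
proof -
  have i: "inv (\<beta> \<otimes> \<gamma>) = inv \<gamma> \<otimes> inv \<beta>" and inv: "inv \<gamma> \<in> carrier G" "inv \<beta> \<in> carrier G"
    using assms by (simp_all add: inv_mult_group)
  interpret CC: bimodule_pair A "C (inv \<gamma>)" "C (inv \<beta>)" by (rule C_pair[OF inv])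
  have xc: "x (inv \<gamma> \<otimes> inv \<beta>) \<in> carrier (C (inv \<gamma> \<otimes> inv \<beta>))" using inv by (simp add: x_closed)
  have "\<Delta> (inv \<gamma>) (inv \<beta>) (x (inv \<gamma> \<otimes> inv \<beta>) \<triangleleft>\<^bsub>C (inv \<gamma> \<otimes> inv \<beta>)\<^esub> a) =
      CC.pure (x (inv \<gamma>)) (x (inv \<beta>) \<triangleleft>\<^bsub>C (inv \<beta>)\<^esub> a)"
    using comult(3)[OF inv assms(5) xc] comult_x[OF inv] CC.tensor_ract(2)[OF assms(5)] x_closed inv by simp
  then show ?thesis
    using CC.sweedler_pure[OF dual_linear[OF assms(4)] dual_linear[OF assms(3)] x_closed[OF inv(1)]
        x_ract_closed[OF inv(2) assms(5)]] x_ract_closed[of "inv \<gamma> \<otimes> inv \<beta>" a] inv assms(5)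
    by (simp add: conv_eq i)
qed

lemma eps_x: "a \<in> carrier A \<Longrightarrow> eps (x \<one> \<triangleleft>\<^bsub>C \<one>\<^esub> a) = a"
  using x_ract_closed[of \<one> a] x_closed[of \<one>] by (simp add: eps_def counit(3) counit_x)

lemma AG_graded_module: "graded_module G Rdual AG Rdual_deg AG_deg"
proof -
  note b = AG_act_biadditive and gen = graded_generated[OF AG_graded_group] and ab = AG_abelian_group
  have R: "ring Rdual" "\<one>\<^bsub>Rdual\<^esub> \<in> carrier Rdual"
    using Rdual_graded_ring ring.ring_simprules(6) by (auto simp: graded_ring_def)
  have assoc: "p \<triangleleft>\<^bsub>AG\<^esub> (r \<otimes>\<^bsub>Rdual\<^esub> r') = (p \<triangleleft>\<^bsub>AG\<^esub> r) \<triangleleft>\<^bsub>AG\<^esub> r'"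
    if prr: "p \<in> carrier AG" "r \<in> carrier Rdual" "r' \<in> carrier Rdual" for p r r'
  proof (rule biadditive_assocI[OF ab Rdual_abelian_group Rdual_abelian_group ab gen
        graded_generated[OF Rdual_graded_group] graded_generated[OF Rdual_graded_group]
        b b Rdual_mult_biadditive b _ prr, symmetric])
    fix p r s assume "p \<in> (\<Union>\<alpha>\<in>carrier G. AG_deg \<alpha>)" "r \<in> (\<Union>\<alpha>\<in>carrier G. Rdual_deg \<alpha>)"
      "s \<in> (\<Union>\<alpha>\<in>carrier G. Rdual_deg \<alpha>)"
    then obtain \<alpha> \<beta> \<gamma> a f g where *: "\<alpha> \<in> carrier G" "\<beta> \<in> carrier G" "\<gamma> \<in> carrier G" "a \<in> carrier A"
      "f \<in> carrier (dual \<beta>)" "g \<in> carrier (dual \<gamma>)" "p = \<mu> \<alpha> a" "r = \<rho> \<beta> f" "s = \<rho> \<gamma> g"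
      using Rdual_degE AG_degE by (metis (no_types, lifting) UN_E)
    then show "(p \<triangleleft>\<^bsub>AG\<^esub> r) \<triangleleft>\<^bsub>AG\<^esub> s = p \<triangleleft>\<^bsub>AG\<^esub> (r \<otimes>\<^bsub>Rdual\<^esub> s)"
      by (simp add: AG_act Rdual_mult conv_closed conv_x dual_closed x_ract_closed m_assoc)
  qed
  have one: "p \<triangleleft>\<^bsub>AG\<^esub> \<one>\<^bsub>Rdual\<^esub> = p" if p: "p \<in> carrier AG" for p
    by (rule additive_eqI[OF ab ab gen biadditive_left[OF b R(2)] additive_id _ p])
      (auto dest!: AG_degE simp: Rdual_simps(5) AG_act eps_closed eps_x)
  have deg: "p \<triangleleft>\<^bsub>AG\<^esub> r \<in> AG_deg (\<alpha> \<otimes> \<beta>)"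
    if "\<alpha> \<in> carrier G" "\<beta> \<in> carrier G" "p \<in> AG_deg \<alpha>" "r \<in> Rdual_deg \<beta>" for \<alpha> \<beta> p r
    using AG_degE[OF that(3)] Rdual_degE[OF that(4)] that(1,2)
    by (auto simp: AG_act intro!: \<mu>_deg dual_closed x_ract_closed)
  show ?thesis
    by (intro graded_module.intro graded_right_module.intro right_module.intro right_module_axioms.intro
        graded_right_module_axioms.intro is_group R ab Rdual_graded_ring AG_graded_group)
      (auto simp: biadditive_closed[OF b] biadditive_add_left[OF b] biadditive_add_right[OF b] assoc one deg)
qed

end

section \<open>Endomorphisms of \<open>A{G}\<close>\<close>

context grouplike_coring
begin

sublocale M: graded_module G Rdual AG Rdual_deg AG_deg by (rule AG_graded_module)
sublocale E: graded_hom G Rdual AG AG Rdual_deg AG_deg AG_deg ..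
sublocale H: graded_hom G Rdual AG "regular Rdual" Rdual_deg AG_deg Rdual_deg
  by (intro graded_hom.intro M.graded_right_module_axioms M.regular_graded_module)

lemma S'_iff: "b \<in> carrier S' \<longleftrightarrow> b \<in> carrier G \<rightarrow>\<^sub>E carrier A \<and>
    (\<forall>\<alpha>\<in>carrier G. \<forall>\<beta>\<in>carrier G. \<forall>f\<in>carrier (dual \<beta>).
      f (b (\<alpha> \<otimes> \<beta>) \<triangleright>\<^bsub>C (inv \<beta>)\<^esub> x (inv \<beta>)) = f (x (inv \<beta>) \<triangleleft>\<^bsub>C (inv \<beta>)\<^esub> b \<alpha>))"
  by (simp add: S'_def)

lemma S'_simps: "zero S' = (\<lambda>\<alpha>\<in>carrier G. \<zero>\<^bsub>A\<^esub>)" "b \<oplus>\<^bsub>S'\<^esub> c = (\<lambda>\<alpha>\<in>carrier G. b \<alpha> \<oplus>\<^bsub>A\<^esub> c \<alpha>)"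
  "b \<otimes>\<^bsub>S'\<^esub> c = (\<lambda>\<alpha>\<in>carrier G. b \<alpha> \<otimes>\<^bsub>A\<^esub> c \<alpha>)" "one S' = (\<lambda>\<alpha>\<in>carrier G. \<one>\<^bsub>A\<^esub>)"
  by (simp_all add: S'_def)

lemma S'_closed: "\<lbrakk>b \<in> carrier S'; \<alpha> \<in> carrier G\<rbrakk> \<Longrightarrow> b \<alpha> \<in> carrier A"
  by (auto simp: S'_iff)

lemma S'_eq:
  assumes "b \<in> carrier S'" "\<alpha> \<in> carrier G" "\<beta> \<in> carrier G" "f \<in> carrier (dual \<beta>)"
  shows "f (x (inv \<beta>) \<triangleleft>\<^bsub>C (inv \<beta>)\<^esub> b \<alpha>) = b (\<alpha> \<otimes> \<beta>) \<otimes>\<^bsub>A\<^esub> f (x (inv \<beta>))"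
proof -
  have "b (\<alpha> \<otimes> \<beta>) \<in> carrier A" using assms S'_closed by simp
  moreover have "f (b (\<alpha> \<otimes> \<beta>) \<triangleright>\<^bsub>C (inv \<beta>)\<^esub> x (inv \<beta>)) = f (x (inv \<beta>) \<triangleleft>\<^bsub>C (inv \<beta>)\<^esub> b \<alpha>)"
    using assms unfolding S'_iff by blast
  ultimately show ?thesis
    using dual_lact[OF assms(4) _ x_closed[OF inv_closed[OF assms(3)]]] by metis
qed

lemma S'_I:
  assumes "b \<in> carrier G \<rightarrow>\<^sub>E carrier A" "\<And>\<alpha> \<beta> f. \<lbrakk>\<alpha> \<in> carrier G; \<beta> \<in> carrier G; f \<in> carrier (dual \<beta>)\<rbrakk> \<Longrightarrow>
    f (x (inv \<beta>) \<triangleleft>\<^bsub>C (inv \<beta>)\<^esub> b \<alpha>) = b (\<alpha> \<otimes> \<beta>) \<otimes>\<^bsub>A\<^esub> f (x (inv \<beta>))"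
  shows "b \<in> carrier S'"
  unfolding S'_iff
proof (intro conjI ballI assms(1))
  fix \<alpha> \<beta> f assume a: "\<alpha> \<in> carrier G" "\<beta> \<in> carrier G" and f: "f \<in> carrier (dual \<beta>)"
  have "b (\<alpha> \<otimes> \<beta>) \<in> carrier A" using assms(1) a by auto
  then show "f (b (\<alpha> \<otimes> \<beta>) \<triangleright>\<^bsub>C (inv \<beta>)\<^esub> x (inv \<beta>)) = f (x (inv \<beta>) \<triangleleft>\<^bsub>C (inv \<beta>)\<^esub> b \<alpha>)"
    using dual_lact[OF f] assms(2)[OF a f] x_closed a by simp
qed

lemma S'_abelian_group: "abelian_group S'"
proof (rule abelian_group_equalizer)
  let ?N = "S' \<lparr>carrier := carrier G \<rightarrow>\<^sub>E carrier A\<rparr>"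
  let ?J = "{(\<alpha>, \<beta>, f). \<alpha> \<in> carrier G \<and> \<beta> \<in> carrier G \<and> f \<in> carrier (dual \<beta>)}"
  show "abelian_group ?N"
    by (rule abelian_group_product[where M = "\<lambda>_. A" and I = "carrier G"]) (auto simp: S'_simps A.abelian_group_axioms)
  show "abelian_group A" by (rule A.abelian_group_axioms)
  show "additive ?N A ((\<lambda>(\<alpha>, \<beta>, f) b. f (b (\<alpha> \<otimes> \<beta>) \<triangleright>\<^bsub>C (inv \<beta>)\<^esub> x (inv \<beta>))) j)" if "j \<in> ?J" for j
  proof -
    obtain \<alpha> \<beta> f where j: "j = (\<alpha>, \<beta>, f)" "\<alpha> \<in> carrier G" "\<beta> \<in> carrier G" "f \<in> carrier (dual \<beta>)"
      using \<open>j \<in> ?J\<close> by auto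
    interpret Cb: bimodule A A "C (inv \<beta>)" using j by (intro C_bimodule) simp
    show ?thesis unfolding j(1) prod.case
      by (rule additiveI) (use j in \<open>auto simp: S'_simps PiE_iff dual_closed Cb.lsmult_closed x_closed
        Cb.lsmult_distr_ring additive_add[OF dual_additive]\<close>)
  qed
  show "additive ?N A ((\<lambda>(\<alpha>, \<beta>, f) b. f (x (inv \<beta>) \<triangleleft>\<^bsub>C (inv \<beta>)\<^esub> b \<alpha>)) j)" if "j \<in> ?J" for j
  proof -
    obtain \<alpha> \<beta> f where j: "j = (\<alpha>, \<beta>, f)" "\<alpha> \<in> carrier G" "\<beta> \<in> carrier G" "f \<in> carrier (dual \<beta>)"
      using \<open>j \<in> ?J\<close> by auto
    interpret Cb: bimodule A A "C (inv \<beta>)" using j by (intro C_bimodule) simp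
    show ?thesis unfolding j(1) prod.case
      by (rule additiveI) (use j in \<open>auto simp: S'_simps PiE_iff dual_closed Cb.rsmult_closed x_closed
        Cb.rsmult_distr_ring additive_add[OF dual_additive]\<close>)
  qed
  show "carrier S' = {b \<in> carrier ?N. \<forall>j\<in>?J. (\<lambda>(\<alpha>, \<beta>, f) b. f (b (\<alpha> \<otimes> \<beta>) \<triangleright>\<^bsub>C (inv \<beta>)\<^esub> x (inv \<beta>))) j b =
      (\<lambda>(\<alpha>, \<beta>, f) b. f (x (inv \<beta>) \<triangleleft>\<^bsub>C (inv \<beta>)\<^esub> b \<alpha>)) j b}"
    by (auto simp: S'_iff)
qed auto

text \<open>The functional \<open>c\<^sub>\<alpha> \<cdot> f\<close> has the same degree as \<open>f\<close>, so the equation for \<open>b\<close> applies to it and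
  turns \<open>f (x b\<^sub>\<alpha> c\<^sub>\<alpha>)\<close> into a multiple of \<open>f (x c\<^sub>\<alpha>)\<close>.\<close>

lemma S'_mult_closed:
  assumes b: "b \<in> carrier S'" and c: "c \<in> carrier S'" shows "b \<otimes>\<^bsub>S'\<^esub> c \<in> carrier S'"
proof (rule S'_I)
  show "b \<otimes>\<^bsub>S'\<^esub> c \<in> carrier G \<rightarrow>\<^sub>E carrier A" using S'_closed[OF b] S'_closed[OF c] by (auto simp: S'_simps)
  fix \<alpha> \<beta> f assume a: "\<alpha> \<in> carrier G" "\<beta> \<in> carrier G" and f: "f \<in> carrier (dual \<beta>)"
  interpret Cb: bimodule A A "C (inv \<beta>)" using a by (intro C_bimodule) simp
  have xb: "x (inv \<beta>) \<in> carrier (C (inv \<beta>))" using a by (simp add: x_closed)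
  note cl = S'_closed[OF b] S'_closed[OF c]
  have "f (x (inv \<beta>) \<triangleleft>\<^bsub>C (inv \<beta>)\<^esub> (b \<alpha> \<otimes>\<^bsub>A\<^esub> c \<alpha>)) = (c \<alpha> \<triangleright>\<^bsub>dual \<beta>\<^esub> f) (x (inv \<beta>) \<triangleleft>\<^bsub>C (inv \<beta>)\<^esub> b \<alpha>)"
    using a cl xb by (simp add: dual_simps Cb.rsmult_assoc Cb.rsmult_closed)
  also have "\<dots> = b (\<alpha> \<otimes> \<beta>) \<otimes>\<^bsub>A\<^esub> f (x (inv \<beta>) \<triangleleft>\<^bsub>C (inv \<beta>)\<^esub> c \<alpha>)"
    using S'_eq[OF b a dual_lsmult_closed[OF a(2) f cl(2)[OF a(1)]]] xb by (simp add: dual_simps)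
  also have "\<dots> = b (\<alpha> \<otimes> \<beta>) \<otimes>\<^bsub>A\<^esub> (c (\<alpha> \<otimes> \<beta>) \<otimes>\<^bsub>A\<^esub> f (x (inv \<beta>)))"
    using S'_eq[OF c a f] by simp
  finally show "f (x (inv \<beta>) \<triangleleft>\<^bsub>C (inv \<beta>)\<^esub> (b \<otimes>\<^bsub>S'\<^esub> c) \<alpha>) = (b \<otimes>\<^bsub>S'\<^esub> c) (\<alpha> \<otimes> \<beta>) \<otimes>\<^bsub>A\<^esub> f (x (inv \<beta>))"
    using a cl dual_closed[OF f xb] by (simp add: S'_simps A.m_assoc)
qed

lemma shift_closed:
  assumes "b \<in> carrier S'" "\<sigma> \<in> carrier G" shows "shift b \<sigma> \<in> carrier S'"
proof (rule S'_I)
  show "shift b \<sigma> \<in> carrier G \<rightarrow>\<^sub>E carrier A" using assms S'_closed by (auto simp: shift_def)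
  show "f (x (inv \<beta>) \<triangleleft>\<^bsub>C (inv \<beta>)\<^esub> shift b \<sigma> \<alpha>) = shift b \<sigma> (\<alpha> \<otimes> \<beta>) \<otimes>\<^bsub>A\<^esub> f (x (inv \<beta>))"
    if "\<alpha> \<in> carrier G" "\<beta> \<in> carrier G" "f \<in> carrier (dual \<beta>)" for \<alpha> \<beta> f
    using that assms(2) S'_eq[OF assms(1) m_closed[OF assms(2) that(1)] that(2,3)]
    by (simp add: shift_def m_assoc)
qed

sublocale DS: abelian_family "carrier G" "\<lambda>_. S'"
  by (rule abelian_family.intro) (rule S'_abelian_group)

lemma GS'_simps:
  "carrier GS' = carrier DS.D" "zero GS' = zero DS.D" "add GS' = add DS.D"
  "mult GS' = bilin_ext (carrier G) (\<lambda>_. S') (\<lambda>_. S') DS.D (\<lambda>\<alpha> b \<beta> c. u (\<alpha> \<otimes> \<beta>) (shift b \<beta> \<otimes>\<^bsub>S'\<^esub> c))"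
  "one GS' = u \<one> \<one>\<^bsub>S'\<^esub>"
  by (simp_all add: GS'_def)

lemma GS'_same_add: "same_add DS.D GS'"
  by (simp add: same_add_def GS'_simps)

lemma GS'_abelian_group: "abelian_group GS'"
  by (rule same_add_abelian_group[OF GS'_same_add DS.dsum_abelian_group])

lemma GS'_graded_group: "graded_group G GS' GS'_deg"
  unfolding GS'_deg_def by (rule graded_group_same_add[OF GS'_same_add dsum_graded[OF S'_abelian_group]])

lemma u_additive: "\<sigma> \<in> carrier G \<Longrightarrow> additive S' DS.D (u \<sigma>)"
  unfolding u_def by (rule DS.dsum_in_additive)

lemma u_closed: "\<lbrakk>\<sigma> \<in> carrier G; b \<in> carrier S'\<rbrakk> \<Longrightarrow> u \<sigma> b \<in> carrier GS'"
  unfolding u_def GS'_simps by (rule DS.dsum_in_closed)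

lemma GS'_pairing: "graded_pairing (carrier G) (\<lambda>_. S') (\<lambda>_. S') DS.D
    (\<lambda>\<alpha> b \<beta> c. u (\<alpha> \<otimes> \<beta>) (shift b \<beta> \<otimes>\<^bsub>S'\<^esub> c))"
proof (intro graded_pairing.intro graded_pairing_axioms.intro DS.abelian_family_axioms DS.dsum_abelian_group)
  fix \<alpha> \<beta> assume ab: "\<alpha> \<in> carrier G" "\<beta> \<in> carrier G"
  show "biadditive S' S' DS.D (\<lambda>b c. u (\<alpha> \<otimes> \<beta>) (shift b \<beta> \<otimes>\<^bsub>S'\<^esub> c))"
  proof (rule biadditive_post[OF _ u_additive])
    show "biadditive S' S' S' (\<lambda>b c. shift b \<beta> \<otimes>\<^bsub>S'\<^esub> c)"
    proof (rule biadditiveI)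
      show "shift b \<beta> \<otimes>\<^bsub>S'\<^esub> c \<in> carrier S'" if "b \<in> carrier S'" "c \<in> carrier S'" for b c
        by (rule S'_mult_closed[OF shift_closed[OF that(1) ab(2)] that(2)])
    qed (use ab in \<open>auto simp: S'_simps shift_def S'_closed A.l_distr A.r_distr intro!: restrict_ext\<close>)
  qed (use ab in simp)
qed

lemma GS'_mult_biadditive: "biadditive GS' GS' GS' (mult GS')"
  unfolding GS'_simps(4)
  using graded_pairing.bilin_ext_biadditive[OF GS'_pairing]
    same_add_biadditive[OF GS'_same_add GS'_same_add GS'_same_add] by simp

lemma GS'_mult:
  "\<lbrakk>\<alpha> \<in> carrier G; \<beta> \<in> carrier G; b \<in> carrier S'; c \<in> carrier S'\<rbrakk> \<Longrightarrow>
    u \<alpha> b \<otimes>\<^bsub>GS'\<^esub> u \<beta> c = u (\<alpha> \<otimes> \<beta>) (shift b \<beta> \<otimes>\<^bsub>S'\<^esub> c)"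
  unfolding GS'_simps(4) using graded_pairing.bilin_ext_in[OF GS'_pairing] by (simp add: u_def)

lemma AG_GS'_simps:
  "carrier AG_GS' = carrier AG" "zero AG_GS' = zero AG" "add AG_GS' = add AG" "rsmult AG_GS' = rsmult AG"
  "lsmult AG_GS' = bilin_ext (carrier G) (\<lambda>_. S') (\<lambda>_. A) AG (\<lambda>\<sigma> b \<alpha> a. \<mu> (\<sigma> \<otimes> \<alpha>) (b \<alpha> \<otimes>\<^bsub>A\<^esub> a))"
  by (simp_all add: AG_GS'_def)

lemma \<mu>_additive_AG: "\<alpha> \<in> carrier G \<Longrightarrow> additive A AG (\<mu> \<alpha>)"
  using \<mu>_additive same_add_additive[OF same_add_refl[of A] AG_same_add] by simp

lemma act_pairing: "graded_pairing (carrier G) (\<lambda>_. S') (\<lambda>_. A) AG (\<lambda>\<sigma> b \<alpha> a. \<mu> (\<sigma> \<otimes> \<alpha>) (b \<alpha> \<otimes>\<^bsub>A\<^esub> a))"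
proof (intro graded_pairing.intro graded_pairing_axioms.intro DS.abelian_family_axioms DA.abelian_family_axioms
    AG_abelian_group)
  fix \<sigma> \<alpha> assume ab: "\<sigma> \<in> carrier G" "\<alpha> \<in> carrier G"
  show "biadditive S' A AG (\<lambda>b a. \<mu> (\<sigma> \<otimes> \<alpha>) (b \<alpha> \<otimes>\<^bsub>A\<^esub> a))"
  proof (rule biadditive_post[OF _ \<mu>_additive_AG])
    show "biadditive S' A A (\<lambda>b a. b \<alpha> \<otimes>\<^bsub>A\<^esub> a)"
      by (rule biadditiveI) (use ab in \<open>auto simp: S'_closed S'_simps A.l_distr A.r_distr\<close>)
  qed (use ab in simp)
qed

lemma act_biadditive: "biadditive GS' AG AG (lsmult AG_GS')"
  unfolding AG_GS'_simps(5)
  using graded_pairing.bilin_ext_biadditive[OF act_pairing]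
    same_add_biadditive[OF GS'_same_add AG_same_add same_add_refl[of AG]] by simp

lemma act:
  "\<lbrakk>\<sigma> \<in> carrier G; \<alpha> \<in> carrier G; b \<in> carrier S'; a \<in> carrier A\<rbrakk> \<Longrightarrow>
    u \<sigma> b \<triangleright>\<^bsub>AG_GS'\<^esub> \<mu> \<alpha> a = \<mu> (\<sigma> \<otimes> \<alpha>) (b \<alpha> \<otimes>\<^bsub>A\<^esub> a)"
  unfolding AG_GS'_simps(5) using graded_pairing.bilin_ext_in[OF act_pairing] by (simp add: u_def \<mu>_def)

lemma \<mu>_inj: "\<lbrakk>\<mu> \<alpha> a = \<mu> \<alpha> a'; \<alpha> \<in> carrier G\<rbrakk> \<Longrightarrow> a = a'"
  by (metis \<mu>_apply)

lemma \<rho>_apply: "\<beta> \<in> carrier G \<Longrightarrow> \<rho> \<alpha> f \<beta> = (if \<beta> = \<alpha> then f else \<zero>\<^bsub>dual \<beta>\<^esub>)"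
  by (rule DR.dsum_in_apply)

lemma \<rho>_inj: "\<lbrakk>\<rho> \<alpha> f = \<rho> \<alpha> f'; \<alpha> \<in> carrier G\<rbrakk> \<Longrightarrow> f = f'"
  by (metis \<rho>_apply)

text \<open>The ring \<open>A\<close> embeds into \<open>R\<^sub>e\<close> by \<open>a \<mapsto> \<epsilon> a\<close>; through this embedding \<open>R\<close>-linear maps are
  right \<open>A\<close>-linear, hence determined by their values at the elements \<open>\<mu>\<^sub>\<alpha>(1)\<close>.\<close>

lemma eps_ract_closed: "a \<in> carrier A \<Longrightarrow> eps \<triangleleft>\<^bsub>dual \<one>\<^esub> a \<in> carrier (dual \<one>)"
  by (rule dual_rsmult_closed[OF one_closed eps_closed])

lemma AG_act_eps:
  assumes "\<alpha> \<in> carrier G" "a \<in> carrier A" "b \<in> carrier A"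
  shows "\<mu> \<alpha> b \<triangleleft>\<^bsub>AG\<^esub> \<rho> \<one> (eps \<triangleleft>\<^bsub>dual \<one>\<^esub> a) = \<mu> \<alpha> (b \<otimes>\<^bsub>A\<^esub> a)"
  using AG_act[OF assms(1) one_closed assms(3) eps_ract_closed[OF assms(2)]] assms
    x_ract_closed[OF one_closed assms(3)] eps_x[OF assms(3)] by (simp add: dual_simps)

text \<open>The equations of \<open>S'\<close> for \<open>b\<close> come from computing \<open>h\<close> at \<open>\<mu>\<^sub>\<alpha>(1) \<cdot> f\<close> in two ways: directly,
  where this element is \<open>\<mu>\<^sub>\<alpha>\<^sub>\<beta>(f(x))\<close>, and as \<open>h(\<mu>\<^sub>\<alpha>(1)) \<cdot> f\<close>.\<close>

lemma END_coordinates: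
  assumes h: "h \<in> E.Hd \<sigma>" and \<sigma>: "\<sigma> \<in> carrier G"
  defines "b \<equiv> (\<lambda>\<alpha>\<in>carrier G. h (\<mu> \<alpha> \<one>\<^bsub>A\<^esub>) (\<sigma> \<otimes> \<alpha>))"
  shows "\<lbrakk>\<alpha> \<in> carrier G; a \<in> carrier A\<rbrakk> \<Longrightarrow> h (\<mu> \<alpha> a) = \<mu> (\<sigma> \<otimes> \<alpha>) (b \<alpha> \<otimes>\<^bsub>A\<^esub> a)"
    and "b \<in> carrier S'" and "\<alpha> \<in> carrier G \<Longrightarrow> h (\<mu> \<alpha> \<one>\<^bsub>A\<^esub>) = \<mu> (\<sigma> \<otimes> \<alpha>) (b \<alpha>)"
proof -
  have h1: "b \<alpha> \<in> carrier A" "h (\<mu> \<alpha> \<one>\<^bsub>A\<^esub>) = \<mu> (\<sigma> \<otimes> \<alpha>) (b \<alpha>)" if \<alpha>: "\<alpha> \<in> carrier G" for \<alpha>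
  proof -
    have "h (\<mu> \<alpha> \<one>\<^bsub>A\<^esub>) \<in> AG_deg (\<sigma> \<otimes> \<alpha>)" by (rule E.HOM_degD(5)[OF h \<alpha>]) (simp add: \<mu>_deg)
    then obtain a where a: "a \<in> carrier A" "h (\<mu> \<alpha> \<one>\<^bsub>A\<^esub>) = \<mu> (\<sigma> \<otimes> \<alpha>) a" using AG_degE by blast
    then have "b \<alpha> = a" using \<alpha> \<sigma> by (simp add: b_def \<mu>_apply)
    then show "b \<alpha> \<in> carrier A" "h (\<mu> \<alpha> \<one>\<^bsub>A\<^esub>) = \<mu> (\<sigma> \<otimes> \<alpha>) (b \<alpha>)" using a by auto
  qed
  then show "\<alpha> \<in> carrier G \<Longrightarrow> h (\<mu> \<alpha> \<one>\<^bsub>A\<^esub>) = \<mu> (\<sigma> \<otimes> \<alpha>) (b \<alpha>)" by blast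
  have \<rho>c: "\<rho> \<beta> f \<in> carrier Rdual" if "\<beta> \<in> carrier G" "f \<in> carrier (dual \<beta>)" for \<beta> f
    using that by (simp add: Rdual_simps DR.dsum_in_closed)
  show ha: "h (\<mu> \<alpha> a) = \<mu> (\<sigma> \<otimes> \<alpha>) (b \<alpha> \<otimes>\<^bsub>A\<^esub> a)" if "\<alpha> \<in> carrier G" "a \<in> carrier A" for \<alpha> a
  proof -
    have "h (\<mu> \<alpha> a) = h (\<mu> \<alpha> \<one>\<^bsub>A\<^esub> \<triangleleft>\<^bsub>AG\<^esub> \<rho> \<one> (eps \<triangleleft>\<^bsub>dual \<one>\<^esub> a))"
      using that by (simp add: AG_act_eps)
    also have "\<dots> = h (\<mu> \<alpha> \<one>\<^bsub>A\<^esub>) \<triangleleft>\<^bsub>AG\<^esub> \<rho> \<one> (eps \<triangleleft>\<^bsub>dual \<one>\<^esub> a)"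
      using that by (intro E.HOM_degD(4)[OF h] \<mu>_closed \<rho>c eps_ract_closed) auto
    finally show ?thesis using that \<sigma> h1 by (simp add: AG_act_eps)
  qed
  show "b \<in> carrier S'"
  proof (rule S'_I)
    show "b \<in> carrier G \<rightarrow>\<^sub>E carrier A" using h1(1) by (auto simp: b_def)
    fix \<alpha> \<beta> f assume a: "\<alpha> \<in> carrier G" "\<beta> \<in> carrier G" and f: "f \<in> carrier (dual \<beta>)"
    interpret Cb: bimodule A A "C (inv \<beta>)" using a by (intro C_bimodule) simp
    have xb: "x (inv \<beta>) \<in> carrier (C (inv \<beta>))" using a by (simp add: x_closed)
    have "h (\<mu> \<alpha> \<one>\<^bsub>A\<^esub> \<triangleleft>\<^bsub>AG\<^esub> \<rho> \<beta> f) = h (\<mu> \<alpha> \<one>\<^bsub>A\<^esub>) \<triangleleft>\<^bsub>AG\<^esub> \<rho> \<beta> f"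
      using a f by (intro E.HOM_degD(4)[OF h] \<mu>_closed \<rho>c) auto
    then have "\<mu> (\<sigma> \<otimes> \<alpha> \<otimes> \<beta>) (b (\<alpha> \<otimes> \<beta>) \<otimes>\<^bsub>A\<^esub> f (x (inv \<beta>))) =
        \<mu> (\<sigma> \<otimes> \<alpha> \<otimes> \<beta>) (f (x (inv \<beta>) \<triangleleft>\<^bsub>C (inv \<beta>)\<^esub> b \<alpha>))"
      using a \<sigma> f h1 xb by (simp add: AG_act Cb.rsmult_one ha dual_closed m_assoc)
    then show "f (x (inv \<beta>) \<triangleleft>\<^bsub>C (inv \<beta>)\<^esub> b \<alpha>) = b (\<alpha> \<otimes> \<beta>) \<otimes>\<^bsub>A\<^esub> f (x (inv \<beta>))"
      using a \<sigma> by (auto dest: \<mu>_inj)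
  qed
qed

text \<open>Conversely, the equation of \<open>b\<close> for the functional \<open>a \<cdot> f\<close> gives linearity at \<open>\<mu>\<^sub>\<alpha>(a) \<cdot> f\<close>.\<close>

lemma act_END:
  assumes \<sigma>: "\<sigma> \<in> carrier G" and b: "b \<in> carrier S'"
  shows "(\<lambda>p\<in>carrier AG. u \<sigma> b \<triangleright>\<^bsub>AG_GS'\<^esub> p) \<in> E.Hd \<sigma>"
proof (rule E.HOM_degI)
  have add: "additive AG AG (lsmult AG_GS' (u \<sigma> b))"
    by (rule biadditive_right[OF act_biadditive u_closed[OF \<sigma> b]])
  note rb = M.ract_biadditive
  show "additive AG AG (\<lambda>p\<in>carrier AG. u \<sigma> b \<triangleright>\<^bsub>AG_GS'\<^esub> p)"
    using add by (auto simp: additive_def)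
  have "u \<sigma> b \<triangleright>\<^bsub>AG_GS'\<^esub> (p \<triangleleft>\<^bsub>AG\<^esub> r) = (u \<sigma> b \<triangleright>\<^bsub>AG_GS'\<^esub> p) \<triangleleft>\<^bsub>AG\<^esub> r"
    if pr: "p \<in> carrier AG" "r \<in> carrier Rdual" for p r
  proof (rule biadditive_eqI[OF AG_abelian_group Rdual_abelian_group AG_abelian_group
        graded_generated[OF AG_graded_group] graded_generated[OF Rdual_graded_group]
        biadditive_post[OF rb add] biadditive_comp[OF rb add additive_id] _ pr])
    fix p r assume "p \<in> (\<Union>\<alpha>\<in>carrier G. AG_deg \<alpha>)" "r \<in> (\<Union>\<alpha>\<in>carrier G. Rdual_deg \<alpha>)"
    then obtain \<alpha> \<beta> a f where *: "\<alpha> \<in> carrier G" "\<beta> \<in> carrier G" "a \<in> carrier A" "f \<in> carrier (dual \<beta>)"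
      "p = \<mu> \<alpha> a" "r = \<rho> \<beta> f"
      using Rdual_degE AG_degE by (metis (no_types, lifting) UN_E)
    interpret Cb: bimodule A A "C (inv \<beta>)" using * by (intro C_bimodule) simp
    have xb: "x (inv \<beta>) \<in> carrier (C (inv \<beta>))" using * by (simp add: x_closed)
    have "f (x (inv \<beta>) \<triangleleft>\<^bsub>C (inv \<beta>)\<^esub> (b \<alpha> \<otimes>\<^bsub>A\<^esub> a)) = (a \<triangleright>\<^bsub>dual \<beta>\<^esub> f) (x (inv \<beta>) \<triangleleft>\<^bsub>C (inv \<beta>)\<^esub> b \<alpha>)"
      using * S'_closed[OF b] xb by (simp add: dual_simps Cb.rsmult_assoc Cb.rsmult_closed)
    also have "\<dots> = b (\<alpha> \<otimes> \<beta>) \<otimes>\<^bsub>A\<^esub> f (x (inv \<beta>) \<triangleleft>\<^bsub>C (inv \<beta>)\<^esub> a)"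
      using S'_eq[OF b *(1,2) dual_lsmult_closed[OF *(2,4,3)]] xb by (simp add: dual_simps)
    finally show "u \<sigma> b \<triangleright>\<^bsub>AG_GS'\<^esub> (p \<triangleleft>\<^bsub>AG\<^esub> r) = (u \<sigma> b \<triangleright>\<^bsub>AG_GS'\<^esub> p) \<triangleleft>\<^bsub>AG\<^esub> r"
      using * \<sigma> b S'_closed[OF b] xb
      by (simp add: AG_act act dual_closed Cb.rsmult_closed m_assoc)
  qed
  then show "(\<lambda>p\<in>carrier AG. u \<sigma> b \<triangleright>\<^bsub>AG_GS'\<^esub> p) (m \<triangleleft>\<^bsub>AG\<^esub> r) = (\<lambda>p\<in>carrier AG. u \<sigma> b \<triangleright>\<^bsub>AG_GS'\<^esub> p) m \<triangleleft>\<^bsub>AG\<^esub> r"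
    if "m \<in> carrier AG" "r \<in> carrier Rdual" for m r
    using that by (simp add: M.ract_closed)
  show "(\<lambda>p\<in>carrier AG. u \<sigma> b \<triangleright>\<^bsub>AG_GS'\<^esub> p) m \<in> AG_deg (\<sigma> \<otimes> \<alpha>)" if "\<alpha> \<in> carrier G" "m \<in> AG_deg \<alpha>" for \<alpha> m
    using AG_degE[OF that(2)] that(1) \<sigma> b S'_closed[OF b] by (auto simp: act \<mu>_closed intro!: \<mu>_deg)
qed simp

text \<open>In any other degree \<open>\<tau>\<close>, the component of \<open>h(\<mu>\<^sub>\<alpha>(1))\<close> at \<open>\<tau>\<alpha> \<noteq> \<sigma>\<alpha>\<close> vanishes.\<close>

lemma \<Xi>_deg:
  assumes h: "h \<in> E.Hd \<sigma>" and \<sigma>: "\<sigma> \<in> carrier G"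
  shows "\<Xi> h = u \<sigma> (\<lambda>\<alpha>\<in>carrier G. h (\<mu> \<alpha> \<one>\<^bsub>A\<^esub>) (\<sigma> \<otimes> \<alpha>))"
proof -
  have "h (\<mu> \<alpha> \<one>\<^bsub>A\<^esub>) (\<tau> \<otimes> \<alpha>) = \<zero>\<^bsub>A\<^esub>" if "\<tau> \<in> carrier G" "\<tau> \<noteq> \<sigma>" "\<alpha> \<in> carrier G" for \<tau> \<alpha>
    unfolding END_coordinates(3)[OF h \<sigma> that(3)] using that \<sigma> by (simp add: \<mu>_apply)
  then show ?thesis
    using \<sigma> by (auto simp: \<Xi>_def u_def dsum_in_def S'_simps intro!: restrict_ext)
qed

lemma \<Xi>_additive: "additive E.H GS' \<Xi>"
proof (rule additive_generatedI[OF GS'_abelian_group E.HOM_generated])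
  show "\<Xi> \<zero>\<^bsub>E.H\<^esub> = \<zero>\<^bsub>GS'\<^esub>"
    by (auto simp: \<Xi>_def E.HOM_zero GS'_simps DS.dsum_zero S'_simps \<mu>_closed AG_simps(2) DA.dsum_zero
        intro!: restrict_ext)
  show "\<Xi> (h \<oplus>\<^bsub>E.H\<^esub> k) = \<Xi> h \<oplus>\<^bsub>GS'\<^esub> \<Xi> k" if "h \<in> carrier E.H" "k \<in> carrier E.H" for h k
    by (auto simp: \<Xi>_def E.HOM_add GS'_simps DS.dsum_add S'_simps \<mu>_closed AG_simps(3) DA.dsum_add
        intro!: restrict_ext)
  show "\<Xi> h \<in> carrier GS'" if "h \<in> (\<Union>\<sigma>\<in>carrier G. E.Hd \<sigma>)" for h
    using that \<Xi>_deg u_closed END_coordinates(2) by auto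
qed

lemma \<Xi>_bij_deg:
  assumes \<sigma>: "\<sigma> \<in> carrier G" shows "bij_betw \<Xi> (E.Hd \<sigma>) (GS'_deg \<sigma>)"
  unfolding bij_betw_def
proof (intro conjI inj_onI subset_antisym subsetI)
  let ?b = "\<lambda>h. \<lambda>\<alpha>\<in>carrier G. h (\<mu> \<alpha> \<one>\<^bsub>A\<^esub>) (\<sigma> \<otimes> \<alpha>)"
  fix h k assume hk: "h \<in> E.Hd \<sigma>" "k \<in> E.Hd \<sigma>" "\<Xi> h = \<Xi> k"
  have "u \<sigma> (?b h) \<sigma> = u \<sigma> (?b k) \<sigma>" using \<Xi>_deg[OF hk(1) \<sigma>] \<Xi>_deg[OF hk(2) \<sigma>] hk(3) by simp
  then have b: "?b h = ?b k" unfolding u_def using \<sigma> by (simp add: dsum_in_def)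
  show "h = k"
  proof (rule E.HOM_ext)
    fix \<alpha> m assume m: "\<alpha> \<in> carrier G" "m \<in> AG_deg \<alpha>"
    then obtain a where "a \<in> carrier A" "m = \<mu> \<alpha> a" using AG_degE by blast
    then show "h m = k m"
      using END_coordinates(1)[OF hk(1) \<sigma> m(1)] END_coordinates(1)[OF hk(2) \<sigma> m(1)] b by simp
  qed (use E.HOM_degD[OF hk(1)] E.HOM_degD[OF hk(2)] in auto)
next
  fix s assume "s \<in> \<Xi> ` E.Hd \<sigma>"
  then show "s \<in> GS'_deg \<sigma>"
    using \<Xi>_deg[OF _ \<sigma>] END_coordinates(2)[OF _ \<sigma>] by (auto simp: GS'_deg_def dsum_deg_def u_def)
next
  fix s assume "s \<in> GS'_deg \<sigma>"
  then obtain b where b: "b \<in> carrier S'" "s = u \<sigma> b" by (auto simp: GS'_deg_def dsum_deg_def u_def)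
  let ?h = "\<lambda>p\<in>carrier AG. u \<sigma> b \<triangleright>\<^bsub>AG_GS'\<^esub> p"
  have h: "?h \<in> E.Hd \<sigma>" by (rule act_END[OF \<sigma> b(1)])
  have "(\<lambda>\<alpha>\<in>carrier G. ?h (\<mu> \<alpha> \<one>\<^bsub>A\<^esub>) (\<sigma> \<otimes> \<alpha>)) = b"
    using b(1) \<sigma> S'_closed[OF b(1)]
    by (auto simp: fun_eq_iff \<mu>_closed act \<mu>_apply S'_iff PiE_iff extensional_def)
  then have "\<Xi> ?h = s" using \<Xi>_deg[OF h \<sigma>] b(2) by simp
  then show "s \<in> \<Xi> ` E.Hd \<sigma>" using h by blast
qed

abbreviation "END_AG \<equiv> END G Rdual AG AG_deg"

lemma \<Xi>_mult:
  assumes "h \<in> carrier E.H" "k \<in> carrier E.H"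
  shows "\<Xi> (compose (carrier AG) h k) = \<Xi> h \<otimes>\<^bsub>GS'\<^esub> \<Xi> k"
proof (rule biadditive_eqI[OF E.HOM_abelian_group E.HOM_abelian_group GS'_abelian_group E.HOM_generated
      E.HOM_generated biadditive_post[OF E.HOM_compose_biadditive \<Xi>_additive]
      biadditive_comp[OF GS'_mult_biadditive \<Xi>_additive \<Xi>_additive] _ assms])
  fix h k assume "h \<in> (\<Union>\<sigma>\<in>carrier G. E.Hd \<sigma>)" "k \<in> (\<Union>\<sigma>\<in>carrier G. E.Hd \<sigma>)"
  then obtain \<sigma> \<tau> where \<sigma>: "\<sigma> \<in> carrier G" and h: "h \<in> E.Hd \<sigma>" and \<tau>: "\<tau> \<in> carrier G" and k: "k \<in> E.Hd \<tau>" by blast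
  let ?b = "\<lambda>\<alpha>\<in>carrier G. h (\<mu> \<alpha> \<one>\<^bsub>A\<^esub>) (\<sigma> \<otimes> \<alpha>)" and ?c = "\<lambda>\<alpha>\<in>carrier G. k (\<mu> \<alpha> \<one>\<^bsub>A\<^esub>) (\<tau> \<otimes> \<alpha>)"
  note H = END_coordinates[OF h \<sigma>] and K = END_coordinates[OF k \<tau>]
  have "compose (carrier AG) h k (\<mu> \<alpha> \<one>\<^bsub>A\<^esub>) = \<mu> (\<sigma> \<otimes> \<tau> \<otimes> \<alpha>) (?b (\<tau> \<otimes> \<alpha>) \<otimes>\<^bsub>A\<^esub> ?c \<alpha>)" if \<alpha>: "\<alpha> \<in> carrier G" for \<alpha>
  proof -
    have "compose (carrier AG) h k (\<mu> \<alpha> \<one>\<^bsub>A\<^esub>) = h (\<mu> (\<tau> \<otimes> \<alpha>) (?c \<alpha>))"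
      using K(3)[OF \<alpha>] \<alpha> by (simp add: compose_def \<mu>_closed)
    also have "\<dots> = \<mu> (\<sigma> \<otimes> (\<tau> \<otimes> \<alpha>)) (?b (\<tau> \<otimes> \<alpha>) \<otimes>\<^bsub>A\<^esub> ?c \<alpha>)"
      by (rule H(1)) (use \<alpha> \<tau> S'_closed[OF K(2) \<alpha>] in auto)
    finally show ?thesis using \<alpha> \<sigma> \<tau> by (simp only: m_assoc)
  qed
  then have "(\<lambda>\<alpha>\<in>carrier G. compose (carrier AG) h k (\<mu> \<alpha> \<one>\<^bsub>A\<^esub>) (\<sigma> \<otimes> \<tau> \<otimes> \<alpha>)) = shift ?b \<tau> \<otimes>\<^bsub>S'\<^esub> ?c"
    using \<sigma> \<tau> by (auto simp: shift_def S'_simps \<mu>_apply intro!: restrict_ext)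
  then show "\<Xi> (compose (carrier AG) h k) = \<Xi> h \<otimes>\<^bsub>GS'\<^esub> \<Xi> k"
    using \<Xi>_deg[OF E.HOM_compose_deg[OF h k \<sigma> \<tau>]] \<Xi>_deg[OF h \<sigma>] \<Xi>_deg[OF k \<tau>] GS'_mult[OF \<sigma> \<tau> H(2) K(2)] \<sigma> \<tau>
    by simp
qed

lemma \<Xi>_one: "\<Xi> (\<lambda>p\<in>carrier AG. p) = \<one>\<^bsub>GS'\<^esub>"
proof -
  have 1: "(\<lambda>p\<in>carrier AG. p) \<in> E.Hd \<one>" using M.S_one by (simp add: M.S_simps)
  have "(\<lambda>\<alpha>\<in>carrier G. (\<lambda>p\<in>carrier AG. p) (\<mu> \<alpha> \<one>\<^bsub>A\<^esub>) (\<one> \<otimes> \<alpha>)) = \<one>\<^bsub>S'\<^esub>"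
    by (auto simp: S'_simps \<mu>_closed \<mu>_apply intro!: restrict_ext)
  then show ?thesis using \<Xi>_deg[OF 1 one_closed] by (simp add: GS'_simps(5))
qed

lemma \<Xi>_iso: "\<Xi> \<in> graded_ring_iso G END_AG E.Hd GS' GS'_deg"
proof -
  have "bij_betw \<Xi> (carrier E.H) (carrier GS')"
    by (rule graded_bij_betw[OF E.HOM_graded GS'_graded_group \<Xi>_additive \<Xi>_bij_deg])
  then have "\<Xi> \<in> ring_iso END_AG GS'"
    using \<Xi>_mult \<Xi>_one additive_closed[OF \<Xi>_additive] additive_add[OF \<Xi>_additive]
    by (auto simp: ring_iso_def ring_hom_def M.S_simps)
  then show ?thesis using \<Xi>_bij_deg by (auto simp: graded_ring_iso_def bij_betw_def)
qed

lemma \<Xi>_act: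
  assumes "h \<in> carrier E.H" "p \<in> carrier AG" shows "h p = \<Xi> h \<triangleright>\<^bsub>AG_GS'\<^esub> p"
proof (rule biadditive_eqI[OF E.HOM_abelian_group AG_abelian_group AG_abelian_group E.HOM_generated
      graded_generated[OF AG_graded_group] _ biadditive_comp[OF act_biadditive \<Xi>_additive additive_id] _ assms])
  show "biadditive E.H AG AG (\<lambda>h p. h p)"
    by (rule biadditiveI) (auto simp: E.HOM_closed E.HOM_add additive_add[OF E.HOM_linear(2)])
  fix h p assume "h \<in> (\<Union>\<sigma>\<in>carrier G. E.Hd \<sigma>)" "p \<in> (\<Union>\<sigma>\<in>carrier G. AG_deg \<sigma>)"
  then obtain \<sigma> \<alpha> a where *: "\<sigma> \<in> carrier G" "h \<in> E.Hd \<sigma>" "\<alpha> \<in> carrier G" "a \<in> carrier A" "p = \<mu> \<alpha> a"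
    using AG_degE by blast
  show "h p = \<Xi> h \<triangleright>\<^bsub>AG_GS'\<^esub> p"
    using END_coordinates(1)[OF *(2,1,3,4)] act[OF *(1,3) END_coordinates(2)[OF *(2,1)] *(4)] \<Xi>_deg[OF *(2,1)] *(5)
    by simp
qed


section \<open>Functionals on \<open>A{G}\<close>\<close>

lemma dual_ract_apply: "c \<in> carrier (C (inv \<alpha>)) \<Longrightarrow> (f \<triangleleft>\<^bsub>dual \<alpha>\<^esub> a) c = f c \<otimes>\<^bsub>A\<^esub> a"
  and dual_lact_apply: "c \<in> carrier (C (inv \<alpha>)) \<Longrightarrow> (a \<triangleright>\<^bsub>dual \<alpha>\<^esub> f) c = f (c \<triangleleft>\<^bsub>C (inv \<alpha>)\<^esub> a)"
  by (simp_all add: dual_simps)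

text \<open>Both sides evaluate \<open>g\<close> at \<open>m (f(n) a) = (m f(n)) a\<close>.\<close>

lemma conv_ract_left:
  assumes "\<alpha> \<in> carrier G" "\<beta> \<in> carrier G" "f \<in> carrier (dual \<alpha>)" "g \<in> carrier (dual \<beta>)" "a \<in> carrier A"
  shows "conv \<alpha> (f \<triangleleft>\<^bsub>dual \<alpha>\<^esub> a) \<beta> g = conv \<alpha> f \<beta> (a \<triangleright>\<^bsub>dual \<beta>\<^esub> g)"
proof -
  have inv: "inv \<beta> \<in> carrier G" "inv \<alpha> \<in> carrier G" and i: "inv (\<alpha> \<otimes> \<beta>) = inv \<beta> \<otimes> inv \<alpha>"
    using assms by (simp_all add: inv_mult_group)
  interpret CC: bimodule_pair A "C (inv \<beta>)" "C (inv \<alpha>)" by (rule C_pair[OF inv])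
  note fl = dual_linear[OF assms(3)] and gl = dual_linear[OF assms(4)]
    and fa = dual_linear[OF dual_rsmult_closed[OF assms(1,3,5)]] and ga = dual_linear[OF dual_lsmult_closed[OF assms(2,4,5)]]
  have "sweedler A (C (inv \<beta>)) g (f \<triangleleft>\<^bsub>dual \<alpha>\<^esub> a) t = sweedler A (C (inv \<beta>)) (a \<triangleright>\<^bsub>dual \<beta>\<^esub> g) f t"
    if "t \<in> carrier CC.T" for t
    by (rule CC.tensor_eqI[OF CC.A_group CC.sweedler_additive[OF gl fa] CC.sweedler_additive[OF ga fl] _ that])
      (auto simp: CC.sweedler_pure[OF gl fa] CC.sweedler_pure[OF ga fl] dual_ract_apply dual_lact_apply dual_closed[OF assms(3)]
        assms(5) CC.M.rsmult_assoc CC.M.rsmult_closed)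
  then show ?thesis
    using additive_closed[OF comult(1)[OF inv]] by (auto simp: conv_eq i intro!: restrict_ext)
qed

lemma conv_ract_right:
  assumes "\<alpha> \<in> carrier G" "\<beta> \<in> carrier G" "f \<in> carrier (dual \<alpha>)" "g \<in> carrier (dual \<beta>)" "a \<in> carrier A"
  shows "conv \<alpha> f \<beta> (g \<triangleleft>\<^bsub>dual \<beta>\<^esub> a) = conv \<alpha> f \<beta> g \<triangleleft>\<^bsub>dual (\<alpha> \<otimes> \<beta>)\<^esub> a"
proof -
  have inv: "inv \<beta> \<in> carrier G" "inv \<alpha> \<in> carrier G" and i: "inv (\<alpha> \<otimes> \<beta>) = inv \<beta> \<otimes> inv \<alpha>"
    using assms by (simp_all add: inv_mult_group)
  interpret CC: bimodule_pair A "C (inv \<beta>)" "C (inv \<alpha>)" by (rule C_pair[OF inv])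
  note fl = dual_linear[OF assms(3)] and gl = dual_linear[OF assms(4)]
    and ga = dual_linear[OF dual_rsmult_closed[OF assms(2,4,5)]]
  have mult: "additive A A (\<lambda>t. t \<otimes>\<^bsub>A\<^esub> a)" using assms(5) by (auto simp: additive_def A.l_distr)
  have "sweedler A (C (inv \<beta>)) (g \<triangleleft>\<^bsub>dual \<beta>\<^esub> a) f t = sweedler A (C (inv \<beta>)) g f t \<otimes>\<^bsub>A\<^esub> a"
    if "t \<in> carrier CC.T" for t
    by (rule CC.tensor_eqI[OF CC.A_group CC.sweedler_additive[OF ga fl] additive_comp[OF CC.sweedler_additive[OF gl fl] mult] _ that])
      (auto simp: CC.sweedler_pure[OF ga fl] CC.sweedler_pure[OF gl fl] dual_ract_apply dual_closed[OF assms(3)]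
        CC.M.rsmult_closed)
  then show ?thesis
    using additive_closed[OF comult(1)[OF inv]]
    by (auto simp: conv_eq i dual_simps(3)[of "\<alpha> \<otimes> \<beta>"] intro!: restrict_ext)
qed

lemma conv_eps_ract:
  assumes "\<alpha> \<in> carrier G" "f \<in> carrier (dual \<alpha>)" "a \<in> carrier A"
  shows "conv \<alpha> f \<one> (eps \<triangleleft>\<^bsub>dual \<one>\<^esub> a) = f \<triangleleft>\<^bsub>dual \<alpha>\<^esub> a"
  using conv_ract_right[OF assms(1) one_closed assms(2) eps_closed assms(3)] assms by (simp add: conv_eps_right)

lemma dual_ract_assoc:
  assumes "f \<in> carrier (dual \<alpha>)" "a \<in> carrier A" "b \<in> carrier A"
  shows "(f \<triangleleft>\<^bsub>dual \<alpha>\<^esub> a) \<triangleleft>\<^bsub>dual \<alpha>\<^esub> b = f \<triangleleft>\<^bsub>dual \<alpha>\<^esub> (a \<otimes>\<^bsub>A\<^esub> b)"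
  using assms by (auto simp: dual_simps dual_closed A.m_assoc intro!: restrict_ext)

text \<open>The equations defining \<open>Q'\<close> say \<open>q\<^sub>\<gamma> # f = q\<^sub>\<gamma>\<^sub>\<delta> \<cdot> f(x)\<close> in \<open>R\<close>, for \<open>f\<close> of
  degree \<open>\<delta>\<close>, since \<open>f (q(c) x) = q(c) f(x)\<close>.\<close>

lemma Q'_iff: "q \<in> carrier Q' \<longleftrightarrow> q \<in> (\<Pi>\<^sub>E \<alpha>\<in>carrier G. carrier (dual \<alpha>)) \<and>
    (\<forall>\<alpha>\<in>carrier G. \<forall>\<beta>\<in>carrier G. \<forall>f\<in>carrier (dual \<beta>).
      conv \<alpha> (q \<alpha>) \<beta> f = q (\<alpha> \<otimes> \<beta>) \<triangleleft>\<^bsub>dual (\<alpha> \<otimes> \<beta>)\<^esub> f (x (inv \<beta>)))" (is "_ \<longleftrightarrow> ?q \<and> ?E")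
proof -
  have "(\<forall>c\<in>carrier (C (inv (\<alpha> \<otimes> \<beta>))).
        tensor_lift A (\<lambda>c\<^sub>1 c\<^sub>2. f (c\<^sub>1 \<triangleleft>\<^bsub>C (inv \<beta>)\<^esub> q \<alpha> c\<^sub>2)) (\<Delta> (inv \<beta>) (inv \<alpha>) c) =
        f (q (\<alpha> \<otimes> \<beta>) c \<triangleright>\<^bsub>C (inv \<beta>)\<^esub> x (inv \<beta>))) \<longleftrightarrow>
      conv \<alpha> (q \<alpha>) \<beta> f = q (\<alpha> \<otimes> \<beta>) \<triangleleft>\<^bsub>dual (\<alpha> \<otimes> \<beta>)\<^esub> f (x (inv \<beta>))"
    if q: ?q and a: "\<alpha> \<in> carrier G" "\<beta> \<in> carrier G" and f: "f \<in> carrier (dual \<beta>)" for \<alpha> \<beta> f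
  proof -
    have qd: "q (\<alpha> \<otimes> \<beta>) \<in> carrier (dual (\<alpha> \<otimes> \<beta>))" using q a by (auto simp: PiE_iff)
    have "f (q (\<alpha> \<otimes> \<beta>) c \<triangleright>\<^bsub>C (inv \<beta>)\<^esub> x (inv \<beta>)) = q (\<alpha> \<otimes> \<beta>) c \<otimes>\<^bsub>A\<^esub> f (x (inv \<beta>))"
      if "c \<in> carrier (C (inv (\<alpha> \<otimes> \<beta>)))" for c
      by (rule dual_lact[OF f dual_closed[OF qd that] x_closed[OF inv_closed[OF a(2)]]])
    then show ?thesis
      by (auto simp: conv_def dual_simps fun_eq_iff restrict_def)
  qed
  then show ?thesis
    unfolding Q'_def by (auto cong: conj_cong ball_cong)
qed

lemma Q'_simps: "zero Q' = (\<lambda>\<alpha>\<in>carrier G. \<zero>\<^bsub>dual \<alpha>\<^esub>)" "p \<oplus>\<^bsub>Q'\<^esub> q = (\<lambda>\<alpha>\<in>carrier G. p \<alpha> \<oplus>\<^bsub>dual \<alpha>\<^esub> q \<alpha>)"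
  by (simp_all add: Q'_def)

lemma Q'_closed: "\<lbrakk>q \<in> carrier Q'; \<alpha> \<in> carrier G\<rbrakk> \<Longrightarrow> q \<alpha> \<in> carrier (dual \<alpha>)"
  by (auto simp: Q'_iff)

lemma Q'_eq: "\<lbrakk>q \<in> carrier Q'; \<alpha> \<in> carrier G; \<beta> \<in> carrier G; f \<in> carrier (dual \<beta>)\<rbrakk> \<Longrightarrow>
    conv \<alpha> (q \<alpha>) \<beta> f = q (\<alpha> \<otimes> \<beta>) \<triangleleft>\<^bsub>dual (\<alpha> \<otimes> \<beta>)\<^esub> f (x (inv \<beta>))"
  by (simp add: Q'_iff)

lemma dual_ract_additive:
  assumes "\<alpha> \<in> carrier G" "a \<in> carrier A" shows "additive (dual \<alpha>) (dual \<alpha>) (\<lambda>f. f \<triangleleft>\<^bsub>dual \<alpha>\<^esub> a)"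
  by (rule additiveI) (use assms in \<open>auto simp: dual_rsmult_closed, auto simp: dual_simps dual_closed A.l_distr intro!: restrict_ext\<close>)

lemma dual_ract_biadditive:
  assumes "\<alpha> \<in> carrier G" shows "biadditive (dual \<alpha>) A (dual \<alpha>) (rsmult (dual \<alpha>))"
  unfolding biadditive_def
proof (intro conjI ballI additiveI)
  fix f a a' assume "f \<in> carrier (dual \<alpha>)" "a \<in> carrier A" "a' \<in> carrier A"
  then show "f \<triangleleft>\<^bsub>dual \<alpha>\<^esub> (a \<oplus>\<^bsub>A\<^esub> a') = (f \<triangleleft>\<^bsub>dual \<alpha>\<^esub> a) \<oplus>\<^bsub>dual \<alpha>\<^esub> (f \<triangleleft>\<^bsub>dual \<alpha>\<^esub> a')"
    by (auto simp: dual_simps dual_closed A.r_distr intro!: restrict_ext)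
qed (use assms additive_closed[OF dual_ract_additive] additive_add[OF dual_ract_additive] in auto)

lemma Q'_abelian_group: "abelian_group Q'"
proof (rule abelian_group_equalizer)
  let ?N = "Q' \<lparr>carrier := \<Pi>\<^sub>E \<alpha>\<in>carrier G. carrier (dual \<alpha>)\<rparr>"
  let ?J = "{(\<alpha>, \<beta>, f). \<alpha> \<in> carrier G \<and> \<beta> \<in> carrier G \<and> f \<in> carrier (dual \<beta>)}"
  let ?T = "\<lambda>(\<alpha>, \<beta>, f). dual (\<alpha> \<otimes> \<beta>)"
  show "abelian_group ?N"
    by (rule abelian_group_product[where M = dual and I = "carrier G"]) (auto simp: Q'_simps dual_abelian_group)
  show "abelian_group (?T j)" if "j \<in> ?J" for j using that dual_abelian_group by auto
  have ev: "additive ?N (dual \<alpha>) (\<lambda>q. q \<alpha>)" if "\<alpha> \<in> carrier G" for \<alpha>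
    by (rule additiveI) (use that in \<open>auto simp: Q'_simps\<close>)
  show "additive ?N (?T j) ((\<lambda>(\<alpha>, \<beta>, f) q. conv \<alpha> (q \<alpha>) \<beta> f) j)" if "j \<in> ?J" for j
  proof -
    obtain \<alpha> \<beta> f where j: "j = (\<alpha>, \<beta>, f)" "\<alpha> \<in> carrier G" "\<beta> \<in> carrier G" "f \<in> carrier (dual \<beta>)"
      using \<open>j \<in> ?J\<close> by auto
    show ?thesis unfolding j(1) prod.case
      by (rule additive_comp[OF ev[OF j(2)] biadditive_left[OF conv_biadditive[OF j(2,3)] j(4)]])
  qed
  show "additive ?N (?T j) ((\<lambda>(\<alpha>, \<beta>, f) q. q (\<alpha> \<otimes> \<beta>) \<triangleleft>\<^bsub>dual (\<alpha> \<otimes> \<beta>)\<^esub> f (x (inv \<beta>))) j)" if "j \<in> ?J" for j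
  proof -
    obtain \<alpha> \<beta> f where j: "j = (\<alpha>, \<beta>, f)" "\<alpha> \<in> carrier G" "\<beta> \<in> carrier G" "f \<in> carrier (dual \<beta>)"
      using \<open>j \<in> ?J\<close> by auto
    show ?thesis unfolding j(1) prod.case
      by (rule additive_comp[OF ev dual_ract_additive]) (use j in \<open>auto simp: dual_closed x_closed\<close>)
  qed
  show "carrier Q' = {q \<in> carrier ?N. \<forall>j\<in>?J. (\<lambda>(\<alpha>, \<beta>, f) q. conv \<alpha> (q \<alpha>) \<beta> f) j q =
      (\<lambda>(\<alpha>, \<beta>, f) q. q (\<alpha> \<otimes> \<beta>) \<triangleleft>\<^bsub>dual (\<alpha> \<otimes> \<beta>)\<^esub> f (x (inv \<beta>))) j q}"
    by (auto simp: Q'_iff)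
qed auto

sublocale DQ: abelian_family "carrier G" "\<lambda>_. Q'"
  by (rule abelian_family.intro) (rule Q'_abelian_group)

text \<open>Multiply the equations of \<open>q\<close> from the left by \<open>f\<close>, using associativity of \<open>#\<close>.\<close>

lemma Q'_lact_closed:
  assumes \<beta>: "\<beta> \<in> carrier G" and f: "f \<in> carrier (dual \<beta>)" and q: "q \<in> carrier Q'"
  shows "Q'_lact \<beta> f q \<in> carrier Q'"
proof -
  have cl: "conv \<beta> f (inv \<beta> \<otimes> \<gamma>) (q (inv \<beta> \<otimes> \<gamma>)) \<in> carrier (dual \<gamma>)" if "\<gamma> \<in> carrier G" for \<gamma>
    using conv_closed[OF \<beta> _ f Q'_closed[OF q, of "inv \<beta> \<otimes> \<gamma>"]] that \<beta> by (simp add: m_assoc[symmetric])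
  have "conv \<gamma> (conv \<beta> f (inv \<beta> \<otimes> \<gamma>) (q (inv \<beta> \<otimes> \<gamma>))) \<delta> g =
      conv \<beta> f (inv \<beta> \<otimes> (\<gamma> \<otimes> \<delta>)) (q (inv \<beta> \<otimes> (\<gamma> \<otimes> \<delta>))) \<triangleleft>\<^bsub>dual (\<gamma> \<otimes> \<delta>)\<^esub> g (x (inv \<delta>))"
    if a: "\<gamma> \<in> carrier G" "\<delta> \<in> carrier G" and g: "g \<in> carrier (dual \<delta>)" for \<gamma> \<delta> g
  proof -
    have \<gamma>': "inv \<beta> \<otimes> \<gamma> \<in> carrier G" and m: "\<beta> \<otimes> (inv \<beta> \<otimes> \<gamma>) = \<gamma>" "\<beta> \<otimes> (inv \<beta> \<otimes> \<gamma> \<otimes> \<delta>) = \<gamma> \<otimes> \<delta>"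
      using a \<beta> by (simp_all add: m_assoc[symmetric])
    have gx: "g (x (inv \<delta>)) \<in> carrier A" using a g by (simp add: dual_closed x_closed)
    have "conv (\<beta> \<otimes> (inv \<beta> \<otimes> \<gamma>)) (conv \<beta> f (inv \<beta> \<otimes> \<gamma>) (q (inv \<beta> \<otimes> \<gamma>))) \<delta> g =
        conv \<beta> f (inv \<beta> \<otimes> \<gamma> \<otimes> \<delta>) (conv (inv \<beta> \<otimes> \<gamma>) (q (inv \<beta> \<otimes> \<gamma>)) \<delta> g)"
      by (rule conv_assoc[OF \<beta> \<gamma>' a(2) f Q'_closed[OF q \<gamma>'] g])
    also have "\<dots> = conv \<beta> f (inv \<beta> \<otimes> \<gamma> \<otimes> \<delta>) (q (inv \<beta> \<otimes> \<gamma> \<otimes> \<delta>)) \<triangleleft>\<^bsub>dual (\<beta> \<otimes> (inv \<beta> \<otimes> \<gamma> \<otimes> \<delta>))\<^esub> g (x (inv \<delta>))"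
      unfolding Q'_eq[OF q \<gamma>' a(2) g]
      by (rule conv_ract_right[OF \<beta> _ f _ gx]) (use \<gamma>' a Q'_closed[OF q] in auto)
    finally show ?thesis unfolding m using a \<beta> by (simp add: m_assoc)
  qed
  then show ?thesis using cl by (auto simp: Q'_iff Q'_lact_def)
qed

text \<open>The factor \<open>b\<^sub>\<gamma>\<close> moves to the other side of \<open>#\<close>. The equation of \<open>q\<close> then applies to
  \<open>b\<^sub>\<gamma> \<cdot> g\<close>, and that of \<open>b\<close> brings the factor back as \<open>b\<^sub>\<gamma>\<^sub>\<delta>\<close>.\<close>

lemma Q'_ract_closed:
  assumes q: "q \<in> carrier Q'" and b: "b \<in> carrier S'" shows "Q'_ract q b \<in> carrier Q'"
proof -
  have "conv \<gamma> (q \<gamma> \<triangleleft>\<^bsub>dual \<gamma>\<^esub> b \<gamma>) \<delta> g =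
      (q (\<gamma> \<otimes> \<delta>) \<triangleleft>\<^bsub>dual (\<gamma> \<otimes> \<delta>)\<^esub> b (\<gamma> \<otimes> \<delta>)) \<triangleleft>\<^bsub>dual (\<gamma> \<otimes> \<delta>)\<^esub> g (x (inv \<delta>))"
    if a: "\<gamma> \<in> carrier G" "\<delta> \<in> carrier G" and g: "g \<in> carrier (dual \<delta>)" for \<gamma> \<delta> g
  proof -
    have xd: "x (inv \<delta>) \<in> carrier (C (inv \<delta>))" using a by (simp add: x_closed)
    note bc = S'_closed[OF b]
    have "conv \<gamma> (q \<gamma> \<triangleleft>\<^bsub>dual \<gamma>\<^esub> b \<gamma>) \<delta> g = conv \<gamma> (q \<gamma>) \<delta> (b \<gamma> \<triangleright>\<^bsub>dual \<delta>\<^esub> g)"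
      by (rule conv_ract_left[OF a Q'_closed[OF q a(1)] g bc[OF a(1)]])
    also have "\<dots> = q (\<gamma> \<otimes> \<delta>) \<triangleleft>\<^bsub>dual (\<gamma> \<otimes> \<delta>)\<^esub> g (x (inv \<delta>) \<triangleleft>\<^bsub>C (inv \<delta>)\<^esub> b \<gamma>)"
      using Q'_eq[OF q a dual_lsmult_closed[OF a(2) g bc[OF a(1)]]] xd by (simp add: dual_simps(4))
    also have "\<dots> = q (\<gamma> \<otimes> \<delta>) \<triangleleft>\<^bsub>dual (\<gamma> \<otimes> \<delta>)\<^esub> (b (\<gamma> \<otimes> \<delta>) \<otimes>\<^bsub>A\<^esub> g (x (inv \<delta>)))"
      using S'_eq[OF b a g] by simp
    finally show ?thesis
      using dual_ract_assoc[OF Q'_closed[OF q] bc dual_closed[OF g xd]] a by simp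
  qed
  then show ?thesis
    using q b S'_closed[OF b] Q'_closed[OF q] by (auto simp: Q'_iff Q'_ract_def dual_rsmult_closed)
qed

lemma DQ_same: "same_add DQ.D Q'G"
  by (simp add: same_add_def Q'G_def Let_def)

lemma Q'G_simps:
  "rsmult Q'G = bilin_ext (carrier G) (\<lambda>_. Q') (\<lambda>_. S') DQ.D
         (\<lambda>\<alpha> q \<tau> b. \<omega> (\<alpha> \<otimes> \<tau>) (Q'_ract q (shift b (inv (\<alpha> \<otimes> \<tau>)))))"
  "lsmult Q'G = bilin_ext (carrier G) dual (\<lambda>_. Q') DQ.D (\<lambda>\<beta> f \<alpha> q. \<omega> (\<beta> \<otimes> \<alpha>) (Q'_lact \<beta> f q))"
  by (simp_all add: Q'G_def Let_def)

lemma Q'G_abelian_group: "abelian_group Q'G"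
  by (rule same_add_abelian_group[OF DQ_same DQ.dsum_abelian_group])

lemma Q'G_graded_group: "graded_group G Q'G Q'G_deg"
  unfolding Q'G_deg_def by (rule graded_group_same_add[OF DQ_same dsum_graded[OF Q'_abelian_group]])

lemma \<omega>_additive: "\<sigma> \<in> carrier G \<Longrightarrow> additive Q' DQ.D (\<omega> \<sigma>)"
  unfolding \<omega>_def by (rule DQ.dsum_in_additive)

lemma \<omega>_closed: "\<lbrakk>\<sigma> \<in> carrier G; q \<in> carrier Q'\<rbrakk> \<Longrightarrow> \<omega> \<sigma> q \<in> carrier Q'G"
  using additive_closed[OF \<omega>_additive] DQ_same by (simp add: same_add_def)

lemma Q'G_lact_pairing: "graded_pairing (carrier G) dual (\<lambda>_. Q') DQ.D (\<lambda>\<beta> f \<alpha> q. \<omega> (\<beta> \<otimes> \<alpha>) (Q'_lact \<beta> f q))"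
proof (intro graded_pairing.intro graded_pairing_axioms.intro DR.abelian_family_axioms DQ.abelian_family_axioms
    DQ.dsum_abelian_group)
  fix \<beta> \<alpha> assume ab: "\<beta> \<in> carrier G" "\<alpha> \<in> carrier G"
  have m: "\<beta> \<otimes> (inv \<beta> \<otimes> \<gamma>) = \<gamma>" if "\<gamma> \<in> carrier G" for \<gamma>
    using that ab by (simp add: m_assoc[symmetric])
  have cb: "biadditive (dual \<beta>) (dual (inv \<beta> \<otimes> \<gamma>)) (dual \<gamma>) (\<lambda>f g. conv \<beta> f (inv \<beta> \<otimes> \<gamma>) g)"
    if "\<gamma> \<in> carrier G" for \<gamma>
    using conv_biadditive[OF ab(1), of "inv \<beta> \<otimes> \<gamma>"] m[OF that] that ab by simp
  show "biadditive (dual \<beta>) Q' DQ.D (\<lambda>f q. \<omega> (\<beta> \<otimes> \<alpha>) (Q'_lact \<beta> f q))"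
  proof (rule biadditive_post[OF _ \<omega>_additive])
    show "biadditive (dual \<beta>) Q' Q' (Q'_lact \<beta>)"
      by (rule biadditiveI) (use ab Q'_lact_closed biadditive_add_left[OF cb] biadditive_add_right[OF cb] in
          \<open>auto simp: Q'_lact_def Q'_simps Q'_closed intro!: restrict_ext\<close>)
  qed (use ab in simp)
qed

lemma Q'G_lact_biadditive: "biadditive Rdual Q'G Q'G (lsmult Q'G)"
  unfolding Q'G_simps(2)
  using graded_pairing.bilin_ext_biadditive[OF Q'G_lact_pairing]
    same_add_biadditive[OF Rdual_same_add DQ_same DQ_same] by simp

lemma Q'G_lact:
  "\<lbrakk>\<beta> \<in> carrier G; \<alpha> \<in> carrier G; f \<in> carrier (dual \<beta>); q \<in> carrier Q'\<rbrakk> \<Longrightarrow>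
    \<rho> \<beta> f \<triangleright>\<^bsub>Q'G\<^esub> \<omega> \<alpha> q = \<omega> (\<beta> \<otimes> \<alpha>) (Q'_lact \<beta> f q)"
  unfolding Q'G_simps(2) using graded_pairing.bilin_ext_in[OF Q'G_lact_pairing] by (simp add: \<omega>_def)

lemma Q'G_ract_pairing: "graded_pairing (carrier G) (\<lambda>_. Q') (\<lambda>_. S') DQ.D
    (\<lambda>\<alpha> q \<tau> b. \<omega> (\<alpha> \<otimes> \<tau>) (Q'_ract q (shift b (inv (\<alpha> \<otimes> \<tau>)))))"
proof (intro graded_pairing.intro graded_pairing_axioms.intro DS.abelian_family_axioms DQ.abelian_family_axioms
    DQ.dsum_abelian_group)
  fix \<alpha> \<tau> assume ab: "\<alpha> \<in> carrier G" "\<tau> \<in> carrier G"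
  show "biadditive Q' S' DQ.D (\<lambda>q b. \<omega> (\<alpha> \<otimes> \<tau>) (Q'_ract q (shift b (inv (\<alpha> \<otimes> \<tau>)))))"
  proof (rule biadditive_post[OF _ \<omega>_additive])
    show "biadditive Q' S' Q' (\<lambda>q b. Q'_ract q (shift b (inv (\<alpha> \<otimes> \<tau>))))"
    proof (rule biadditiveI)
      show "Q'_ract q (shift b (inv (\<alpha> \<otimes> \<tau>))) \<in> carrier Q'" if "q \<in> carrier Q'" "b \<in> carrier S'" for q b
        by (rule Q'_ract_closed[OF that(1) shift_closed[OF that(2)]]) (use ab in simp)
    qed (use ab biadditive_add_left[OF dual_ract_biadditive] biadditive_add_right[OF dual_ract_biadditive] in
        \<open>auto simp: Q'_ract_def Q'_simps S'_simps shift_def Q'_closed S'_closed intro!: restrict_ext\<close>)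
  qed (use ab in simp)
qed

lemma Q'G_ract_biadditive: "biadditive Q'G GS' Q'G (rsmult Q'G)"
  unfolding Q'G_simps(1)
  using graded_pairing.bilin_ext_biadditive[OF Q'G_ract_pairing]
    same_add_biadditive[OF DQ_same GS'_same_add DQ_same] by simp

lemma Q'G_ract:
  "\<lbrakk>\<alpha> \<in> carrier G; \<tau> \<in> carrier G; q \<in> carrier Q'; b \<in> carrier S'\<rbrakk> \<Longrightarrow>
    \<omega> \<alpha> q \<triangleleft>\<^bsub>Q'G\<^esub> u \<tau> b = \<omega> (\<alpha> \<otimes> \<tau>) (Q'_ract q (shift b (inv (\<alpha> \<otimes> \<tau>))))"
  unfolding Q'G_simps(1) using graded_pairing.bilin_ext_in[OF Q'G_ract_pairing] by (simp add: \<omega>_def u_def)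

text \<open>The pairings \<open>nu\<close> and \<open>om\<close> induce the connecting maps \<open>\<nu>'\<close> and \<open>\<omega>'\<close>.\<close>

definition nu :: "('g \<Rightarrow> 'g \<Rightarrow> 'c \<Rightarrow> 'a) \<Rightarrow> ('g \<Rightarrow> 'a) \<Rightarrow> ('g \<Rightarrow> 'c \<Rightarrow> 'a)" where
  "nu = bilin_ext (carrier G) (\<lambda>_. Q') (\<lambda>_. A) Rdual
     (\<lambda>\<sigma> q \<alpha> a. \<rho> (\<sigma> \<otimes> \<alpha>) (q (\<sigma> \<otimes> \<alpha>) \<triangleleft>\<^bsub>dual (\<sigma> \<otimes> \<alpha>)\<^esub> a))"

lemma \<rho>_additive: "\<alpha> \<in> carrier G \<Longrightarrow> additive (dual \<alpha>) Rdual (\<rho> \<alpha>)"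
  using DR.dsum_in_additive[of \<alpha>] same_add_additive[OF same_add_refl[of "dual \<alpha>"] Rdual_same_add] by simp

lemma \<rho>_closed: "\<lbrakk>\<alpha> \<in> carrier G; f \<in> carrier (dual \<alpha>)\<rbrakk> \<Longrightarrow> \<rho> \<alpha> f \<in> carrier Rdual"
  by (rule additive_closed[OF \<rho>_additive])

lemma nu_pairing: "graded_pairing (carrier G) (\<lambda>_. Q') (\<lambda>_. A) Rdual
     (\<lambda>\<sigma> q \<alpha> a. \<rho> (\<sigma> \<otimes> \<alpha>) (q (\<sigma> \<otimes> \<alpha>) \<triangleleft>\<^bsub>dual (\<sigma> \<otimes> \<alpha>)\<^esub> a))"
proof (intro graded_pairing.intro graded_pairing_axioms.intro DA.abelian_family_axioms DQ.abelian_family_axioms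
    Rdual_abelian_group)
  fix \<sigma> \<alpha> assume ab: "\<sigma> \<in> carrier G" "\<alpha> \<in> carrier G"
  have ev: "additive Q' (dual (\<sigma> \<otimes> \<alpha>)) (\<lambda>q. q (\<sigma> \<otimes> \<alpha>))"
    by (rule additiveI) (use ab in \<open>auto simp: Q'_closed Q'_simps\<close>)
  show "biadditive Q' A Rdual (\<lambda>q a. \<rho> (\<sigma> \<otimes> \<alpha>) (q (\<sigma> \<otimes> \<alpha>) \<triangleleft>\<^bsub>dual (\<sigma> \<otimes> \<alpha>)\<^esub> a))"
    by (rule biadditive_post[OF biadditive_comp[OF dual_ract_biadditive ev additive_id] \<rho>_additive])
      (use ab in auto)
qed

lemma nu_biadditive: "biadditive Q'G AG Rdual nu"
  unfolding nu_def
  using graded_pairing.bilin_ext_biadditive[OF nu_pairing]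
    same_add_biadditive[OF DQ_same AG_same_add same_add_refl[of Rdual]] by simp

lemma nu_eq:
  "\<lbrakk>\<sigma> \<in> carrier G; \<alpha> \<in> carrier G; q \<in> carrier Q'; a \<in> carrier A\<rbrakk> \<Longrightarrow>
    nu (\<omega> \<sigma> q) (\<mu> \<alpha> a) = \<rho> (\<sigma> \<otimes> \<alpha>) (q (\<sigma> \<otimes> \<alpha>) \<triangleleft>\<^bsub>dual (\<sigma> \<otimes> \<alpha>)\<^esub> a)"
  unfolding nu_def using graded_pairing.bilin_ext_in[OF nu_pairing] by (simp add: \<omega>_def \<mu>_def)

text \<open>The equation of \<open>S'\<close> at \<open>\<alpha>\<close>, \<open>\<beta>\<close> is that of \<open>q\<close> at \<open>\<sigma>\<alpha>\<close>, \<open>\<beta>\<close>, evaluated at the element \<open>x a\<close>.\<close>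

lemma grouplike_value_closed:
  assumes \<sigma>: "\<sigma> \<in> carrier G" and q: "q \<in> carrier Q'" and a: "a \<in> carrier A"
  shows "(\<lambda>\<beta>\<in>carrier G. q (\<sigma> \<otimes> \<beta>) (x (inv (\<sigma> \<otimes> \<beta>)) \<triangleleft>\<^bsub>C (inv (\<sigma> \<otimes> \<beta>))\<^esub> a)) \<in> carrier S'"
proof (rule S'_I)
  let ?v = "\<lambda>\<beta>. q \<beta> (x (inv \<beta>) \<triangleleft>\<^bsub>C (inv \<beta>)\<^esub> a)"
  have v: "?v \<beta> \<in> carrier A" if "\<beta> \<in> carrier G" for \<beta>
    using that by (intro dual_closed[OF Q'_closed[OF q]] x_ract_closed a) auto
  show "(\<lambda>\<beta>\<in>carrier G. ?v (\<sigma> \<otimes> \<beta>)) \<in> carrier G \<rightarrow>\<^sub>E carrier A" using v \<sigma> by auto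
  fix \<alpha> \<beta> f assume ab: "\<alpha> \<in> carrier G" "\<beta> \<in> carrier G" and f: "f \<in> carrier (dual \<beta>)"
  have s: "\<sigma> \<otimes> \<alpha> \<in> carrier G" using \<sigma> ab by simp
  have "f (x (inv \<beta>) \<triangleleft>\<^bsub>C (inv \<beta>)\<^esub> ?v (\<sigma> \<otimes> \<alpha>)) =
      conv (\<sigma> \<otimes> \<alpha>) (q (\<sigma> \<otimes> \<alpha>)) \<beta> f (x (inv (\<sigma> \<otimes> \<alpha> \<otimes> \<beta>)) \<triangleleft>\<^bsub>C (inv (\<sigma> \<otimes> \<alpha> \<otimes> \<beta>))\<^esub> a)"
    by (rule conv_x[OF s ab(2) Q'_closed[OF q s] f a, symmetric])
  also have "\<dots> = ?v (\<sigma> \<otimes> \<alpha> \<otimes> \<beta>) \<otimes>\<^bsub>A\<^esub> f (x (inv \<beta>))"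
    unfolding Q'_eq[OF q s ab(2) f] using x_ract_closed[of "inv (\<sigma> \<otimes> \<alpha> \<otimes> \<beta>)" a] s ab a by (simp add: dual_simps)
  finally show "f (x (inv \<beta>) \<triangleleft>\<^bsub>C (inv \<beta>)\<^esub> (\<lambda>\<beta>\<in>carrier G. ?v (\<sigma> \<otimes> \<beta>)) \<alpha>) =
      (\<lambda>\<beta>\<in>carrier G. ?v (\<sigma> \<otimes> \<beta>)) (\<alpha> \<otimes> \<beta>) \<otimes>\<^bsub>A\<^esub> f (x (inv \<beta>))"
    using \<sigma> ab by (simp add: m_assoc)
qed

definition om :: "('g \<Rightarrow> 'a) \<Rightarrow> ('g \<Rightarrow> 'g \<Rightarrow> 'c \<Rightarrow> 'a) \<Rightarrow> ('g \<Rightarrow> 'g \<Rightarrow> 'a)" where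
  "om = bilin_ext (carrier G) (\<lambda>_. A) (\<lambda>_. Q') GS'
     (\<lambda>\<alpha> a \<sigma> q. u (\<alpha> \<otimes> \<sigma>)
        (\<lambda>\<beta>\<in>carrier G. q (\<sigma> \<otimes> \<beta>) (x (inv (\<sigma> \<otimes> \<beta>)) \<triangleleft>\<^bsub>C (inv (\<sigma> \<otimes> \<beta>))\<^esub> a)))"

lemma om_pairing: "graded_pairing (carrier G) (\<lambda>_. A) (\<lambda>_. Q') GS'
     (\<lambda>\<alpha> a \<sigma> q. u (\<alpha> \<otimes> \<sigma>)
        (\<lambda>\<beta>\<in>carrier G. q (\<sigma> \<otimes> \<beta>) (x (inv (\<sigma> \<otimes> \<beta>)) \<triangleleft>\<^bsub>C (inv (\<sigma> \<otimes> \<beta>))\<^esub> a)))"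
proof (intro graded_pairing.intro graded_pairing_axioms.intro DA.abelian_family_axioms DQ.abelian_family_axioms
    GS'_abelian_group)
  fix \<alpha> \<sigma> assume ab: "\<alpha> \<in> carrier G" "\<sigma> \<in> carrier G"
  have ua: "additive S' GS' (u (\<alpha> \<otimes> \<sigma>))"
    using u_additive[of "\<alpha> \<otimes> \<sigma>"] ab same_add_additive[OF same_add_refl[of S'] GS'_same_add] by simp
  show "biadditive A Q' GS' (\<lambda>a q. u (\<alpha> \<otimes> \<sigma>)
        (\<lambda>\<beta>\<in>carrier G. q (\<sigma> \<otimes> \<beta>) (x (inv (\<sigma> \<otimes> \<beta>)) \<triangleleft>\<^bsub>C (inv (\<sigma> \<otimes> \<beta>))\<^esub> a)))"
  proof (rule biadditive_post[OF biadditiveI ua])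
    show "(\<lambda>\<beta>\<in>carrier G. q (\<sigma> \<otimes> \<beta>) (x (inv (\<sigma> \<otimes> \<beta>)) \<triangleleft>\<^bsub>C (inv (\<sigma> \<otimes> \<beta>))\<^esub> a)) \<in> carrier S'"
      if "a \<in> carrier A" "q \<in> carrier Q'" for a q
      by (rule grouplike_value_closed[OF ab(2) that(2,1)])
    show "(\<lambda>\<beta>\<in>carrier G. q (\<sigma> \<otimes> \<beta>) (x (inv (\<sigma> \<otimes> \<beta>)) \<triangleleft>\<^bsub>C (inv (\<sigma> \<otimes> \<beta>))\<^esub> (a \<oplus>\<^bsub>A\<^esub> a'))) =
        (\<lambda>\<beta>\<in>carrier G. q (\<sigma> \<otimes> \<beta>) (x (inv (\<sigma> \<otimes> \<beta>)) \<triangleleft>\<^bsub>C (inv (\<sigma> \<otimes> \<beta>))\<^esub> a)) \<oplus>\<^bsub>S'\<^esub>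
        (\<lambda>\<beta>\<in>carrier G. q (\<sigma> \<otimes> \<beta>) (x (inv (\<sigma> \<otimes> \<beta>)) \<triangleleft>\<^bsub>C (inv (\<sigma> \<otimes> \<beta>))\<^esub> a'))"
      if "a \<in> carrier A" "a' \<in> carrier A" "q \<in> carrier Q'" for a a' q
      using that ab additive_add[OF dual_additive[OF Q'_closed]] x_ract_closed
        bimodule.rsmult_distr_ring[OF C_bimodule] x_closed
      by (auto simp: S'_simps intro!: restrict_ext)
    show "(\<lambda>\<beta>\<in>carrier G. (q \<oplus>\<^bsub>Q'\<^esub> q') (\<sigma> \<otimes> \<beta>) (x (inv (\<sigma> \<otimes> \<beta>)) \<triangleleft>\<^bsub>C (inv (\<sigma> \<otimes> \<beta>))\<^esub> a)) =
        (\<lambda>\<beta>\<in>carrier G. q (\<sigma> \<otimes> \<beta>) (x (inv (\<sigma> \<otimes> \<beta>)) \<triangleleft>\<^bsub>C (inv (\<sigma> \<otimes> \<beta>))\<^esub> a)) \<oplus>\<^bsub>S'\<^esub>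
        (\<lambda>\<beta>\<in>carrier G. q' (\<sigma> \<otimes> \<beta>) (x (inv (\<sigma> \<otimes> \<beta>)) \<triangleleft>\<^bsub>C (inv (\<sigma> \<otimes> \<beta>))\<^esub> a))"
      if "a \<in> carrier A" "q \<in> carrier Q'" "q' \<in> carrier Q'" for a q q'
      using that ab x_ract_closed by (auto simp: S'_simps Q'_simps dual_simps intro!: restrict_ext)
  qed
qed

lemma om_biadditive: "biadditive AG Q'G GS' om"
  unfolding om_def
  using graded_pairing.bilin_ext_biadditive[OF om_pairing]
    same_add_biadditive[OF AG_same_add DQ_same same_add_refl[of GS']] by simp

lemma om_eq:
  "\<lbrakk>\<alpha> \<in> carrier G; \<sigma> \<in> carrier G; a \<in> carrier A; q \<in> carrier Q'\<rbrakk> \<Longrightarrow>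
    om (\<mu> \<alpha> a) (\<omega> \<sigma> q) = u (\<alpha> \<otimes> \<sigma>)
        (\<lambda>\<beta>\<in>carrier G. q (\<sigma> \<otimes> \<beta>) (x (inv (\<sigma> \<otimes> \<beta>)) \<triangleleft>\<^bsub>C (inv (\<sigma> \<otimes> \<beta>))\<^esub> a))"
  unfolding om_def using graded_pairing.bilin_ext_in[OF om_pairing] by (simp add: \<omega>_def \<mu>_def)

text \<open>As for endomorphisms, the equations of \<open>Q'\<close> come from computing \<open>\<phi>(\<mu>\<^sub>\<alpha>(1) \<cdot> f)\<close> in two ways.\<close>

lemma HOM_coordinates:
  assumes h: "\<phi> \<in> H.Hd \<sigma>" and \<sigma>: "\<sigma> \<in> carrier G"
  defines "q \<equiv> (\<lambda>\<gamma>\<in>carrier G. \<phi> (\<mu> (inv \<sigma> \<otimes> \<gamma>) \<one>\<^bsub>A\<^esub>) \<gamma>)"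
  shows "\<lbrakk>\<alpha> \<in> carrier G; a \<in> carrier A\<rbrakk> \<Longrightarrow> \<phi> (\<mu> \<alpha> a) = \<rho> (\<sigma> \<otimes> \<alpha>) (q (\<sigma> \<otimes> \<alpha>) \<triangleleft>\<^bsub>dual (\<sigma> \<otimes> \<alpha>)\<^esub> a)"
    and "q \<in> carrier Q'" and "\<gamma> \<in> carrier G \<Longrightarrow> \<phi> (\<mu> (inv \<sigma> \<otimes> \<gamma>) \<one>\<^bsub>A\<^esub>) = \<rho> \<gamma> (q \<gamma>)"
proof -
  have h1: "q \<gamma> \<in> carrier (dual \<gamma>)" "\<phi> (\<mu> (inv \<sigma> \<otimes> \<gamma>) \<one>\<^bsub>A\<^esub>) = \<rho> \<gamma> (q \<gamma>)" if \<gamma>: "\<gamma> \<in> carrier G" for \<gamma>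
  proof -
    have "\<phi> (\<mu> (inv \<sigma> \<otimes> \<gamma>) \<one>\<^bsub>A\<^esub>) \<in> Rdual_deg (\<sigma> \<otimes> (inv \<sigma> \<otimes> \<gamma>))"
      by (rule H.HOM_degD(5)[OF h]) (use \<gamma> \<sigma> in \<open>auto simp: \<mu>_deg\<close>)
    then have "\<phi> (\<mu> (inv \<sigma> \<otimes> \<gamma>) \<one>\<^bsub>A\<^esub>) \<in> Rdual_deg \<gamma>" using \<gamma> \<sigma> by (simp add: m_assoc[symmetric])
    then obtain f where f: "f \<in> carrier (dual \<gamma>)" "\<phi> (\<mu> (inv \<sigma> \<otimes> \<gamma>) \<one>\<^bsub>A\<^esub>) = \<rho> \<gamma> f" using Rdual_degE by blast
    then have "q \<gamma> = f" using \<gamma> by (simp add: q_def \<rho>_apply)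
    then show "q \<gamma> \<in> carrier (dual \<gamma>)" "\<phi> (\<mu> (inv \<sigma> \<otimes> \<gamma>) \<one>\<^bsub>A\<^esub>) = \<rho> \<gamma> (q \<gamma>)" using f by auto
  qed
  then show "\<gamma> \<in> carrier G \<Longrightarrow> \<phi> (\<mu> (inv \<sigma> \<otimes> \<gamma>) \<one>\<^bsub>A\<^esub>) = \<rho> \<gamma> (q \<gamma>)" by blast
  have h2: "\<phi> (\<mu> \<alpha> \<one>\<^bsub>A\<^esub>) = \<rho> (\<sigma> \<otimes> \<alpha>) (q (\<sigma> \<otimes> \<alpha>))" if "\<alpha> \<in> carrier G" for \<alpha>
    using h1(2)[of "\<sigma> \<otimes> \<alpha>"] that \<sigma> by (simp add: m_assoc[symmetric])
  have lin: "\<phi> (\<mu> \<alpha> \<one>\<^bsub>A\<^esub> \<triangleleft>\<^bsub>AG\<^esub> \<rho> \<beta> f) = \<rho> (\<sigma> \<otimes> \<alpha> \<otimes> \<beta>) (conv (\<sigma> \<otimes> \<alpha>) (q (\<sigma> \<otimes> \<alpha>)) \<beta> f)"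
    if "\<alpha> \<in> carrier G" "\<beta> \<in> carrier G" "f \<in> carrier (dual \<beta>)" for \<alpha> \<beta> f
    using that H.HOM_degD(4)[OF h \<mu>_closed[OF that(1) A.one_closed] \<rho>_closed[OF that(2,3)]] \<sigma> h1(1)
    by (simp add: h2 Rdual_mult)
  show ha: "\<phi> (\<mu> \<alpha> a) = \<rho> (\<sigma> \<otimes> \<alpha>) (q (\<sigma> \<otimes> \<alpha>) \<triangleleft>\<^bsub>dual (\<sigma> \<otimes> \<alpha>)\<^esub> a)" if "\<alpha> \<in> carrier G" "a \<in> carrier A" for \<alpha> a
    using lin[OF that(1) one_closed eps_ract_closed[OF that(2)]] that \<sigma> h1(1)
    by (simp add: AG_act_eps conv_eps_ract)
  show "q \<in> carrier Q'"
    unfolding Q'_iff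
  proof (intro conjI ballI)
    show "q \<in> (\<Pi>\<^sub>E \<alpha>\<in>carrier G. carrier (dual \<alpha>))" using h1(1) by (auto simp: q_def)
    fix \<alpha> \<beta> f assume a: "\<alpha> \<in> carrier G" "\<beta> \<in> carrier G" and f: "f \<in> carrier (dual \<beta>)"
    interpret Cb: bimodule A A "C (inv \<beta>)" using a by (intro C_bimodule) simp
    have xb: "x (inv \<beta>) \<in> carrier (C (inv \<beta>))" using a by (simp add: x_closed)
    have \<alpha>': "inv \<sigma> \<otimes> \<alpha> \<in> carrier G" and m: "\<sigma> \<otimes> (inv \<sigma> \<otimes> \<alpha>) = \<alpha>" "\<sigma> \<otimes> (inv \<sigma> \<otimes> \<alpha> \<otimes> \<beta>) = \<alpha> \<otimes> \<beta>"
      using a \<sigma> by (simp_all add: m_assoc[symmetric])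
    have "\<rho> (\<alpha> \<otimes> \<beta>) (conv \<alpha> (q \<alpha>) \<beta> f) = \<phi> (\<mu> (inv \<sigma> \<otimes> \<alpha>) \<one>\<^bsub>A\<^esub> \<triangleleft>\<^bsub>AG\<^esub> \<rho> \<beta> f)"
      using lin[OF \<alpha>' a(2) f] by (simp add: m)
    also have "\<dots> = \<phi> (\<mu> (inv \<sigma> \<otimes> \<alpha> \<otimes> \<beta>) (f (x (inv \<beta>))))"
      using AG_act[OF \<alpha>' a(2) A.one_closed f] xb by (simp add: Cb.rsmult_one)
    also have "\<dots> = \<rho> (\<alpha> \<otimes> \<beta>) (q (\<alpha> \<otimes> \<beta>) \<triangleleft>\<^bsub>dual (\<alpha> \<otimes> \<beta>)\<^esub> f (x (inv \<beta>)))"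
      using ha[of "inv \<sigma> \<otimes> \<alpha> \<otimes> \<beta>" "f (x (inv \<beta>))"] \<alpha>' a f xb by (simp add: m dual_closed)
    finally show "conv \<alpha> (q \<alpha>) \<beta> f = q (\<alpha> \<otimes> \<beta>) \<triangleleft>\<^bsub>dual (\<alpha> \<otimes> \<beta>)\<^esub> f (x (inv \<beta>))"
      by (rule \<rho>_inj) (use a in simp)
  qed
qed

text \<open>Conversely, the equation of \<open>q\<close> for the functional \<open>a \<cdot> f\<close> gives linearity at \<open>\<mu>\<^sub>\<alpha>(a) \<cdot> f\<close>.\<close>

lemma nu_HOM:
  assumes \<sigma>: "\<sigma> \<in> carrier G" and q: "q \<in> carrier Q'"
  shows "(\<lambda>p\<in>carrier AG. nu (\<omega> \<sigma> q) p) \<in> H.Hd \<sigma>"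
proof (rule H.HOM_degI)
  have add: "additive AG Rdual (nu (\<omega> \<sigma> q))"
    by (rule biadditive_right[OF nu_biadditive \<omega>_closed[OF \<sigma> q]])
  show "additive AG (regular Rdual) (\<lambda>p\<in>carrier AG. nu (\<omega> \<sigma> q) p)"
    using add by (auto simp: additive_def)
  have "nu (\<omega> \<sigma> q) (p \<triangleleft>\<^bsub>AG\<^esub> r) = nu (\<omega> \<sigma> q) p \<otimes>\<^bsub>Rdual\<^esub> r"
    if pr: "p \<in> carrier AG" "r \<in> carrier Rdual" for p r
  proof (rule biadditive_eqI[OF AG_abelian_group Rdual_abelian_group Rdual_abelian_group
        graded_generated[OF AG_graded_group] graded_generated[OF Rdual_graded_group]
        biadditive_post[OF M.ract_biadditive add] biadditive_comp[OF Rdual_mult_biadditive add additive_id] _ pr])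
    fix p r assume "p \<in> (\<Union>\<alpha>\<in>carrier G. AG_deg \<alpha>)" "r \<in> (\<Union>\<alpha>\<in>carrier G. Rdual_deg \<alpha>)"
    then obtain \<alpha> \<beta> a f where *: "\<alpha> \<in> carrier G" "\<beta> \<in> carrier G" "a \<in> carrier A" "f \<in> carrier (dual \<beta>)"
      "p = \<mu> \<alpha> a" "r = \<rho> \<beta> f"
      using Rdual_degE AG_degE by (metis (no_types, lifting) UN_E)
    have xb: "x (inv \<beta>) \<in> carrier (C (inv \<beta>))" using * by (simp add: x_closed)
    have s: "\<sigma> \<otimes> \<alpha> \<in> carrier G" using \<sigma> * by simp
    have fx: "f (x (inv \<beta>) \<triangleleft>\<^bsub>C (inv \<beta>)\<^esub> a) \<in> carrier A" by (rule dual_closed[OF *(4) x_ract_closed[OF inv_closed[OF *(2)] *(3)]])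
    have "conv (\<sigma> \<otimes> \<alpha>) (q (\<sigma> \<otimes> \<alpha>) \<triangleleft>\<^bsub>dual (\<sigma> \<otimes> \<alpha>)\<^esub> a) \<beta> f = conv (\<sigma> \<otimes> \<alpha>) (q (\<sigma> \<otimes> \<alpha>)) \<beta> (a \<triangleright>\<^bsub>dual \<beta>\<^esub> f)"
      by (rule conv_ract_left[OF s *(2) Q'_closed[OF q s] *(4,3)])
    also have "\<dots> = q (\<sigma> \<otimes> \<alpha> \<otimes> \<beta>) \<triangleleft>\<^bsub>dual (\<sigma> \<otimes> \<alpha> \<otimes> \<beta>)\<^esub> f (x (inv \<beta>) \<triangleleft>\<^bsub>C (inv \<beta>)\<^esub> a)"
      using Q'_eq[OF q s *(2) dual_lsmult_closed[OF *(2,4,3)]] xb by (simp add: dual_simps(4))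
    finally have c: "conv (\<sigma> \<otimes> \<alpha>) (q (\<sigma> \<otimes> \<alpha>) \<triangleleft>\<^bsub>dual (\<sigma> \<otimes> \<alpha>)\<^esub> a) \<beta> f =
        q (\<sigma> \<otimes> \<alpha> \<otimes> \<beta>) \<triangleleft>\<^bsub>dual (\<sigma> \<otimes> \<alpha> \<otimes> \<beta>)\<^esub> f (x (inv \<beta>) \<triangleleft>\<^bsub>C (inv \<beta>)\<^esub> a)" .
    have "nu (\<omega> \<sigma> q) (p \<triangleleft>\<^bsub>AG\<^esub> r) = \<rho> (\<sigma> \<otimes> \<alpha> \<otimes> \<beta>) (q (\<sigma> \<otimes> \<alpha> \<otimes> \<beta>) \<triangleleft>\<^bsub>dual (\<sigma> \<otimes> \<alpha> \<otimes> \<beta>)\<^esub>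
        f (x (inv \<beta>) \<triangleleft>\<^bsub>C (inv \<beta>)\<^esub> a))"
      using * \<sigma> q fx by (simp add: AG_act nu_eq m_assoc)
    also have "\<dots> = nu (\<omega> \<sigma> q) p \<otimes>\<^bsub>Rdual\<^esub> r"
      using * \<sigma> q s dual_rsmult_closed[OF s Q'_closed[OF q s] *(3)] c by (simp add: nu_eq Rdual_mult)
    finally show "nu (\<omega> \<sigma> q) (p \<triangleleft>\<^bsub>AG\<^esub> r) = nu (\<omega> \<sigma> q) p \<otimes>\<^bsub>Rdual\<^esub> r" .
  qed
  then show "(\<lambda>p\<in>carrier AG. nu (\<omega> \<sigma> q) p) (m \<triangleleft>\<^bsub>AG\<^esub> r) = (\<lambda>p\<in>carrier AG. nu (\<omega> \<sigma> q) p) m \<triangleleft>\<^bsub>regular Rdual\<^esub> r"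
    if "m \<in> carrier AG" "r \<in> carrier Rdual" for m r
    using that by (simp add: M.ract_closed)
  show "(\<lambda>p\<in>carrier AG. nu (\<omega> \<sigma> q) p) m \<in> Rdual_deg (\<sigma> \<otimes> \<alpha>)" if "\<alpha> \<in> carrier G" "m \<in> AG_deg \<alpha>" for \<alpha> m
    using AG_degE[OF that(2)] that(1) \<sigma> q by (auto simp: nu_eq \<mu>_closed intro!: \<rho>_deg dual_rsmult_closed[OF _ Q'_closed])
qed simp

lemma \<Psi>_deg:
  assumes h: "\<phi> \<in> H.Hd \<sigma>" and \<sigma>: "\<sigma> \<in> carrier G"
  shows "\<Psi> \<phi> = \<omega> \<sigma> (\<lambda>\<gamma>\<in>carrier G. \<phi> (\<mu> (inv \<sigma> \<otimes> \<gamma>) \<one>\<^bsub>A\<^esub>) \<gamma>)"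
proof -
  let ?q = "\<lambda>\<gamma>\<in>carrier G. \<phi> (\<mu> (inv \<sigma> \<otimes> \<gamma>) \<one>\<^bsub>A\<^esub>) \<gamma>"
  have "\<phi> (\<mu> (inv \<tau> \<otimes> \<alpha>) \<one>\<^bsub>A\<^esub>) \<alpha> = \<zero>\<^bsub>dual \<alpha>\<^esub>" if \<tau>: "\<tau> \<in> carrier G" "\<tau> \<noteq> \<sigma>" and \<alpha>: "\<alpha> \<in> carrier G" for \<tau> \<alpha>
  proof -
    have \<tau>\<alpha>: "inv \<tau> \<otimes> \<alpha> \<in> carrier G" using \<tau> \<alpha> by simp
    have "\<sigma> \<otimes> (inv \<tau> \<otimes> \<alpha>) \<noteq> \<alpha>"
    proof
      assume "\<sigma> \<otimes> (inv \<tau> \<otimes> \<alpha>) = \<alpha>"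
      then have "\<sigma> \<otimes> inv \<tau> \<otimes> \<alpha> = \<one> \<otimes> \<alpha>" using \<sigma> \<tau> \<alpha> by (simp add: m_assoc)
      then have "\<sigma> \<otimes> inv \<tau> = \<one>" using \<sigma> \<tau> \<alpha> by (subst (asm) right_cancel) auto
      then have "\<sigma> \<otimes> inv \<tau> \<otimes> \<tau> = \<tau>" using \<tau> by simp
      then show False using \<sigma> \<tau> by (simp add: m_assoc)
    qed
    then show ?thesis
      unfolding HOM_coordinates(1)[OF h \<sigma> \<tau>\<alpha> A.one_closed] using \<alpha> by (simp add: \<rho>_apply)
  qed
  then show ?thesis
    using \<sigma> by (auto simp: \<Psi>_def \<omega>_def dsum_in_def Q'_simps intro!: restrict_ext)
qed

lemma Q'G_add_simps: "carrier Q'G = carrier DQ.D" "zero Q'G = zero DQ.D" "add Q'G = add DQ.D"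
  using DQ_same by (auto simp: same_add_def)

lemma \<Psi>_additive: "additive H.H Q'G \<Psi>"
proof (rule additive_generatedI[OF Q'G_abelian_group H.HOM_generated])
  show "\<Psi> \<zero>\<^bsub>H.H\<^esub> = \<zero>\<^bsub>Q'G\<^esub>"
    by (auto simp: \<Psi>_def H.HOM_zero Q'G_add_simps DQ.dsum_zero Q'_simps \<mu>_closed Rdual_simps(2) DR.dsum_zero
        intro!: restrict_ext)
  show "\<Psi> (h \<oplus>\<^bsub>H.H\<^esub> k) = \<Psi> h \<oplus>\<^bsub>Q'G\<^esub> \<Psi> k" if "h \<in> carrier H.H" "k \<in> carrier H.H" for h k
    by (auto simp: \<Psi>_def H.HOM_add Q'G_add_simps DQ.dsum_add Q'_simps \<mu>_closed Rdual_simps(3) DR.dsum_add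
        intro!: restrict_ext)
  show "\<Psi> h \<in> carrier Q'G" if "h \<in> (\<Union>\<sigma>\<in>carrier G. H.Hd \<sigma>)" for h
    using that \<Psi>_deg \<omega>_closed HOM_coordinates(2) by auto
qed

lemma \<Psi>_bij_deg:
  assumes \<sigma>: "\<sigma> \<in> carrier G" shows "bij_betw \<Psi> (H.Hd \<sigma>) (Q'G_deg \<sigma>)"
  unfolding bij_betw_def
proof (intro conjI inj_onI subset_antisym subsetI)
  let ?q = "\<lambda>h. \<lambda>\<gamma>\<in>carrier G. h (\<mu> (inv \<sigma> \<otimes> \<gamma>) \<one>\<^bsub>A\<^esub>) \<gamma>"
  fix h k assume hk: "h \<in> H.Hd \<sigma>" "k \<in> H.Hd \<sigma>" "\<Psi> h = \<Psi> k"
  have "\<omega> \<sigma> (?q h) \<sigma> = \<omega> \<sigma> (?q k) \<sigma>" using \<Psi>_deg[OF hk(1) \<sigma>] \<Psi>_deg[OF hk(2) \<sigma>] hk(3) by simp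
  then have b: "?q h = ?q k" unfolding \<omega>_def using \<sigma> by (simp add: dsum_in_def)
  show "h = k"
  proof (rule H.HOM_ext)
    fix \<alpha> m assume m: "\<alpha> \<in> carrier G" "m \<in> AG_deg \<alpha>"
    then obtain a where "a \<in> carrier A" "m = \<mu> \<alpha> a" using AG_degE by blast
    then show "h m = k m"
      using HOM_coordinates(1)[OF hk(1) \<sigma> m(1)] HOM_coordinates(1)[OF hk(2) \<sigma> m(1)] b by simp
  qed (use H.HOM_degD[OF hk(1)] H.HOM_degD[OF hk(2)] in auto)
next
  fix s assume "s \<in> \<Psi> ` H.Hd \<sigma>"
  then show "s \<in> Q'G_deg \<sigma>"
    using \<Psi>_deg[OF _ \<sigma>] HOM_coordinates(2)[OF _ \<sigma>] by (auto simp: Q'G_deg_def dsum_deg_def \<omega>_def)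
next
  fix s assume "s \<in> Q'G_deg \<sigma>"
  then obtain q where q: "q \<in> carrier Q'" "s = \<omega> \<sigma> q" by (auto simp: Q'G_deg_def dsum_deg_def \<omega>_def)
  let ?h = "\<lambda>p\<in>carrier AG. nu (\<omega> \<sigma> q) p"
  have h: "?h \<in> H.Hd \<sigma>" by (rule nu_HOM[OF \<sigma> q(1)])
  have "?h (\<mu> (inv \<sigma> \<otimes> \<gamma>) \<one>\<^bsub>A\<^esub>) \<gamma> = q \<gamma>" if \<gamma>: "\<gamma> \<in> carrier G" for \<gamma>
  proof -
    have m: "\<sigma> \<otimes> (inv \<sigma> \<otimes> \<gamma>) = \<gamma>" using \<gamma> \<sigma> by (simp add: m_assoc[symmetric])
    have "q \<gamma> \<triangleleft>\<^bsub>dual \<gamma>\<^esub> \<one>\<^bsub>A\<^esub> = q \<gamma>"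
      by (rule dual_ext[OF dual_rsmult_closed[OF \<gamma> Q'_closed[OF q(1) \<gamma>] A.one_closed] Q'_closed[OF q(1) \<gamma>]])
        (use dual_closed[OF Q'_closed[OF q(1) \<gamma>]] in \<open>simp add: dual_simps\<close>)
    then show ?thesis
      using nu_eq[OF \<sigma> _ q(1) A.one_closed, of "inv \<sigma> \<otimes> \<gamma>"] \<gamma> \<sigma> by (simp add: m \<mu>_closed \<rho>_apply)
  qed
  then have "(\<lambda>\<gamma>\<in>carrier G. ?h (\<mu> (inv \<sigma> \<otimes> \<gamma>) \<one>\<^bsub>A\<^esub>) \<gamma>) = q"
    using q(1) by (intro extensionalityI[of _ "carrier G"]) (auto simp: Q'_iff PiE_iff)
  then have "\<Psi> ?h = s" using \<Psi>_deg[OF h \<sigma>] q(2) by simp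
  then show "s \<in> \<Psi> ` H.Hd \<sigma>" using h by blast
qed

lemma \<Psi>_lact:
  assumes "r \<in> carrier Rdual" "\<phi> \<in> carrier H.H" shows "\<Psi> (M.lmul r \<phi>) = r \<triangleright>\<^bsub>Q'G\<^esub> \<Psi> \<phi>"
proof (rule biadditive_eqI[OF Rdual_abelian_group H.HOM_abelian_group Q'G_abelian_group
      graded_generated[OF Rdual_graded_group] H.HOM_generated
      biadditive_post[OF M.lmul_biadditive \<Psi>_additive] biadditive_comp[OF Q'G_lact_biadditive additive_id \<Psi>_additive] _ assms])
  fix r \<phi> assume "r \<in> (\<Union>\<alpha>\<in>carrier G. Rdual_deg \<alpha>)" "\<phi> \<in> (\<Union>\<sigma>\<in>carrier G. H.Hd \<sigma>)"
  then obtain \<beta> f \<sigma> where r: "\<beta> \<in> carrier G" "r \<in> Rdual_deg \<beta>" "f \<in> carrier (dual \<beta>)" "r = \<rho> \<beta> f"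
    and \<sigma>: "\<sigma> \<in> carrier G" and \<phi>: "\<phi> \<in> H.Hd \<sigma>" using Rdual_degE by blast
  let ?q = "\<lambda>\<gamma>\<in>carrier G. \<phi> (\<mu> (inv \<sigma> \<otimes> \<gamma>) \<one>\<^bsub>A\<^esub>) \<gamma>"
  note D = HOM_coordinates[OF \<phi> \<sigma>]
  have "M.lmul r \<phi> (\<mu> (inv (\<beta> \<otimes> \<sigma>) \<otimes> \<gamma>) \<one>\<^bsub>A\<^esub>) \<gamma> = conv \<beta> f (inv \<beta> \<otimes> \<gamma>) (?q (inv \<beta> \<otimes> \<gamma>))" if \<gamma>: "\<gamma> \<in> carrier G" for \<gamma>
  proof -
    have m: "inv (\<beta> \<otimes> \<sigma>) \<otimes> \<gamma> = inv \<sigma> \<otimes> (inv \<beta> \<otimes> \<gamma>)" "\<beta> \<otimes> (inv \<beta> \<otimes> \<gamma>) = \<gamma>"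
      using r(1) \<sigma> \<gamma> by (simp_all add: inv_mult_group m_assoc, simp add: m_assoc[symmetric])
    have \<gamma>': "inv \<beta> \<otimes> \<gamma> \<in> carrier G" "inv \<sigma> \<otimes> (inv \<beta> \<otimes> \<gamma>) \<in> carrier G" using r \<sigma> \<gamma> by auto
    have "M.lmul r \<phi> (\<mu> (inv (\<beta> \<otimes> \<sigma>) \<otimes> \<gamma>) \<one>\<^bsub>A\<^esub>) = \<rho> \<beta> f \<otimes>\<^bsub>Rdual\<^esub> \<rho> (inv \<beta> \<otimes> \<gamma>) (?q (inv \<beta> \<otimes> \<gamma>))"
      unfolding m(1) M.lmul_def D(3)[OF \<gamma>'(1), symmetric] r(4) using \<mu>_closed[OF \<gamma>'(2) A.one_closed] by simp
    also have "\<dots> = \<rho> \<gamma> (conv \<beta> f (inv \<beta> \<otimes> \<gamma>) (?q (inv \<beta> \<otimes> \<gamma>)))"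
      using Rdual_mult[OF r(1) \<gamma>'(1) r(3) Q'_closed[OF D(2) \<gamma>'(1)]] m(2) by simp
    finally show ?thesis using \<gamma> by (simp only: \<rho>_apply if_True simp_thms)
  qed
  then have "(\<lambda>\<gamma>\<in>carrier G. M.lmul r \<phi> (\<mu> (inv (\<beta> \<otimes> \<sigma>) \<otimes> \<gamma>) \<one>\<^bsub>A\<^esub>) \<gamma>) = Q'_lact \<beta> f ?q"
    unfolding Q'_lact_def by (intro restrict_ext)
  then show "\<Psi> (M.lmul r \<phi>) = r \<triangleright>\<^bsub>Q'G\<^esub> \<Psi> \<phi>"
    using \<Psi>_deg[OF M.lmul_deg[OF r(2) \<phi> r(1) \<sigma>]] \<Psi>_deg[OF \<phi> \<sigma>] Q'G_lact[OF r(1) \<sigma> r(3) D(2)] r(1,4) \<sigma> by simp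
qed

lemma \<Psi>_ract:
  assumes "\<phi> \<in> carrier H.H" "h \<in> carrier E.H"
  shows "\<Psi> (compose (carrier AG) \<phi> h) = \<Psi> \<phi> \<triangleleft>\<^bsub>Q'G\<^esub> \<Xi> h"
proof (rule biadditive_eqI[OF H.HOM_abelian_group E.HOM_abelian_group Q'G_abelian_group H.HOM_generated E.HOM_generated
      biadditive_post[OF H.HOM_compose_biadditive \<Psi>_additive] biadditive_comp[OF Q'G_ract_biadditive \<Psi>_additive \<Xi>_additive] _ assms])
  fix \<phi> h assume "\<phi> \<in> (\<Union>\<sigma>\<in>carrier G. H.Hd \<sigma>)" "h \<in> (\<Union>\<sigma>\<in>carrier G. E.Hd \<sigma>)"
  then obtain \<sigma> \<tau> where \<sigma>: "\<sigma> \<in> carrier G" and \<phi>: "\<phi> \<in> H.Hd \<sigma>" and \<tau>: "\<tau> \<in> carrier G" and h: "h \<in> E.Hd \<tau>" by blast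
  let ?q = "\<lambda>\<gamma>\<in>carrier G. \<phi> (\<mu> (inv \<sigma> \<otimes> \<gamma>) \<one>\<^bsub>A\<^esub>) \<gamma>" and ?b = "\<lambda>\<alpha>\<in>carrier G. h (\<mu> \<alpha> \<one>\<^bsub>A\<^esub>) (\<tau> \<otimes> \<alpha>)"
  note D = HOM_coordinates[OF \<phi> \<sigma>] and E = END_coordinates[OF h \<tau>]
  have st: "inv (\<sigma> \<otimes> \<tau>) \<in> carrier G" using \<sigma> \<tau> by simp
  have "compose (carrier AG) \<phi> h (\<mu> (inv (\<sigma> \<otimes> \<tau>) \<otimes> \<gamma>) \<one>\<^bsub>A\<^esub>) \<gamma> = ?q \<gamma> \<triangleleft>\<^bsub>dual \<gamma>\<^esub> shift ?b (inv (\<sigma> \<otimes> \<tau>)) \<gamma>"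
    if \<gamma>: "\<gamma> \<in> carrier G" for \<gamma>
  proof -
    let ?\<delta> = "inv (\<sigma> \<otimes> \<tau>) \<otimes> \<gamma>"
    have \<delta>: "?\<delta> \<in> carrier G" "\<tau> \<otimes> ?\<delta> \<in> carrier G" using \<sigma> \<tau> \<gamma> by auto
    have m: "\<sigma> \<otimes> (\<tau> \<otimes> ?\<delta>) = \<gamma>"
      using \<sigma> \<tau> \<gamma> by (simp add: m_assoc[symmetric])
    have "compose (carrier AG) \<phi> h (\<mu> ?\<delta> \<one>\<^bsub>A\<^esub>) = \<phi> (\<mu> (\<tau> \<otimes> ?\<delta>) (?b ?\<delta>))"
      using E(3)[OF \<delta>(1)] \<mu>_closed[OF \<delta>(1) A.one_closed] by (simp add: compose_def)
    also have "\<dots> = \<rho> \<gamma> (?q \<gamma> \<triangleleft>\<^bsub>dual \<gamma>\<^esub> ?b ?\<delta>)"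
      using D(1)[OF \<delta>(2) S'_closed[OF E(2) \<delta>(1)]] unfolding m .
    finally show ?thesis using \<gamma> by (simp only: \<rho>_apply if_True simp_thms shift_def restrict_apply')
  qed
  then have "(\<lambda>\<gamma>\<in>carrier G. compose (carrier AG) \<phi> h (\<mu> (inv (\<sigma> \<otimes> \<tau>) \<otimes> \<gamma>) \<one>\<^bsub>A\<^esub>) \<gamma>) = Q'_ract ?q (shift ?b (inv (\<sigma> \<otimes> \<tau>)))"
    unfolding Q'_ract_def by (intro restrict_ext)
  then show "\<Psi> (compose (carrier AG) \<phi> h) = \<Psi> \<phi> \<triangleleft>\<^bsub>Q'G\<^esub> \<Xi> h"
    using \<Psi>_deg[OF H.HOM_compose_deg[OF \<phi> h \<sigma> \<tau>]] \<Psi>_deg[OF \<phi> \<sigma>] \<Xi>_deg[OF h \<tau>] Q'G_ract[OF \<sigma> \<tau> D(2) E(2)] \<sigma> \<tau>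
    by simp
qed

lemma om_rank_one:
  assumes "p \<in> carrier AG" "\<phi> \<in> carrier H.H" shows "om p (\<Psi> \<phi>) = \<Xi> (M.rank_one p \<phi>)"
proof (rule biadditive_eqI[OF AG_abelian_group H.HOM_abelian_group GS'_abelian_group
      graded_generated[OF AG_graded_group] H.HOM_generated
      biadditive_comp[OF om_biadditive additive_id \<Psi>_additive] biadditive_post[OF M.rank_one_biadditive \<Xi>_additive] _ assms])
  fix p \<phi> assume "p \<in> (\<Union>\<alpha>\<in>carrier G. AG_deg \<alpha>)" "\<phi> \<in> (\<Union>\<sigma>\<in>carrier G. H.Hd \<sigma>)"
  then obtain \<alpha> a \<sigma> where p: "\<alpha> \<in> carrier G" "p \<in> AG_deg \<alpha>" "a \<in> carrier A" "p = \<mu> \<alpha> a"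
    and \<sigma>: "\<sigma> \<in> carrier G" and \<phi>: "\<phi> \<in> H.Hd \<sigma>" using AG_degE by blast
  let ?q = "\<lambda>\<gamma>\<in>carrier G. \<phi> (\<mu> (inv \<sigma> \<otimes> \<gamma>) \<one>\<^bsub>A\<^esub>) \<gamma>"
  note D = HOM_coordinates[OF \<phi> \<sigma>]
  have "M.rank_one p \<phi> (\<mu> \<beta> \<one>\<^bsub>A\<^esub>) (\<alpha> \<otimes> \<sigma> \<otimes> \<beta>) = ?q (\<sigma> \<otimes> \<beta>) (x (inv (\<sigma> \<otimes> \<beta>)) \<triangleleft>\<^bsub>C (inv (\<sigma> \<otimes> \<beta>))\<^esub> a)"
    if \<beta>: "\<beta> \<in> carrier G" for \<beta>
  proof -
    have s: "\<sigma> \<otimes> \<beta> \<in> carrier G" using \<sigma> \<beta> by simp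
    have m: "inv \<sigma> \<otimes> (\<sigma> \<otimes> \<beta>) = \<beta>" using \<sigma> \<beta> by (simp add: m_assoc[symmetric])
    have "M.rank_one p \<phi> (\<mu> \<beta> \<one>\<^bsub>A\<^esub>) = \<mu> \<alpha> a \<triangleleft>\<^bsub>AG\<^esub> \<rho> (\<sigma> \<otimes> \<beta>) (?q (\<sigma> \<otimes> \<beta>))"
      unfolding D(3)[OF s, symmetric] m M.rank_one_def p(4) using \<mu>_closed[OF \<beta> A.one_closed] by simp
    also have "\<dots> = \<mu> (\<alpha> \<otimes> (\<sigma> \<otimes> \<beta>)) (?q (\<sigma> \<otimes> \<beta>) (x (inv (\<sigma> \<otimes> \<beta>)) \<triangleleft>\<^bsub>C (inv (\<sigma> \<otimes> \<beta>))\<^esub> a))"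
      by (rule AG_act[OF p(1) s p(3) Q'_closed[OF D(2) s]])
    finally show ?thesis using p(1) \<sigma> \<beta> by (simp only: m_assoc \<mu>_apply if_True simp_thms m_closed)
  qed
  then have "(\<lambda>\<beta>\<in>carrier G. M.rank_one p \<phi> (\<mu> \<beta> \<one>\<^bsub>A\<^esub>) (\<alpha> \<otimes> \<sigma> \<otimes> \<beta>)) =
      (\<lambda>\<beta>\<in>carrier G. ?q (\<sigma> \<otimes> \<beta>) (x (inv (\<sigma> \<otimes> \<beta>)) \<triangleleft>\<^bsub>C (inv (\<sigma> \<otimes> \<beta>))\<^esub> a))"
    by (intro restrict_ext)
  then show "om p (\<Psi> \<phi>) = \<Xi> (M.rank_one p \<phi>)"
    using \<Xi>_deg[OF M.rank_one_deg[OF p(2) \<phi> p(1) \<sigma>]] \<Psi>_deg[OF \<phi> \<sigma>] om_eq[OF p(1) \<sigma> p(3) D(2)] p(1,4) \<sigma> by simp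
qed

lemma nu_eval:
  assumes "\<phi> \<in> carrier H.H" "p \<in> carrier AG" shows "nu (\<Psi> \<phi>) p = \<phi> p"
proof (rule biadditive_eqI[OF H.HOM_abelian_group AG_abelian_group Rdual_abelian_group H.HOM_generated
      graded_generated[OF AG_graded_group] biadditive_comp[OF nu_biadditive \<Psi>_additive additive_id] _ _ assms])
  show "biadditive H.H AG Rdual (\<lambda>\<phi> p. \<phi> p)"
    by (rule biadditiveI) (auto simp: M.D_closed H.HOM_add additive_add[OF H.HOM_linear(2), simplified])
  fix \<phi> p assume "\<phi> \<in> (\<Union>\<sigma>\<in>carrier G. H.Hd \<sigma>)" "p \<in> (\<Union>\<sigma>\<in>carrier G. AG_deg \<sigma>)"
  then obtain \<sigma> \<alpha> a where *: "\<sigma> \<in> carrier G" "\<phi> \<in> H.Hd \<sigma>" "\<alpha> \<in> carrier G" "a \<in> carrier A" "p = \<mu> \<alpha> a"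
    using AG_degE by blast
  show "nu (\<Psi> \<phi>) p = \<phi> p"
    using HOM_coordinates(1)[OF *(2,1,3,4)] nu_eq[OF *(1,3) HOM_coordinates(2)[OF *(2,1)] *(4)] \<Psi>_deg[OF *(2,1)] *(5)
    by simp
qed


section \<open>The isomorphism of Morita contexts\<close>

sublocale GM: paired_morita_context G GM_AG M.rank_one "\<lambda>q p. q p"
  unfolding GM_AG_def by (rule M.module_morita_paired)

lemma GM_AG_simps:
  "mcS GM_AG = END_AG" "mcdS GM_AG = E.Hd" "mcR GM_AG = Rdual" "mcdR GM_AG = Rdual_deg" "mcP GM_AG = M.PS"
  "mcdP GM_AG = AG_deg" "mcQ GM_AG = M.QR" "mcdQ GM_AG = H.Hd"
  by (simp_all add: GM_AG_def module_morita_def M.lmul_def[abs_def])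

lemma GM'_simps:
  "mcS GM' = GS'" "mcdS GM' = GS'_deg" "mcR GM' = Rdual" "mcdR GM' = Rdual_deg" "mcP GM' = AG_GS'"
  "mcdP GM' = AG_deg" "mcQ GM' = Q'G" "mcdQ GM' = Q'G_deg" "mcphi GM' = tensor_lift GS' om"
  "mcpsi GM' = tensor_lift Rdual nu"
  by (simp_all add: GM'_def \<omega>'_def \<nu>'_def om_def nu_def)

lemma \<Psi>_iso: "\<Psi> \<in> graded_bimod_iso G Rdual END_AG id \<Xi> M.QR H.Hd Q'G Q'G_deg"
proof -
  have "bij_betw \<Psi> (carrier H.H) (carrier Q'G)"
    by (rule graded_bij_betw[OF H.HOM_graded Q'G_graded_group \<Psi>_additive \<Psi>_bij_deg])
  then show ?thesis
    using \<Psi>_bij_deg additive_add[OF \<Psi>_additive]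
    by (auto simp: graded_bimod_iso_def M.S_simps \<Psi>_lact \<Psi>_ract bij_betw_def)
qed

lemma contexts_isomorphic:
  "paired_morita_context G GM' om nu" "graded_morita_iso G GM_AG GM' \<Xi> id id \<Psi>"
proof -
  have P: "graded_group G AG_GS' AG_deg"
    by (rule graded_group_same_add[OF _ AG_graded_group]) (simp add: same_add_def AG_GS'_simps)
  have "id \<in> graded_ring_iso G Rdual Rdual_deg Rdual Rdual_deg"
    by (auto simp: graded_ring_iso_def ring_iso_def ring_hom_def)
  moreover have "id \<in> graded_bimod_iso G END_AG Rdual \<Xi> id M.PS AG_deg AG_GS' AG_deg"
    by (auto simp: graded_bimod_iso_def AG_GS'_simps(1,3,4) M.S_simps \<Xi>_act[symmetric])
  ultimately show "paired_morita_context G GM' om nu" "graded_morita_iso G GM_AG GM' \<Xi> id id \<Psi>"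
    using GM.paired_morita_transport[of GM' \<Xi> id id \<Psi> om nu] GS'_graded_group Rdual_graded_group P
      Q'G_graded_group \<Xi>_iso \<Psi>_iso
    by (simp_all add: GM_AG_simps GM'_simps om_rank_one nu_eval)
qed

sublocale GM': paired_morita_context G GM' om nu
  by (rule contexts_isomorphic(1))

lemma \<Xi>_formula:
  assumes \<sigma>: "\<sigma> \<in> carrier G" and h: "h \<in> mcdS GM_AG \<sigma>"
  shows "\<Xi> h = u \<sigma> (\<lambda>\<alpha>\<in>carrier G. inv_into (carrier A) (\<mu> (\<sigma> \<otimes> \<alpha>)) (h (\<mu> \<alpha> \<one>\<^bsub>A\<^esub>)))"
proof -
  let ?b = "\<lambda>\<alpha>\<in>carrier G. h (\<mu> \<alpha> \<one>\<^bsub>A\<^esub>) (\<sigma> \<otimes> \<alpha>)"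
  have h': "h \<in> E.Hd \<sigma>" using h by (simp add: GM_AG_simps)
  note E = END_coordinates[OF h' \<sigma>]
  have "inv_into (carrier A) (\<mu> (\<sigma> \<otimes> \<alpha>)) (h (\<mu> \<alpha> \<one>\<^bsub>A\<^esub>)) = h (\<mu> \<alpha> \<one>\<^bsub>A\<^esub>) (\<sigma> \<otimes> \<alpha>)" if \<alpha>: "\<alpha> \<in> carrier G" for \<alpha>
  proof -
    have "inj_on (\<mu> (\<sigma> \<otimes> \<alpha>)) (carrier A)" using \<sigma> \<alpha> by (auto intro!: inj_onI dest: \<mu>_inj)
    then have "inv_into (carrier A) (\<mu> (\<sigma> \<otimes> \<alpha>)) (\<mu> (\<sigma> \<otimes> \<alpha>) (?b \<alpha>)) = ?b \<alpha>"
      by (rule inv_into_f_f[OF _ S'_closed[OF E(2) \<alpha>]])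
    then show ?thesis unfolding E(3)[OF \<alpha>, symmetric] using \<alpha> by simp
  qed
  then have "(\<lambda>\<alpha>\<in>carrier G. inv_into (carrier A) (\<mu> (\<sigma> \<otimes> \<alpha>)) (h (\<mu> \<alpha> \<one>\<^bsub>A\<^esub>))) = ?b" by (intro restrict_ext)
  then show ?thesis using \<Xi>_deg[OF h' \<sigma>] by simp
qed

lemma \<Psi>_formula:
  assumes \<sigma>: "\<sigma> \<in> carrier G" and h: "\<phi> \<in> mcdQ GM_AG \<sigma>"
  shows "\<Psi> \<phi> = \<omega> \<sigma> (\<lambda>\<alpha>\<in>carrier G. inv_into (carrier (dual \<alpha>)) (\<rho> \<alpha>) (\<phi> (\<mu> (inv \<sigma> \<otimes> \<alpha>) \<one>\<^bsub>A\<^esub>)))"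
proof -
  let ?q = "\<lambda>\<gamma>\<in>carrier G. \<phi> (\<mu> (inv \<sigma> \<otimes> \<gamma>) \<one>\<^bsub>A\<^esub>) \<gamma>"
  have h': "\<phi> \<in> H.Hd \<sigma>" using h by (simp add: GM_AG_simps)
  note D = HOM_coordinates[OF h' \<sigma>]
  have "inv_into (carrier (dual \<alpha>)) (\<rho> \<alpha>) (\<phi> (\<mu> (inv \<sigma> \<otimes> \<alpha>) \<one>\<^bsub>A\<^esub>)) = \<phi> (\<mu> (inv \<sigma> \<otimes> \<alpha>) \<one>\<^bsub>A\<^esub>) \<alpha>"
    if \<alpha>: "\<alpha> \<in> carrier G" for \<alpha>
  proof -
    have "inj_on (\<rho> \<alpha>) (carrier (dual \<alpha>))" using \<alpha> by (auto intro!: inj_onI dest: \<rho>_inj)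
    then have "inv_into (carrier (dual \<alpha>)) (\<rho> \<alpha>) (\<rho> \<alpha> (?q \<alpha>)) = ?q \<alpha>"
      by (rule inv_into_f_f[OF _ Q'_closed[OF D(2) \<alpha>]])
    then show ?thesis unfolding D(3)[OF \<alpha>, symmetric] using \<alpha> by simp
  qed
  then have "(\<lambda>\<alpha>\<in>carrier G. inv_into (carrier (dual \<alpha>)) (\<rho> \<alpha>) (\<phi> (\<mu> (inv \<sigma> \<otimes> \<alpha>) \<one>\<^bsub>A\<^esub>))) = ?q"
    by (intro restrict_ext)
  then show ?thesis using \<Psi>_deg[OF h' \<sigma>] by simp
qed

end

theorem theorem8p7:
  fixes G :: "'g monoid" and A :: "'a ring" and C :: "'g \<Rightarrow> ('a, 'a, 'c) bimodule"
    and \<Delta> :: "'g \<Rightarrow> 'g \<Rightarrow> 'c \<Rightarrow> ('c, 'c) tensor" and \<epsilon> :: "'c \<Rightarrow> 'a" and x :: "'g \<Rightarrow> 'c"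
  assumes "grouplike_coring G A C \<Delta> \<epsilon> x"
  shows
   "let GM = grouplike_coring.GM_AG G A C \<Delta> \<epsilon> x;
        GM' = grouplike_coring.GM' G A C \<Delta> \<epsilon> x;
        \<Xi> = grouplike_coring.\<Xi> G A;
        \<Psi> = grouplike_coring.\<Psi> G A;
        S' = grouplike_coring.S' G A C x;
        Q' = grouplike_coring.Q' G A C \<Delta> x;
        R = group_coring.dual G A C;
        \<rho> = dsum_in (carrier G) R;
        \<mu> = group_coring.\<mu> G A;
        u = grouplike_coring.u G A C x;
        \<omega> = grouplike_coring.\<omega> G A C \<Delta> x
    in graded_morita G GM \<and>
       graded_morita G GM' \<and>
       graded_morita_iso G GM GM' \<Xi> id id \<Psi> \<and>
       (\<forall>\<sigma>\<in>carrier G. \<forall>h\<in>mcdS GM \<sigma>.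
          \<Xi> h = u \<sigma> (\<lambda>\<alpha>\<in>carrier G. inv_into (carrier A) (\<mu> (\<sigma> \<otimes>\<^bsub>G\<^esub> \<alpha>)) (h (\<mu> \<alpha> \<one>\<^bsub>A\<^esub>)))) \<and>
       (\<forall>\<sigma>\<in>carrier G. \<forall>\<phi>\<in>mcdQ GM \<sigma>.
          \<Psi> \<phi> = \<omega> \<sigma> (\<lambda>\<alpha>\<in>carrier G.
            inv_into (carrier (R \<alpha>)) (\<rho> \<alpha>) (\<phi> (\<mu> (inv\<^bsub>G\<^esub> \<sigma> \<otimes>\<^bsub>G\<^esub> \<alpha>) \<one>\<^bsub>A\<^esub>)))) \<and>
       (\<forall>\<alpha>\<in>carrier G. \<forall>\<sigma>\<in>carrier G. \<forall>a\<in>carrier A. \<forall>q\<in>carrier Q'.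
          mcphi GM' (mcpq GM' (\<mu> \<alpha> a) (\<omega> \<sigma> q)) =
            u (\<alpha> \<otimes>\<^bsub>G\<^esub> \<sigma>) (\<lambda>\<beta>\<in>carrier G.
              q (\<sigma> \<otimes>\<^bsub>G\<^esub> \<beta>) (x (inv\<^bsub>G\<^esub> (\<sigma> \<otimes>\<^bsub>G\<^esub> \<beta>)) \<triangleleft>\<^bsub>C (inv\<^bsub>G\<^esub> (\<sigma> \<otimes>\<^bsub>G\<^esub> \<beta>))\<^esub> a))) \<and>
       (\<forall>\<alpha>\<in>carrier G. \<forall>\<sigma>\<in>carrier G. \<forall>a\<in>carrier A. \<forall>q\<in>carrier Q'.
          mcpsi GM' (mcqp GM' (\<omega> \<sigma> q) (\<mu> \<alpha> a)) =
            \<rho> (\<sigma> \<otimes>\<^bsub>G\<^esub> \<alpha>) (q (\<sigma> \<otimes>\<^bsub>G\<^esub> \<alpha>) \<triangleleft>\<^bsub>R (\<sigma> \<otimes>\<^bsub>G\<^esub> \<alpha>)\<^esub> a))"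
proof -
  interpret grouplike_coring G A C \<Delta> \<epsilon> x by (rule assms)
  have c: "\<mu> \<alpha> a \<in> carrier (mcP GM')" "\<omega> \<sigma> q \<in> carrier (mcQ GM')"
    if "\<alpha> \<in> carrier G" "\<sigma> \<in> carrier G" "a \<in> carrier A" "q \<in> carrier Q'" for \<alpha> \<sigma> a q
    using that by (simp_all add: GM'_simps AG_GS'_simps(1) \<mu>_closed \<omega>_closed)
  show ?thesis
    unfolding Let_def
    by (intro conjI ballI GM.graded_morita GM'.graded_morita contexts_isomorphic(2) \<Xi>_formula \<Psi>_formula)
      (simp_all only: GM'.phi_lift(3)[OF c] GM'.psi_lift(3)[OF c(2,1)] om_eq nu_eq)
qed

end
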